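(* Let $q\in[1,\infty)$ and $r\in(0,1)$. Let $u\in B^r_{q,\infty}(\mathbb{R}^N,\mathbb{R}^d)$, let $E\subset\mathbb{R}^N$ be an $\mathcal{L}^N$-measurable set and let $\eta\in W^{1,1}(\mathbb{R}^N)$. For each $\varepsilon\in(0,\infty)$ put $u_\varepsilon(x):=\int_{\mathbb{R}^N}\eta(z)u(x-\varepsilon z)\,dz$. Assume that the limit $$\lim_{\varepsilon\to 0^+}\int_{S^{N-1}}\int_E\chi_{E}(x+\varepsilon n)\frac{|u(x+\varepsilon n)-u(x)|^q}{\varepsilon^{rq}}\,dx\,d\mathcal{H}^{N-1}(n)$$ exists. Then, for every kernel $\{\rho_\varepsilon\}_{\varepsilon\in(0,a)}$, the following limits exist and $$\lim_{\varepsilon\to 0^+}\frac{1}{|\ln\varepsilon|}\left[u_\varepsilon\right]^q_{W^{r,q}(E,\mathbb{R}^d)}=\left|\int_{\mathbb{R}^N}\eta(z)dz\right|^q\mathcal{H}^{N-1}(S^{N-1})\lim_{\varepsilon\to 0^+}\int_{E}\int_{E}\rho_{\varepsilon}(|x-y|)\frac{|u(x)-u(y)|^q}{|x-y|^{rq}}\,dy\,dx$$ $$=\left|\int_{\mathbb{R}^N}\eta(z)dz\right|^q\lim_{\varepsilon\to 0^+}\int_{S^{N-1}}\int_E\chi_{E}(x+\varepsilon n)\frac{|u(x+\varepsilon n)-u(x)|^q}{\varepsilon^{rq}}\,dx\,d\mathcal{H}^{N-1}(n).$$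
   Context: $N,d$ are natural numbers ($\geq1$). $\mathcal{L}^N$ is Lebesgue measure on $\mathbb{R}^N$, $\mathcal{H}^{N-1}$ is $(N-1)$-dimensional Hausdorff measure, $S^{N-1}$ is the unit sphere in $\mathbb{R}^N$, $\chi_E$ is the characteristic function of $E$. For $1\leq q<\infty$, $r\in(0,1)$, the Besov space is $$B^r_{q,\infty}(\mathbb{R}^N,\mathbb{R}^d):=\Big\{u\in L^q(\mathbb{R}^N,\mathbb{R}^d):\sup_{h\in\mathbb{R}^N\setminus\{0\}}\int_{\mathbb{R}^N}\frac{|u(x+h)-u(x)|^q}{|h|^{rq}}dx<\infty\Big\}.$$ The Gagliardo seminorm on a measurable set $E\subset\mathbb{R}^N$ is $\left[u\right]_{W^{r,q}(E,\mathbb{R}^d)}:=\left(\int_{E}\int_{E}\frac{|u(x)-u(y)|^q}{|x-y|^{N+rq}}dx\,dy\right)^{1/q}$. $W^{1,1}(\mathbb{R}^N)$ is the usual Sobolev space of real-valued functions. Kernel: let $a\in(0,\infty]$ and let $\rho_\varepsilon:(0,\infty)\to[0,\infty)$, $\varepsilon\in(0,a)$, be a family of $\mathcal{L}^1$-measurable functions. The family is a kernel if $\int_{\mathbb{R}^N}\rho_\varepsilon(|z|)dz=1$ for all $\varepsilon\in(0,a)$ and, for every $\delta\in(0,\infty)$, $\lim_{\varepsilon\to0^+}\int_\delta^\infty\rho_\varepsilon(t)t^{N-1}dt=0$. *)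

theory Defs
  imports "HOL-Analysis.Analysis"
begin

section \<open>Hausdorff measure\<close>

text \<open>
  The standard normalisation is used: a covering set \<open>C\<close> contributes
  \<open>\<alpha>(k) (diam C / 2)^k\<close>, with \<open>\<alpha>(k)\<close> the volume of the unit ball of dimension \<open>k\<close>.
  The empty set contributes \<open>0\<close>, also for \<open>k = 0\<close>, where \<open>(diam C / 2)^0 = 1\<close>
  (so that the measure of dimension \<open>0\<close> is counting measure).
  Boundedness is required explicitly, since \<open>diameter\<close> is meaningful for bounded sets only.
\<close>

definition hausdorff_content :: "nat \<Rightarrow> 'a::metric_space set \<Rightarrow> ennreal" where
  "hausdorff_content k C =
     (if C = {} then 0 else ennreal (unit_ball_vol (real k) * (diameter C / 2) ^ k))"

definition hausdorff_pre :: "nat \<Rightarrow> real \<Rightarrow> 'a::metric_space set \<Rightarrow> ennreal" where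
  "hausdorff_pre k \<delta> A =
     (INF C\<in>{C :: nat \<Rightarrow> 'a set. A \<subseteq> (\<Union>i. C i) \<and> (\<forall>i. bounded (C i) \<and> diameter (C i) \<le> \<delta>)}.
        \<Sum>i. hausdorff_content k (C i))"

definition hausdorff_outer :: "nat \<Rightarrow> 'a::metric_space set \<Rightarrow> ennreal" where
  "hausdorff_outer k A = (SUP \<delta>\<in>{0<..}. hausdorff_pre k \<delta> A)"

text \<open>The outer measure restricted to its Caratheodory-measurable sets; these include the Borel sets.\<close>

definition hausdorff_measure :: "nat \<Rightarrow> 'a::metric_space measure" where
  "hausdorff_measure k =
     measure_of UNIV (lambda_system UNIV UNIV (hausdorff_outer k)) (hausdorff_outer k)"

lemma hausdorff_pre_mono: "A \<subseteq> B \<Longrightarrow> hausdorff_pre k \<delta> A \<le> hausdorff_pre k \<delta> B"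
  unfolding hausdorff_pre_def by (rule INF_superset_mono) auto

lemma hausdorff_pre_countably_subadditive:
  fixes A :: "nat \<Rightarrow> 'a::metric_space set"
  shows "hausdorff_pre k \<delta> (\<Union>i. A i) \<le> (\<Sum>i. hausdorff_pre k \<delta> (A i))"
proof (rule ennreal_le_epsilon)
  fix e :: real
  assume fin: "(\<Sum>i. hausdorff_pre k \<delta> (A i)) < top" and e: "0 < e"
  define c where "c n = ennreal (e * (1/2) ^ Suc n)" for n
  have "\<exists>C. A n \<subseteq> (\<Union>i. C i) \<and> (\<forall>i. bounded (C i) \<and> diameter (C i) \<le> \<delta>) \<and>
          (\<Sum>i. hausdorff_content k (C i)) \<le> hausdorff_pre k \<delta> (A n) + c n" for n
  proof -
    have "hausdorff_pre k \<delta> (A n) < top"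
      using fin ennreal_suminf_lessD by blast
    moreover have "0 < c n" using e by (simp add: c_def)
    ultimately have "hausdorff_pre k \<delta> (A n) < hausdorff_pre k \<delta> (A n) + c n"
      by (simp add: ennreal_add_left_cancel_less less_top)
    then show ?thesis
      unfolding hausdorff_pre_def[of k \<delta> "A n"] INF_less_iff by (auto intro: less_imp_le)
  qed
  then obtain C where C: "\<And>n. A n \<subseteq> (\<Union>i. C n i)"
      "\<And>n i. bounded (C n i)" "\<And>n i. diameter (C n i) \<le> \<delta>"
      "\<And>n. (\<Sum>i. hausdorff_content k (C n i)) \<le> hausdorff_pre k \<delta> (A n) + c n"
    by metis
  define D where "D m = case_prod C (prod_decode m)" for m
  have "(\<Union>i. A i) \<subseteq> (\<Union>m. D m)"
  proof
    fix x assume "x \<in> (\<Union>i. A i)"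
    then obtain n i where "x \<in> C n i" using C(1) by blast
    then have "x \<in> D (prod_encode (n, i))" by (simp add: D_def)
    then show "x \<in> (\<Union>m. D m)" by blast
  qed
  then have "hausdorff_pre k \<delta> (\<Union>i. A i) \<le> (\<Sum>m. hausdorff_content k (D m))"
    unfolding hausdorff_pre_def
    by (intro INF_lower) (auto simp: D_def C split: prod.split)
  also have "\<dots> = (\<Sum>n. \<Sum>i. hausdorff_content k (C n i))"
    using suminf_ennreal_2dimen[where f = "\<lambda>(n, i). hausdorff_content k (C n i)"
        and g = "\<lambda>n. \<Sum>i. hausdorff_content k (C n i)"]
    by (simp add: D_def comp_def case_prod_unfold)
  also have "\<dots> \<le> (\<Sum>n. hausdorff_pre k \<delta> (A n) + c n)"
    by (intro suminf_le C(4)) auto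
  also have "\<dots> = (\<Sum>n. hausdorff_pre k \<delta> (A n)) + (\<Sum>n. c n)"
    by (rule suminf_add[symmetric]) auto
  also have "(\<Sum>n. c n) = ennreal e"
  proof -
    have "(\<lambda>n. e * (1/2) ^ Suc n) sums (e * 1)"
      by (intro sums_mult power_half_series)
    then have "(\<lambda>n. ennreal (e * (1/2) ^ Suc n)) sums ennreal e"
      using e by (subst sums_ennreal) auto
    then show ?thesis by (simp add: c_def sums_iff)
  qed
  finally show "hausdorff_pre k \<delta> (\<Union>i. A i) \<le> (\<Sum>i. hausdorff_pre k \<delta> (A i)) + ennreal e" .
qed

lemma outer_measure_space_hausdorff_outer:
  "outer_measure_space UNIV (hausdorff_outer k :: 'a::metric_space set \<Rightarrow> ennreal)"
  unfolding outer_measure_space_def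
proof (intro conjI)
  have "hausdorff_pre k \<delta> ({} :: 'a set) \<le> 0" if "0 < \<delta>" for \<delta>
    unfolding hausdorff_pre_def
    by (rule INF_lower2[of "\<lambda>_. {}"]) (use that in \<open>auto simp: hausdorff_content_def diameter_def\<close>)
  then show "positive UNIV (hausdorff_outer k :: 'a set \<Rightarrow> ennreal)"
    by (auto simp: positive_def hausdorff_outer_def)
  show "increasing UNIV (hausdorff_outer k :: 'a set \<Rightarrow> ennreal)"
    by (auto simp: increasing_def hausdorff_outer_def intro!: SUP_mono hausdorff_pre_mono)
  show "countably_subadditive UNIV (hausdorff_outer k :: 'a set \<Rightarrow> ennreal)"
  proof (clarsimp simp: countably_subadditive_def)
    fix A :: "nat \<Rightarrow> 'a set"
    show "hausdorff_outer k (\<Union>i. A i) \<le> (\<Sum>i. hausdorff_outer k (A i))"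
      unfolding hausdorff_outer_def[of k "\<Union>i. A i"]
    proof (rule SUP_least)
      fix \<delta> :: real assume "\<delta> \<in> {0<..}"
      then have "hausdorff_pre k \<delta> (A i) \<le> hausdorff_outer k (A i)" for i
        unfolding hausdorff_outer_def by (rule SUP_upper)
      then have "(\<Sum>i. hausdorff_pre k \<delta> (A i)) \<le> (\<Sum>i. hausdorff_outer k (A i))"
        by (intro suminf_le) auto
      then show "hausdorff_pre k \<delta> (\<Union>i. A i) \<le> (\<Sum>i. hausdorff_outer k (A i))"
        using hausdorff_pre_countably_subadditive order_trans by blast
    qed
  qed
qed

lemma measure_space_hausdorff_outer:
  "measure_space (UNIV :: 'a::metric_space set)
     (lambda_system UNIV UNIV (hausdorff_outer k)) (hausdorff_outer k)"
proof -
  interpret sigma_algebra UNIV "UNIV :: 'a set set"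
    using sigma_algebra_Pow[of "UNIV :: 'a set"] by simp
  show ?thesis
    by (rule caratheodory_lemma[OF outer_measure_space_hausdorff_outer])
qed

lemma sets_hausdorff_measure:
  "sets (hausdorff_measure k :: 'a::metric_space measure) =
     lambda_system UNIV UNIV (hausdorff_outer k)"
proof -
  interpret sigma_algebra "UNIV :: 'a set" "lambda_system UNIV UNIV (hausdorff_outer k)"
    using measure_space_hausdorff_outer[where 'a = 'a and k = k] by (simp add: measure_space_def)
  show ?thesis
    unfolding hausdorff_measure_def by (simp add: sigma_sets_eq)
qed

lemma emeasure_hausdorff_measure:
  fixes A :: "'a::metric_space set"
  assumes "A \<in> sets (hausdorff_measure k)"
  shows "emeasure (hausdorff_measure k) A = hausdorff_outer k A"
proof -
  have "measure_space (UNIV :: 'a set) (lambda_system UNIV UNIV (hausdorff_outer k)) (hausdorff_outer k)"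
    by (rule measure_space_hausdorff_outer)
  then show ?thesis
    using assms unfolding sets_hausdorff_measure unfolding hausdorff_measure_def measure_space_def
    by (intro emeasure_measure_of_sigma) auto
qed


section \<open>Function spaces\<close>

definition besov_space :: "real \<Rightarrow> real \<Rightarrow> ('a::euclidean_space \<Rightarrow> 'b::euclidean_space) set" where
  "besov_space r q =
     {u \<in> borel_measurable lebesgue.
        (\<integral>\<^sup>+ x. ennreal (norm (u x) powr q) \<partial>lebesgue) < \<infinity> \<and>
        (SUP h\<in>UNIV - {0}.
           \<integral>\<^sup>+ x. ennreal (norm (u (x + h) - u x) powr q / norm h powr (r * q)) \<partial>lebesgue) < \<infinity>}"

text \<open>Powers of extended nonnegative reals, for exponents \<open>p > 0\<close>.\<close>

definition ennreal_powr :: "ennreal \<Rightarrow> real \<Rightarrow> ennreal" where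
  "ennreal_powr x p = (if x = \<infinity> then \<infinity> else ennreal (enn2real x powr p))"

definition gagliardo_seminorm ::
    "real \<Rightarrow> real \<Rightarrow> 'a::euclidean_space set \<Rightarrow> ('a \<Rightarrow> 'b::euclidean_space) \<Rightarrow> ennreal" where
  "gagliardo_seminorm r q E u =
     ennreal_powr
       (\<integral>\<^sup>+ y\<in>E. (\<integral>\<^sup>+ x\<in>E.
          ennreal (norm (u x - u y) powr q / norm (x - y) powr (real DIM('a) + r * q))
        \<partial>lebesgue) \<partial>lebesgue)
       (1 / q)"

primrec cont_diff :: "nat \<Rightarrow> ('a::euclidean_space \<Rightarrow> real) \<Rightarrow> bool" where
  "cont_diff 0 f \<longleftrightarrow> continuous_on UNIV f"
| "cont_diff (Suc k) f \<longleftrightarrow>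
     (\<forall>x. f differentiable (at x)) \<and>
     (\<forall>i\<in>Basis. cont_diff k (\<lambda>x. frechet_derivative f (at x) i))"

definition test_functions :: "('a::euclidean_space \<Rightarrow> real) set" where
  "test_functions = {\<phi>. (\<forall>k. cont_diff k \<phi>) \<and> compact (closure {x. \<phi> x \<noteq> 0})}"

definition has_weak_gradient ::
    "('a::euclidean_space \<Rightarrow> real) \<Rightarrow> ('a \<Rightarrow> 'a) \<Rightarrow> bool" where
  "has_weak_gradient f g \<longleftrightarrow>
     (\<forall>\<phi>\<in>test_functions. \<forall>i\<in>Basis.
        (\<integral>x. f x * frechet_derivative \<phi> (at x) i \<partial>lebesgue) = - (\<integral>x. (g x \<bullet> i) * \<phi> x \<partial>lebesgue))"

definition sobolev_W11 :: "('a::euclidean_space \<Rightarrow> real) set" where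
  "sobolev_W11 =
     {f. integrable lebesgue f \<and> (\<exists>g. integrable lebesgue g \<and> has_weak_gradient f g)}"


section \<open>Kernels and mollification\<close>

text \<open>
  The type argument fixes the space \<open>\<real>\<^sup>N\<close>.  Only the values of \<open>\<rho> \<epsilon>\<close> on \<open>(0, \<infinity>)\<close> matter:
  the integrand \<open>\<rho> \<epsilon> (norm z)\<close> uses \<open>\<rho> \<epsilon> 0\<close> at the null set \<open>z = 0\<close> only.
\<close>

definition is_kernel :: "'a::euclidean_space itself \<Rightarrow> ereal \<Rightarrow> (real \<Rightarrow> real \<Rightarrow> real) \<Rightarrow> bool" where
  "is_kernel _ a \<rho> \<longleftrightarrow>
     0 < a \<and>
     (\<forall>\<epsilon>. 0 < \<epsilon> \<and> ereal \<epsilon> < a \<longrightarrow>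
        \<rho> \<epsilon> \<in> borel_measurable (lebesgue_on {0<..}) \<and>
        (\<forall>t>0. 0 \<le> \<rho> \<epsilon> t) \<and>
        (\<integral>\<^sup>+ z. ennreal (\<rho> \<epsilon> (norm (z :: 'a))) \<partial>lebesgue) = 1) \<and>
     (\<forall>\<delta>>0. ((\<lambda>\<epsilon>. \<integral>\<^sup>+ t\<in>{\<delta><..}. ennreal (\<rho> \<epsilon> t * t ^ (DIM('a) - 1)) \<partial>lebesgue) \<longlongrightarrow> 0)
        (at_right 0))"

definition mollify ::
    "('a::euclidean_space \<Rightarrow> real) \<Rightarrow> ('a \<Rightarrow> 'b::euclidean_space) \<Rightarrow> real \<Rightarrow> 'a \<Rightarrow> 'b" where
  "mollify \<eta> u \<epsilon> x = (\<integral>z. \<eta> z *\<^sub>R u (x - \<epsilon> *\<^sub>R z) \<partial>lebesgue)"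

end

theory Submission
  imports Defs
begin

text \<open>
  Let \<open>D v z\<close> be the integral over \<open>x, x + z \<in> E\<close> of the \<open>q\<close>-th power of
  \<open>norm (v (x + z) - v x)\<close>. In polar coordinates the Gagliardo seminorm and the kernel functional
  are integrals over \<open>t > 0\<close> of weights against \<open>\<Phi> t\<close>, the integral of
  \<open>D u (t n) / t powr (r q)\<close> over unit vectors \<open>n\<close>. By hypothesis \<open>\<Phi>\<close> tends to \<open>L\<close> at \<open>0\<close>, and
  \<open>\<Phi>\<close> is bounded because \<open>u\<close> is a Besov function. The kernels are approximate identities
  at \<open>t = 0\<close> of mass \<open>1 / \<sigma>(S)\<close>, which gives the limit of the kernel functional.

  For the seminorm of the mollified function \<open>u\<^sub>\<epsilon>\<close> only the shell \<open>\<epsilon> < norm z < 1\<close> matters: the region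
  \<open>norm z \<ge> 1\<close> is controlled by the \<open>L\<^sup>q\<close>-norm of \<open>u\<close>, and for \<open>norm z \<le> \<epsilon>\<close> the estimate
  \<open>\<integral>\<bar>\<eta> (y + h) - \<eta> y\<bar> dy \<le> norm h * \<integral>norm (\<nabla>\<eta>)\<close> yields \<open>D u\<^sub>\<epsilon> z \<le> C (norm z * \<epsilon> powr (r - 1)) powr q\<close>, so both
  regions contribute \<open>O(1)\<close>, which is killed by the factor \<open>1 / \<bar>ln \<epsilon>\<bar>\<close>. On the shell \<open>u\<^sub>\<epsilon>\<close> may be
  replaced by \<open>(\<integral>\<eta>) u\<close>, because the increments of the difference over \<open>z\<close> are at most of the
  order \<open>min (norm z) (\<epsilon> * norm y) powr (r q)\<close>, integrated against \<open>\<bar>\<eta> y\<bar>\<close>. The logarithmic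
  average of \<open>\<Phi>\<close> over \<open>(\<epsilon>, 1)\<close> tends to \<open>L\<close>.

  The surface measure enters through polar coordinates as the cone measure of the unit sphere, which has
  to be identified with the Hausdorff measure. One inequality is isodiametric: a subset of the sphere of
  diameter \<open>d\<close> spans a thin conical shell \<open>A\<close>, the volume of \<open>A\<close> is at most that of
  \<open>(A - A) / 2\<close> by the Brunn-Minkowski inequality, and \<open>(A - A) / 2\<close> lies in a cylinder of radius about
  \<open>d / 2\<close>. The other one is a Vitali covering of the sphere by small caps.
\<close>

section \<open>Volumes of midpoint sets\<close>

text \<open>The logarithm is the mass of \<open>dt / t\<close> on (\<epsilon>, 1), the weight that
  polar coordinates leave on the shell. The main obstacle is that \<eta> and its gradient are merely
  integrable, without moments. On the shell, the increments of the remainder are bounded, after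
  integration in z, by a multiple of \<open>min \<bar>ln \<epsilon>\<bar> (norm y powr (r * q) / (r
  * q))\<close>: small against \<open>\<bar>ln \<epsilon>\<bar>\<close> for each y and bounded by it
  uniformly, so dominated convergence against \<open>\<bar>\<eta> y\<bar>\<close> applies. Near the
  diagonal, subtracting u(x) under the integral would require a moment of the kernel increment;
  instead u is compared with its average b at scale \<epsilon>, since the norm of u - b is
  O(\<open>\<epsilon> powr r\<close>) and invariant under translation. As the energies are q-th
  powers, the triangle inequality is used in the form of \<open>powr_add_le_weighted\<close>, whose
  leading factor tends to 1. On the sphere, cone measure is bounded by Hausdorff measure on every
  Borel set, but the reverse bound is shown for the total mass only. All estimates are made for
  Borel representatives, for which Fubini arguments stay measurable.\<close>

text \<open>The multiplicative form of the Brunn-Minkowski inequality, with equal weights, is all that the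
  isodiametric estimate needs. It is proved for finite unions of boxes by the Hadwiger-Ohmann argument
  (both families are cut by parallel hyperplanes in the same ratio) and extended to open sets.\<close>

definition midpoints :: "'a::real_vector set \<Rightarrow> 'a set \<Rightarrow> 'a set" where
  "midpoints A B = (\<Union>a\<in>A. \<Union>b\<in>B. {(1/2) *\<^sub>R (a + b)})"

lemma midpoints_commute: "midpoints A B = midpoints B A"
  unfolding midpoints_def by (auto simp: add.commute)

lemma midpoints_mono: "A \<subseteq> A' \<Longrightarrow> B \<subseteq> B' \<Longrightarrow> midpoints A B \<subseteq> midpoints A' B'"
  unfolding midpoints_def by blast

lemma open_midpoints:
  fixes A B :: "'a::real_normed_vector set"
  assumes "open B" shows "open (midpoints A B)"
proof -
  have "midpoints A B = (\<Union>a\<in>A. (\<lambda>x. (1/2) *\<^sub>R a + x) ` ((\<lambda>x. (1/2) *\<^sub>R x) ` B))"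
    by (auto simp: midpoints_def scaleR_add_right)
  then show ?thesis
    using assms by (simp add: open_UN open_scaling open_translation)
qed

lemma bounded_midpoints:
  fixes A B :: "'a::real_normed_vector set"
  assumes "bounded A" "bounded B" shows "bounded (midpoints A B)"
proof -
  obtain a b where ab: "\<forall>x\<in>A. norm x \<le> a" "\<forall>x\<in>B. norm x \<le> b"
    using assms by (auto simp: bounded_iff)
  have "norm (x + y) \<le> a + b" if "x \<in> A" "y \<in> B" for x y
    using ab that by (meson add_mono norm_triangle_le)
  then show ?thesis
    unfolding bounded_iff midpoints_def by (intro exI[of _ "(a + b) / 2"]) auto
qed

text \<open>Open boxes lose only a null set when cut by a hyperplane, and excluding empty ones makes
  the cardinality a measure that drops when a cut removes a box.\<close>

definition box_family :: "'a::euclidean_space set set \<Rightarrow> bool" where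
  "box_family \<A> \<longleftrightarrow> finite \<A> \<and> disjoint \<A> \<and> (\<forall>Q\<in>\<A>. Q \<noteq> {} \<and> (\<exists>a b. Q = box a b))"

lemma box_family_open: "box_family \<A> \<Longrightarrow> open (\<Union>\<A>)"
  by (auto simp: box_family_def intro!: open_Union)

lemma box_family_bounded: "box_family \<A> \<Longrightarrow> bounded (\<Union>\<A>)"
  by (auto simp: box_family_def intro!: bounded_Union)

lemma box_Int_lower_halfspace:
  assumes i: "i \<in> Basis"
  shows "\<exists>a' b'. box a (b::'a::euclidean_space) \<inter> {x. x \<bullet> i < c} = box a' b'"
proof (intro exI)
  show "box a b \<inter> {x. x \<bullet> i < c} = box a (\<Sum>j\<in>Basis. (if j = i then min (b \<bullet> i) c else b \<bullet> j) *\<^sub>R j)"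
  proof (intro set_eqI iffI)
    fix x assume x: "x \<in> box a (\<Sum>j\<in>Basis. (if j = i then min (b \<bullet> i) c else b \<bullet> j) *\<^sub>R j)"
    then have "a \<bullet> j < x \<bullet> j \<and> x \<bullet> j < (if j = i then min (b \<bullet> i) c else b \<bullet> j)" if "j \<in> Basis" for j
      using that by (auto simp: mem_box)
    note * = this
    have "a \<bullet> j < x \<bullet> j \<and> x \<bullet> j < b \<bullet> j" if "j \<in> Basis" for j
      using *[OF that] by (auto split: if_splits)
    then show "x \<in> box a b \<inter> {x. x \<bullet> i < c}"
      using *[OF i] by (auto simp: mem_box)
  qed (use i in \<open>auto simp: mem_box\<close>)
qed

lemma box_Int_upper_halfspace:
  assumes i: "i \<in> Basis"
  shows "\<exists>a' b'. box a (b::'a::euclidean_space) \<inter> {x. x \<bullet> i > c} = box a' b'"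
proof (intro exI)
  show "box a b \<inter> {x. x \<bullet> i > c} = box (\<Sum>j\<in>Basis. (if j = i then max (a \<bullet> i) c else a \<bullet> j) *\<^sub>R j) b"
  proof (intro set_eqI iffI)
    fix x assume x: "x \<in> box (\<Sum>j\<in>Basis. (if j = i then max (a \<bullet> i) c else a \<bullet> j) *\<^sub>R j) b"
    then have "(if j = i then max (a \<bullet> i) c else a \<bullet> j) < x \<bullet> j \<and> x \<bullet> j < b \<bullet> j" if "j \<in> Basis" for j
      using that by (auto simp: mem_box)
    note * = this
    have "a \<bullet> j < x \<bullet> j \<and> x \<bullet> j < b \<bullet> j" if "j \<in> Basis" for j
      using *[OF that] by (auto split: if_splits)
    then show "x \<in> box a b \<inter> {x. x \<bullet> i > c}"
      using *[OF i] by (auto simp: mem_box)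
  qed (use i in \<open>auto simp: mem_box\<close>)
qed

text \<open>Boxes emptied by the cut are discarded, so the number of boxes drops as soon as one of
  them lies on the other side; this strict inequality drives the later induction.\<close>

lemma box_family_restrict:
  assumes \<A>: "box_family \<A>" and H: "\<And>a b. \<exists>a' b'. box a b \<inter> H = box a' b'"
  defines "\<A>' \<equiv> (\<lambda>Q. Q \<inter> H) ` \<A> - {{}}"
  shows "box_family \<A>'" "\<Union>\<A>' = \<Union>\<A> \<inter> H" "card \<A>' \<le> card \<A>"
    "Q \<in> \<A> \<Longrightarrow> Q \<inter> H = {} \<Longrightarrow> card \<A>' < card \<A>"
proof -
  have fin: "finite \<A>" and dj: "\<And>Q R. Q \<in> \<A> \<Longrightarrow> R \<in> \<A> \<Longrightarrow> Q \<noteq> R \<Longrightarrow> Q \<inter> R = {}"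
    using \<A> by (auto simp: box_family_def disjoint_def)
  show "box_family \<A>'"
    unfolding box_family_def \<A>'_def
  proof (intro conjI ballI)
    show "finite ((\<lambda>Q. Q \<inter> H) ` \<A> - {{}})" using fin by simp
    show "disjoint ((\<lambda>Q. Q \<inter> H) ` \<A> - {{}})"
      using dj by (force simp: disjoint_def)
    fix Q assume Q: "Q \<in> (\<lambda>Q. Q \<inter> H) ` \<A> - {{}}"
    then show "Q \<noteq> {}" by simp
    obtain P where P: "P \<in> \<A>" "Q = P \<inter> H" using Q by blast
    then obtain a b where "P = box a b" using \<A> unfolding box_family_def by metis
    then show "\<exists>a b. Q = box a b" using H[of a b] P(2) by simp
  qed
  show "\<Union>\<A>' = \<Union>\<A> \<inter> H" by (auto simp: \<A>'_def)
  have 1: "card \<A>' \<le> card ((\<lambda>Q. Q \<inter> H) ` \<A>)"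
    unfolding \<A>'_def using fin by (intro card_mono) auto
  show "card \<A>' \<le> card \<A>" using 1 card_image_le[OF fin, of "\<lambda>Q. Q \<inter> H"] by linarith
  show "card \<A>' < card \<A>" if "Q \<in> \<A>" "Q \<inter> H = {}"
  proof -
    have "{} \<in> (\<lambda>Q. Q \<inter> H) ` \<A>" using imageI[OF that(1), of "\<lambda>Q. Q \<inter> H"] that(2) by simp
    then have "card \<A>' < card ((\<lambda>Q. Q \<inter> H) ` \<A>)"
      unfolding \<A>'_def using fin by (intro psubset_card_mono finite_imageI) blast+
    then show ?thesis using card_image_le[OF fin, of "\<lambda>Q. Q \<inter> H"] by linarith
  qed
qed

lemma measure_lborel_halfspace_split:
  fixes A :: "'a::euclidean_space set"
  assumes A: "A \<in> sets borel" "bounded A" and i: "i \<in> Basis"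
  shows "measure lborel A = measure lborel (A \<inter> {x. x \<bullet> i < c}) + measure lborel (A \<inter> {x. x \<bullet> i > c})"
proof -
  have fin: "emeasure lborel B < \<infinity>" if "B \<subseteq> A" for B
    using that A(2) by (intro emeasure_bounded_finite) (auto intro: bounded_subset)
  have neg: "{x. x \<bullet> i = c} \<in> null_sets lborel"
    using negligible_standard_hyperplane[OF i, of c] borel_closed[OF closed_hyperplane[of i c]]
    by (simp add: negligible_iff_null_sets null_sets_completion_iff inner_commute)
  have "AE x in lborel. x \<notin> {x. x \<bullet> i = c}" using neg by (rule AE_not_in)
  then have "measure lborel A = measure lborel ((A \<inter> {x. x \<bullet> i < c}) \<union> (A \<inter> {x. x \<bullet> i > c}))"
    using A by (intro measure_eq_AE) (auto intro!: measurable_sets)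
  also have "\<dots> = measure lborel (A \<inter> {x. x \<bullet> i < c}) + measure lborel (A \<inter> {x. x \<bullet> i > c})"
    using A fin[of "A \<inter> {x. x \<bullet> i < c}"] fin[of "A \<inter> {x. x \<bullet> i > c}"]
    by (intro measure_Union) auto
  finally show ?thesis .
qed

text \<open>The midpoint set contains the box whose edges are the averages of the given edges; the
  rest is the arithmetic-geometric mean inequality, edge by edge.\<close>

lemma box_volume_midpoints:
  fixes a b c d :: "'a::euclidean_space"
  assumes "box a b \<noteq> {}" "box c d \<noteq> {}"
  shows "measure lborel (box a b) * measure lborel (box c d)
           \<le> (measure lborel (midpoints (box a b) (box c d)))\<^sup>2"
proof -
  have ab: "\<And>i. i \<in> Basis \<Longrightarrow> a \<bullet> i < b \<bullet> i" and cd: "\<And>i. i \<in> Basis \<Longrightarrow> c \<bullet> i < d \<bullet> i"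
    using assms by (auto simp: box_ne_empty)
  let ?m = "box ((1/2) *\<^sub>R (a + c)) ((1/2) *\<^sub>R (b + d))"
  have sub: "?m \<subseteq> midpoints (box a b) (box c d)"
  proof
    fix x assume x: "x \<in> ?m"
    \<comment> \<open>\<open>t i\<close> is the relative position of \<open>x\<close> in the
      averaged box; \<open>y\<close> and \<open>z\<close> take the same relative position in the two
      given boxes.\<close>
    define t where "t i = (2 * (x \<bullet> i) - (a + c) \<bullet> i) / ((b + d) \<bullet> i - (a + c) \<bullet> i)" for i
    have t: "0 < t i \<and> t i < 1" if i: "i \<in> Basis" for i
      using x i ab[OF i] cd[OF i] by (auto simp: t_def mem_box inner_add_left field_simps)
    define y where "y = (\<Sum>i\<in>Basis. (a \<bullet> i + t i * (b \<bullet> i - a \<bullet> i)) *\<^sub>R i)"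
    define z where "z = (\<Sum>i\<in>Basis. (c \<bullet> i + t i * (d \<bullet> i - c \<bullet> i)) *\<^sub>R i)"
    have "x \<bullet> i = (1/2) *\<^sub>R (y + z) \<bullet> i" if i: "i \<in> Basis" for i
    proof -
      have "(b + d) \<bullet> i - (a + c) \<bullet> i \<noteq> 0" using ab[OF i] cd[OF i] by (simp add: inner_add_left)
      then have "t i * ((b + d) \<bullet> i - (a + c) \<bullet> i) = 2 * (x \<bullet> i) - (a + c) \<bullet> i"
        by (simp add: t_def)
      moreover have "y \<bullet> i = a \<bullet> i + t i * (b \<bullet> i - a \<bullet> i)" "z \<bullet> i = c \<bullet> i + t i * (d \<bullet> i - c \<bullet> i)"
        using i by (simp_all add: y_def z_def)
      ultimately show ?thesis by (simp add: inner_add_left algebra_simps)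
    qed
    then have "x = (1/2) *\<^sub>R (y + z)" by (rule euclidean_eqI)
    moreover have "y \<in> box a b" "z \<in> box c d"
    proof -
      have *: "p < p + s * (q - p) \<and> p + s * (q - p) < q" if "p < q" "0 < s \<and> s < 1" for p q s :: real
      proof -
        have "0 < s * (q - p)" "s * (q - p) < 1 * (q - p)"
          using that by (auto intro: mult_pos_pos mult_strict_right_mono)
        then show ?thesis by simp
      qed
      show "y \<in> box a b" "z \<in> box c d"
        using *[OF ab t] *[OF cd t] by (auto simp: y_def z_def mem_box)
    qed
    ultimately show "x \<in> midpoints (box a b) (box c d)"
      unfolding midpoints_def by blast
  qed
  have "measure lborel (box a b) * measure lborel (box c d)
      = (\<Prod>i\<in>Basis. (b \<bullet> i - a \<bullet> i) * (d \<bullet> i - c \<bullet> i))"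
    using ab cd by (simp add: measure_lborel_box_eq less_imp_le prod.distrib inner_diff_left)
  also have "\<dots> \<le> (\<Prod>i\<in>Basis. (((b + d) \<bullet> i - (a + c) \<bullet> i) / 2)\<^sup>2)"
  proof (rule prod_mono, intro conjI)
    fix i :: 'a assume i: "i \<in> Basis"
    show "0 \<le> (b \<bullet> i - a \<bullet> i) * (d \<bullet> i - c \<bullet> i)" using ab[OF i] cd[OF i] by simp
    have "0 \<le> ((b \<bullet> i - a \<bullet> i) - (d \<bullet> i - c \<bullet> i))\<^sup>2" by simp
    then show "(b \<bullet> i - a \<bullet> i) * (d \<bullet> i - c \<bullet> i) \<le> (((b + d) \<bullet> i - (a + c) \<bullet> i) / 2)\<^sup>2"
      by (simp add: power2_eq_square algebra_simps)
  qed
  also have "\<dots> = (measure lborel ?m)\<^sup>2"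
  proof -
    have "((1/2) *\<^sub>R (a + c)) \<bullet> i \<le> ((1/2) *\<^sub>R (b + d)) \<bullet> i" if "i \<in> Basis" for i
      using ab[OF that] cd[OF that] by (simp add: inner_add_left)
    then have "measure lborel ?m = (\<Prod>i\<in>Basis. ((1/2) *\<^sub>R (b + d) - (1/2) *\<^sub>R (a + c)) \<bullet> i)"
      by (subst measure_lborel_box_eq) auto
    also have "\<dots> = (\<Prod>i\<in>Basis. ((b + d) \<bullet> i - (a + c) \<bullet> i) / 2)"
      by (intro prod.cong) (auto simp: inner_diff_left diff_divide_distrib)
    finally show ?thesis by (simp add: prod_power_distrib)
  qed
  also have "\<dots> \<le> (measure lborel (midpoints (box a b) (box c d)))\<^sup>2"
    using sub by (intro power_mono measure_mono_fmeasurable fmeasurableI emeasure_bounded_finite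
        bounded_midpoints) (auto intro: borel_open open_midpoints)
  finally show ?thesis .
qed

text \<open>Two disjoint boxes are separated by a coordinate hyperplane, so each open side misses
  one of them completely.\<close>

lemma box_family_split:
  fixes \<A> :: "'a::euclidean_space set set"
  assumes \<A>: "box_family \<A>" "2 \<le> card \<A>"
  obtains i c \<A>1 \<A>2 where "i \<in> Basis" "box_family \<A>1" "box_family \<A>2"
    "\<Union>\<A>1 = \<Union>\<A> \<inter> {x. x \<bullet> i < c}" "\<Union>\<A>2 = \<Union>\<A> \<inter> {x. x \<bullet> i > c}"
    "card \<A>1 < card \<A>" "card \<A>2 < card \<A>"
proof -
  have "\<not> card \<A> \<le> 1" using \<A> by simp
  then obtain P Q where PQ: "P \<in> \<A>" "Q \<in> \<A>" "P \<noteq> Q"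
    using \<A>(1) by (metis box_family_def card_le_Suc0_iff_eq One_nat_def)
  then obtain a b c d where boxes: "P = box a b" "Q = box c d" "box a b \<noteq> {}" "box c d \<noteq> {}"
    and dj: "box a b \<inter> box c d = {}"
    using \<A>(1) unfolding box_family_def disjoint_def by metis
  then obtain i where i: "i \<in> Basis" "b \<bullet> i \<le> c \<bullet> i \<or> d \<bullet> i \<le> a \<bullet> i"
    using disjoint_interval(4)[of a b c d] unfolding box_ne_empty by (metis not_le)
  have "\<exists>s. P \<inter> {x. x \<bullet> i > s} = {} \<and> Q \<inter> {x. x \<bullet> i < s} = {} \<or>
      Q \<inter> {x. x \<bullet> i > s} = {} \<and> P \<inter> {x. x \<bullet> i < s} = {}"
    using i(2)
  proof
    assume "b \<bullet> i \<le> c \<bullet> i"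
    then show ?thesis using i(1) boxes by (intro exI[of _ "b \<bullet> i"] disjI1) (force simp: mem_box)
  next
    assume "d \<bullet> i \<le> a \<bullet> i"
    then show ?thesis using i(1) boxes by (intro exI[of _ "d \<bullet> i"] disjI2) (force simp: mem_box)
  qed
  then obtain s P' Q' where s: "P' \<in> \<A>" "Q' \<in> \<A>" "P' \<inter> {x. x \<bullet> i > s} = {}" "Q' \<inter> {x. x \<bullet> i < s} = {}"
    using PQ by blast
  note lo = box_family_restrict[OF \<A>(1) box_Int_lower_halfspace[OF i(1), of _ _ s]]
  note hi = box_family_restrict[OF \<A>(1) box_Int_upper_halfspace[OF i(1), of _ _ s]]
  show ?thesis
    by (rule that[OF i(1) lo(1) hi(1) lo(2) hi(2) lo(4)[OF s(2,4)] hi(4)[OF s(1,3)]])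
qed

text \<open>Intermediate value theorem: the volume below height \<open>s\<close> is Lipschitz in
  \<open>s\<close>, since a bounded set has slices of bounded area.\<close>

lemma halfspace_ratio_exists:
  fixes B :: "'a::euclidean_space set"
  assumes B: "B \<in> sets borel" "bounded B" and i: "i \<in> Basis" and \<theta>: "0 \<le> \<theta>" "\<theta> \<le> 1"
  obtains s where "measure lborel (B \<inter> {x. x \<bullet> i < s}) = \<theta> * measure lborel B"
proof -
  obtain a where a: "B \<subseteq> cbox (- a) a" using bounded_subset_cbox_symmetric[OF B(2)] by auto
  define f where "f s = measure lborel (B \<inter> {x. x \<bullet> i < s})" for s
  \<comment> \<open>\<open>K\<close> is the area of the cross-section of a box containing
    \<open>B\<close>, hence a Lipschitz constant for \<open>f\<close>.\<close>
  define K where "K = (\<Prod>j\<in>Basis - {i}. 2 * \<bar>a \<bullet> j\<bar>)"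
  have K: "0 \<le> K" unfolding K_def by (intro prod_nonneg) auto
  have lip: "\<bar>f t - f s\<bar> \<le> K * (t - s)" if "s \<le> t" for s t
  proof -
    let ?c = "cbox (\<Sum>j\<in>Basis. (if j = i then s else - \<bar>a \<bullet> j\<bar>) *\<^sub>R j) (\<Sum>j\<in>Basis. (if j = i then t else \<bar>a \<bullet> j\<bar>) *\<^sub>R j)"
    have fin: "emeasure lborel C < \<infinity>" if "C \<subseteq> B" for C
      using that B(2) by (intro emeasure_bounded_finite) (auto intro: bounded_subset)
    have "B \<inter> {x. x \<bullet> i < t} = (B \<inter> {x. x \<bullet> i < s}) \<union> (B \<inter> {x. s \<le> x \<bullet> i \<and> x \<bullet> i < t})"
      using that by auto
    also have "measure lborel \<dots> = f s + measure lborel (B \<inter> {x. s \<le> x \<bullet> i \<and> x \<bullet> i < t})"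
      unfolding f_def using B fin[of "B \<inter> {x. x \<bullet> i < s}"] fin[of "B \<inter> {x. s \<le> x \<bullet> i \<and> x \<bullet> i < t}"]
      by (intro measure_Union) auto
    finally have f: "f t = f s + measure lborel (B \<inter> {x. s \<le> x \<bullet> i \<and> x \<bullet> i < t})" by (simp add: f_def)
    have "x \<in> ?c" if x: "x \<in> B \<inter> {x. s \<le> x \<bullet> i \<and> x \<bullet> i < t}" for x
    proof -
      have "x \<in> cbox (- a) a" using x a by auto
      then have "- \<bar>a \<bullet> j\<bar> \<le> x \<bullet> j \<and> x \<bullet> j \<le> \<bar>a \<bullet> j\<bar>" if "j \<in> Basis" for j
        using that by (force simp: mem_box)
      then show ?thesis using x by (auto simp: mem_box)
    qed
    then have "measure lborel (B \<inter> {x. s \<le> x \<bullet> i \<and> x \<bullet> i < t}) \<le> measure lborel ?c"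
      using B by (intro measure_mono_fmeasurable fmeasurableI emeasure_bounded_finite) auto
    also have "\<dots> = (\<Prod>j\<in>Basis. (if j = i then t - s else 2 * \<bar>a \<bullet> j\<bar>))"
      using that by (subst measure_lborel_cbox_eq) (auto simp: inner_diff_left intro!: prod.cong)
    also have "\<dots> = (t - s) * K"
      unfolding K_def using i by (subst prod.remove[of _ i]) (auto intro!: prod.cong)
    finally show ?thesis using f measure_nonneg[of lborel "B \<inter> {x. s \<le> x \<bullet> i \<and> x \<bullet> i < t}"]
      by (simp add: mult.commute)
  qed
  have "continuous_on UNIV f"
  proof (rule continuous_onI)
    fix s e :: real assume e: "0 < e"
    have "dist (f t) (f s) \<le> e" if "dist t s < e / (K + 1)" for t
    proof -
      have "\<bar>f t - f s\<bar> \<le> K * \<bar>t - s\<bar>"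
        using lip[of s t] lip[of t s] by (cases "s \<le> t") (auto simp: abs_minus_commute)
      also have "\<dots> \<le> (K + 1) * \<bar>t - s\<bar>" by (intro mult_right_mono) auto
      also have "\<dots> \<le> e" using that K by (simp add: dist_real_def field_simps)
      finally show ?thesis by (simp add: dist_real_def)
    qed
    then show "\<exists>d>0. \<forall>x'\<in>UNIV. dist x' s < d \<longrightarrow> dist (f x') (f s) \<le> e"
      using e K by (intro exI[of _ "e / (K + 1)"]) auto
  qed
  moreover have "f (- \<bar>a \<bullet> i\<bar>) = 0"
  proof -
    have "B \<inter> {x. x \<bullet> i < - \<bar>a \<bullet> i\<bar>} = {}" using a i by (force simp: mem_box)
    then show ?thesis by (simp add: f_def)
  qed
  moreover have "f (\<bar>a \<bullet> i\<bar> + 1) = measure lborel B"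
  proof -
    have "B \<inter> {x. x \<bullet> i < \<bar>a \<bullet> i\<bar> + 1} = B" using a i by (force simp: mem_box)
    then show ?thesis by (simp add: f_def)
  qed
  ultimately have "\<exists>s\<ge>- \<bar>a \<bullet> i\<bar>. s \<le> \<bar>a \<bullet> i\<bar> + 1 \<and> f s = \<theta> * measure lborel B"
    using \<theta> by (intro IVT') (auto intro: continuous_on_subset mult_left_le_one_le)
  then show ?thesis using that by (auto simp: f_def)
qed

lemma measure_pos_open:
  fixes A :: "'a::euclidean_space set"
  assumes "open A" "bounded A" "A \<noteq> {}"
  shows "0 < measure lborel A"
proof -
  have "emeasure lborel A \<noteq> 0"
    using open_not_negligible[OF assms(1,3)] assms
    by (auto simp: negligible_iff_null_sets null_sets_completion_iff null_sets_def)
  then show ?thesis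
    using emeasure_bounded_finite[OF assms(2)]
    by (simp add: measure_def enn2real_positive_iff zero_less_iff_neq_zero)
qed

text \<open>Induction on the total number of boxes. If the cuts are at heights \<open>c\<close> and
  \<open>s\<close>, the midpoint sets of the lower and of the upper parts lie on opposite sides of
  height \<open>(c + s) / 2\<close>, so their volumes add; the equal ratio gives both parts the same
  factor \<open>sqrt (b / a)\<close>.\<close>

lemma box_family_volume_midpoints:
  fixes \<A> \<B> :: "'a::euclidean_space set set"
  assumes "box_family \<A>" "box_family \<B>"
  shows "measure lborel (\<Union>\<A>) * measure lborel (\<Union>\<B>) \<le> (measure lborel (midpoints (\<Union>\<A>) (\<Union>\<B>)))\<^sup>2"
  using assms
proof (induction "card \<A> + card \<B>" arbitrary: \<A> \<B> rule: less_induct)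
  case less
  \<comment> \<open>Stated for a generic pair with its own induction hypothesis, because either of
    the two families may be the one that has at least two boxes.\<close>
  have step: "measure lborel (\<Union>\<A>) * measure lborel (\<Union>\<B>) \<le> (measure lborel (midpoints (\<Union>\<A>) (\<Union>\<B>)))\<^sup>2"
    if A: "box_family \<A>" and B: "box_family \<B>" and card: "2 \<le> card \<A>"
      and IH: "\<And>\<A>' \<B>' :: 'a set set. card \<A>' < card \<A> \<Longrightarrow> card \<B>' \<le> card \<B> \<Longrightarrow> box_family \<A>' \<Longrightarrow> box_family \<B>' \<Longrightarrow>
        measure lborel (\<Union>\<A>') * measure lborel (\<Union>\<B>') \<le> (measure lborel (midpoints (\<Union>\<A>') (\<Union>\<B>')))\<^sup>2"
    for \<A> \<B> :: "'a set set"
  proof -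
    obtain i c \<A>1 \<A>2 where i: "i \<in> Basis" and fam: "box_family \<A>1" "box_family \<A>2"
      and U: "\<Union>\<A>1 = \<Union>\<A> \<inter> {x. x \<bullet> i < c}" "\<Union>\<A>2 = \<Union>\<A> \<inter> {x. x \<bullet> i > c}"
      and less: "card \<A>1 < card \<A>" "card \<A>2 < card \<A>"
      using box_family_split[OF A card] by metis
    note bo = box_family_open[OF A] box_family_open[OF B] box_family_bounded[OF A] box_family_bounded[OF B]
    define a where "a = measure lborel (\<Union>\<A>)"
    define b where "b = measure lborel (\<Union>\<B>)"
    have "\<Union>\<A> \<noteq> {}" using A card by (force simp: box_family_def)
    then have a: "0 < a" unfolding a_def using bo by (intro measure_pos_open)
    define a1 where "a1 = measure lborel (\<Union>\<A>1)"
    define a2 where "a2 = measure lborel (\<Union>\<A>2)"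
    have a12: "a = a1 + a2" "0 \<le> a1" "0 \<le> a2"
      unfolding a_def a1_def a2_def U using bo i by (auto intro!: measure_lborel_halfspace_split)
    obtain s where s: "measure lborel (\<Union>\<B> \<inter> {x. x \<bullet> i < s}) = (a1 / a) * b"
      using halfspace_ratio_exists[of "\<Union>\<B>" i "a1 / a"] bo i a a12 unfolding b_def by auto
    define \<B>1 where "\<B>1 = (\<lambda>Q. Q \<inter> {x. x \<bullet> i < s}) ` \<B> - {{}}"
    define \<B>2 where "\<B>2 = (\<lambda>Q. Q \<inter> {x. x \<bullet> i > s}) ` \<B> - {{}}"
    note B1 = box_family_restrict[OF B box_Int_lower_halfspace[OF i, of _ _ s], folded \<B>1_def]
    note B2 = box_family_restrict[OF B box_Int_upper_halfspace[OF i, of _ _ s], folded \<B>2_def]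
    have b1: "measure lborel (\<Union>\<B>1) = (a1 / a) * b" using s B1 by simp
    have b2: "measure lborel (\<Union>\<B>2) = (a2 / a) * b"
    proof -
      have "b = measure lborel (\<Union>\<B> \<inter> {x. x \<bullet> i < s}) + measure lborel (\<Union>\<B> \<inter> {x. x \<bullet> i > s})"
        unfolding b_def using bo i by (intro measure_lborel_halfspace_split) auto
      then have "b = (a1 / a) * b + measure lborel (\<Union>\<B>2)"
        using s B2(2) by simp
      then show ?thesis using a a12(1) by (simp add: field_simps)
    qed
    let ?M = "midpoints (\<Union>\<A>) (\<Union>\<B>)"
    let ?M1 = "midpoints (\<Union>\<A>1) (\<Union>\<B>1)"
    let ?M2 = "midpoints (\<Union>\<A>2) (\<Union>\<B>2)"
    have b0: "0 \<le> b" by (simp add: b_def)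
    \<comment> \<open>A part of volume \<open>x\<close> is paired with one of volume
      \<open>(x / a) * b\<close>; the product is the square of
      \<open>x * sqrt (b / a)\<close>.\<close>
    have rt: "x * sqrt (b / a) \<le> m" if "x * ((x / a) * b) \<le> m\<^sup>2" "0 \<le> x" "0 \<le> m" for x m :: real
    proof (rule power2_le_imp_le)
      show "(x * sqrt (b / a))\<^sup>2 \<le> m\<^sup>2" using that a b0 by (simp add: power2_eq_square power_mult_distrib field_simps)
    qed (use that in auto)
    have IH1: "a1 * sqrt (b / a) \<le> measure lborel ?M1"
      using IH[OF less(1) B1(3) fam(1) B1(1)] a12 b1 a1_def by (intro rt) auto
    have IH2: "a2 * sqrt (b / a) \<le> measure lborel ?M2"
      using IH[OF less(2) B2(3) fam(2) B2(1)] a12 b2 a2_def by (intro rt) auto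
    have om: "open ?M" "open ?M1" "open ?M2" "bounded ?M" "bounded ?M1" "bounded ?M2"
      using bo fam B1(1) B2(1) by (auto intro!: open_midpoints bounded_midpoints box_family_open box_family_bounded simp del: Union_iff)
    have dj: "?M1 \<inter> ?M2 = {}"
    proof -
      have "x \<bullet> i < (c + s) / 2" if "x \<in> ?M1" for x
        using that unfolding midpoints_def U B1 by (auto simp: inner_add_left)
      moreover have "x \<bullet> i > (c + s) / 2" if "x \<in> ?M2" for x
        using that unfolding midpoints_def U B2 by (auto simp: inner_add_left)
      ultimately show ?thesis by force
    qed
    have "a * sqrt (b / a) \<le> measure lborel ?M1 + measure lborel ?M2"
      using IH1 IH2 unfolding a12(1) by (simp add: algebra_simps)
    also have "\<dots> = measure lborel (?M1 \<union> ?M2)"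
      using om dj by (intro measure_Union[symmetric]) (auto dest: emeasure_bounded_finite)
    also have "\<dots> \<le> measure lborel ?M"
      using om U B1(2) B2(2) by (intro measure_mono_fmeasurable fmeasurableI emeasure_bounded_finite Un_least midpoints_mono) auto
    finally have "(a * sqrt (b / a))\<^sup>2 \<le> (measure lborel ?M)\<^sup>2"
      using a b0 by (intro power_mono) auto
    also have "(a * sqrt (b / a))\<^sup>2 = a * b" using a b0 by (simp add: power_mult_distrib power2_eq_square[of a])
    finally show ?thesis by (simp add: a_def b_def)
  qed
  consider "\<A> = {}" | "\<B> = {}" | "2 \<le> card \<A>" | "2 \<le> card \<B>" | "card \<A> = 1" "card \<B> = 1"
  proof -
    have "finite \<A>" "finite \<B>" using less.prems by (auto simp: box_family_def)
    then have "\<A> = {} \<or> card \<A> = 1 \<or> 2 \<le> card \<A>" "\<B> = {} \<or> card \<B> = 1 \<or> 2 \<le> card \<B>"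
      using card_eq_0_iff[of \<A>] card_eq_0_iff[of \<B>] by linarith+
    then show thesis using that by blast
  qed
  then show ?case
  proof cases
    case 3
    show ?thesis
      by (rule step[OF less.prems 3], rule less.hyps) auto
  next
    case 4
    have "measure lborel (\<Union>\<B>) * measure lborel (\<Union>\<A>) \<le> (measure lborel (midpoints (\<Union>\<B>) (\<Union>\<A>)))\<^sup>2"
      by (rule step[OF less.prems(2,1) 4], rule less.hyps) auto
    then show ?thesis by (simp add: midpoints_commute mult.commute)
  next
    case 5
    then obtain P Q where "\<A> = {P}" "\<B> = {Q}" by (metis card_1_singletonE)
    then show ?thesis using less.prems by (auto simp: box_family_def intro!: box_volume_midpoints)
  qed auto
qed

text \<open>A gauge that equals \<open>A\<close> at the points of \<open>A\<close> forces every cell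
  of the covering lemma into \<open>A\<close>. Finitely many cells nearly exhaust the volume, and
  passing to their interiors loses only the frontiers, a null set.\<close>

lemma open_approx_box_family:
  fixes A :: "'a::euclidean_space set"
  assumes A: "open A" "bounded A" and e: "0 < e"
  obtains \<A> where "box_family \<A>" "\<Union>\<A> \<subseteq> A" "measure lborel A < measure lborel (\<Union>\<A>) + e"
proof -
  show ?thesis
  proof (cases "A = {}")
    case True
    then show ?thesis using that[of "{}"] e by (simp add: box_family_def)
  next
    case False
  obtain a where a0: "A \<subseteq> box (- a) a" using bounded_subset_box_symmetric[OF A(2)] by auto
  then have a: "A \<subseteq> cbox (- a) a" "box (- a) a \<noteq> {}" using False box_subset_cbox by blast+
  define g where "g x = (if x \<in> A then A else UNIV)" for x
  have "gauge g" unfolding gauge_def g_def using A by auto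
  from covering_lemma[OF a this] obtain \<D> where D: "countable \<D>"
    "\<And>K. K \<in> \<D> \<Longrightarrow> interior K \<noteq> {} \<and> (\<exists>c d. K = cbox c d)"
    "pairwise (\<lambda>A B. interior A \<inter> interior B = {}) \<D>"
    "\<And>K. K \<in> \<D> \<Longrightarrow> \<exists>x \<in> A \<inter> K. K \<subseteq> g x" "A \<subseteq> \<Union>\<D>"
    by metis
  have sub: "K \<subseteq> A" if "K \<in> \<D>" for K using D(4)[OF that] by (auto simp: g_def)
  have bo: "\<exists>c d. K = cbox c d \<and> interior K = box c d \<and> box c d \<noteq> {}" if "K \<in> \<D>" for K
    using D(2)[OF that] by (metis interior_cbox)
  have ne: "\<D> \<noteq> {}" using D(5) False by auto
  define F where "F n = from_nat_into \<D> ` {..n}" for n :: nat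
  have F: "F n \<subseteq> \<D>" for n using from_nat_into[OF ne] by (auto simp: F_def)
  have UF: "(\<Union>n. \<Union>(F n)) = A"
  proof
    show "(\<Union>n. \<Union>(F n)) \<subseteq> A" using F sub by blast
    show "A \<subseteq> (\<Union>n. \<Union>(F n))"
    proof
      fix x assume "x \<in> A"
      then obtain K where "K \<in> \<D>" "x \<in> K" using D(5) by blast
      then obtain n where "from_nat_into \<D> n = K" using from_nat_into_surj[OF D(1)] by blast
      then show "x \<in> (\<Union>n. \<Union>(F n))" using \<open>x \<in> K\<close> by (auto simp: F_def)
    qed
  qed
  have Fb: "\<Union>(F n) \<in> sets lborel" for n
    using F[of n] bo by (intro sets.finite_Union) (force simp: F_def)+
  have "(\<lambda>n. measure lborel (\<Union>(F n))) \<longlonglongrightarrow> measure lborel (\<Union>n. \<Union>(F n))"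
  proof (intro Lim_measure_incseq)
    show "incseq (\<lambda>n. \<Union>(F n))"
      unfolding incseq_def F_def by (intro allI impI Union_mono image_mono) auto
  qed (use Fb emeasure_bounded_finite[OF A(2)] UF in auto)
  then have "\<forall>\<^sub>F n in sequentially. measure lborel A - e < measure lborel (\<Union>(F n))"
    using e unfolding UF by (intro order_tendstoD) auto
  then obtain n where n: "measure lborel A - e < measure lborel (\<Union>(F n))"
    by (metis eventually_happens sequentially_bot)
  define \<A> where "\<A> = interior ` F n"
  have fam: "box_family \<A>"
    unfolding box_family_def
  proof (intro conjI ballI)
    show "finite \<A>" by (simp add: \<A>_def F_def)
    show "disjoint \<A>"
    proof (rule disjointI)
      fix P Q assume PQ: "P \<in> \<A>" "Q \<in> \<A>" "P \<noteq> Q"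
      then obtain K L where "K \<in> F n" "L \<in> F n" "P = interior K" "Q = interior L"
        by (auto simp: \<A>_def)
      then show "P \<inter> Q = {}" using pairwiseD[OF D(3), of K L] F[of n] PQ(3) by blast
    qed
    fix Q assume "Q \<in> \<A>"
    then show "Q \<noteq> {}" "\<exists>a b. Q = box a b" unfolding \<A>_def using bo F[of n] by (metis imageE subsetD)+
  qed
  have "(\<Union>K\<in>F n. frontier K) \<in> null_sets lborel"
  proof (rule null_sets.finite_UN)
    show "finite (F n)" by (simp add: F_def)
    fix K assume "K \<in> F n"
    then obtain c d where "K = cbox c d" using bo F by blast
    then show "frontier K \<in> null_sets lborel"
      using negligible_frontier_interval(1)[of c d]
      by (simp add: negligible_iff_null_sets null_sets_completion_iff frontier_def)
  qed
  then have "AE x in lborel. x \<notin> (\<Union>K\<in>F n. frontier K)" by (rule AE_not_in)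
  then have "measure lborel (\<Union>(F n)) = measure lborel (\<Union>\<A>)"
  proof (intro measure_eq_AE)
    assume *: "AE x in lborel. x \<notin> (\<Union>K\<in>F n. frontier K)"
    have cl: "closed K" if "K \<in> F n" for K using bo F[of n] that by force
    show "AE x in lborel. (x \<in> \<Union>(F n)) = (x \<in> \<Union>\<A>)"
      using *
    proof eventually_elim
      case (elim x)
      have "x \<in> K \<longleftrightarrow> x \<in> interior K" if "K \<in> F n" for K
        using elim that cl[OF that] interior_subset[of K] by (auto simp: frontier_def)
      then show ?case by (simp add: \<A>_def)
    qed
  qed (use Fb borel_open[OF box_family_open[OF fam]] in auto)
  moreover have "\<Union>\<A> \<subseteq> A" using F[of n] sub interior_subset unfolding \<A>_def by blast
  ultimately show ?thesis using n fam by (intro that[of \<A>]) auto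
  qed
qed

lemma volume_midpoints:
  fixes A B :: "'a::euclidean_space set"
  assumes A: "open A" "bounded A" and B: "open B" "bounded B"
  shows "measure lborel A * measure lborel B \<le> (measure lborel (midpoints A B))\<^sup>2"
proof (cases "measure lborel A = 0 \<or> measure lborel B = 0")
  case False
  let ?a = "measure lborel A" and ?b = "measure lborel B" and ?m = "measure lborel (midpoints A B)"
  have ab: "0 < ?a" "0 < ?b" using False by (auto simp: zero_less_measure_iff)
  show ?thesis
  proof (rule tendsto_upperbound)
    show "((\<lambda>e. (?a - e) * (?b - e)) \<longlongrightarrow> ?a * ?b) (at_right 0)"
      by (auto intro!: tendsto_eq_intros)
    have "\<forall>\<^sub>F e in at_right 0. e \<in> {0<..<min ?a ?b}"
      using ab by (intro eventually_at_right_real) auto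
    then show "\<forall>\<^sub>F e in at_right 0. (?a - e) * (?b - e) \<le> ?m\<^sup>2"
    proof eventually_elim
      case (elim e)
      obtain \<A> where 1: "box_family \<A>" "\<Union>\<A> \<subseteq> A" "?a < measure lborel (\<Union>\<A>) + e"
        using open_approx_box_family[OF A, of e] elim by auto
      obtain \<B> where 2: "box_family \<B>" "\<Union>\<B> \<subseteq> B" "?b < measure lborel (\<Union>\<B>) + e"
        using open_approx_box_family[OF B, of e] elim by auto
      have "(?a - e) * (?b - e) \<le> measure lborel (\<Union>\<A>) * measure lborel (\<Union>\<B>)"
        using 1(3) 2(3) elim by (intro mult_mono) auto
      also have "\<dots> \<le> (measure lborel (midpoints (\<Union>\<A>) (\<Union>\<B>)))\<^sup>2"
        by (rule box_family_volume_midpoints[OF 1(1) 2(1)])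
      also have "\<dots> \<le> ?m\<^sup>2"
        using 1 2 A B by (intro power_mono measure_mono_fmeasurable fmeasurableI emeasure_bounded_finite
          midpoints_mono bounded_midpoints) (auto intro!: borel_open open_midpoints box_family_open simp del: Union_iff)
      finally show ?case .
    qed
  qed simp
qed auto

text \<open>Reflection preserves volume, so the product in \<open>volume_midpoints\<close> becomes a
  square; the midpoint set is half of the difference set \<open>A - A\<close>.\<close>

lemma volume_le_symmetrization:
  fixes A :: "'a::euclidean_space set"
  assumes A: "open A" "bounded A"
  shows "measure lborel A \<le> measure lborel (midpoints A (uminus ` A))"
proof -
  have o: "open (uminus ` A)" "bounded (uminus ` A)"
    using A by (auto simp: open_negations)
  have "emeasure lborel (uminus ` A) = emeasure lborel A"
    using emeasure_lebesgue_affine[of "-1" 0 A] A o by (simp add: image_def)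
  then have "measure lborel (uminus ` A) = measure lborel A" by (simp add: measure_def)
  then have "(measure lborel A)\<^sup>2 \<le> (measure lborel (midpoints A (uminus ` A)))\<^sup>2"
    using volume_midpoints[OF A o] by (simp add: power2_eq_square)
  then show ?thesis by (rule power2_le_imp_le) simp
qed

section \<open>Isometries and cylinders\<close>

lemma nn_integral_lborel_translate:
  fixes f :: "'a::euclidean_space \<Rightarrow> ennreal"
  assumes [measurable]: "f \<in> borel_measurable borel"
  shows "(\<integral>\<^sup>+x. f (c + x) \<partial>lborel) = (\<integral>\<^sup>+x. f x \<partial>lborel)"
proof -
  have "(\<integral>\<^sup>+x. f x \<partial>lborel) = (\<integral>\<^sup>+x. f x \<partial>distr lborel borel ((+) c))"
    by (simp add: lborel_distr_plus)
  also have "\<dots> = (\<integral>\<^sup>+x. f (c + x) \<partial>lborel)"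
    by (subst nn_integral_distr) auto
  finally show ?thesis by simp
qed

lemma nn_integral_lborel_scale:
  fixes f :: "'a::euclidean_space \<Rightarrow> ennreal"
  assumes [measurable]: "f \<in> borel_measurable borel" and c: "c \<noteq> 0"
  shows "(\<integral>\<^sup>+x. f x \<partial>lborel) = ennreal (\<bar>c\<bar> ^ DIM('a)) * (\<integral>\<^sup>+x. f (c *\<^sub>R x) \<partial>lborel)"
proof -
  have "(\<integral>\<^sup>+x. f x \<partial>lborel) = (\<integral>\<^sup>+x. f x \<partial>density (distr lborel borel (\<lambda>x. 0 + c *\<^sub>R x)) (\<lambda>_. ennreal (\<bar>c\<bar> ^ DIM('a))))"
    using lborel_affine[OF c, of "0::'a"] by simp
  also have "\<dots> = (\<integral>\<^sup>+x. ennreal (\<bar>c\<bar> ^ DIM('a)) * f (c *\<^sub>R x) \<partial>lborel)"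
    by (subst nn_integral_density) (auto simp: nn_integral_distr)
  also have "\<dots> = ennreal (\<bar>c\<bar> ^ DIM('a)) * (\<integral>\<^sup>+x. f (c *\<^sub>R x) \<partial>lborel)"
    by (rule nn_integral_cmult) simp
  finally show ?thesis .
qed

text \<open>Rotation invariance from translation invariance: the double integral of
  \<open>indicator ?B (T x) * indicator A (T x + y)\<close> is evaluated in two ways. Integrating in
  \<open>y\<close> first gives the volume of \<open>A\<close> times that of the unit ball
  \<open>?B\<close>, which \<open>T\<close> preserves; shifting \<open>x\<close> first gives the
  volume of the preimage of \<open>A\<close> times that of a unit ball.\<close>

lemma emeasure_lborel_orthogonal:
  fixes T :: "'a::euclidean_space \<Rightarrow> 'a"
  assumes T: "orthogonal_transformation T" and [measurable]: "A \<in> sets borel"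
  shows "emeasure lborel (T -` A) = emeasure lborel A"
proof -
  have lin: "linear T" using T by (simp add: orthogonal_transformation_linear)
  have [measurable]: "T \<in> borel_measurable borel"
    using lin by (intro borel_measurable_continuous_onI linear_continuous_on linear_conv_bounded_linear[THEN iffD1])
  have norm: "norm (T x) = norm x" for x using T by (simp add: orthogonal_transformation)
  have surj: "surj T" using T by (rule orthogonal_transformation_surj)
  let ?B = "ball (0::'a) 1"
  have [measurable]: "?B \<in> sets borel" by simp
  have [measurable]: "(\<lambda>p. T (snd p)) \<in> borel_measurable (lborel \<Otimes>\<^sub>M lborel)" "(\<lambda>p. T (fst p)) \<in> borel_measurable (lborel \<Otimes>\<^sub>M lborel)"
    by (rule measurable_compose[OF measurable_snd] measurable_compose[OF measurable_fst]; simp)+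
  have "emeasure lborel A * emeasure lborel ?B
      = (\<integral>\<^sup>+x. indicator ?B (T x) * emeasure lborel A \<partial>lborel)"
  proof -
    have "indicator ?B (T x) = (indicator ?B x :: ennreal)" for x
      by (auto simp: indicator_def norm)
    then have "(\<integral>\<^sup>+x. indicator ?B (T x) * emeasure lborel A \<partial>lborel)
        = (\<integral>\<^sup>+x. indicator ?B x * emeasure lborel A \<partial>lborel)" by (intro nn_integral_cong) simp
    also have "\<dots> = emeasure lborel ?B * emeasure lborel A"
      by (subst nn_integral_multc) (simp_all add: borel_measurable_indicator)
    finally show ?thesis by (simp add: mult.commute)
  qed
  also have "\<dots> = (\<integral>\<^sup>+x. (\<integral>\<^sup>+y. indicator ?B (T x) * indicator A (T x + y) \<partial>lborel) \<partial>lborel)"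
    by (simp add: nn_integral_cmult nn_integral_lborel_translate)
  also have "\<dots> = (\<integral>\<^sup>+y. (\<integral>\<^sup>+x. indicator ?B (T x) * indicator A (T x + y) \<partial>lborel) \<partial>lborel)"
    by (rule lborel_pair.Fubini') measurable
  also have "\<dots> = (\<integral>\<^sup>+y. (\<integral>\<^sup>+x. indicator ?B (T x - y) * indicator A (T x) \<partial>lborel) \<partial>lborel)"
  proof (rule nn_integral_cong)
    fix y
    \<comment> \<open>Shifting \<open>x\<close> by a preimage of \<open>y\<close> turns
      \<open>T x + y\<close> into \<open>T x\<close> and moves \<open>y\<close> to the ball
      factor.\<close>
    obtain w where w: "T w = y" using surj by (metis surjD)
    have "(\<integral>\<^sup>+x. indicator ?B (T x) * indicator A (T x + y) \<partial>lborel)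
        = (\<integral>\<^sup>+x. indicator ?B (T (- w + x)) * indicator A (T (- w + x) + y) \<partial>lborel)"
      by (rule nn_integral_lborel_translate[symmetric]) measurable
    also have "\<dots> = (\<integral>\<^sup>+x. indicator ?B (T x - y) * indicator A (T x) \<partial>lborel)"
      by (simp add: linear_add[OF lin] linear_diff[OF lin] linear_neg[OF lin] w)
    finally show "(\<integral>\<^sup>+x. indicator ?B (T x) * indicator A (T x + y) \<partial>lborel)
      = (\<integral>\<^sup>+x. indicator ?B (T x - y) * (indicator A (T x) :: ennreal) \<partial>lborel)" .
  qed
  also have "\<dots> = (\<integral>\<^sup>+x. (\<integral>\<^sup>+y. indicator ?B (T x - y) * indicator A (T x) \<partial>lborel) \<partial>lborel)"
    by (rule lborel_pair.Fubini') measurable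
  also have "\<dots> = (\<integral>\<^sup>+x. emeasure lborel ?B * indicator A (T x) \<partial>lborel)"
  proof (rule nn_integral_cong)
    fix x
    have "indicator ?B (T x - y) = (indicator (ball (T x) 1) y :: ennreal)" for y
      by (auto simp: indicator_def dist_norm norm_minus_commute)
    then have "(\<integral>\<^sup>+y. indicator ?B (T x - y) * indicator A (T x) \<partial>lborel)
        = (\<integral>\<^sup>+y. indicator (ball (T x) 1) y * indicator A (T x) \<partial>lborel)"
      by (intro nn_integral_cong) simp
    also have "\<dots> = emeasure lborel (ball (T x) 1) * indicator A (T x)"
      by (subst nn_integral_multc) (simp_all add: borel_measurable_indicator)
    also have "emeasure lborel (ball (T x) 1) = emeasure lborel ?B"
      by (simp add: emeasure_ball)
    finally show "(\<integral>\<^sup>+y. indicator ?B (T x - y) * indicator A (T x) \<partial>lborel)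
       = emeasure lborel ?B * indicator A (T x)" .
  qed
  also have "\<dots> = emeasure lborel ?B * emeasure lborel (T -` A)"
  proof -
    have Tm: "T -` A \<in> sets borel" using measurable_sets_borel[of T borel A] by simp
    have "indicator A (T x) = (indicator (T -` A) x :: ennreal)" for x by (auto simp: indicator_def)
    then have "(\<integral>\<^sup>+x. emeasure lborel ?B * indicator A (T x) \<partial>lborel)
        = (\<integral>\<^sup>+x. emeasure lborel ?B * indicator (T -` A) x \<partial>lborel)"
      by (intro nn_integral_cong) simp
    then show ?thesis using Tm by (simp add: nn_integral_cmult)
  qed
  finally have "emeasure lborel ?B * emeasure lborel (T -` A) = emeasure lborel ?B * emeasure lborel A"
    by (simp add: mult.commute)
  moreover have "emeasure lborel ?B \<noteq> 0" "emeasure lborel ?B \<noteq> top"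
    using less_imp_neq[OF unit_ball_vol_pos[of "real DIM('a)"]] by (auto simp: emeasure_ball)
  ultimately show ?thesis by (simp add: ennreal_mult_cancel_left)
qed

lemma orthogonal_transformation_exists_unit:
  fixes a b :: "'a::euclidean_space"
  assumes "norm a = 1" "norm b = 1"
  obtains T where "orthogonal_transformation T" "T a = b"
proof (cases "a = b")
  case True
  then show ?thesis using that[of "\<lambda>x. x"] by (simp add: orthogonal_transformation_id)
next
  case False
  define w where "w = a - b"
  \<comment> \<open>Reflection in the hyperplane orthogonal to \<open>a - b\<close>, which exchanges
    the two unit vectors.\<close>
  define T where "T v = v - (2 * (v \<bullet> w) / (w \<bullet> w)) *\<^sub>R w" for v
  have w: "w \<bullet> w \<noteq> 0" using False by (simp add: w_def)
  have "linear T"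
    unfolding T_def by (intro linearI) (auto simp: inner_add_left algebra_simps add_divide_distrib)
  moreover have "T v \<bullet> T u = v \<bullet> u" for v u
    using w by (simp add: T_def inner_diff_left inner_diff_right inner_commute field_simps)
  ultimately have "orthogonal_transformation T" by (simp add: orthogonal_transformation_def)
  moreover have "T a = b"
  proof -
    have "a \<bullet> a = 1" "b \<bullet> b = 1" using assms by (simp_all add: dot_square_norm)
    then have "2 * (a \<bullet> w) = w \<bullet> w" by (simp add: w_def inner_diff_left inner_diff_right inner_commute)
    then show ?thesis using w by (simp add: T_def) (simp add: w_def)
  qed
  ultimately show ?thesis by (rule that)
qed

definition cylinder :: "'a::euclidean_space \<Rightarrow> real \<Rightarrow> real \<Rightarrow> real \<Rightarrow> 'a set" where
  "cylinder a s t R = {v. s \<le> v \<bullet> a \<and> v \<bullet> a \<le> t \<and> norm (v - (v \<bullet> a) *\<^sub>R a) \<le> R}"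

lemma closed_cylinder: "closed (cylinder a s t R)"
  unfolding cylinder_def by (intro closed_Collect_conj closed_Collect_le continuous_intros)

lemma borel_cylinder [measurable]: "cylinder a s t R \<in> sets borel"
  by (rule borel_closed[OF closed_cylinder])

text \<open>\<open>lborel\<close> is the image of the product of the coordinate measures indexed by
  \<open>Basis\<close>. Splitting off the coordinate \<open>i\<close> leaves a ball in the product
  over \<open>Basis - {i}\<close>, which is measured there by \<open>emeasure_cball_aux\<close>, so
  that no type of dimension \<open>DIM('a) - 1\<close> is involved.\<close>

lemma emeasure_cylinder_Basis:
  fixes i :: "'a::euclidean_space"
  assumes i: "i \<in> Basis" and st: "s \<le> t" and R: "0 < R"
  shows "emeasure lborel (cylinder i s t R) =
    ennreal ((t - s) * (unit_ball_vol (real (DIM('a) - 1)) * R ^ (DIM('a) - 1)))"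
proof -
  interpret product_sigma_finite "\<lambda>_::'a. lborel :: real measure" by standard
  let ?A = "Basis - {i}" and ?M = "\<lambda>A. Pi\<^sub>M A (\<lambda>_::'a. lborel :: real measure)"
  let ?S = "\<lambda>A. {f. s \<le> f i \<and> f i \<le> t \<and> sqrt (\<Sum>j\<in>?A. (f j)\<^sup>2) \<le> R} \<inter> space (?M A)"
  have ins: "insert i ?A = Basis" using i by auto
  have tan: "norm (v - (v \<bullet> i) *\<^sub>R i) = sqrt (\<Sum>j\<in>?A. (v \<bullet> j)\<^sup>2)" for v :: 'a
  proof -
    have "norm (v - (v \<bullet> i) *\<^sub>R i) = sqrt (\<Sum>j\<in>insert i ?A. ((v - (v \<bullet> i) *\<^sub>R i) \<bullet> j)\<^sup>2)"
      unfolding ins by (subst norm_eq_sqrt_inner, subst euclidean_inner) (simp add: power2_eq_square)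
    also have "(\<Sum>j\<in>insert i ?A. ((v - (v \<bullet> i) *\<^sub>R i) \<bullet> j)\<^sup>2)
        = ((v - (v \<bullet> i) *\<^sub>R i) \<bullet> i)\<^sup>2 + (\<Sum>j\<in>?A. ((v - (v \<bullet> i) *\<^sub>R i) \<bullet> j)\<^sup>2)"
      by (rule sum.insert) auto
    also have "((v - (v \<bullet> i) *\<^sub>R i) \<bullet> i)\<^sup>2 = 0" using i by (simp add: inner_diff_left)
    also have "(\<Sum>j\<in>?A. ((v - (v \<bullet> i) *\<^sub>R i) \<bullet> j)\<^sup>2) = (\<Sum>j\<in>?A. (v \<bullet> j)\<^sup>2)"
    proof (rule sum.cong[OF refl])
      fix j assume "j \<in> ?A"
      then have "i \<bullet> j = 0" using i by (metis DiffD1 DiffD2 insertI1 inner_not_same_Basis)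
      then show "((v - (v \<bullet> i) *\<^sub>R i) \<bullet> j)\<^sup>2 = (v \<bullet> j)\<^sup>2" by (simp add: inner_diff_left)
    qed
    finally show ?thesis by simp
  qed
  have m: "?S Basis \<in> sets (?M Basis)" using i by measurable
  have "emeasure lborel (cylinder i s t R)
      = emeasure (distr (?M Basis) borel (\<lambda>f. \<Sum>b\<in>Basis. f b *\<^sub>R b)) (cylinder i s t R)"
    by (subst lborel_eq) simp
  also have "\<dots> = emeasure (?M Basis) (?S Basis)"
    using i by (subst emeasure_distr) (auto simp: cylinder_def tan intro!: arg_cong[where f="emeasure _"])
  also have "\<dots> = (\<integral>\<^sup>+f. indicator (?S (insert i ?A)) f \<partial>?M (insert i ?A))"
    unfolding ins using m by (rule nn_integral_indicator[symmetric])
  also have "\<dots> = (\<integral>\<^sup>+y. (\<integral>\<^sup>+f. indicator (?S (insert i ?A)) (f(i := y)) \<partial>?M ?A) \<partial>lborel)"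
  proof (rule product_nn_integral_insert_rev)
    show "indicator (?S (insert i ?A)) \<in> borel_measurable (?M (insert i ?A))"
      using m unfolding ins by (rule borel_measurable_indicator)
  qed auto
  also have "\<dots> = (\<integral>\<^sup>+y. (\<integral>\<^sup>+f. indicator {s..t} y * indicator ({f. sqrt (\<Sum>j\<in>?A. (f j)\<^sup>2) \<le> R} \<inter> space (?M ?A)) f \<partial>?M ?A) \<partial>lborel)"
  proof (intro nn_integral_cong)
    fix y and f :: "'a \<Rightarrow> real" assume f: "f \<in> space (?M ?A)"
    have "(\<Sum>j\<in>?A. ((f(i := y)) j)\<^sup>2) = (\<Sum>j\<in>?A. (f j)\<^sup>2)" by (intro sum.cong) auto
    moreover have "f(i := y) \<in> space (?M (insert i ?A))"
      using f by (auto simp: space_PiM PiE_def extensional_def)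
    ultimately show "indicator (?S (insert i ?A)) (f(i := y)) =
        indicator {s..t} y * (indicator ({f. sqrt (\<Sum>j\<in>?A. (f j)\<^sup>2) \<le> R} \<inter> space (?M ?A)) f :: ennreal)"
      using f by (auto simp: indicator_def)
  qed
  also have "\<dots> = (\<integral>\<^sup>+y. indicator {s..t} y * ennreal (unit_ball_vol (real (card ?A)) * R ^ card ?A) \<partial>lborel)"
  proof (rule nn_integral_cong)
    fix y
    have "{f. sqrt (\<Sum>j\<in>?A. (f j)\<^sup>2) \<le> R} \<inter> space (?M ?A) \<in> sets (?M ?A)" by measurable
    then show "(\<integral>\<^sup>+f. indicator {s..t} y * indicator ({f. sqrt (\<Sum>j\<in>?A. (f j)\<^sup>2) \<le> R} \<inter> space (?M ?A)) f \<partial>?M ?A)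
      = indicator {s..t} y * ennreal (unit_ball_vol (real (card ?A)) * R ^ card ?A)"
      using emeasure_cball_aux[of ?A R] R by (subst nn_integral_cmult) auto
  qed
  also have "\<dots> = ennreal (t - s) * ennreal (unit_ball_vol (real (card ?A)) * R ^ card ?A)"
    using st by (subst nn_integral_multc) auto
  also have "card ?A = DIM('a) - 1" using i by simp
  finally show ?thesis using st R by (simp add: ennreal_mult)
qed

lemma emeasure_cylinder:
  fixes a :: "'a::euclidean_space"
  assumes a: "norm a = 1" and st: "s \<le> t" and R: "0 < R"
  shows "emeasure lborel (cylinder a s t R) =
    ennreal ((t - s) * (unit_ball_vol (real (DIM('a) - 1)) * R ^ (DIM('a) - 1)))"
proof -
  obtain i :: 'a where i: "i \<in> Basis" by (meson ex_in_conv nonempty_Basis)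
  obtain T where T: "orthogonal_transformation T" "T a = i"
    using orthogonal_transformation_exists_unit[OF a, of i] i by auto
  have lin: "linear T" using T by (simp add: orthogonal_transformation_linear)
  have "T -` cylinder i s t R = cylinder a s t R"
  proof -
    have "T v \<bullet> i = v \<bullet> a" for v
      using T by (metis orthogonal_transformation_def)
    moreover have "norm (T v - (v \<bullet> a) *\<^sub>R i) = norm (v - (v \<bullet> a) *\<^sub>R a)" for v
    proof -
      have "T v - (v \<bullet> a) *\<^sub>R i = T (v - (v \<bullet> a) *\<^sub>R a)"
        by (simp add: linear_diff[OF lin] linear_scale[OF lin] T(2))
      then show ?thesis using T(1) by (simp add: orthogonal_transformation)
    qed
    ultimately show ?thesis by (auto simp: cylinder_def)
  qed
  then show ?thesis
    using emeasure_lborel_orthogonal[OF T(1), of "cylinder i s t R"] emeasure_cylinder_Basis[OF i st R] by simp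
qed

section \<open>Cone measure and polar coordinates\<close>

text \<open>Cone measure: \<open>DIM('a)\<close> times the volume of the part of the unit ball above
  a set of directions. The factor makes \<open>t ^ (DIM('a) - 1)\<close> the radial density without
  further constant. It is kept as a Borel measure on the whole space, carried by the unit
  sphere.\<close>

definition sphere_measure :: "'a::euclidean_space measure" where
  "sphere_measure = distr (density lborel (\<lambda>x. ennreal (real DIM('a)) * indicator (ball 0 1 - {0}) x)) borel (\<lambda>x. x /\<^sub>R norm x)"

lemma sets_sphere_measure [simp, measurable_cong]: "sets sphere_measure = sets borel"
  by (simp add: sphere_measure_def)

lemma space_sphere_measure [simp]: "space sphere_measure = UNIV"
  by (simp add: sphere_measure_def)

lemma measurable_normalize [measurable]:
  "(\<lambda>x::'a::euclidean_space. x /\<^sub>R norm x) \<in> borel_measurable borel"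
  by (intro borel_measurable_scaleR borel_measurable_inverse borel_measurable_norm) auto

lemma borel_punctured_ball [measurable]: "ball 0 R - {0 :: 'a::euclidean_space} \<in> sets borel"
  by (intro sets.Diff borel_open borel_closed) auto

lemma nn_integral_sphere_measure:
  fixes f :: "'a::euclidean_space \<Rightarrow> ennreal"
  assumes [measurable]: "f \<in> borel_measurable borel"
  shows "(\<integral>\<^sup>+n. f n \<partial>sphere_measure)
    = ennreal (real DIM('a)) * (\<integral>\<^sup>+x. indicator (ball 0 1 - {0}) x * f (x /\<^sub>R norm x) \<partial>lborel)"
  unfolding sphere_measure_def
  by (subst nn_integral_distr, measurable, subst nn_integral_density, measurable)
     (subst nn_integral_cmult[symmetric], measurable, simp add: mult.assoc)

lemma emeasure_lborel_sector:
  fixes B :: "'a::euclidean_space set"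
  assumes [measurable]: "B \<in> sets borel" and R: "0 < R"
  shows "(\<integral>\<^sup>+x. indicator (ball 0 R - {0}) x * indicator B (x /\<^sub>R norm x) \<partial>lborel)
    = ennreal (R ^ DIM('a) / real DIM('a)) * emeasure sphere_measure B"
proof -
  have "(\<integral>\<^sup>+x. indicator (ball 0 R - {0}) x * indicator B (x /\<^sub>R norm x) \<partial>(lborel::'a measure))
    = ennreal (\<bar>R\<bar> ^ DIM('a)) * (\<integral>\<^sup>+x. indicator (ball 0 R - {0}) (R *\<^sub>R x) * indicator B ((R *\<^sub>R x) /\<^sub>R norm (R *\<^sub>R x)) \<partial>lborel)"
  proof (rule nn_integral_lborel_scale)
    show "(\<lambda>x::'a. indicator (ball 0 R - {0}) x * indicator B (x /\<^sub>R norm x) :: ennreal) \<in> borel_measurable borel"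
      by measurable
  qed (use R in simp)
  also have "(\<integral>\<^sup>+x. indicator (ball 0 R - {0}) (R *\<^sub>R x) * indicator B ((R *\<^sub>R x) /\<^sub>R norm (R *\<^sub>R x)) \<partial>(lborel::'a measure))
     = (\<integral>\<^sup>+x. indicator (ball 0 1 - {0}) x * indicator B (x /\<^sub>R norm x) \<partial>lborel)"
    using R by (intro nn_integral_cong) (auto simp: indicator_def field_simps)
  also have "\<dots> = ennreal (1 / real DIM('a)) * emeasure sphere_measure B"
  proof -
    have "emeasure sphere_measure B = (\<integral>\<^sup>+n. indicator B n \<partial>sphere_measure)" by simp
    also have "\<dots> = ennreal (real DIM('a)) * (\<integral>\<^sup>+x. indicator (ball 0 1 - {0}) x * indicator B (x /\<^sub>R norm x) \<partial>lborel)"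
      by (rule nn_integral_sphere_measure) simp
    finally show ?thesis by (simp add: mult.assoc[symmetric] ennreal_mult[symmetric] DIM_positive)
  qed
  finally show ?thesis using R by (simp add: mult.assoc[symmetric] ennreal_mult[symmetric])
qed

lemma emeasure_sphere_measure_UNIV:
  "emeasure (sphere_measure :: 'a::euclidean_space measure) UNIV = ennreal (real DIM('a) * unit_ball_vol (real DIM('a)))"
proof -
  have "emeasure (sphere_measure :: 'a measure) UNIV = (\<integral>\<^sup>+n. indicator UNIV n \<partial>(sphere_measure :: 'a measure))" by simp
  also have "\<dots> = ennreal (real DIM('a)) * emeasure lborel (ball 0 1 - {0} :: 'a set)"
    by (subst nn_integral_sphere_measure) auto
  also have "emeasure lborel (ball 0 1 - {0} :: 'a set) = emeasure lborel (ball (0::'a) 1)"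
    by (intro emeasure_Diff_null_set) (auto intro: finite_imp_null_set_lborel)
  finally show ?thesis by (simp add: emeasure_ball ennreal_mult)
qed

lemma sphere_measure_finite: "emeasure (sphere_measure :: 'a::euclidean_space measure) B < \<infinity>"
  by (rule le_less_trans[OF emeasure_space]) (simp add: emeasure_sphere_measure_UNIV)

lemma sphere_measure_UNIV_pos: "0 < emeasure (sphere_measure :: 'a::euclidean_space measure) UNIV"
  by (simp add: emeasure_sphere_measure_UNIV DIM_positive)

interpretation sphere_measure: finite_measure "sphere_measure :: 'a::euclidean_space measure"
  using sphere_measure_finite[where 'a='a and B=UNIV] by (intro finite_measureI) simp

lemma AE_sphere_measure: "AE n in sphere_measure. norm (n::'a::euclidean_space) = 1"
proof (rule AE_I'[of "- sphere 0 1"])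
  have "emeasure sphere_measure (- sphere (0::'a) 1) = (\<integral>\<^sup>+n. indicator (- sphere (0::'a) 1) n \<partial>sphere_measure)" by simp
  also have "\<dots> = ennreal (real DIM('a)) * (\<integral>\<^sup>+x. indicator (ball 0 1 - {0}) x * indicator (- sphere 0 1) (x /\<^sub>R norm x) \<partial>(lborel :: 'a measure))"
    by (rule nn_integral_sphere_measure) simp
  also have "(\<integral>\<^sup>+x. indicator (ball 0 1 - {0}) x * indicator (- sphere 0 1) (x /\<^sub>R norm x) \<partial>(lborel :: 'a measure))
      = (\<integral>\<^sup>+x. 0 \<partial>(lborel :: 'a measure))"
  proof (rule nn_integral_cong)
    show "indicator (ball 0 1 - {0}) x * indicator (- sphere 0 1) (x /\<^sub>R norm x) = (0::ennreal)" for x :: 'a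
      by (cases "x = 0") (auto simp: indicator_def)
  qed
  finally show "- sphere (0::'a) 1 \<in> null_sets sphere_measure" by (auto intro!: null_setsI)
qed auto

lemma nn_integral_power_Icc:
  assumes "0 \<le> s" "s \<le> t" "0 < n"
  shows "(\<integral>\<^sup>+r. ennreal (r ^ (n - 1)) * indicator {s..t} r \<partial>lborel) = ennreal ((t ^ n - s ^ n) / real n)"
proof -
  have "(\<integral>\<^sup>+r. ennreal (r ^ (n - 1)) * indicator {s..t} r \<partial>lborel) = ennreal (t ^ n / real n - s ^ n / real n)"
    using assms by (intro nn_integral_FTC_Icc) (auto intro!: derivative_eq_intros)
  then show ?thesis by (simp add: diff_divide_distrib)
qed

text \<open>Both measures agree on the half-lines \<open>{..<R}\<close>, where their values are
  volumes of sectors of balls and scale like \<open>R ^ DIM('a)\<close>; half-lines form an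
  intersection-stable generator.\<close>

lemma distr_norm_sector:
  fixes B :: "'a::euclidean_space set"
  assumes [measurable]: "B \<in> sets borel"
  shows "distr (density lborel (\<lambda>x. indicator (- {0}) x * indicator B (x /\<^sub>R norm x))) borel norm
     = density lborel (\<lambda>t. indicator {0<..} t * (emeasure sphere_measure B * ennreal (t ^ (DIM('a) - 1))))"
  (is "?L = ?R")
proof -
  let ?s = "emeasure sphere_measure B"
  have L': "emeasure ?L {..<R} = (\<integral>\<^sup>+x. indicator (ball 0 R - {0}) x * indicator B (x /\<^sub>R norm x) \<partial>lborel)" for R
  proof -
    have o: "(norm :: 'a \<Rightarrow> real) -` {..<R} \<in> sets borel"
      by (rule borel_open) (intro open_vimage continuous_intros open_lessThan)
    show ?thesis
      by (subst emeasure_distr, simp, simp, subst emeasure_density)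
         (use o in \<open>auto intro!: nn_integral_cong simp: indicator_def\<close>)
  qed
  have L: "emeasure ?L {..<R} = ennreal (R ^ DIM('a) / real DIM('a)) * ?s" if "0 < R" for R
    using L'[of R] emeasure_lborel_sector[OF assms that] by simp
  have R: "emeasure ?R {..<R} = ennreal (R ^ DIM('a) / real DIM('a)) * ?s" if "0 < R" for R
  proof -
    have "emeasure ?R {..<R} = (\<integral>\<^sup>+t. ?s * (ennreal (t ^ (DIM('a) - 1)) * indicator {0..R} t) \<partial>lborel)"
    proof (subst emeasure_density, measurable, rule nn_integral_cong_AE)
      have "AE t in lborel. t \<notin> {0, R}" by (intro AE_not_in countable_imp_null_set_lborel) auto
      then show "AE t in lborel. indicator {0<..} t * (?s * ennreal (t ^ (DIM('a) - 1))) * indicator {..<R} t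
          = ?s * (ennreal (t ^ (DIM('a) - 1)) * indicator {0..R} t)"
        by eventually_elim (auto simp: indicator_def)
    qed
    also have "\<dots> = ?s * ennreal ((R ^ DIM('a) - 0 ^ DIM('a)) / real DIM('a))"
      using that nn_integral_power_Icc[of 0 R "DIM('a)"] by (subst nn_integral_cmult) (simp_all del: ennreal_power)
    finally show ?thesis by (simp add: mult.commute DIM_positive zero_power)
  qed
  have 0: "emeasure ?L {..<R} = 0" "emeasure ?R {..<R} = 0" if "R \<le> 0" for R
  proof -
    show "emeasure ?L {..<R} = 0" 
    proof -
      have "\<not> norm x < R" for x :: 'a using that order_trans[OF that norm_ge_zero[of x]] by simp
      then show ?thesis unfolding L' by (simp add: indicator_def)
    qed
    show "emeasure ?R {..<R} = 0"
      using that by (subst emeasure_density) (auto simp: nn_integral_0_iff_AE indicator_def)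
  qed
  show ?thesis
  proof (rule measure_eqI_generator_eq[where E="range lessThan" and \<Omega>=UNIV and A="\<lambda>i. {..< real i}"])
    show "Int_stable (range lessThan :: real set set)"
      by (force simp: Int_stable_def intro: image_eqI[of _ _ "min _ _"])
    show "sets ?L = sigma_sets UNIV (range lessThan)" "sets ?R = sigma_sets UNIV (range lessThan)"
      by (simp_all add: borel_Iio)
    show "(\<Union>i. {..<real i}) = UNIV" using reals_Archimedean2 by blast
    fix X :: "real set" assume "X \<in> range lessThan"
    then obtain R where "X = {..<R}" by auto
    then show "emeasure ?L X = emeasure ?R X" using L[of R] R[of R] 0[of R] by (cases "R \<le> 0") auto
  next
    fix i :: nat
    show "emeasure ?L {..<real i} \<noteq> \<infinity>"
      using L[of "real i"] 0[of "real i"] sphere_measure_finite[of B]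
      by (cases i) (auto simp: ennreal_mult_eq_top_iff)
  qed auto
qed

text \<open>The image of \<open>lborel\<close> under
  \<open>x \<mapsto> (norm x, x /\<^sub>R norm x)\<close> is a product measure: on a rectangle
  \<open>A \<times> B\<close> this is \<open>distr_norm_sector\<close> for the directions in
  \<open>B\<close>. The origin, a null set without direction, is removed.\<close>

theorem polar_coordinates:
  fixes f :: "'a::euclidean_space \<Rightarrow> ennreal"
  assumes [measurable]: "f \<in> borel_measurable borel"
  shows "(\<integral>\<^sup>+x. f x \<partial>lborel)
    = (\<integral>\<^sup>+t. indicator {0<..} t * ennreal (t ^ (DIM('a) - 1)) * (\<integral>\<^sup>+n. f (t *\<^sub>R n) \<partial>sphere_measure) \<partial>lborel)"
proof -
  let ?M1 = "density lborel (\<lambda>t. indicator {0<..} t * ennreal (t ^ (DIM('a) - 1))) :: real measure"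
  let ?P = "distr (density lborel (indicator (- {0}))) (borel \<Otimes>\<^sub>M borel) (\<lambda>x::'a. (norm x, x /\<^sub>R norm x))"
  have sf: "sigma_finite_measure ?M1"
  proof -
    have "AE t in (lborel :: real measure). indicator {0<..} t * ennreal (t ^ (DIM('a) - 1)) \<noteq> \<infinity>"
      by (auto simp: indicator_def)
    then show ?thesis by (subst sigma_finite_measure.sigma_finite_iff_density_finite[OF lborel.sigma_finite_measure_axioms]) (auto simp del: ennreal_power)
  qed
  have eq: "?M1 \<Otimes>\<^sub>M (sphere_measure :: 'a measure) = ?P"
  proof (rule pair_measure_eqI[OF sf])
    show "sigma_finite_measure (sphere_measure :: 'a measure)" by (rule sphere_measure.sigma_finite_measure_axioms)
    show "sets (?M1 \<Otimes>\<^sub>M (sphere_measure :: 'a measure)) = sets ?P"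
      by (subst sets_distr, rule sets_pair_measure_cong) auto
    fix A and B :: "'a set" assume A: "A \<in> sets ?M1" and B: "B \<in> sets sphere_measure"
    then have [measurable]: "A \<in> sets borel" "B \<in> sets borel" by auto
    have "emeasure ?P (A \<times> B) = (\<integral>\<^sup>+x. indicator (- {0}) x * (indicator A (norm x) * indicator B (x /\<^sub>R norm x)) \<partial>lborel)"
      by (subst emeasure_distr, measurable, subst emeasure_density, measurable)
         (auto intro!: nn_integral_cong simp: indicator_def)
    also have "\<dots> = emeasure (distr (density lborel (\<lambda>x. indicator (- {0}) x * indicator B (x /\<^sub>R norm x))) borel norm) A"
      by (subst emeasure_distr, measurable, subst emeasure_density, measurable)
         (auto intro!: nn_integral_cong simp: indicator_def)
    also have "\<dots> = emeasure (density lborel (\<lambda>t. indicator {0<..} t * (emeasure sphere_measure B * ennreal (t ^ (DIM('a) - 1))))) A"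
      by (subst distr_norm_sector) auto
    also have "\<dots> = emeasure ?M1 A * emeasure sphere_measure B"
    proof -
      have "emeasure (density lborel (\<lambda>t. indicator {0<..} t * (emeasure sphere_measure B * ennreal (t ^ (DIM('a) - 1))))) A
        = (\<integral>\<^sup>+t. indicator {0<..} t * ennreal (t ^ (DIM('a) - 1)) * indicator A t * emeasure sphere_measure B \<partial>lborel)"
        by (subst emeasure_density) (auto simp: mult_ac simp del: ennreal_power)
      also have "\<dots> = (\<integral>\<^sup>+t. indicator {0<..} t * ennreal (t ^ (DIM('a) - 1)) * indicator A t \<partial>lborel) * emeasure sphere_measure B"
        by (rule nn_integral_multc) measurable
      finally show ?thesis by (subst (2) emeasure_density) simp_all
    qed
    finally show "emeasure ?M1 A * emeasure sphere_measure B = emeasure ?P (A \<times> B)" by simp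
  qed
  have "AE x in (lborel :: 'a measure). x \<notin> {0}" by (intro AE_not_in countable_imp_null_set_lborel) auto
  then have "(\<integral>\<^sup>+x. f x \<partial>lborel) = (\<integral>\<^sup>+x. indicator (- {0}) x * f (norm x *\<^sub>R (x /\<^sub>R norm x)) \<partial>lborel)"
    by (intro nn_integral_cong_AE) auto
  also have "\<dots> = (\<integral>\<^sup>+p. f (fst p *\<^sub>R snd p) \<partial>?P)"
    by (subst nn_integral_distr, measurable, subst nn_integral_density) auto
  also have "\<dots> = (\<integral>\<^sup>+p. f (fst p *\<^sub>R snd p) \<partial>(?M1 \<Otimes>\<^sub>M (sphere_measure :: 'a measure)))"
    by (simp only: eq)
  also have "\<dots> = (\<integral>\<^sup>+t. (\<integral>\<^sup>+n. f (t *\<^sub>R n) \<partial>sphere_measure) \<partial>?M1)"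
    by (subst sphere_measure.nn_integral_fst[symmetric]) auto
  also have "\<dots> = (\<integral>\<^sup>+t. indicator {0<..} t * ennreal (t ^ (DIM('a) - 1)) * (\<integral>\<^sup>+n. f (t *\<^sub>R n) \<partial>sphere_measure) \<partial>lborel)"
    by (subst nn_integral_density) (auto intro!: sphere_measure.borel_measurable_nn_integral simp del: ennreal_power)
  finally show ?thesis .
qed

text \<open>Thin shells over a set of directions turn statements on cone measure into statements on
  volumes, both in the isodiametric bound and in the bound for caps.\<close>

lemma emeasure_lborel_shell:
  fixes B :: "'a::euclidean_space set"
  assumes [measurable]: "B \<in> sets borel" and st: "0 < s" "s \<le> t"
  shows "emeasure lborel {x. s \<le> norm x \<and> norm x \<le> t \<and> x /\<^sub>R norm x \<in> B}
    = ennreal ((t ^ DIM('a) - s ^ DIM('a)) / real DIM('a)) * emeasure sphere_measure B"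
proof -
  let ?X = "{x. s \<le> norm x \<and> norm x \<le> t \<and> x /\<^sub>R norm x \<in> B}"
  have [measurable]: "?X \<in> sets borel" by measurable
  have "emeasure lborel ?X = (\<integral>\<^sup>+x. indicator ?X x \<partial>lborel)" by simp
  also have "\<dots> = (\<integral>\<^sup>+r. indicator {0<..} r * ennreal (r ^ (DIM('a) - 1)) * (\<integral>\<^sup>+n. indicator ?X (r *\<^sub>R n) \<partial>sphere_measure) \<partial>lborel)"
    by (rule polar_coordinates) measurable
  also have "\<dots> = (\<integral>\<^sup>+r. (ennreal (r ^ (DIM('a) - 1)) * indicator {s..t} r) * emeasure sphere_measure B \<partial>lborel)"
  proof (rule nn_integral_cong)
    fix r :: real
    show "indicator {0<..} r * ennreal (r ^ (DIM('a) - 1)) * (\<integral>\<^sup>+n. indicator ?X (r *\<^sub>R n) \<partial>sphere_measure)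
       = ennreal (r ^ (DIM('a) - 1)) * indicator {s..t} r * emeasure sphere_measure B"
    proof (cases "0 < r")
      case True
      have "(\<integral>\<^sup>+n. indicator ?X (r *\<^sub>R n) \<partial>sphere_measure) = (\<integral>\<^sup>+n. indicator {s..t} r * indicator B n \<partial>sphere_measure)"
        using AE_sphere_measure[where 'a='a] True
        by (intro nn_integral_cong_AE) (auto elim!: eventually_mono simp: indicator_def)
      then show ?thesis using True by (simp add: nn_integral_cmult mult.assoc del: ennreal_power)
    qed (use st in auto)
  qed
  also have "\<dots> = ennreal ((t ^ DIM('a) - s ^ DIM('a)) / real DIM('a)) * emeasure sphere_measure B"
    using nn_integral_power_Icc[of s t "DIM('a)"] st by (subst nn_integral_multc) (simp_all del: ennreal_power)
  finally show ?thesis .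
qed

section \<open>Hausdorff measure of the unit sphere\<close>

lemma hausdorff_outer_mono: "A \<subseteq> B \<Longrightarrow> hausdorff_outer k A \<le> hausdorff_outer k B"
  unfolding hausdorff_outer_def by (intro SUP_mono) (auto intro: hausdorff_pre_mono)

lemma hausdorff_outer_empty [simp]: "hausdorff_outer k ({} :: 'a::metric_space set) = 0"
  using outer_measure_space_hausdorff_outer[of k, where 'a='a]
  unfolding outer_measure_space_def positive_def by blast

text \<open>The predicate \<open>countably_subadditive\<close> speaks of disjoint families, so the
  sets are first made disjoint.\<close>

lemma hausdorff_outer_countable_subadditive:
  fixes A :: "nat \<Rightarrow> 'a::metric_space set"
  shows "hausdorff_outer k (\<Union>i. A i) \<le> (\<Sum>i. hausdorff_outer k (A i))"
proof -
  have "hausdorff_outer k (\<Union>i. disjointed A i) \<le> (\<Sum>i. hausdorff_outer k (disjointed A i))"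
    using outer_measure_space_hausdorff_outer[of k, where 'a='a] disjoint_family_disjointed[of A]
    unfolding outer_measure_space_def countably_subadditive_def by blast
  also have "\<dots> \<le> (\<Sum>i. hausdorff_outer k (A i))"
    by (intro suminf_le hausdorff_outer_mono disjointed_subset) auto
  finally show ?thesis by (simp add: UN_disjointed_eq)
qed

lemma hausdorff_outer_subadditive:
  "hausdorff_outer k (A \<union> B) \<le> hausdorff_outer k A + hausdorff_outer k B"
proof -
  have "hausdorff_outer k (\<Union>i. (binaryset A B) i) \<le> (\<Sum>i. hausdorff_outer k (binaryset A B i))"
    by (rule hausdorff_outer_countable_subadditive)
  also have "\<dots> = hausdorff_outer k A + hausdorff_outer k B"
    by (rule suminf_binaryset_eq) simp
  finally show ?thesis by (simp add: UN_binaryset_eq)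
qed

lemma hausdorff_pre_antimono: "\<delta> \<le> \<delta>' \<Longrightarrow> hausdorff_pre k \<delta>' A \<le> hausdorff_pre k \<delta> A"
  unfolding hausdorff_pre_def by (rule INF_superset_mono) (auto intro: order_trans)

lemma hausdorff_pre_le_outer: "0 < \<delta> \<Longrightarrow> hausdorff_pre k \<delta> A \<le> hausdorff_outer k A"
  unfolding hausdorff_outer_def by (rule SUP_upper) simp

text \<open>A set of diameter at most \<delta> cannot meet both \<open>A\<close> and
  \<open>B\<close>, so a cover of the union splits into a cover of each.\<close>

lemma hausdorff_pre_separated:
  fixes A B :: "'a::metric_space set"
  assumes sep: "\<And>x y. x \<in> A \<Longrightarrow> y \<in> B \<Longrightarrow> \<delta> < dist x y" and \<delta>: "0 < \<delta>"
  shows "hausdorff_pre k \<delta> A + hausdorff_pre k \<delta> B \<le> hausdorff_pre k \<delta> (A \<union> B)"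
  unfolding hausdorff_pre_def[of k \<delta> "A \<union> B"]
proof (rule INF_greatest)
  fix C :: "nat \<Rightarrow> 'a set" assume "C \<in> {C. A \<union> B \<subseteq> (\<Union>i. C i) \<and> (\<forall>i. bounded (C i) \<and> diameter (C i) \<le> \<delta>)}"
  then have C: "A \<union> B \<subseteq> (\<Union>i. C i)" "\<And>i. bounded (C i)" "\<And>i. diameter (C i) \<le> \<delta>" by auto
  \<comment> \<open>Removed members are replaced by the empty set; its content is 0 even for
    \<open>k = 0\<close>, so the two sums add up to the original one.\<close>
  define P where "P i = (if C i \<inter> A = {} then {} else C i)" for i :: nat
  define Q where "Q i = (if C i \<inter> A = {} then C i else {})" for i :: nat
  have "hausdorff_pre k \<delta> A \<le> (\<Sum>i. hausdorff_content k (P i))"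
    unfolding hausdorff_pre_def
  proof (rule INF_lower, safe)
    fix x assume x: "x \<in> A"
    then obtain i where "x \<in> C i" using C(1) by blast
    then show "x \<in> (\<Union>i. P i)" using x by (auto simp: P_def)
  qed (use C(2,3) \<delta> in \<open>auto simp: P_def\<close>)
  moreover have "hausdorff_pre k \<delta> B \<le> (\<Sum>i. hausdorff_content k (Q i))"
    unfolding hausdorff_pre_def
  proof (rule INF_lower, safe)
    fix y assume y: "y \<in> B"
    then obtain i where i: "y \<in> C i" using C(1) by blast
    have "C i \<inter> A = {}"
    proof (rule ccontr)
      assume "C i \<inter> A \<noteq> {}"
      then obtain x where x: "x \<in> C i" "x \<in> A" by blast
      have "dist x y \<le> diameter (C i)" by (rule diameter_bounded_bound[OF C(2) x(1) i])
      then show False using sep[OF x(2) y] C(3)[of i] by linarith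
    qed
    then show "y \<in> (\<Union>i. Q i)" using i by (auto simp: Q_def)
  qed (use C(2,3) \<delta> in \<open>auto simp: Q_def\<close>)
  ultimately have "hausdorff_pre k \<delta> A + hausdorff_pre k \<delta> B
      \<le> (\<Sum>i. hausdorff_content k (P i)) + (\<Sum>i. hausdorff_content k (Q i))"
    by (rule add_mono)
  also have "\<dots> = (\<Sum>i. hausdorff_content k (P i) + hausdorff_content k (Q i))"
    by (rule suminf_add) auto
  also have "\<dots> = (\<Sum>i. hausdorff_content k (C i))"
    by (intro suminf_cong) (auto simp: P_def Q_def hausdorff_content_def)
  finally show "hausdorff_pre k \<delta> A + hausdorff_pre k \<delta> B \<le> (\<Sum>i. hausdorff_content k (C i))" .
qed

lemma hausdorff_outer_separated:
  fixes A B :: "'a::metric_space set"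
  assumes sep: "\<And>x y. x \<in> A \<Longrightarrow> y \<in> B \<Longrightarrow> d \<le> dist x y" and d: "0 < d"
  shows "hausdorff_outer k A + hausdorff_outer k B \<le> hausdorff_outer k (A \<union> B)"
proof -
  have "hausdorff_outer k A + hausdorff_outer k B = (SUP \<delta>\<in>{0<..}. hausdorff_pre k \<delta> A + hausdorff_pre k \<delta> B)"
    unfolding hausdorff_outer_def
  proof (rule SUP_add_directed_ennreal[symmetric])
    fix \<delta> \<delta>' :: real assume "\<delta> \<in> {0<..}" "\<delta>' \<in> {0<..}"
    then show "\<exists>e\<in>{0<..}. hausdorff_pre k \<delta> A + hausdorff_pre k \<delta>' B \<le> hausdorff_pre k e A + hausdorff_pre k e B"
      by (intro bexI[of _ "min \<delta> \<delta>'"] add_mono hausdorff_pre_antimono) auto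
  qed
  also have "\<dots> \<le> hausdorff_outer k (A \<union> B)"
  proof (rule SUP_least)
    fix \<delta> :: real assume \<delta>: "\<delta> \<in> {0<..}"
    \<comment> \<open>Halving \<open>d\<close> provides the strict inequality required by
      \<open>hausdorff_pre_separated\<close>.\<close>
    let ?e = "min \<delta> (d / 2)"
    have "hausdorff_pre k \<delta> A + hausdorff_pre k \<delta> B \<le> hausdorff_pre k ?e A + hausdorff_pre k ?e B"
      by (intro add_mono hausdorff_pre_antimono) auto
    also have "\<dots> \<le> hausdorff_pre k ?e (A \<union> B)"
    proof (rule hausdorff_pre_separated)
      show "?e < dist x y" if "x \<in> A" "y \<in> B" for x y using sep[OF that] d by (auto simp: min_def)
    qed (use \<delta> d in auto)
    also have "\<dots> \<le> hausdorff_outer k (A \<union> B)"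
      using \<delta> d by (intro hausdorff_pre_le_outer) auto
    finally show "hausdorff_pre k \<delta> A + hausdorff_pre k \<delta> B \<le> hausdorff_outer k (A \<union> B)" .
  qed
  finally show ?thesis .
qed

lemma ennreal_suminf_tail_tendsto_0:
  fixes f :: "nat \<Rightarrow> ennreal"
  assumes "(\<Sum>i. f i) < \<infinity>"
  shows "(\<lambda>n. \<Sum>i. f (i + n)) \<longlonglongrightarrow> 0"
proof -
  have eq: "(\<Sum>i. f (i + n)) = (\<Sum>i. f i) - (\<Sum>i<n. f i)" for n
  proof -
    have "(\<Sum>i. f i) = (\<Sum>i. f (i + n)) + (\<Sum>i<n. f i)" by (rule suminf_offset) simp
    moreover have "(\<Sum>i<n. f i) \<le> (\<Sum>i. f i)" by (rule sum_le_suminf) auto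
    then have "(\<Sum>i<n. f i) \<noteq> top" using assms by (metis infinity_ennreal_def le_less_trans less_irrefl)
    ultimately show ?thesis by simp
  qed
  have "(\<lambda>n. (\<Sum>i. f i) - (\<Sum>i<n. f i)) \<longlonglongrightarrow> (\<Sum>i. f i) - (\<Sum>i. f i)"
    using assms by (intro tendsto_diff_ennreal tendsto_const summable_LIMSEQ) auto
  then show ?thesis unfolding eq using assms by simp
qed

text \<open>Caratheodory's criterion: the part of \<open>X\<close> off \<open>F\<close> is cut into
  layers \<open>D n\<close> by distance to \<open>F\<close>. Layers of equal parity have gaps
  between them, so their measures sum to at most that of \<open>X\<close>; hence the tail over all
  layers tends to 0, while the rest \<open>Y n\<close> is separated from \<open>F\<close>.\<close>

lemma closed_in_lambda_system:
  fixes F :: "'a::metric_space set"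
  assumes F: "closed F"
  shows "F \<in> lambda_system UNIV UNIV (hausdorff_outer k)"
proof (cases "F = {}")
  case True
  then show ?thesis by (simp add: lambda_system_def)
next
  case False
  let ?H = "hausdorff_outer k :: 'a set \<Rightarrow> ennreal"
  have "?H (F \<inter> X) + ?H ((UNIV - F) \<inter> X) \<le> ?H X" if fin: "?H X < \<infinity>" for X
  proof -
    define Y where "Y n = {x\<in>X. 1 / real (n + 1) \<le> infdist x F}" for n
    define D where "D n = {x\<in>X. 1 / real (n + 2) \<le> infdist x F \<and> infdist x F < 1 / real (n + 1)}" for n
    have dist: "a - b \<le> dist x y" if "a \<le> infdist x F" "infdist y F \<le> b" for x y a b
      using infdist_triangle[of x F y] that by linarith
    have skip: "(\<Sum>j<n. ?H (D (2 * j + p))) \<le> ?H X" for p n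
    proof -
      have "(\<Sum>j<n. ?H (D (2 * j + p))) \<le> ?H (\<Union>j<n. D (2 * j + p))"
      proof (induction n)
        case (Suc n)
        \<comment> \<open>The gap between layer \<open>2 * n + p\<close> and the earlier layers of
          the same parity: a full layer lies in between. For \<open>n = 0\<close> there is no
          earlier layer.\<close>
        let ?d = "1 / real (2 * n + p) - 1 / real (2 * n + p + 1)"
        have "?H (\<Union>j<n. D (2 * j + p)) + ?H (D (2 * n + p)) \<le> ?H ((\<Union>j<n. D (2 * j + p)) \<union> D (2 * n + p))"
        proof (cases "n = 0")
          case False
          show ?thesis
          proof (rule hausdorff_outer_separated[where d="?d"])
            fix x y assume "x \<in> (\<Union>j<n. D (2 * j + p))" and y: "y \<in> D (2 * n + p)"
            then obtain j where j: "j < n" "x \<in> D (2 * j + p)" by blast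
            have "1 / real (2 * n + p) \<le> 1 / real (2 * j + p + 2)"
              using j(1) by (intro divide_left_mono) auto
            then have "1 / real (2 * n + p) \<le> infdist x F" using j(2) by (auto simp: D_def)
            moreover have "infdist y F \<le> 1 / real (2 * n + p + 1)" using y by (auto simp: D_def)
            ultimately show "?d \<le> dist x y" by (rule dist)
          next
            show "0 < ?d" using False by (auto intro!: divide_strict_left_mono)
          qed
        qed simp
        moreover have "(\<Union>j<Suc n. D (2 * j + p)) = (\<Union>j<n. D (2 * j + p)) \<union> D (2 * n + p)"
          by (auto simp: lessThan_Suc)
        ultimately show ?case using order_trans[OF add_right_mono[OF Suc.IH]] by simp
      qed simp
      also have "\<dots> \<le> ?H X" by (rule hausdorff_outer_mono) (auto simp: D_def)
      finally show ?thesis .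
    qed
    have part: "(\<Sum>j<2 * n. ?H (D j)) = (\<Sum>j<n. ?H (D (2 * j + 0))) + (\<Sum>j<n. ?H (D (2 * j + 1)))" for n
      by (induction n) (auto simp: algebra_simps)
    have "(\<Sum>j<n. ?H (D j)) \<le> ?H X + ?H X" for n
    proof -
      have "(\<Sum>j<n. ?H (D j)) \<le> (\<Sum>j<2 * n. ?H (D j))" by (intro sum_mono2) auto
      also have "\<dots> \<le> ?H X + ?H X" unfolding part by (intro add_mono skip)
      finally show ?thesis .
    qed
    then have "(\<Sum>j. ?H (D j)) \<le> ?H X + ?H X" by (intro suminf_le_const) auto
    then have sumfin: "(\<Sum>j. ?H (D j)) < \<infinity>" using fin by (simp add: order_le_less_trans ennreal_add_less_top)
    have "?H (F \<inter> X) + ?H ((UNIV - F) \<inter> X) \<le> ?H X + (\<Sum>j. ?H (D (j + n)))" for n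
    proof -
      have "(UNIV - F) \<inter> X \<subseteq> Y n \<union> (\<Union>j. D (j + n))"
      proof
        fix x assume x: "x \<in> (UNIV - F) \<inter> X"
        then have pos: "0 < infdist x F" using F False by (intro infdist_pos_not_in_closed) auto
        show "x \<in> Y n \<union> (\<Union>j. D (j + n))"
        proof (cases "x \<in> Y n")
          case notY: False
          \<comment> \<open>The least \<open>m\<close> whose threshold is reached puts
            \<open>x\<close> into layer \<open>m - 1\<close>, whose index is at least
            \<open>n\<close>.\<close>
          define m where "m = (LEAST m. 1 / real (m + 1) \<le> infdist x F)"
          have "\<exists>m. 1 / real (m + 1) \<le> infdist x F"
            using pos by (metis less_imp_le nat_approx_posE of_nat_Suc Suc_eq_plus1)
          then have m: "1 / real (m + 1) \<le> infdist x F" unfolding m_def by (rule LeastI_ex)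
          have nm: "n < m"
          proof (rule ccontr)
            assume "\<not> n < m"
            then have "1 / real (n + 1) \<le> 1 / real (m + 1)" by (intro divide_left_mono) auto
            then show False using m notY x by (auto simp: Y_def)
          qed
          then have "\<not> 1 / real ((m - 1) + 1) \<le> infdist x F"
            unfolding m_def by (intro not_less_Least) auto
          then have "x \<in> D ((m - 1 - n) + n)" using m nm x by (auto simp: D_def)
          then show ?thesis by blast
        qed simp
      qed
      then have "?H ((UNIV - F) \<inter> X) \<le> ?H (Y n \<union> (\<Union>j. D (j + n)))" by (rule hausdorff_outer_mono)
      also have "\<dots> \<le> ?H (Y n) + ?H (\<Union>j. D (j + n))" by (rule hausdorff_outer_subadditive)
      also have "\<dots> \<le> ?H (Y n) + (\<Sum>j. ?H (D (j + n)))"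
        by (intro add_left_mono hausdorff_outer_countable_subadditive)
      finally have "?H (F \<inter> X) + ?H ((UNIV - F) \<inter> X) \<le> (?H (F \<inter> X) + ?H (Y n)) + (\<Sum>j. ?H (D (j + n)))"
        by (simp add: add_left_mono add.assoc)
      also have "?H (F \<inter> X) + ?H (Y n) \<le> ?H ((F \<inter> X) \<union> Y n)"
      proof (rule hausdorff_outer_separated[where d="1 / real (n + 1)"])
        fix x y assume "x \<in> F \<inter> X" "y \<in> Y n"
        then show "1 / real (n + 1) \<le> dist x y"
          using dist[of "1 / real (n + 1)" y x 0] by (auto simp: Y_def dist_commute)
      qed simp
      also have "\<dots> \<le> ?H X" by (rule hausdorff_outer_mono) (auto simp: Y_def)
      finally show ?thesis by (simp add: add_right_mono)
    qed
    moreover have "(\<lambda>n. ?H X + (\<Sum>j. ?H (D (j + n)))) \<longlonglongrightarrow> ?H X + 0"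
      by (intro tendsto_add tendsto_const ennreal_suminf_tail_tendsto_0 sumfin)
    ultimately show ?thesis
      by (intro LIMSEQ_le_const[of _ "?H X"]) auto
  qed
  then have le: "?H (F \<inter> X) + ?H ((UNIV - F) \<inter> X) \<le> ?H X" for X
    by (cases "?H X < \<infinity>") (auto simp: less_top[symmetric])
  have "?H X \<le> ?H (F \<inter> X) + ?H ((UNIV - F) \<inter> X)" for X
  proof -
    have "X = (F \<inter> X) \<union> ((UNIV - F) \<inter> X)" by auto
    then show ?thesis by (metis hausdorff_outer_subadditive)
  qed
  then show ?thesis using le by (auto simp: lambda_system_def intro: antisym)
qed

lemma borel_in_hausdorff_measure:
  fixes A :: "'a::metric_space set"
  assumes "A \<in> sets borel"
  shows "A \<in> sets (hausdorff_measure k)"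
proof -
  have "A \<in> sigma_sets UNIV {S. closed S}" using assms by (simp add: borel_eq_closed)
  then show ?thesis
  proof (induction rule: sigma_sets.induct)
    case (Basic a)
    then show ?case by (simp add: sets_hausdorff_measure closed_in_lambda_system)
  next
    case (Compl a)
    then show ?case using sets.compl_sets[of a "hausdorff_measure k"]
      by (simp add: hausdorff_measure_def)
  qed auto
qed

section \<open>Isodiametric upper bound for cone measure\<close>

lemma norm_tangential_le:
  assumes "norm a = 1"
  shows "norm (v - (v \<bullet> a) *\<^sub>R a) \<le> norm (v :: 'a::euclidean_space)"
proof (rule power2_le_imp_le)
  have "a \<bullet> a = 1" using assms by (simp add: dot_square_norm)
  then show "(norm (v - (v \<bullet> a) *\<^sub>R a))\<^sup>2 \<le> (norm v)\<^sup>2"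
    unfolding power2_norm_eq_inner by (simp add: inner_diff_left inner_diff_right inner_commute)
qed simp

lemma norm_unit_diff:
  assumes "norm a = 1" "norm b = 1"
  shows "(norm (a - b :: 'a::euclidean_space))\<^sup>2 = 2 - 2 * (a \<bullet> b)"
proof -
  have "a \<bullet> a = 1" "b \<bullet> b = 1" using assms by (simp_all add: dot_square_norm)
  then show ?thesis
    unfolding power2_norm_eq_inner by (simp add: inner_diff_left inner_diff_right inner_commute)
qed

text \<open>The left-hand side is, up to the factor \<open>d\<close> and lower order terms, the volume of the part of the shell
  \<open>1 < norm x < 1 + d\<close> above \<open>U\<close>; by symmetrization this is bounded by the volume of a cylinder.\<close>

lemma sphere_measure_le_isodiametric:
  fixes U :: "'a::euclidean_space set"
  assumes U: "open U" and d: "0 < d" "d \<le> 1" and diam: "\<And>x y. x \<in> U \<Longrightarrow> y \<in> U \<Longrightarrow> dist x y \<le> d"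
  shows "measure sphere_measure U
    \<le> unit_ball_vol (real (DIM('a) - 1)) * (d / 2) ^ (DIM('a) - 1) * (1 + 2 * d) ^ DIM('a)"
proof (cases "U \<inter> sphere 0 1 = {}")
  case True
  have "AE n in sphere_measure. n \<notin> U"
    using AE_sphere_measure by eventually_elim (use True in auto)
  then have "emeasure sphere_measure U = emeasure sphere_measure ({} :: 'a set)" using U by (intro emeasure_eq_AE) auto
  then show ?thesis using d by (simp add: measure_def)
next
  case False
  let ?N = "DIM('a)"
  define \<alpha> where "\<alpha> = unit_ball_vol (real (?N - 1))"
  have \<alpha>: "0 \<le> \<alpha>" by (simp add: \<alpha>_def)
  obtain a where a: "a \<in> U" "norm a = 1" using False by auto
  define A where "A = {x. 1 < norm x \<and> norm x < 1 + d \<and> x /\<^sub>R norm x \<in> U}"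
  have oA: "open A"
  proof -
    have 1: "open ((- {0}) \<inter> (\<lambda>x. x /\<^sub>R norm x) -` U)"
      by (rule continuous_open_preimage) (auto intro!: continuous_intros U)
    have 2: "open {x::'a. 1 < norm x}" "open {x::'a. norm x < 1 + d}"
      by (intro open_Collect_less continuous_intros)+
    have eq: "A = {x. 1 < norm x} \<inter> {x. norm x < 1 + d} \<inter> ((- {0}) \<inter> (\<lambda>x. x /\<^sub>R norm x) -` U)"
      by (auto simp: A_def)
    show ?thesis unfolding eq by (intro open_Int[OF open_Int[OF 2] 1])
  qed
  have bA: "bounded A" unfolding bounded_iff A_def by (intro exI[of _ "1 + d"]) auto
  have mA: "measure lborel A = ((1 + d) ^ ?N - 1) / real ?N * measure sphere_measure U"
  proof -
    let ?X = "{x. 1 \<le> norm x \<and> norm x \<le> 1 + d \<and> x /\<^sub>R norm x \<in> U}"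
    have Um: "U \<in> sets borel" using U by simp
    have null: "sphere (0::'a) r \<in> null_sets lborel" for r
      using negligible_sphere[of "0::'a" r]
      by (simp add: negligible_iff_null_sets null_sets_completion_iff borel_closed)
    have "AE x in lborel. x \<notin> sphere (0::'a) 1" "AE x in lborel. x \<notin> sphere (0::'a) (1 + d)"
      by (intro AE_not_in null)+
    then have "AE x in lborel. x \<in> A \<longleftrightarrow> x \<in> ?X"
      by eventually_elim (auto simp: A_def)
    moreover have "?X \<in> sets lborel" using Um by measurable
    moreover have "A \<in> sets lborel" using oA by simp
    ultimately have "measure lborel A = measure lborel ?X"
      by (intro measure_eq_AE)
    also have "emeasure lborel ?X = ennreal (((1 + d) ^ ?N - 1 ^ ?N) / real ?N) * emeasure sphere_measure U"
      using d by (intro emeasure_lborel_shell Um) auto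
    then have "measure lborel ?X = ((1 + d) ^ ?N - 1) / real ?N * measure sphere_measure U"
      using d by (simp add: measure_def enn2real_mult)
    finally show ?thesis .
  qed
  define P where "P x = x - (x \<bullet> a) *\<^sub>R a" for x
  have aa: "a \<bullet> a = 1" using a by (simp add: dot_square_norm)
  \<comment> \<open>Along \<open>a\<close> the points of \<open>A\<close> have heights between
    \<open>1 - d\<^sup>2 / 2\<close> and \<open>1 + d\<close>; the tangential part of a difference
    is at most \<open>(1 + d) * d + d * d\<close>. Both are halved in the midpoint set.\<close>
  have sub: "midpoints A (uminus ` A) \<subseteq> cylinder a (- ((d + d\<^sup>2 / 2) / 2)) ((d + d\<^sup>2 / 2) / 2) ((1 + 2 * d) * d / 2)"
  proof
    fix v assume "v \<in> midpoints A (uminus ` A)"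
    then obtain x y where xy: "x \<in> A" "y \<in> A" and v: "v = (1/2) *\<^sub>R (x - y)"
      by (auto simp: midpoints_def)
    define nn where "nn z = z /\<^sub>R norm z" for z :: 'a
    have n: "norm (nn z) = 1" "z = norm z *\<^sub>R nn z" "nn z \<in> U" "1 < norm z" "norm z < 1 + d" if "z \<in> A" for z
    proof -
      show "1 < norm z" "norm z < 1 + d" "nn z \<in> U" using that by (auto simp: A_def nn_def)
      then have "z \<noteq> 0" by auto
      then show "norm (nn z) = 1" "z = norm z *\<^sub>R nn z" by (auto simp: nn_def)
    qed
    have na: "1 - d\<^sup>2 / 2 \<le> nn z \<bullet> a" "nn z \<bullet> a \<le> 1" if "z \<in> A" for z
    proof -
      have "norm (nn z - a) \<le> d" using diam[OF n(3)[OF that] a(1)] by (simp add: dist_norm)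
      then have "(norm (nn z - a))\<^sup>2 \<le> d\<^sup>2" by (simp add: power_mono)
      then show "1 - d\<^sup>2 / 2 \<le> nn z \<bullet> a" using norm_unit_diff[OF n(1)[OF that] a(2)] by simp
      show "nn z \<bullet> a \<le> 1" using norm_cauchy_schwarz[of "nn z" a] n(1)[OF that] a(2) by simp
    qed
    have d2: "d\<^sup>2 \<le> 1" using d by (simp add: power_le_one)
    have za: "1 - d\<^sup>2 / 2 \<le> z \<bullet> a \<and> z \<bullet> a \<le> 1 + d" if "z \<in> A" for z
    proof -
      have eq: "z \<bullet> a = norm z * (nn z \<bullet> a)" using n(2)[OF that] by (metis inner_scaleR_left)
      have "1 * (1 - d\<^sup>2 / 2) \<le> norm z * (nn z \<bullet> a)"
        using na[OF that] n(4)[OF that] d2 by (intro mult_mono) auto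
      moreover have "norm z * (nn z \<bullet> a) \<le> (1 + d) * 1"
        using na[OF that] n(5)[OF that] d2 d by (intro mult_mono) auto
      ultimately show ?thesis unfolding eq by simp
    qed
    have "\<bar>x \<bullet> a - y \<bullet> a\<bar> \<le> d + d\<^sup>2 / 2" using za[OF xy(1)] za[OF xy(2)] by linarith
    then have va: "\<bar>v \<bullet> a\<bar> \<le> (d + d\<^sup>2 / 2) / 2" by (simp add: v inner_diff_left abs_divide)
    \<comment> \<open>\<open>P\<close> annihilates \<open>a\<close>, so \<open>a\<close> may be
      subtracted from \<open>nn x\<close>; the radial discrepancy then multiplies a vector of size
      at most \<open>d\<close> and contributes to second order only.\<close>
    have e1: "v - (v \<bullet> a) *\<^sub>R a = (1/2) *\<^sub>R (norm y *\<^sub>R P (nn x - nn y) + (norm x - norm y) *\<^sub>R P (nn x - a))"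
    proof -
      have Pl: "P (s *\<^sub>R u) = s *\<^sub>R P u" "P (u - w) = P u - P w" "P a = 0" for s u w
        by (simp_all add: P_def inner_diff_left algebra_simps aa)
      have "v - (v \<bullet> a) *\<^sub>R a = (1/2) *\<^sub>R (P x - P y)" unfolding v P_def[symmetric] Pl ..
      also have "P x - P y = norm x *\<^sub>R P (nn x) - norm y *\<^sub>R P (nn y)"
        using n(2)[OF xy(1)] n(2)[OF xy(2)] Pl(1) by metis
      also have "\<dots> = norm y *\<^sub>R P (nn x - nn y) + (norm x - norm y) *\<^sub>R P (nn x - a)"
        by (simp add: Pl algebra_simps)
      finally show ?thesis .
    qed
    have e2: "norm (norm y *\<^sub>R P (nn x - nn y) + (norm x - norm y) *\<^sub>R P (nn x - a)) \<le> (1 + d) * d + d * d"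
    proof (rule order_trans[OF norm_triangle_ineq], rule add_mono)
      have "norm (P (nn x - nn y)) \<le> d"
        using norm_tangential_le[OF a(2), of "nn x - nn y"] diam[OF n(3)[OF xy(1)] n(3)[OF xy(2)]]
        by (simp add: P_def dist_norm)
      then show "norm (norm y *\<^sub>R P (nn x - nn y)) \<le> (1 + d) * d"
        using n(5)[OF xy(2)] d by (auto intro!: mult_mono)
      have "norm (P (nn x - a)) \<le> d"
        using norm_tangential_le[OF a(2), of "nn x - a"] diam[OF n(3)[OF xy(1)] a(1)]
        by (simp add: P_def dist_norm)
      moreover have "\<bar>norm x - norm y\<bar> \<le> d" using n(4,5)[OF xy(1)] n(4,5)[OF xy(2)] by linarith
      ultimately show "norm ((norm x - norm y) *\<^sub>R P (nn x - a)) \<le> d * d"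
        using d by (auto intro!: mult_mono)
    qed
    have "norm (v - (v \<bullet> a) *\<^sub>R a) \<le> ((1 + d) * d + d * d) / 2"
      unfolding e1 using e2 by simp
    then have "norm (v - (v \<bullet> a) *\<^sub>R a) \<le> (1 + 2 * d) * d / 2"
      by (simp add: algebra_simps)
    then show "v \<in> cylinder a (- ((d + d\<^sup>2 / 2) / 2)) ((d + d\<^sup>2 / 2) / 2) ((1 + 2 * d) * d / 2)"
      unfolding cylinder_def mem_Collect_eq by (intro conjI) (use va in linarith)+
  qed
  let ?Z = "cylinder a (- ((d + d\<^sup>2 / 2) / 2)) ((d + d\<^sup>2 / 2) / 2) ((1 + 2 * d) * d / 2)"
  let ?s = "measure sphere_measure U"
  have Z: "emeasure lborel ?Z = ennreal ((d + d\<^sup>2 / 2) * (\<alpha> * ((1 + 2 * d) * d / 2) ^ (?N - 1)))"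
  proof -
    have w: "- (w / 2) \<le> w / 2" "w / 2 - - (w / 2) = w" if "0 \<le> w" for w :: real using that by auto
    have 0: "0 \<le> d + d\<^sup>2 / 2" "0 < (1 + 2 * d) * d / 2" using d by auto
    show ?thesis
      unfolding \<alpha>_def emeasure_cylinder[OF a(2) w(1)[OF 0(1)] 0(2)] w(2)[OF 0(1)] ..
  qed
  \<comment> \<open>Bernoulli bounds the volume of the shell from below by \<open>d\<close> times
    the cone measure.\<close>
  have "real ?N * d \<le> (1 + d) ^ ?N - 1"
    using Bernoulli_inequality[of d ?N] d by (simp add: mult.commute)
  then have "d \<le> ((1 + d) ^ ?N - 1) / real ?N" by (simp add: field_simps DIM_positive)
  then have "d * ?s \<le> measure lborel A" unfolding mA by (rule mult_right_mono) simp
  also have "\<dots> \<le> measure lborel (midpoints A (uminus ` A))" by (rule volume_le_symmetrization[OF oA bA])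
  also have "\<dots> \<le> measure lborel ?Z"
    using oA by (intro measure_mono_fmeasurable sub fmeasurableI)
      (auto simp: Z intro!: borel_open open_midpoints open_negations)
  also have "\<dots> = (d + d\<^sup>2 / 2) * (\<alpha> * ((1 + 2 * d) * d / 2) ^ (?N - 1))"
    using d \<alpha> by (simp add: measure_def Z)
  also have "\<dots> = d * ((1 + d / 2) * (\<alpha> * (d / 2) ^ (?N - 1) * (1 + 2 * d) ^ (?N - 1)))"
  proof -
    have "(1 + 2 * d) * d / 2 = (d / 2) * (1 + 2 * d)" by simp
    then have "((1 + 2 * d) * d / 2) ^ (?N - 1) = (d / 2) ^ (?N - 1) * (1 + 2 * d) ^ (?N - 1)"
      by (simp only: power_mult_distrib)
    moreover have "(d + d\<^sup>2 / 2) * (\<alpha> * (X * Y)) = d * ((1 + d / 2) * (\<alpha> * X * Y))" for X Y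
      by (simp add: power2_eq_square distrib_left distrib_right)
    ultimately show ?thesis by (simp only:)
  qed
  finally have "?s \<le> (1 + d / 2) * (\<alpha> * (d / 2) ^ (?N - 1) * (1 + 2 * d) ^ (?N - 1))"
    using d by simp
  also have "\<dots> \<le> (1 + 2 * d) * (\<alpha> * (d / 2) ^ (?N - 1) * (1 + 2 * d) ^ (?N - 1))"
    using d \<alpha> by (intro mult_right_mono) auto
  also have "\<dots> = \<alpha> * (d / 2) ^ (?N - 1) * (1 + 2 * d) ^ Suc (?N - 1)"
    by (simp only: power_Suc mult.assoc mult.left_commute mult.commute)
  also have "Suc (?N - 1) = ?N" by (simp add: DIM_positive)
  finally show ?thesis by (simp add: \<alpha>_def)
qed

text \<open>Covering sets in the definition of Hausdorff measure are arbitrary. Closures make them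
  measurable, and open neighbourhoods of radius \<open>e / 2\<close>, of diameter at most
  \<open>diameter C + e\<close>, obey the isodiametric bound; the extra \<open>e\<close> also covers
  sets of diameter 0.\<close>

lemma sphere_measure_closure_le:
  fixes C :: "'a::euclidean_space set"
  assumes C: "bounded C" "diameter C < 1"
  shows "measure sphere_measure (closure C)
    \<le> unit_ball_vol (real (DIM('a) - 1)) * (diameter C / 2) ^ (DIM('a) - 1) * (1 + 2 * diameter C) ^ DIM('a)"
proof (rule tendsto_lowerbound)
  let ?f = "\<lambda>e. unit_ball_vol (real (DIM('a) - 1)) * ((diameter C + e) / 2) ^ (DIM('a) - 1) * (1 + 2 * (diameter C + e)) ^ DIM('a)"
  show "(?f \<longlongrightarrow> unit_ball_vol (real (DIM('a) - 1)) * (diameter C / 2) ^ (DIM('a) - 1) * (1 + 2 * diameter C) ^ DIM('a)) (at_right 0)"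
    by (auto intro!: tendsto_eq_intros)
  have "\<forall>\<^sub>F e in at_right 0. e \<in> {0<..<1 - diameter C}"
    using C by (intro eventually_at_right_real) auto
  then show "\<forall>\<^sub>F e in at_right 0. measure sphere_measure (closure C) \<le> ?f e"
  proof eventually_elim
    case (elim e)
    define U where "U = (\<Union>x\<in>C. ball x (e / 2))"
    have "closure C \<subseteq> U"
    proof
      fix x assume "x \<in> closure C"
      then obtain y where "y \<in> C" "dist y x < e / 2"
        using elim unfolding closure_approachable by (metis greaterThanLessThan_iff half_gt_zero)
      then show "x \<in> U" by (auto simp: U_def)
    qed
    moreover have oU: "open U" by (auto simp: U_def)
    ultimately have "measure sphere_measure (closure C) \<le> measure sphere_measure U"
      by (intro sphere_measure.finite_measure_mono) auto
    also have "\<dots> \<le> ?f e"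
    proof (rule sphere_measure_le_isodiametric[OF oU])
      show "0 < diameter C + e" "diameter C + e \<le> 1" using elim diameter_ge_0[OF C(1)] by auto
      fix x y assume "x \<in> U" "y \<in> U"
      then obtain p q where pq: "p \<in> C" "q \<in> C" "dist p x < e / 2" "dist q y < e / 2" by (auto simp: U_def)
      have "dist p q \<le> diameter C" using diameter_bounded_bound[OF C(1) pq(1,2)] .
      moreover have "dist x y \<le> dist x p + dist p q + dist q y" by metric
      ultimately show "dist x y \<le> diameter C + e" using pq(3,4) by (simp add: dist_commute)
    qed
    finally show ?case .
  qed
qed simp

text \<open>A cover of fineness \<delta> costs only the factor
  \<open>(1 + 2 * \<delta>) ^ DIM('a)\<close>, which tends to 1.\<close>

lemma sphere_measure_le_hausdorff:
  fixes B :: "'a::euclidean_space set"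
  assumes [measurable]: "B \<in> sets borel"
  shows "emeasure sphere_measure B \<le> hausdorff_outer (DIM('a) - 1) B"
proof -
  let ?N = "DIM('a)"
  have "ennreal (measure sphere_measure B / (1 + 2 * \<delta>) ^ ?N) \<le> hausdorff_outer (?N - 1) B"
    if \<delta>: "0 < \<delta>" "\<delta> < 1" for \<delta>
  proof -
    have "ennreal (measure sphere_measure B / (1 + 2 * \<delta>) ^ ?N) \<le> hausdorff_pre (?N - 1) \<delta> B"
      unfolding hausdorff_pre_def
    proof (rule INF_greatest)
      fix C :: "nat \<Rightarrow> 'a set"
      assume "C \<in> {C. B \<subseteq> (\<Union>i. C i) \<and> (\<forall>i. bounded (C i) \<and> diameter (C i) \<le> \<delta>)}"
      then have C: "B \<subseteq> (\<Union>i. C i)" "\<And>i. bounded (C i)" "\<And>i. diameter (C i) \<le> \<delta>" by auto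
      have le: "emeasure sphere_measure (closure (C i)) \<le> ennreal ((1 + 2 * \<delta>) ^ ?N) * hausdorff_content (?N - 1) (C i)" for i
      proof (cases "C i = {}")
        case False
        let ?d = "diameter (C i)"
        have d0: "0 \<le> ?d" by (rule diameter_ge_0[OF C(2)])
        have "measure sphere_measure (closure (C i))
          \<le> unit_ball_vol (real (?N - 1)) * (?d / 2) ^ (?N - 1) * (1 + 2 * ?d) ^ ?N"
          using C(2) C(3)[of i] \<delta> by (intro sphere_measure_closure_le) auto
        also have "\<dots> \<le> unit_ball_vol (real (?N - 1)) * (?d / 2) ^ (?N - 1) * (1 + 2 * \<delta>) ^ ?N"
          using C(3)[of i] d0 by (intro mult_left_mono power_mono) auto
        finally show ?thesis
          using False \<delta> by (simp add: sphere_measure.emeasure_eq_measure hausdorff_content_def ennreal_mult'[symmetric] mult_ac ennreal_leI)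
      qed simp
      have "emeasure sphere_measure B \<le> emeasure sphere_measure (\<Union>i. closure (C i))"
        using C(1) closure_subset by (intro emeasure_mono) (blast, auto)
      also have "\<dots> \<le> (\<Sum>i. emeasure sphere_measure (closure (C i)))"
        by (intro emeasure_subadditive_countably) auto
      also have "\<dots> \<le> (\<Sum>i. ennreal ((1 + 2 * \<delta>) ^ ?N) * hausdorff_content (?N - 1) (C i))"
        by (intro suminf_le le) auto
      also have "\<dots> = ennreal ((1 + 2 * \<delta>) ^ ?N) * (\<Sum>i. hausdorff_content (?N - 1) (C i))" by simp
      finally have "ennreal (1 / (1 + 2 * \<delta>) ^ ?N) * emeasure sphere_measure B
         \<le> ennreal (1 / (1 + 2 * \<delta>) ^ ?N) * (ennreal ((1 + 2 * \<delta>) ^ ?N) * (\<Sum>i. hausdorff_content (?N - 1) (C i)))"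
        by (rule mult_left_mono) simp
      also have "\<dots> = (\<Sum>i. hausdorff_content (?N - 1) (C i))"
        using \<delta> by (simp add: mult.assoc[symmetric] ennreal_mult'[symmetric] del: ennreal_power)
      finally show "ennreal (measure sphere_measure B / (1 + 2 * \<delta>) ^ ?N) \<le> (\<Sum>i. hausdorff_content (?N - 1) (C i))"
        using \<delta> by (simp add: sphere_measure.emeasure_eq_measure ennreal_mult'[symmetric] del: ennreal_power)
    qed
    also have "\<dots> \<le> hausdorff_outer (?N - 1) B" by (rule hausdorff_pre_le_outer[OF \<delta>(1)])
    finally show ?thesis .
  qed
  then have ev: "\<forall>\<^sub>F \<delta> in at_right 0. ennreal (measure sphere_measure B / (1 + 2 * \<delta>) ^ ?N) \<le> hausdorff_outer (?N - 1) B"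
    by (intro eventually_mono[OF eventually_at_right_real[of 0 1]]) auto
  have "((\<lambda>\<delta>. ennreal (measure sphere_measure B / (1 + 2 * \<delta>) ^ ?N)) \<longlongrightarrow> ennreal (measure sphere_measure B / (1 + 2 * 0) ^ ?N)) (at_right 0)"
    by (intro tendsto_intros) auto
  from tendsto_upperbound[OF this ev] show ?thesis
    by (simp add: sphere_measure.emeasure_eq_measure)
qed

text \<open>The shell of thickness \<open>R\<close> above the cap contains a cylinder of radius
  \<open>R\<close> that stands on the tangent plane at \<open>a\<close>. The height
  \<open>R - R\<^sup>2 / 2\<close> is chosen so that its farthest points still have norm at most
  \<open>1 + R\<close>.\<close>

lemma sphere_measure_cap_ge:
  fixes a :: "'a::euclidean_space"
  assumes a: "norm a = 1" and R: "0 < R" "R \<le> 1"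
  shows "unit_ball_vol (real (DIM('a) - 1)) * R ^ (DIM('a) - 1) * (1 - R / 2)
    \<le> measure sphere_measure (cball a R) * (1 + R) ^ (DIM('a) - 1)"
proof -
  let ?N = "DIM('a)"
  let ?X = "{x. 1 \<le> norm x \<and> norm x \<le> 1 + R \<and> x /\<^sub>R norm x \<in> cball a R}"
  let ?Z = "cylinder a 1 (1 + (R - R\<^sup>2 / 2)) R"
  define \<alpha> where "\<alpha> = unit_ball_vol (real (?N - 1))"
  have aa: "a \<bullet> a = 1" using a by (simp add: dot_square_norm)
  have R2: "R\<^sup>2 \<le> R" using R by (simp add: power2_eq_square mult_left_le)
  have sub: "?Z \<subseteq> ?X"
  proof
    fix v assume "v \<in> ?Z"
    define s where "s = v \<bullet> a"
    define w where "w = v - s *\<^sub>R a"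
    define m where "m = norm v"
    have s: "1 \<le> s" "s \<le> 1 + (R - R\<^sup>2 / 2)" and w: "norm w \<le> R"
      using \<open>v \<in> ?Z\<close> by (simp_all add: cylinder_def s_def w_def)
    have w2: "(norm w)\<^sup>2 \<le> R\<^sup>2" by (rule power_mono[OF w norm_ge_zero])
    have "w \<bullet> w = v \<bullet> v - s * (v \<bullet> a) - s * (v \<bullet> a) + s * s * (a \<bullet> a)"
      by (simp add: w_def inner_diff_left inner_diff_right inner_commute[of a v] right_diff_distrib)
    then have "w \<bullet> w = v \<bullet> v - s\<^sup>2"
      unfolding aa s_def[symmetric] by (simp add: power2_eq_square)
    then have ms: "m\<^sup>2 = s\<^sup>2 + (norm w)\<^sup>2" unfolding m_def power2_norm_eq_inner by linarith
    have "s\<^sup>2 \<le> m\<^sup>2" unfolding ms by simp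
    then have sm: "s \<le> m" by (rule power2_le_imp_le) (simp add: m_def)
    have m1: "1 \<le> m" using s sm by simp
    have "m\<^sup>2 \<le> (1 + (R - R\<^sup>2 / 2))\<^sup>2 + R\<^sup>2"
      unfolding ms using s R2 R by (intro add_mono power_mono w2) auto
    also have "\<dots> = (1 + R)\<^sup>2 - R ^ 3 + R ^ 4 / 4"
      by (simp add: power2_eq_square power3_eq_cube power4_eq_xxxx field_simps)
    also have "\<dots> \<le> (1 + R)\<^sup>2"
    proof -
      have "R ^ 4 \<le> R ^ 3" using R by (intro power_decreasing) auto
      moreover have "0 \<le> R ^ 3" using R by simp
      ultimately show ?thesis by linarith
    qed
    finally have m2: "m \<le> 1 + R" by (rule power2_le_imp_le) (use R in simp)
    \<comment> \<open>The squared chord between \<open>a\<close> and the direction of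
      \<open>v\<close> is at most \<open>(norm w)\<^sup>2\<close>, so radial projection sends
      \<open>v\<close> into the cap.\<close>
    have "(norm (v /\<^sub>R m - a))\<^sup>2 = 2 - 2 * (s / m)"
    proof -
      have "norm (v /\<^sub>R m) = 1" using m1 unfolding m_def
        by (metis norm_scaleR abs_inverse abs_norm_cancel left_inverse not_one_le_zero)
      from norm_unit_diff[OF this a] show ?thesis by (simp add: s_def divide_inverse mult.commute)
    qed
    also have "\<dots> = 2 * (m - s) / m" using m1 by (simp add: field_simps)
    also have "\<dots> \<le> (norm w)\<^sup>2"
    proof -
      have "(norm w)\<^sup>2 = (m - s) * (m + s)" using ms by (simp add: power2_eq_square algebra_simps)
      moreover have "2 * (m - s) \<le> (m - s) * (m + s) * m"
      proof -
        have "2 \<le> (m + s) * m" using mult_mono[of 2 "m + s" 1 m] m1 s by simp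
        then have "(m - s) * 2 \<le> (m - s) * ((m + s) * m)" using sm by (intro mult_left_mono) auto
        then show ?thesis by (simp add: mult_ac)
      qed
      ultimately show ?thesis using m1 by (simp add: divide_le_eq)
    qed
    also have "\<dots> \<le> R\<^sup>2" by (rule w2)
    finally have "norm (v /\<^sub>R m - a) \<le> R" by (rule power2_le_imp_le) (use R in simp)
    then show "v \<in> ?X" using m1 m2 by (simp add: m_def dist_norm norm_minus_commute)
  qed
  have [measurable]: "cball a R \<in> sets borel" by simp
  have Xm: "?X \<in> sets borel" by measurable
  have X: "emeasure lborel ?X = ennreal (((1 + R) ^ ?N - 1) / real ?N) * emeasure sphere_measure (cball a R)"
    using emeasure_lborel_shell[of "cball a R" 1 "1 + R"] R by simp
  \<comment> \<open>Bernoulli for the base \<open>1 / (1 + R) = 1 - R / (1 + R)\<close>, multiplied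
    by \<open>(1 + R) ^ ?N\<close>.\<close>
  have bern: "((1 + R) ^ ?N - 1) / real ?N \<le> R * (1 + R) ^ (?N - 1)"
  proof -
    define x where "x = 1 + R"
    have x: "0 < x" using R by (simp add: x_def)
    have eq: "1 + - R / x = 1 / x" using x by (simp add: x_def field_simps)
    have "- 1 \<le> - R / x" using R by (simp add: x_def field_simps)
    from Bernoulli_inequality[OF this, of ?N]
    have "1 - real ?N * (R / x) \<le> (1 / x) ^ ?N" unfolding eq by simp
    then have "(1 - real ?N * (R / x)) * x ^ ?N \<le> (1 / x) ^ ?N * x ^ ?N"
      using x by (intro mult_right_mono) auto
    moreover have "(1 / x) ^ ?N * x ^ ?N = 1" using x by (simp add: power_divide)
    moreover have "(1 - n * (R / x)) * (x * y) = x * y - n * (R * y)" for n y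
      using x by (simp add: left_diff_distrib)
    moreover have "x ^ ?N = x * x ^ (?N - 1)" by (rule power_eq_if[THEN trans]) simp
    ultimately have "x ^ ?N - 1 \<le> real ?N * (R * x ^ (?N - 1))" by simp
    then show ?thesis unfolding x_def by (simp add: divide_le_eq mult.commute)
  qed
  have Z: "measure lborel ?Z = (R - R\<^sup>2 / 2) * (\<alpha> * R ^ (?N - 1))"
    using emeasure_cylinder[OF a, of 1 "1 + (R - R\<^sup>2 / 2)" R] R R2 by (simp add: measure_def \<alpha>_def)
  have "(R - R\<^sup>2 / 2) * (\<alpha> * R ^ (?N - 1)) \<le> measure lborel ?X"
    unfolding Z[symmetric]
  proof (intro measure_mono_fmeasurable sub fmeasurableI)
    show "emeasure lborel ?X < \<infinity>"
      unfolding X by (simp add: sphere_measure.emeasure_eq_measure ennreal_mult_less_top)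
  qed (use Xm in auto)
  also have "\<dots> = ((1 + R) ^ ?N - 1) / real ?N * measure sphere_measure (cball a R)"
    unfolding measure_def X using R by (simp add: enn2real_mult)
  also have "\<dots> \<le> R * (1 + R) ^ (?N - 1) * measure sphere_measure (cball a R)"
    by (intro mult_right_mono bern) simp
  finally have "R * (\<alpha> * R ^ (?N - 1) * (1 - R / 2)) \<le> R * (measure sphere_measure (cball a R) * (1 + R) ^ (?N - 1))"
    by (simp add: power2_eq_square algebra_simps)
  then show ?thesis using R by (simp add: \<alpha>_def)
qed

text \<open>Vitali covering with a cut-off \<open>k\<close>: the first \<open>k\<close> disjoint
  balls are used as they are and the later ones are enlarged five times. The enlarged ones cost a
  constant times the tail of a convergent series, so letting \<open>k\<close> grow leaves only the
  sum over the disjoint caps. Enlarged balls have radius at most \<open>5 * \<delta>\<close>, whence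
  the fineness \<open>10 * \<delta>\<close>.\<close>

lemma hausdorff_pre_sphere_le:
  assumes \<delta>: "0 < \<delta>" "\<delta> < 1"
  shows "hausdorff_pre (DIM('a) - 1) (10 * \<delta>) (sphere (0::'a::euclidean_space) 1)
    \<le> ennreal ((1 + \<delta>) ^ (DIM('a) - 1) / (1 - \<delta> / 2)) * emeasure (sphere_measure :: 'a measure) UNIV"
proof -
  let ?N = "DIM('a)" and ?\<sigma> = "sphere_measure :: 'a measure"
  define \<kappa> where "\<kappa> = (1 + \<delta>) ^ (?N - 1) / (1 - \<delta> / 2)"
  have \<kappa>: "0 \<le> \<kappa>" using \<delta> by (simp add: \<kappa>_def)
  define \<alpha> where "\<alpha> = unit_ball_vol (real (?N - 1))"
  have \<alpha>: "0 \<le> \<alpha>" by (simp add: \<alpha>_def)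
  have cap: "\<alpha> * R ^ (?N - 1) \<le> \<kappa> * measure ?\<sigma> (cball a R)" if "norm a = 1" "0 < R" "R \<le> \<delta>" for a :: 'a and R
  proof -
    have "\<alpha> * R ^ (?N - 1) * (1 - \<delta> / 2) \<le> \<alpha> * R ^ (?N - 1) * (1 - R / 2)"
      using that \<alpha> by (intro mult_left_mono) auto
    also have "\<dots> \<le> measure ?\<sigma> (cball a R) * (1 + R) ^ (?N - 1)"
      unfolding \<alpha>_def using that \<delta> by (intro sphere_measure_cap_ge) auto
    also have "\<dots> \<le> measure ?\<sigma> (cball a R) * (1 + \<delta>) ^ (?N - 1)"
      using that by (intro mult_left_mono power_mono) auto
    finally show ?thesis using \<delta> by (simp add: \<kappa>_def field_simps)
  qed
  define K where "K = sphere (0::'a) 1 \<times> {0<..\<delta>}"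
  obtain C where C: "countable C" "C \<subseteq> K"
    and disj: "pairwise (\<lambda>i j. disjnt (cball (fst i) (snd i)) (cball (fst j) (snd j))) C"
    and cov: "\<And>i. i \<in> K \<Longrightarrow> \<exists>j. j \<in> C \<and> \<not> disjnt (cball (fst i) (snd i)) (cball (fst j) (snd j)) \<and>
                  cball (fst i) (snd i) \<subseteq> ball (fst j) (5 * snd j)"
  proof -
    have K: "0 < snd i \<and> snd i \<le> \<delta>" if "i \<in> K" for i using that by (auto simp: K_def)
    show thesis
    proof (rule Vitali_covering_lemma_cballs_balls[of K snd \<delta> fst])
      fix C' assume "countable C'" "C' \<subseteq> K" "pairwise (\<lambda>i j. disjnt (cball (fst i) (snd i)) (cball (fst j) (snd j))) C'"
        "\<And>i. i \<in> K \<Longrightarrow> \<exists>j. j \<in> C' \<and> \<not> disjnt (cball (fst i) (snd i)) (cball (fst j) (snd j)) \<and>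
                  cball (fst i) (snd i) \<subseteq> ball (fst j) (5 * snd j)"
      then show thesis by (rule that)
    qed (rule K)
  qed
  \<comment> \<open>\<open>C\<close> may be finite; indices outside \<open>I\<close> receive empty
    sets.\<close>
  define I where "I = to_nat_on C ` C"
  define p where "p = from_nat_into C"
  have p: "p n \<in> C" "to_nat_on C (p n) = n" if "n \<in> I" for n
    using that C(1) by (auto simp: I_def p_def from_nat_into_to_nat_on)
  have pK: "norm (fst (p n)) = 1" "0 < snd (p n)" "snd (p n) \<le> \<delta>" if "n \<in> I" for n
    using p(1)[OF that] C(2) by (auto simp: K_def)
  define D where "D n = (if n \<in> I then cball (fst (p n)) (snd (p n)) else {})" for n
  define D5 where "D5 n = (if n \<in> I then cball (fst (p n)) (5 * snd (p n)) else {})" for n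
  have Dm: "range D \<subseteq> sets ?\<sigma>" by (auto simp: D_def)
  have "disjoint_family D"
    unfolding disjoint_family_on_def
  proof (intro ballI impI)
    fix m n :: nat assume mn: "m \<noteq> n"
    show "D m \<inter> D n = {}"
    proof (cases "m \<in> I \<and> n \<in> I")
      case True
      then have "p m \<noteq> p n" using p(2) mn by metis
      then show ?thesis using pairwiseD[OF disj p(1) p(1)] True by (auto simp: D_def disjnt_def)
    qed (auto simp: D_def)
  qed
  then have sum: "(\<Sum>n. emeasure ?\<sigma> (D n)) \<le> emeasure ?\<sigma> UNIV"
    using suminf_emeasure[OF Dm] emeasure_space[of ?\<sigma> "\<Union>(range D)"] by simp
  have contD: "hausdorff_content (?N - 1) (D n) \<le> ennreal \<kappa> * emeasure ?\<sigma> (D n)" for n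
  proof (cases "n \<in> I")
    case True
    then have "ennreal (\<alpha> * (snd (p n)) ^ (?N - 1)) \<le> ennreal (\<kappa> * measure ?\<sigma> (D n))"
      using cap[OF pK[OF True]] by (auto simp: D_def intro!: ennreal_leI)
    then show ?thesis using True pK[OF True] \<kappa>
      by (auto simp: D_def hausdorff_content_def \<alpha>_def sphere_measure.emeasure_eq_measure ennreal_mult')
  qed (simp add: D_def hausdorff_content_def)
  have contD5: "hausdorff_content (?N - 1) (D5 n) \<le> ennreal (5 ^ (?N - 1) * \<kappa>) * emeasure ?\<sigma> (D n)" for n
  proof (cases "n \<in> I")
    case True
    then have "ennreal (5 ^ (?N - 1) * (\<alpha> * (snd (p n)) ^ (?N - 1))) \<le> ennreal (5 ^ (?N - 1) * (\<kappa> * measure ?\<sigma> (D n)))"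
      using cap[OF pK[OF True]] by (auto simp: D_def intro!: ennreal_leI)
    then show ?thesis using True pK[OF True] \<kappa>
      by (auto simp: D_def D5_def hausdorff_content_def \<alpha>_def sphere_measure.emeasure_eq_measure
          ennreal_mult'[symmetric] power_mult_distrib mult_ac)
  qed (simp add: D5_def hausdorff_content_def)
  have bound: "hausdorff_pre (?N - 1) (10 * \<delta>) (sphere (0::'a) 1)
    \<le> ennreal \<kappa> * emeasure ?\<sigma> UNIV + ennreal (5 ^ (?N - 1) * \<kappa>) * (\<Sum>n. emeasure ?\<sigma> (D (n + k)))" for k
  proof -
    define G where "G n = (if n < k then D n else D5 n)" for n
    have "hausdorff_pre (?N - 1) (10 * \<delta>) (sphere (0::'a) 1) \<le> (\<Sum>n. hausdorff_content (?N - 1) (G n))"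
      unfolding hausdorff_pre_def
    proof (rule INF_lower, intro CollectI conjI allI)
      show "sphere 0 1 \<subseteq> (\<Union>n. G n)"
      proof
        fix x :: 'a assume x: "x \<in> sphere 0 1"
        show "x \<in> (\<Union>n. G n)"
        proof (cases "x \<in> (\<Union>n<k. D n)")
          case True
          then obtain n where "n < k" "x \<in> D n" by blast
          then show ?thesis by (intro UN_I[of n]) (auto simp: G_def)
        next
          case False
          \<comment> \<open>A ball around \<open>x\<close> misses the first \<open>k\<close> balls,
            so the selected ball that meets it, and whose enlargement contains it, has index at
            least \<open>k\<close>.\<close>
          have "closed (\<Union>n<k. D n)" by (intro closed_UN) (auto simp: D_def)
          then have "open (- (\<Union>n<k. D n))" by (simp add: closed_def)
          then obtain e where e: "0 < e" "cball x e \<subseteq> - (\<Union>n<k. D n)"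
            using False by (meson ComplI open_contains_cball)
          have "(x, min e \<delta>) \<in> K" using x e \<delta> by (simp add: K_def)
          from cov[OF this] obtain j where j: "j \<in> C" "\<not> disjnt (cball x (min e \<delta>)) (cball (fst j) (snd j))"
            "cball x (min e \<delta>) \<subseteq> ball (fst j) (5 * snd j)" by auto
          define n where "n = to_nat_on C j"
          have n: "n \<in> I" "p n = j" using j(1) C(1) by (auto simp: n_def I_def p_def)
          have "\<not> n < k"
          proof
            assume "n < k"
            then have "cball x (min e \<delta>) \<inter> D n = {}" using e by force
            then show False using j(2) n by (auto simp: D_def disjnt_def)
          qed
          moreover have "x \<in> D5 n"
            using subsetD[OF j(3), of x] n e \<delta> by (auto simp: D5_def)
          ultimately show ?thesis by (intro UN_I[of n]) (auto simp: G_def)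
        qed
      qed
      fix n
      show "bounded (G n)" by (auto simp: G_def D_def D5_def)
      show "diameter (G n) \<le> 10 * \<delta>" using pK[of n] \<delta> by (auto simp: G_def D_def D5_def)
    qed
    also have "\<dots> \<le> (\<Sum>n. ennreal \<kappa> * emeasure ?\<sigma> (D n) + ennreal (5 ^ (?N - 1) * \<kappa>) * (if n < k then 0 else emeasure ?\<sigma> (D n)))"
      using contD contD5 by (intro suminf_le) (auto simp: G_def add_increasing)
    also have "\<dots> = (\<Sum>n. ennreal \<kappa> * emeasure ?\<sigma> (D n)) + (\<Sum>n. ennreal (5 ^ (?N - 1) * \<kappa>) * (if n < k then 0 else emeasure ?\<sigma> (D n)))"
      by (rule suminf_add[symmetric]) auto
    also have "\<dots> = ennreal \<kappa> * (\<Sum>n. emeasure ?\<sigma> (D n)) + ennreal (5 ^ (?N - 1) * \<kappa>) * (\<Sum>n. if n < k then 0 else emeasure ?\<sigma> (D n))"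
      by simp
    also have "(\<Sum>n. if n < k then 0 else emeasure ?\<sigma> (D n)) = (\<Sum>n. emeasure ?\<sigma> (D (n + k)))"
      by (subst suminf_offset[of _ k]) auto
    also have "ennreal \<kappa> * (\<Sum>n. emeasure ?\<sigma> (D n)) \<le> ennreal \<kappa> * emeasure ?\<sigma> UNIV"
      by (intro mult_left_mono sum) simp
    finally show ?thesis by (simp add: add_right_mono)
  qed
  have fin: "(\<Sum>n. emeasure ?\<sigma> (D n)) < \<infinity>"
    by (rule le_less_trans[OF sum sphere_measure_finite])
  have "(\<lambda>k. ennreal \<kappa> * emeasure ?\<sigma> UNIV + ennreal (5 ^ (?N - 1) * \<kappa>) * (\<Sum>n. emeasure ?\<sigma> (D (n + k))))
     \<longlonglongrightarrow> ennreal \<kappa> * emeasure ?\<sigma> UNIV + ennreal (5 ^ (?N - 1) * \<kappa>) * 0"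
    by (intro tendsto_add tendsto_const ennreal_tendsto_cmult ennreal_suminf_tail_tendsto_0 fin) simp
  then have "hausdorff_pre (?N - 1) (10 * \<delta>) (sphere (0::'a) 1)
      \<le> ennreal \<kappa> * emeasure ?\<sigma> UNIV + ennreal (5 ^ (?N - 1) * \<kappa>) * 0"
    by (rule LIMSEQ_le_const) (use bound in blast)
  then show ?thesis by (simp add: \<kappa>_def)
qed

lemma hausdorff_outer_sphere_le:
  "hausdorff_outer (DIM('a) - 1) (sphere (0::'a::euclidean_space) 1) \<le> emeasure (sphere_measure :: 'a measure) UNIV"
  unfolding hausdorff_outer_def
proof (rule SUP_least)
  let ?\<sigma> = "sphere_measure :: 'a measure" and ?N = "DIM('a)"
  fix \<delta> :: real assume \<delta>: "\<delta> \<in> {0<..}"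
  have "((\<lambda>e. ennreal ((1 + e) ^ (?N - 1) / (1 - e / 2) * measure ?\<sigma> UNIV)) \<longlongrightarrow> ennreal ((1 + 0) ^ (?N - 1) / (1 - 0 / 2) * measure ?\<sigma> UNIV)) (at_right 0)"
    by (intro tendsto_intros) auto
  moreover have "\<forall>\<^sub>F e in at_right 0. hausdorff_pre (?N - 1) \<delta> (sphere (0::'a) 1) \<le> ennreal ((1 + e) ^ (?N - 1) / (1 - e / 2) * measure ?\<sigma> UNIV)"
  proof (rule eventually_mono[OF eventually_at_right_real[of 0 "min (\<delta> / 10) 1"]])
    fix e assume e: "e \<in> {0<..<min (\<delta> / 10) 1}"
    have "hausdorff_pre (?N - 1) \<delta> (sphere (0::'a) 1) \<le> hausdorff_pre (?N - 1) (10 * e) (sphere (0::'a) 1)"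
      using e by (intro hausdorff_pre_antimono) auto
    also have "\<dots> \<le> ennreal ((1 + e) ^ (?N - 1) / (1 - e / 2)) * emeasure ?\<sigma> UNIV"
      using e by (intro hausdorff_pre_sphere_le) auto
    also have "\<dots> = ennreal ((1 + e) ^ (?N - 1) / (1 - e / 2) * measure ?\<sigma> UNIV)"
    proof -
      have "0 \<le> (1 + e) ^ (?N - 1) / (1 - e / 2)" using e by simp
      then show ?thesis by (simp only: sphere_measure.emeasure_eq_measure ennreal_mult')
    qed
    finally show "hausdorff_pre (?N - 1) \<delta> (sphere (0::'a) 1) \<le> ennreal ((1 + e) ^ (?N - 1) / (1 - e / 2) * measure ?\<sigma> UNIV)" .
  qed (use \<delta> in auto)
  ultimately show "hausdorff_pre (?N - 1) \<delta> (sphere (0::'a) 1) \<le> emeasure ?\<sigma> UNIV"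
    using tendsto_lowerbound[of _ _ "at_right (0::real)" "hausdorff_pre (?N - 1) \<delta> (sphere (0::'a) 1)"]
    by (force simp: sphere_measure.emeasure_eq_measure)
qed

section \<open>Agreement of cone measure and Hausdorff measure on Borel sets\<close>

lemma emeasure_sphere_measure_Int_sphere:
  fixes B :: "'a::euclidean_space set"
  assumes "B \<in> sets borel"
  shows "emeasure sphere_measure (B \<inter> sphere 0 1) = emeasure sphere_measure B"
  using assms AE_sphere_measure by (intro emeasure_eq_AE) auto

text \<open>Cone measure is at most Hausdorff measure on \<open>B\<close> and on the rest of the
  sphere; the reverse inequality for the finite total masses leaves no room for a strict
  one.\<close>

theorem emeasure_hausdorff_sphere:
  fixes B :: "'a::euclidean_space set"
  assumes B: "B \<in> sets borel"
  shows "emeasure (hausdorff_measure (DIM('a) - 1)) (B \<inter> sphere 0 1) = emeasure sphere_measure B"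
proof -
  let ?H = "hausdorff_measure (DIM('a) - 1) :: 'a measure" and ?\<sigma> = "sphere_measure :: 'a measure"
  let ?S = "sphere (0::'a) 1"
  have m: "A \<in> sets borel \<Longrightarrow> A \<in> sets ?H" for A by (rule borel_in_hausdorff_measure)
  have S: "?S \<in> sets borel" by (simp add: borel_closed)
  have ge: "emeasure ?\<sigma> A \<le> emeasure ?H A" if "A \<in> sets borel" for A
    unfolding emeasure_hausdorff_measure[OF m[OF that]] by (rule sphere_measure_le_hausdorff[OF that])
  have "emeasure ?H (B \<inter> ?S) + emeasure ?\<sigma> (?S - B) \<le> emeasure ?H (B \<inter> ?S) + emeasure ?H (?S - B)"
    using B S by (intro add_left_mono ge) auto
  also have "\<dots> = emeasure ?H ?S"
  proof -
    have "(B \<inter> ?S) \<union> (?S - B) = ?S" by auto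
    moreover have "emeasure ?H (B \<inter> ?S) + emeasure ?H (?S - B) = emeasure ?H ((B \<inter> ?S) \<union> (?S - B))"
      using B S by (intro plus_emeasure m) auto
    ultimately show ?thesis by simp
  qed
  also have "\<dots> \<le> emeasure ?\<sigma> UNIV"
    unfolding emeasure_hausdorff_measure[OF m[OF S]] by (rule hausdorff_outer_sphere_le)
  also have "\<dots> = emeasure ?\<sigma> ?S" using emeasure_sphere_measure_Int_sphere[of "UNIV :: 'a set"] by simp
  also have "\<dots> = emeasure ?\<sigma> (B \<inter> ?S) + emeasure ?\<sigma> (?S - B)"
  proof -
    have "(B \<inter> ?S) \<union> (?S - B) = ?S" by auto
    moreover have "emeasure ?\<sigma> (B \<inter> ?S) + emeasure ?\<sigma> (?S - B) = emeasure ?\<sigma> ((B \<inter> ?S) \<union> (?S - B))"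
      using B S by (intro plus_emeasure) auto
    ultimately show ?thesis by simp
  qed
  finally have "emeasure ?H (B \<inter> ?S) \<le> emeasure ?\<sigma> (B \<inter> ?S)"
    using sphere_measure_finite[of "?S - B"] by (simp add: ennreal_add_left_cancel_le add.commute)
  then show ?thesis
    using antisym[OF _ ge[of "B \<inter> ?S"]] B S emeasure_sphere_measure_Int_sphere[OF B] by simp
qed

text \<open>The Hausdorff measure lives on all Caratheodory-measurable sets; the identity map pushes
  its restriction to the sphere down to a Borel measure, which is
  \<open>sphere_measure\<close>.\<close>

theorem nn_integral_hausdorff_sphere:
  fixes f :: "'a::euclidean_space \<Rightarrow> ennreal"
  assumes f[measurable]: "f \<in> borel_measurable borel"
  shows "(\<integral>\<^sup>+n\<in>sphere 0 1. f n \<partial>hausdorff_measure (DIM('a) - 1)) = (\<integral>\<^sup>+n. f n \<partial>sphere_measure)"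
proof -
  let ?H = "hausdorff_measure (DIM('a) - 1) :: 'a measure"
  have sp: "space ?H = UNIV" by (simp add: hausdorff_measure_def)
  have m: "A \<in> sets borel \<Longrightarrow> A \<in> sets ?H" for A by (rule borel_in_hausdorff_measure)
  have mf: "g \<in> borel_measurable ?H" if "g \<in> borel_measurable borel" for g :: "'a \<Rightarrow> ennreal"
    using that m sp by (auto simp: measurable_def)
  have id: "(\<lambda>x. x) \<in> density ?H (indicator (sphere 0 1)) \<rightarrow>\<^sub>M borel"
    using m sp by (auto simp: measurable_def)
  have S: "sphere (0::'a) 1 \<in> sets ?H" by (intro m) (simp add: borel_closed)
  have "distr (density ?H (indicator (sphere 0 1))) borel (\<lambda>x. x) = sphere_measure"
  proof (rule measure_eqI)
    fix A assume "A \<in> sets (distr (density ?H (indicator (sphere 0 1))) borel (\<lambda>x. x))"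
    then have A: "A \<in> sets borel" by simp
    have "emeasure (distr (density ?H (indicator (sphere 0 1))) borel (\<lambda>x. x)) A
        = emeasure (density ?H (indicator (sphere 0 1))) A"
      using A id sp by (simp add: emeasure_distr)
    also have "\<dots> = (\<integral>\<^sup>+x. indicator (A \<inter> sphere 0 1) x \<partial>?H)"
    proof (subst emeasure_density)
      show "(\<integral>\<^sup>+x. indicator (sphere 0 1) x * indicator A x \<partial>?H) = (\<integral>\<^sup>+x. indicator (A \<inter> sphere 0 1) x \<partial>?H)"
        by (rule nn_integral_cong) (auto split: split_indicator)
    qed (use m[OF A] S in \<open>simp_all add: borel_measurable_indicator\<close>)
    also have "\<dots> = emeasure ?H (A \<inter> sphere 0 1)" using m[OF A] S by simp
    finally show "emeasure (distr (density ?H (indicator (sphere 0 1))) borel (\<lambda>x. x)) A = emeasure sphere_measure A"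
      using emeasure_hausdorff_sphere[OF A] by simp
  qed simp
  then have "(\<integral>\<^sup>+n. f n \<partial>sphere_measure) = (\<integral>\<^sup>+n. f n \<partial>distr (density ?H (indicator (sphere 0 1))) borel (\<lambda>x. x))"
    by simp
  also have "\<dots> = (\<integral>\<^sup>+n. f n \<partial>density ?H (indicator (sphere 0 1)))"
    by (rule nn_integral_distr[OF id]) simp
  also have "\<dots> = (\<integral>\<^sup>+n. f n * indicator (sphere 0 1) n \<partial>?H)"
  proof (subst nn_integral_density)
    show "f \<in> borel_measurable ?H" by (rule mf[OF f])
    show "indicator (sphere 0 1) \<in> borel_measurable ?H" using S by (rule borel_measurable_indicator)
  qed (simp add: mult.commute)
  finally show ?thesis by simp
qed

section \<open>Translations of Sobolev functions\<close>

text \<open>Borel representatives keep maps such as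
  \<open>(x, y) \<mapsto> u (x - e *\<^sub>R y)\<close> measurable on the product, as Fubini
  arguments require.\<close>

lemma borel_version:
  fixes f :: "'a::euclidean_space \<Rightarrow> 'b::euclidean_space"
  assumes f: "f \<in> borel_measurable lebesgue"
  obtains f' where "f' \<in> borel_measurable borel" "AE x in lborel. f x = f' x"
proof -
  have "\<exists>f'\<in>borel_measurable lborel. AE x in lborel. f x \<bullet> i = f' x" for i
    using f by (intro completion_ex_borel_measurable_real) simp
  then obtain F where F: "\<And>i. F i \<in> borel_measurable lborel" "\<And>i. AE x in lborel. f x \<bullet> i = F i x"
    by metis
  have "AE x in lborel. \<forall>i\<in>Basis. f x \<bullet> i = F i x"
    using F(2) by (simp add: AE_finite_all)
  then have "AE x in lborel. f x = (\<Sum>i\<in>Basis. F i x *\<^sub>R i)"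
    by eventually_elim (metis (no_types, lifting) euclidean_representation sum.cong)
  moreover have "(\<lambda>x. \<Sum>i\<in>Basis. F i x *\<^sub>R i) \<in> borel_measurable borel"
    using F(1) by (intro borel_measurable_sum borel_measurable_scaleR) (auto simp: measurable_lborel1)
  ultimately show ?thesis using that by blast
qed

text \<open>A concrete algebra of smooth functions, closed under differentiation and large enough to approximate
  indicators of open sets. Testing against these gives the translation estimate by duality, without mollifying.\<close>

definition flat_exp :: "nat \<Rightarrow> real \<Rightarrow> real" where
  "flat_exp k t = (if t \<le> 0 then 0 else inverse t ^ k / exp (inverse t))"

lemma flat_exp_nonneg: "0 \<le> flat_exp k t"
  by (simp add: flat_exp_def)

lemma flat_exp_pos_iff: "0 < flat_exp k t \<longleftrightarrow> 0 < t"
  by (simp add: flat_exp_def)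

lemma flat_exp_tendsto_0: "(flat_exp k \<longlongrightarrow> 0) (at 0)"
proof (rule filterlim_split_at_real)
  have "\<forall>\<^sub>F t in at_left 0. flat_exp k t = 0"
    by (auto simp: eventually_at_filter flat_exp_def)
  then show "(flat_exp k \<longlongrightarrow> 0) (at_left 0)" by (rule tendsto_eventually)
  have "((\<lambda>t. inverse t ^ k / exp (inverse t)) \<longlongrightarrow> (0::real)) (at_right 0)"
    by (rule filterlim_compose[OF tendsto_power_div_exp_0 filterlim_inverse_at_top_right])
  then show "(flat_exp k \<longlongrightarrow> 0) (at_right 0)"
    by (rule Lim_transform_eventually) (auto simp: eventually_at_filter flat_exp_def)
qed

text \<open>The index \<open>k\<close> closes the family under differentiation. At
  \<open>t = 0\<close> the difference quotient of \<open>flat_exp k\<close> is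
  \<open>flat_exp (k + 1)\<close>, which tends to 0.\<close>

lemma flat_exp_has_real_derivative:
  "(flat_exp k has_real_derivative flat_exp (k + 2) t - real k * flat_exp (k + 1) t) (at t)"
proof (cases t "0::real" rule: linorder_cases)
  case less
  have "((\<lambda>_. 0) has_real_derivative flat_exp (k + 2) t - real k * flat_exp (k + 1) t) (at t)"
    using less by (simp add: flat_exp_def)
  then show ?thesis
    by (rule has_field_derivative_transform_within_open[where S="{..<0}"]) (use less in \<open>auto simp: flat_exp_def\<close>)
next
  case equal
  have "((\<lambda>h. (flat_exp k (0 + h) - flat_exp k 0) / h) \<longlongrightarrow> 0) (at 0)"
  proof (rule Lim_transform_eventually[OF flat_exp_tendsto_0[of "k + 1"]])
    show "\<forall>\<^sub>F h in at 0. flat_exp (k + 1) h = (flat_exp k (0 + h) - flat_exp k 0) / h"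
      by (auto simp: eventually_at_filter flat_exp_def field_simps)
  qed
  then show ?thesis using equal by (simp add: DERIV_def flat_exp_def)
next
  case greater
  have "((\<lambda>t. inverse t ^ k / exp (inverse t)) has_real_derivative flat_exp (k + 2) t - real k * flat_exp (k + 1) t) (at t)"
  proof -
    define y where "y = inverse t"
    have D1: "((\<lambda>u. u ^ k / exp u) has_real_derivative (real k * y ^ (k - 1) - y ^ k) / exp y) (at y)"
      by (auto intro!: derivative_eq_intros simp: power2_eq_square field_simps)
    have D2: "(inverse has_real_derivative - y\<^sup>2) (at t)"
      using greater by (auto intro!: derivative_eq_intros simp: y_def power2_eq_square)
    have "(real k * y ^ (k - 1) - y ^ k) / exp y * (- y\<^sup>2) = flat_exp (k + 2) t - real k * flat_exp (k + 1) t"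
    proof -
      have "flat_exp m t = y ^ m / exp y" for m using greater by (simp add: flat_exp_def y_def)
      then show ?thesis by (cases k) (simp_all add: power2_eq_square field_simps)
    qed
    then show ?thesis
      using DERIV_chain2[OF D1[unfolded y_def] D2[unfolded y_def]] by (simp add: y_def)
  qed
  then show ?thesis
    by (rule has_field_derivative_transform_within_open[where S="{0<..}"]) (use greater in \<open>auto simp: flat_exp_def\<close>)
qed

text \<open>Affine arguments \<open>c + v \<bullet> x\<close> give closure under translation and,
  through products, bumps on boxes; \<open>exp\<close> serves the saturation
  \<open>1 - exp (- n * F)\<close> of a sum of bumps.\<close>

inductive_set elementary_smooth :: "('a::euclidean_space \<Rightarrow> real) set" where
  const: "(\<lambda>x. c) \<in> elementary_smooth"
| flat: "(\<lambda>x. flat_exp k (c + v \<bullet> x)) \<in> elementary_smooth"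
| exp: "f \<in> elementary_smooth \<Longrightarrow> (\<lambda>x. exp (f x)) \<in> elementary_smooth"
| add: "f \<in> elementary_smooth \<Longrightarrow> g \<in> elementary_smooth \<Longrightarrow> (\<lambda>x. f x + g x) \<in> elementary_smooth"
| mult: "f \<in> elementary_smooth \<Longrightarrow> g \<in> elementary_smooth \<Longrightarrow> (\<lambda>x. f x * g x) \<in> elementary_smooth"

lemma elementary_smooth_diff:
  assumes "f \<in> elementary_smooth" "g \<in> elementary_smooth"
  shows "(\<lambda>x. f x - g x) \<in> elementary_smooth"
proof -
  have "(\<lambda>x. f x + (-1) * g x) \<in> elementary_smooth"
    by (intro elementary_smooth.intros assms)
  then show ?thesis by simp
qed

lemma elementary_smooth_sum:
  "finite I \<Longrightarrow> (\<And>i. i \<in> I \<Longrightarrow> f i \<in> elementary_smooth) \<Longrightarrow> (\<lambda>x. \<Sum>i\<in>I. f i x) \<in> elementary_smooth"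
  by (induction I rule: finite_induct) (auto intro: elementary_smooth.intros)

lemma elementary_smooth_prod:
  "finite I \<Longrightarrow> (\<And>i. i \<in> I \<Longrightarrow> f i \<in> elementary_smooth) \<Longrightarrow> (\<lambda>x. \<Prod>i\<in>I. f i x) \<in> elementary_smooth"
  by (induction I rule: finite_induct) (auto intro: elementary_smooth.intros)

lemma elementary_smooth_shift:
  "f \<in> elementary_smooth \<Longrightarrow> (\<lambda>x. f (x + a)) \<in> elementary_smooth"
proof (induction rule: elementary_smooth.induct)
  case (flat k c v)
  have "(\<lambda>x. flat_exp k ((c + v \<bullet> a) + v \<bullet> x)) \<in> elementary_smooth" by (rule elementary_smooth.flat)
  then show ?case by (simp add: inner_add_right algebra_simps)
qed (auto intro: elementary_smooth.intros)

lemma elementary_smooth_derivative: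
  assumes "f \<in> elementary_smooth"
  obtains f' where "\<And>x. (f has_derivative f' x) (at x)" "\<And>h. (\<lambda>x. f' x h) \<in> elementary_smooth"
proof -
  have "\<exists>f'. (\<forall>x. (f has_derivative f' x) (at x)) \<and> (\<forall>h. (\<lambda>x. f' x h) \<in> elementary_smooth)"
    using assms
  proof (induction rule: elementary_smooth.induct)
    case (const c)
    show ?case by (intro exI[of _ "\<lambda>x h. 0"]) (auto intro: elementary_smooth.const)
  next
    case (flat k c v)
    show ?case
    proof (intro exI[of _ "\<lambda>x h. (flat_exp (k + 2) (c + v \<bullet> x) - real k * flat_exp (k + 1) (c + v \<bullet> x)) * (v \<bullet> h)"] conjI allI)
      fix x
      have "((\<lambda>x. c + v \<bullet> x) has_derivative (\<lambda>h. v \<bullet> h)) (at x)"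
        by (auto intro!: derivative_eq_intros)
      from has_derivative_compose[OF this flat_exp_has_real_derivative[of k "c + v \<bullet> x", unfolded has_field_derivative_def]]
      show "((\<lambda>x. flat_exp k (c + v \<bullet> x)) has_derivative
          (\<lambda>h. (flat_exp (k + 2) (c + v \<bullet> x) - real k * flat_exp (k + 1) (c + v \<bullet> x)) * (v \<bullet> h))) (at x)" .
      fix h
      show "(\<lambda>x. (flat_exp (k + 2) (c + v \<bullet> x) - real k * flat_exp (k + 1) (c + v \<bullet> x)) * (v \<bullet> h)) \<in> elementary_smooth"
        by (intro elementary_smooth.mult elementary_smooth_diff elementary_smooth.flat elementary_smooth.const)
    qed
  next
    case (exp f)
    then obtain f' where f': "\<And>x. (f has_derivative f' x) (at x)" "\<And>h. (\<lambda>x. f' x h) \<in> elementary_smooth" by blast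
    show ?case
      by (rule exI[of _ "\<lambda>x h. f' x h * exp (f x)"])
         (auto intro!: has_derivative_exp f' elementary_smooth.mult elementary_smooth.exp exp)
  next
    case (add f g)
    then obtain f' g' where f': "\<And>x. (f has_derivative f' x) (at x)" "\<And>h. (\<lambda>x. f' x h) \<in> elementary_smooth"
      and g': "\<And>x. (g has_derivative g' x) (at x)" "\<And>h. (\<lambda>x. g' x h) \<in> elementary_smooth" by blast
    show ?case
      by (rule exI[of _ "\<lambda>x h. f' x h + g' x h"])
         (auto intro!: has_derivative_add f' g' elementary_smooth.add)
  next
    case (mult f g)
    then obtain f' g' where f': "\<And>x. (f has_derivative f' x) (at x)" "\<And>h. (\<lambda>x. f' x h) \<in> elementary_smooth"
      and g': "\<And>x. (g has_derivative g' x) (at x)" "\<And>h. (\<lambda>x. g' x h) \<in> elementary_smooth" by blast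
    show ?case
      by (rule exI[of _ "\<lambda>x h. f x * g' x h + f' x h * g x"])
         (auto intro!: has_derivative_mult f' g' elementary_smooth.add elementary_smooth.mult mult)
  qed
  then show ?thesis using that by blast
qed

lemma elementary_smooth_continuous_on:
  assumes "f \<in> elementary_smooth"
  shows "continuous_on A f"
proof -
  obtain f' where "\<And>x. (f has_derivative f' x) (at x)"
    using elementary_smooth_derivative[OF assms] by metis
  then show ?thesis
    by (meson continuous_at_imp_continuous_on has_derivative_continuous)
qed

lemma elementary_smooth_cont_diff: "f \<in> elementary_smooth \<Longrightarrow> cont_diff k f"
proof (induction k arbitrary: f)
  case 0
  then show ?case by (simp add: elementary_smooth_continuous_on)
next
  case (Suc k)
  obtain f' where f': "\<And>x. (f has_derivative f' x) (at x)" "\<And>h. (\<lambda>x. f' x h) \<in> elementary_smooth"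
    using elementary_smooth_derivative[OF Suc.prems] by metis
  have "frechet_derivative f (at x) = f' x" for x
    using frechet_derivative_at[OF f'(1)] by simp
  then show ?case using f' Suc.IH by (auto simp: differentiable_def)
qed

lemma elementary_smooth_test_function:
  assumes "f \<in> elementary_smooth" "bounded {x. f x \<noteq> 0}"
  shows "f \<in> test_functions"
  using assms elementary_smooth_cont_diff by (auto simp: test_functions_def compact_closure)

definition box_bump :: "'a::euclidean_space \<Rightarrow> 'a \<Rightarrow> 'a \<Rightarrow> real" where
  "box_bump a b x = (\<Prod>i\<in>Basis. flat_exp 0 (x \<bullet> i - a \<bullet> i) * flat_exp 0 (b \<bullet> i - x \<bullet> i))"

lemma box_bump_elementary_smooth: "box_bump a b \<in> elementary_smooth"
proof -
  have "(\<lambda>x. \<Prod>i\<in>Basis. flat_exp 0 (- (a \<bullet> i) + i \<bullet> x) * flat_exp 0 (b \<bullet> i + (- i) \<bullet> x)) \<in> elementary_smooth"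
    by (intro elementary_smooth_prod elementary_smooth.mult elementary_smooth.flat) auto
  moreover have "box_bump a b = (\<lambda>x. \<Prod>i\<in>Basis. flat_exp 0 (- (a \<bullet> i) + i \<bullet> x) * flat_exp 0 (b \<bullet> i + (- i) \<bullet> x))"
    by (simp add: box_bump_def fun_eq_iff inner_commute)
  ultimately show ?thesis by simp
qed

lemma box_bump_nonneg: "0 \<le> box_bump a b x"
  by (auto simp: box_bump_def intro!: prod_nonneg mult_nonneg_nonneg flat_exp_nonneg)

lemma box_bump_pos_iff: "0 < box_bump a b x \<longleftrightarrow> x \<in> box a b"
proof
  assume "x \<in> box a b"
  then show "0 < box_bump a b x"
    by (auto simp: box_bump_def mem_box flat_exp_pos_iff intro!: prod_pos mult_pos_pos)
next
  assume pos: "0 < box_bump a b x"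
  show "x \<in> box a b"
    unfolding mem_box
  proof
    fix i :: 'a assume i: "i \<in> Basis"
    have "flat_exp 0 (x \<bullet> i - a \<bullet> i) * flat_exp 0 (b \<bullet> i - x \<bullet> i) \<noteq> 0"
    proof
      assume "flat_exp 0 (x \<bullet> i - a \<bullet> i) * flat_exp 0 (b \<bullet> i - x \<bullet> i) = 0"
      then have "box_bump a b x = 0" unfolding box_bump_def using i by (intro prod_zero) auto
      then show False using pos by simp
    qed
    then have "0 < flat_exp 0 (x \<bullet> i - a \<bullet> i)" "0 < flat_exp 0 (b \<bullet> i - x \<bullet> i)"
      using flat_exp_nonneg by (auto simp: less_le)
    then show "a \<bullet> i < x \<bullet> i \<and> x \<bullet> i < b \<bullet> i" by (simp add: flat_exp_pos_iff)
  qed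
qed

text \<open>\<open>U\<close> is a countable union of boxes, and \<open>F n\<close> sums the bumps of
  the first of them. Then \<open>1 - exp (- n * F n)\<close> vanishes off \<open>U\<close>, and at a
  point of \<open>U\<close> the sum stays above a positive constant from some index on.\<close>

lemma open_indicator_smooth_approx:
  fixes U :: "'a::euclidean_space set"
  assumes U: "open U"
  obtains \<theta> where "\<And>n::nat. \<theta> n \<in> elementary_smooth" "\<And>n. bounded {x. \<theta> n x \<noteq> 0}"
    "\<And>n x. 0 \<le> \<theta> n x \<and> \<theta> n x \<le> 1" "\<And>x. (\<lambda>n. \<theta> n x) \<longlonglongrightarrow> indicator U x"
proof -
  obtain \<D> where D: "countable \<D>" "\<D> \<subseteq> Pow U" "\<And>X. X \<in> \<D> \<Longrightarrow> \<exists>a b. X = box a b" "\<Union>\<D> = U"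
    using open_countable_Union_open_box[OF U] by metis
  \<comment> \<open>The added empty box makes the enumeration meaningful also when \<open>U\<close>
    is empty.\<close>
  let ?D = "insert {} \<D>"
  have ne: "?D \<noteq> {}" by simp
  have cD: "countable ?D" using D(1) by simp
  have "\<exists>a b. from_nat_into ?D n = box a b" for n
    using from_nat_into[OF ne, of n] D(3) box_idem[of "0::'a"] by (metis insert_iff)
  then obtain a b where ab: "\<And>n. from_nat_into ?D n = box (a n) (b n)" by metis
  define F where "F n x = (\<Sum>j\<le>n. box_bump (a j) (b j) x)" for n x
  define \<theta> where "\<theta> n x = 1 - exp ((- real n) * F n x)" for n x
  have F0: "0 \<le> F n x" for n x unfolding F_def by (intro sum_nonneg box_bump_nonneg)
  have sub: "box (a j) (b j) \<subseteq> U" for j using from_nat_into[OF ne, of j] D(2) ab[of j] by auto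
  have Fz: "F n x = 0" if "x \<notin> (\<Union>j\<le>n. box (a j) (b j))" for n x
    unfolding F_def
  proof (intro sum.neutral ballI)
    fix j assume "j \<in> {..n}"
    then have "\<not> 0 < box_bump (a j) (b j) x" using that unfolding box_bump_pos_iff by blast
    then show "box_bump (a j) (b j) x = 0" using box_bump_nonneg[of "a j" "b j" x] by linarith
  qed
  show ?thesis
  proof
    fix n
    show "\<theta> n \<in> elementary_smooth"
      unfolding \<theta>_def F_def
      by (intro elementary_smooth_diff elementary_smooth.const elementary_smooth.exp elementary_smooth.mult
          elementary_smooth_sum box_bump_elementary_smooth) auto
    have "{x. \<theta> n x \<noteq> 0} \<subseteq> (\<Union>j\<le>n. box (a j) (b j))" 
    proof
      fix x assume "x \<in> {x. \<theta> n x \<noteq> 0}"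
      then have "F n x \<noteq> 0" by (auto simp: \<theta>_def)
      then show "x \<in> (\<Union>j\<le>n. box (a j) (b j))" using Fz by blast
    qed
    moreover have "bounded (\<Union>j\<le>n. box (a j) (b j))" by auto
    ultimately show "bounded {x. \<theta> n x \<noteq> 0}" by (rule bounded_subset[rotated])
  next
    fix n x
    show "0 \<le> \<theta> n x \<and> \<theta> n x \<le> 1" using F0[of n x] by (simp add: \<theta>_def)
  next
    fix x
    show "(\<lambda>n. \<theta> n x) \<longlonglongrightarrow> indicator U x"
    proof (cases "x \<in> U")
      case False
      then have "\<theta> n x = 0" for n using Fz[of x n] sub by (auto simp: \<theta>_def)
      then show ?thesis using False by simp
    next
      case True
      then obtain X where X: "X \<in> \<D>" "x \<in> X" using D(4) by blast
      then obtain m where m: "from_nat_into ?D m = X" using from_nat_into_surj[OF cD, of X] by auto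
      define c where "c = box_bump (a m) (b m) x"
      have c: "0 < c" unfolding c_def box_bump_pos_iff using ab[of m] m X by simp
      have lim: "(\<lambda>n. 1 - exp (- (c * real n))) \<longlonglongrightarrow> 1 - 0"
      proof (intro tendsto_intros filterlim_compose[OF exp_at_bot])
        show "filterlim (\<lambda>n. - (c * real n)) at_bot sequentially"
          using c by (simp add: filterlim_uminus_at_top[symmetric] filterlim_tendsto_pos_mult_at_top[OF tendsto_const] filterlim_real_sequentially)
      qed
      have lo: "\<forall>\<^sub>F n in sequentially. 1 - exp (- (c * real n)) \<le> \<theta> n x"
      proof (rule eventually_sequentiallyI[of m])
        fix n assume "m \<le> n"
        then have "c \<le> F n x" unfolding F_def c_def
          by (intro member_le_sum) (auto intro: box_bump_nonneg)
        then show "1 - exp (- (c * real n)) \<le> \<theta> n x"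
          using mult_left_mono[of c "F n x" "real n"] by (simp add: \<theta>_def mult.commute)
      qed
      have up: "\<forall>\<^sub>F n in sequentially. \<theta> n x \<le> 1" by (simp add: \<theta>_def)
      have "(\<lambda>n. \<theta> n x) \<longlonglongrightarrow> 1"
        by (rule tendsto_sandwich[OF lo up _ tendsto_const]) (use lim in simp)
      then show ?thesis using True by simp
    qed
  qed
qed

section \<open>Weak gradients and translations in L1\<close>

lemma integral_lborel_translate:
  fixes f :: "'a::euclidean_space \<Rightarrow> 'b::{banach, second_countable_topology}"
  assumes [measurable]: "f \<in> borel_measurable borel"
  shows "(\<integral>x. f (c + x) \<partial>lborel) = (\<integral>x. f x \<partial>lborel)"
proof -
  have "(\<integral>x. f x \<partial>lborel) = (\<integral>x. f x \<partial>distr lborel borel ((+) c))"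
    by (simp add: lborel_distr_plus)
  also have "\<dots> = (\<integral>x. f (c + x) \<partial>lborel)"
    by (subst integral_distr) auto
  finally show ?thesis by simp
qed

lemma integrable_lborel_translate:
  fixes f :: "'a::euclidean_space \<Rightarrow> 'b::{banach, second_countable_topology}"
  assumes f: "integrable lborel f"
  shows "integrable lborel (\<lambda>x. f (c + x))"
proof -
  have "integrable (distr lborel borel ((+) c)) f" using f by (simp add: lborel_distr_plus)
  then show ?thesis by (subst (asm) integrable_distr_eq) (use f in auto)
qed

lemma integral_abs_le_AE:
  fixes f g :: "'b \<Rightarrow> real"
  assumes "integrable M g" "AE x in M. \<bar>f x\<bar> \<le> g x"
  shows "\<bar>\<integral>x. f x \<partial>M\<bar> \<le> (\<integral>x. g x \<partial>M)"
proof -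
  have "\<bar>\<integral>x. f x \<partial>M\<bar> \<le> (\<integral>x. \<bar>f x\<bar> \<partial>M)" by (rule integral_abs_bound)
  also have "\<dots> \<le> (\<integral>x. g x \<partial>M)"
  proof (rule integral_mono_AE'[OF assms])
    show "AE x in M. 0 \<le> g x" using assms(2) by eventually_elim (rule order_trans[OF abs_ge_zero])
  qed
  finally show ?thesis .
qed

text \<open>The conditions of \<open>sobolev_W11\<close> and the gradient it provides, restated for
  Borel representatives and \<open>lborel\<close>.\<close>

definition borel_weak_gradient :: "('a::euclidean_space \<Rightarrow> real) \<Rightarrow> ('a \<Rightarrow> 'a) \<Rightarrow> bool" where
  "borel_weak_gradient f g \<longleftrightarrow> integrable lborel f \<and> integrable lborel g \<and>
     (\<forall>\<phi>\<in>test_functions. \<forall>i\<in>Basis.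
        (\<integral>x. f x * frechet_derivative \<phi> (at x) i \<partial>lborel) = - (\<integral>x. (g x \<bullet> i) * \<phi> x \<partial>lborel))"

lemma elementary_smooth_bounded:
  assumes f: "f \<in> elementary_smooth" and bd: "bounded A" and z: "\<And>x. x \<notin> A \<Longrightarrow> f x = 0"
  obtains C where "\<And>x. \<bar>f x\<bar> \<le> C" "0 \<le> C"
proof -
  have "compact (f ` closure A)"
    using bd by (intro compact_continuous_image elementary_smooth_continuous_on f) (simp add: compact_closure)
  then obtain C where C: "\<And>x. x \<in> closure A \<Longrightarrow> \<bar>f x\<bar> \<le> C"
    using compact_imp_bounded[of "f ` closure A"] unfolding bounded_iff by auto
  have "\<bar>f x\<bar> \<le> max C 0" for x
  proof (cases "x \<in> A")
    case True
    then show ?thesis using C[of x] closure_subset by fastforce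
  qed (simp add: z)
  then show ?thesis using that by fastforce
qed

text \<open>The translation is moved from \<open>f\<close> to \<theta>, whose increment is the
  integral of its derivative along the segment from \<open>y\<close> to \<open>y - h\<close>. After
  Fubini each slice is a weak-gradient identity for a shifted test function, bounded by
  Cauchy-Schwarz.\<close>

lemma weak_gradient_translation_test:
  fixes h :: "'a::euclidean_space"
  assumes wg: "borel_weak_gradient f g" and \<theta>: "\<theta> \<in> elementary_smooth" "bounded {x. \<theta> x \<noteq> 0}" "\<And>x. \<bar>\<theta> x\<bar> \<le> 1"
  shows "\<bar>\<integral>y. (f (y + h) - f y) * \<theta> y \<partial>lborel\<bar> \<le> norm h * (\<integral>y. norm (g y) \<partial>lborel)"
proof -
  have f: "integrable lborel f" and g: "integrable lborel g"
    using wg by (auto simp: borel_weak_gradient_def)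
  have [measurable]: "f \<in> borel_measurable borel" "g \<in> borel_measurable borel"
    using borel_measurable_integrable[OF f] borel_measurable_integrable[OF g] by auto
  obtain D where D: "\<And>x. (\<theta> has_derivative D x) (at x)" "\<And>h. (\<lambda>x. D x h) \<in> elementary_smooth"
    using elementary_smooth_derivative[OF \<theta>(1)] by metis
  have \<theta>c: "continuous_on UNIV \<theta>" by (rule elementary_smooth_continuous_on[OF \<theta>(1)])
  have [measurable]: "\<theta> \<in> borel_measurable borel" by (rule borel_measurable_continuous_onI[OF \<theta>c])
  have Dc: "continuous_on UNIV (\<lambda>x. D x h)" for h by (rule elementary_smooth_continuous_on[OF D(2)])
  have [measurable]: "(\<lambda>x. D x h) \<in> borel_measurable borel" for h by (rule borel_measurable_continuous_onI[OF Dc])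
  have Dz: "D x h = 0" if "x \<notin> closure {x. \<theta> x \<noteq> 0}" for x h
  proof -
    have "((\<lambda>_. 0) has_derivative (\<lambda>_. 0)) (at x)" by simp
    then have "(\<theta> has_derivative (\<lambda>_. 0)) (at x)"
      by (rule has_derivative_transform_within_open[where s="- closure {x. \<theta> x \<noteq> 0}"])
         (use that closure_subset[of "{x. \<theta> x \<noteq> 0}"] in \<open>auto simp: closed_closure\<close>)
    then have "D x = (\<lambda>_. 0)" by (rule has_derivative_unique[OF D(1)])
    then show ?thesis by simp
  qed
  obtain C where C: "\<And>x. \<bar>D x h\<bar> \<le> C" "0 \<le> C"
    using elementary_smooth_bounded[OF D(2)[of h], of "closure {x. \<theta> x \<noteq> 0}"] \<theta>(2) Dz by (metis bounded_closure)
  have int_mult: "integrable lborel (\<lambda>y. f y * k y)" if "k \<in> borel_measurable borel" "\<And>y. \<bar>k y\<bar> \<le> B" for k B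
  proof (rule Bochner_Integration.integrable_bound[where f="\<lambda>y. B * f y"])
    show "integrable lborel (\<lambda>y. B * f y)" using f by simp
    show "(\<lambda>y. f y * k y) \<in> borel_measurable lborel" using that(1) by measurable
    have "0 \<le> B" using that(2)[of undefined] by (rule order_trans[OF abs_ge_zero])
    then show "AE y in lborel. norm (f y * k y) \<le> norm (B * f y)"
      using mult_right_mono[OF that(2) abs_ge_zero] by (intro AE_I2) (simp add: abs_mult mult.commute)
  qed
  \<comment> \<open>The definition tests only basis directions; linearity of the derivative extends
    it to \<open>h\<close>, and shifts of \<theta> are again test functions.\<close>
  have weak: "(\<integral>y. f y * D (y - a) h \<partial>lborel) = - (\<integral>y. (g y \<bullet> h) * \<theta> (y - a) \<partial>lborel)" for a
  proof -
    let ?\<phi> = "\<lambda>y. \<theta> (y - a)"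
    have \<phi>: "?\<phi> \<in> elementary_smooth" using elementary_smooth_shift[OF \<theta>(1), of "- a"] by simp
    have "{x. ?\<phi> x \<noteq> 0} = (\<lambda>x. a + x) ` {x. \<theta> x \<noteq> 0}" by force
    then have "bounded {x. ?\<phi> x \<noteq> 0}" using \<theta>(2) by (simp add: bounded_translation)
    then have test: "?\<phi> \<in> test_functions" using \<phi> by (intro elementary_smooth_test_function)
    have D': "(?\<phi> has_derivative D (y - a)) (at y)" for y
    proof -
      have "((\<lambda>y. y - a) has_derivative (\<lambda>h. h)) (at y)" by (auto intro!: derivative_eq_intros)
      from has_derivative_compose[OF this D(1)] show ?thesis .
    qed
    then have fd: "frechet_derivative ?\<phi> (at y) = D (y - a)" for y
      using frechet_derivative_at[OF D'] by simp
    have lin: "linear (D y)" for y using D(1) has_derivative_linear by blast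
    have Dsum: "D y h = (\<Sum>i\<in>Basis. (h \<bullet> i) * D y i)" for y
    proof -
      have "D y (\<Sum>i\<in>Basis. (h \<bullet> i) *\<^sub>R i) = (\<Sum>i\<in>Basis. (h \<bullet> i) * D y i)"
        by (simp add: linear_sum[OF lin] linear_scale[OF lin])
      then show ?thesis by (simp add: euclidean_representation)
    qed
    have intD: "integrable lborel (\<lambda>y. f y * D (y - a) i)" for i
    proof -
      obtain B where B: "\<And>x. \<bar>D x i\<bar> \<le> B"
        using elementary_smooth_bounded[OF D(2)[of i], of "closure {x. \<theta> x \<noteq> 0}"] \<theta>(2) Dz by (metis bounded_closure)
      show ?thesis by (rule int_mult[of _ B]) (use B in auto)
    qed
    have intg: "integrable lborel (\<lambda>y. (g y \<bullet> i) * \<theta> (y - a))" for i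
    proof (rule Bochner_Integration.integrable_bound[where f="\<lambda>y. g y \<bullet> i"])
      show "integrable lborel (\<lambda>y. g y \<bullet> i)" using g by simp
      show "AE y in lborel. norm ((g y \<bullet> i) * \<theta> (y - a)) \<le> norm (g y \<bullet> i)"
        using \<theta>(3) by (auto simp: abs_mult intro!: mult_left_le)
    qed measurable
    have "(\<integral>y. f y * D (y - a) h \<partial>lborel) = (\<integral>y. (\<Sum>i\<in>Basis. (h \<bullet> i) * (f y * D (y - a) i)) \<partial>lborel)"
      by (subst Dsum) (simp add: sum_distrib_left mult_ac)
    also have "\<dots> = (\<Sum>i\<in>Basis. (h \<bullet> i) * (\<integral>y. f y * D (y - a) i \<partial>lborel))"
      using intD by (subst Bochner_Integration.integral_sum) auto
    also have "\<dots> = (\<Sum>i\<in>Basis. (h \<bullet> i) * - (\<integral>y. (g y \<bullet> i) * \<theta> (y - a) \<partial>lborel))"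
      using wg test fd by (intro sum.cong) (auto simp: borel_weak_gradient_def)
    also have "\<dots> = - (\<Sum>i\<in>Basis. (\<integral>y. (h \<bullet> i) * ((g y \<bullet> i) * \<theta> (y - a)) \<partial>lborel))"
      by (simp add: sum_negf)
    also have "\<dots> = - (\<integral>y. (\<Sum>i\<in>Basis. (h \<bullet> i) * ((g y \<bullet> i) * \<theta> (y - a))) \<partial>lborel)"
      using intg by (subst Bochner_Integration.integral_sum) auto
    also have "\<dots> = - (\<integral>y. (g y \<bullet> h) * \<theta> (y - a) \<partial>lborel)"
      by (subst euclidean_inner[of "g _" h]) (simp add: sum_distrib_right sum_distrib_left mult_ac)
    finally show ?thesis .
  qed
  have ftc: "\<theta> (y - h) - \<theta> y = - (\<integral>s. indicator {0..1} s * D (y - s *\<^sub>R h) h \<partial>lborel)" for y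
  proof -
    have "(\<integral>s. (- D (y - s *\<^sub>R h) h) * indicator {0..1} s \<partial>lborel) = \<theta> (y - 1 *\<^sub>R h) - \<theta> (y - 0 *\<^sub>R h)"
    proof (rule integral_FTC_Icc_real)
      fix s :: real
      have "((\<lambda>s. y - s *\<^sub>R h) has_derivative (\<lambda>t. - (t *\<^sub>R h))) (at s)" by (auto intro!: derivative_eq_intros)
      from has_derivative_compose[OF this D(1)]
      have "((\<lambda>s. \<theta> (y - s *\<^sub>R h)) has_derivative (\<lambda>t. D (y - s *\<^sub>R h) (- (t *\<^sub>R h)))) (at s)" .
      moreover have "linear (D (y - s *\<^sub>R h))" using D(1) has_derivative_linear by blast
      then have "(\<lambda>t. D (y - s *\<^sub>R h) (- (t *\<^sub>R h))) = (*) (- D (y - s *\<^sub>R h) h)"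
        by (auto simp: fun_eq_iff linear_neg linear_scale)
      ultimately show "((\<lambda>s. \<theta> (y - s *\<^sub>R h)) has_real_derivative - D (y - s *\<^sub>R h) h) (at s)"
        by (simp add: has_field_derivative_def)
      have "continuous_on UNIV (\<lambda>s. - D (y - s *\<^sub>R h) h)"
        by (intro continuous_intros continuous_on_compose2[OF Dc[of h]]) auto
      then show "isCont (\<lambda>s. - D (y - s *\<^sub>R h) h) s" by (simp add: continuous_on_eq_continuous_at)
    qed simp
    then show ?thesis by (simp add: mult.commute)
  qed
  have intP: "integrable (lborel \<Otimes>\<^sub>M lborel) (\<lambda>(s, y). indicator {0..1} s * (f y * D (y - s *\<^sub>R h) h))"
  proof (rule lborel_pair.Fubini_integrable)
    show "(\<lambda>(s, y). indicator {0..1} s * (f y * D (y - s *\<^sub>R h) h)) \<in> borel_measurable (lborel \<Otimes>\<^sub>M lborel)"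
    proof -
      have "continuous_on UNIV (\<lambda>p::real \<times> 'a. D (snd p - fst p *\<^sub>R h) h)"
        by (intro continuous_on_compose2[OF Dc[of h]] continuous_intros) auto
      then have [measurable]: "(\<lambda>p::real \<times> 'a. D (snd p - fst p *\<^sub>R h) h) \<in> borel_measurable (lborel \<Otimes>\<^sub>M lborel)"
        using borel_measurable_continuous_onI by (simp add: lborel_prod)
      show ?thesis unfolding case_prod_beta' by measurable
    qed
    have bound: "\<bar>f y * D (y - s *\<^sub>R h) h\<bar> \<le> C * \<bar>f y\<bar>" for s y
      using mult_left_mono[OF C(1)[of "y - s *\<^sub>R h"] abs_ge_zero[of "f y"]] by (simp add: abs_mult mult.commute)
    show "integrable lborel (\<lambda>s. \<integral>y. norm (case (s, y) of (s, y) \<Rightarrow> indicator {0..1} s * (f y * D (y - s *\<^sub>R h) h)) \<partial>lborel)"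
    proof (rule Bochner_Integration.integrable_bound[where f="\<lambda>s. indicator {0..1} s * (C * (\<integral>y. \<bar>f y\<bar> \<partial>lborel))"])
      show "integrable lborel (\<lambda>s. indicator {0..1::real} s * (C * (\<integral>y. \<bar>f y\<bar> \<partial>lborel)))" by auto
      have "continuous_on UNIV (\<lambda>p::real \<times> 'a. D (snd p - fst p *\<^sub>R h) h)"
        by (intro continuous_on_compose2[OF Dc[of h]] continuous_intros) auto
      then have [measurable]: "(\<lambda>p::real \<times> 'a. D (snd p - fst p *\<^sub>R h) h) \<in> borel_measurable (lborel \<Otimes>\<^sub>M lborel)"
        using borel_measurable_continuous_onI by (simp add: lborel_prod)
      show "(\<lambda>s. \<integral>y. norm (case (s, y) of (s, y) \<Rightarrow> indicator {0..1} s * (f y * D (y - s *\<^sub>R h) h)) \<partial>lborel) \<in> borel_measurable lborel"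
        unfolding case_prod_beta' by measurable
      show "AE s in lborel. norm (\<integral>y. norm (case (s, y) of (s, y) \<Rightarrow> indicator {0..1} s * (f y * D (y - s *\<^sub>R h) h)) \<partial>lborel)
          \<le> norm (indicator {0..1} s * (C * (\<integral>y. \<bar>f y\<bar> \<partial>lborel)))"
      proof (rule AE_I2)
        fix s :: real
        have "(\<integral>y. \<bar>f y * D (y - s *\<^sub>R h) h\<bar> \<partial>lborel) \<le> (\<integral>y. C * \<bar>f y\<bar> \<partial>lborel)"
          using f bound C by (intro integral_mono integrable_abs int_mult[where B=C]) auto
        then have "(\<integral>y. \<bar>f y * D (y - s *\<^sub>R h) h\<bar> \<partial>lborel) \<le> C * (\<integral>y. \<bar>f y\<bar> \<partial>lborel)" by simp
        then show "norm (\<integral>y. norm (case (s, y) of (s, y) \<Rightarrow> indicator {0..1} s * (f y * D (y - s *\<^sub>R h) h)) \<partial>lborel)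
          \<le> norm (indicator {0..1} s * (C * (\<integral>y. \<bar>f y\<bar> \<partial>lborel)))"
          using C(2) by (cases "s \<in> {0..1}") (auto simp: abs_mult integral_nonneg_AE)
      qed
    qed
    show "AE s in lborel. integrable lborel (\<lambda>y. case (s, y) of (s, y) \<Rightarrow> indicator {0..1} s * (f y * D (y - s *\<^sub>R h) h))"
      using C by (auto intro!: int_mult[where B=C])
  qed
  have "(\<integral>y. (f (y + h) - f y) * \<theta> y \<partial>lborel) = (\<integral>y. f y * (\<theta> (y - h) - \<theta> y) \<partial>lborel)"
  proof -
    have i1: "integrable lborel (\<lambda>y. f y * \<theta> y)" "integrable lborel (\<lambda>y. f y * \<theta> (y - h))"
      using \<theta>(3) by (auto intro!: int_mult[where B=1])
    have i2: "integrable lborel (\<lambda>y. f (h + y) * \<theta> y)"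
      using integrable_lborel_translate[OF i1(2), of h] by simp
    have "(\<integral>y. (f (y + h) - f y) * \<theta> y \<partial>lborel) = (\<integral>y. f (h + y) * \<theta> y \<partial>lborel) - (\<integral>y. f y * \<theta> y \<partial>lborel)"
      using i1(1) i2 by (subst Bochner_Integration.integral_diff[symmetric]) (auto simp: algebra_simps)
    also have "(\<integral>y. f (h + y) * \<theta> y \<partial>lborel) = (\<integral>y. f y * \<theta> (y - h) \<partial>lborel)"
      using integral_lborel_translate[of "\<lambda>y. f y * \<theta> (y - h)" h] by simp
    finally show ?thesis using i1 by (simp add: right_diff_distrib)
  qed
  also have "\<dots> = - (\<integral>y. (\<integral>s. indicator {0..1} s * (f y * D (y - s *\<^sub>R h) h) \<partial>lborel) \<partial>lborel)"
    unfolding ftc by (simp add: integral_mult_right_zero[symmetric] mult.left_commute del: integral_mult_right_zero)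
  also have "\<dots> = - (\<integral>s. (\<integral>y. indicator {0..1} s * (f y * D (y - s *\<^sub>R h) h) \<partial>lborel) \<partial>lborel)"
    by (simp only: lborel_pair.Fubini_integral[OF intP])
  also have "\<dots> = (\<integral>s. indicator {0..1} s * (\<integral>y. (g y \<bullet> h) * \<theta> (y - s *\<^sub>R h) \<partial>lborel) \<partial>lborel)"
    by (simp add: weak)
  finally have eq: "(\<integral>y. (f (y + h) - f y) * \<theta> y \<partial>lborel) = (\<integral>s. indicator {0..1} s * (\<integral>y. (g y \<bullet> h) * \<theta> (y - s *\<^sub>R h) \<partial>lborel) \<partial>lborel)" .
  have gb: "\<bar>\<integral>y. (g y \<bullet> h) * \<theta> (y - a) \<partial>lborel\<bar> \<le> norm h * (\<integral>y. norm (g y) \<partial>lborel)" for a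
  proof -
    have "\<bar>\<integral>y. (g y \<bullet> h) * \<theta> (y - a) \<partial>lborel\<bar> \<le> (\<integral>y. norm (g y) * norm h \<partial>lborel)"
    proof (rule integral_abs_le_AE)
      show "AE y in lborel. \<bar>(g y \<bullet> h) * \<theta> (y - a)\<bar> \<le> norm (g y) * norm h"
      proof (rule AE_I2)
        fix y
        have "\<bar>g y \<bullet> h\<bar> * \<bar>\<theta> (y - a)\<bar> \<le> (norm (g y) * norm h) * 1"
          by (intro mult_mono Cauchy_Schwarz_ineq2 \<theta>(3)) auto
        then show "\<bar>(g y \<bullet> h) * \<theta> (y - a)\<bar> \<le> norm (g y) * norm h" by (simp add: abs_mult)
      qed
    qed (use g in auto)
    then show ?thesis by (simp add: mult.commute)
  qed
  have "\<bar>\<integral>s. indicator {0..1} s * (\<integral>y. (g y \<bullet> h) * \<theta> (y - s *\<^sub>R h) \<partial>lborel) \<partial>lborel\<bar>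
      \<le> (\<integral>s. indicator {0..1::real} s * (norm h * (\<integral>y. norm (g y) \<partial>lborel)) \<partial>lborel)"
  proof (rule integral_abs_le_AE)
    show "integrable lborel (\<lambda>s. indicat_real {0..1::real} s * (norm h * (\<integral>y. norm (g y) \<partial>lborel)))"
      by auto
    show "AE s in lborel. \<bar>indicat_real {0..1} s * (\<integral>y. (g y \<bullet> h) * \<theta> (y - s *\<^sub>R h) \<partial>lborel)\<bar>
       \<le> indicat_real {0..1} s * (norm h * (\<integral>y. norm (g y) \<partial>lborel))"
      using gb by (intro AE_I2) (auto simp: indicator_def)
  qed
  also have "\<dots> = norm h * (\<integral>y. norm (g y) \<partial>lborel)" by simp
  finally show ?thesis unfolding eq .
qed

lemma outer_regular_obtain:
  fixes M :: "'a::euclidean_space measure"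
  assumes "sets M = sets borel" "emeasure M (space M) \<noteq> \<infinity>" "B \<in> sets borel" "0 < (e::real)"
  obtains U where "open U" "B \<subseteq> U" "emeasure M (U - B) < ennreal e"
proof -
  interpret finite_measure M by (rule finite_measureI) (rule assms)
  have "emeasure M B < emeasure M B + ennreal e"
    using assms(4) by (simp add: emeasure_eq_measure ennreal_plus[symmetric] ennreal_less_iff del: ennreal_plus)
  then have "(INF U \<in> {U. B \<subseteq> U \<and> open U}. emeasure M U) < emeasure M B + ennreal e"
    using outer_regular[OF assms(1-3)] by simp
  then obtain U where U: "B \<subseteq> U" "open U" "emeasure M U < emeasure M B + ennreal e"
    unfolding INF_less_iff by auto
  have "emeasure M B + emeasure M (U - B) = emeasure M (B \<union> (U - B))"
    using U assms by (intro plus_emeasure) auto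
  also have "B \<union> (U - B) = U" using U by auto
  finally have "emeasure M B + emeasure M (U - B) < emeasure M B + ennreal e" using U(3) by simp
  then have "emeasure M (U - B) < ennreal e"
    by (subst (asm) ennreal_add_left_cancel_less) auto
  then show ?thesis using U that by blast
qed

text \<open>Duality: the L1 norm of \<Delta> is its integral against its sign. The sign is replaced
  by \<open>indicator U - indicator V\<close> for open sets around \<open>P\<close> and
  \<open>Q\<close>, and this function is a pointwise limit of test functions bounded by one.\<close>

theorem weak_gradient_translation:
  fixes h :: "'a::euclidean_space"
  assumes wg: "borel_weak_gradient f g"
  shows "(\<integral>y. \<bar>f (y + h) - f y\<bar> \<partial>lborel) \<le> norm h * (\<integral>y. norm (g y) \<partial>lborel)"
proof (rule field_le_epsilon)
  fix e0 :: real assume e0: "0 < e0"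
  define e where "e = e0 / 2"
  have e: "0 < e" using e0 by (simp add: e_def)
  let ?K = "norm h * (\<integral>y. norm (g y) \<partial>lborel)"
  define \<Delta> where "\<Delta> y = f (y + h) - f y" for y
  have f: "integrable lborel f" using wg by (auto simp: borel_weak_gradient_def)
  have \<Delta>: "integrable lborel \<Delta>"
    unfolding \<Delta>_def using integrable_lborel_translate[OF f, of h] f by (simp add: add.commute)
  have [measurable]: "\<Delta> \<in> borel_measurable borel" using borel_measurable_integrable[OF \<Delta>] by simp
  \<comment> \<open>Outer regularity is used for the finite measure with density
    \<open>\<bar>\<Delta>\<bar>\<close>, so the errors on \<open>U - P\<close> and
    \<open>V - Q\<close> come out already weighted.\<close>
  define M where "M = density lborel (\<lambda>y. ennreal \<bar>\<Delta> y\<bar>)"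
  have M: "sets M = sets borel" "emeasure M (space M) \<noteq> \<infinity>"
  proof -
    show "sets M = sets borel" by (simp add: M_def)
    have "emeasure M (space M) = (\<integral>\<^sup>+y. ennreal \<bar>\<Delta> y\<bar> \<partial>lborel)"
      by (simp add: M_def emeasure_density)
    also have "\<dots> < \<infinity>" using \<Delta> by (simp add: integrable_iff_bounded)
    finally show "emeasure M (space M) \<noteq> \<infinity>" by simp
  qed
  define P where "P = {y. 0 < \<Delta> y}"
  define Q where "Q = {y. \<Delta> y < 0}"
  have PQ[measurable]: "P \<in> sets borel" "Q \<in> sets borel" by (simp_all add: P_def Q_def)
  obtain U where U: "open U" "P \<subseteq> U" "emeasure M (U - P) < ennreal e"
    using outer_regular_obtain[OF M PQ(1) e] by metis
  obtain V where V: "open V" "Q \<subseteq> V" "emeasure M (V - Q) < ennreal e"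
    using outer_regular_obtain[OF M PQ(2) e] by metis
  have [measurable]: "U \<in> sets borel" "V \<in> sets borel" using U V by auto
  have small: "(\<integral>y. \<bar>\<Delta> y\<bar> * indicator A y \<partial>lborel) \<le> e" "integrable lborel (\<lambda>y. \<bar>\<Delta> y\<bar> * indicator A y)"
    if A: "A \<in> sets borel" "emeasure M A < ennreal e" for A
  proof -
    show i: "integrable lborel (\<lambda>y. \<bar>\<Delta> y\<bar> * indicator A y)"
      using A \<Delta> by (intro integrable_real_mult_indicator) auto
    have "ennreal (\<integral>y. \<bar>\<Delta> y\<bar> * indicator A y \<partial>lborel) = (\<integral>\<^sup>+y. ennreal (\<bar>\<Delta> y\<bar> * indicator A y) \<partial>lborel)"
      by (rule nn_integral_eq_integral[OF i, symmetric]) auto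
    also have "\<dots> = emeasure M A"
      using A by (simp add: M_def emeasure_density ennreal_mult' ennreal_indicator)
    finally have "ennreal (\<integral>y. \<bar>\<Delta> y\<bar> * indicator A y \<partial>lborel) \<le> ennreal e" using A(2) by simp
    then show "(\<integral>y. \<bar>\<Delta> y\<bar> * indicator A y \<partial>lborel) \<le> e" using e by (simp add: ennreal_le_iff)
  qed
  obtain \<theta>U where \<theta>U: "\<And>n::nat. \<theta>U n \<in> elementary_smooth" "\<And>n. bounded {x. \<theta>U n x \<noteq> 0}"
    "\<And>n x. 0 \<le> \<theta>U n x \<and> \<theta>U n x \<le> 1" "\<And>x. (\<lambda>n. \<theta>U n x) \<longlonglongrightarrow> indicator U x"
    using open_indicator_smooth_approx[OF U(1)] by metis
  obtain \<theta>V where \<theta>V: "\<And>n::nat. \<theta>V n \<in> elementary_smooth" "\<And>n. bounded {x. \<theta>V n x \<noteq> 0}"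
    "\<And>n x. 0 \<le> \<theta>V n x \<and> \<theta>V n x \<le> 1" "\<And>x. (\<lambda>n. \<theta>V n x) \<longlonglongrightarrow> indicator V x"
    using open_indicator_smooth_approx[OF V(1)] by metis
  define \<theta> where "\<theta> n x = \<theta>U n x - \<theta>V n x" for n x
  have \<theta>: "\<theta> n \<in> elementary_smooth" "bounded {x. \<theta> n x \<noteq> 0}" "\<bar>\<theta> n x\<bar> \<le> 1" for n x
  proof -
    show "\<theta> n \<in> elementary_smooth" unfolding \<theta>_def using \<theta>U(1) \<theta>V(1) by (rule elementary_smooth_diff)
    have "{x. \<theta> n x \<noteq> 0} \<subseteq> {x. \<theta>U n x \<noteq> 0} \<union> {x. \<theta>V n x \<noteq> 0}" by (auto simp: \<theta>_def)
    then show "bounded {x. \<theta> n x \<noteq> 0}" using \<theta>U(2) \<theta>V(2) by (meson bounded_Un bounded_subset)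
    show "\<bar>\<theta> n x\<bar> \<le> 1" using \<theta>U(3)[of n x] \<theta>V(3)[of n x] by (auto simp: \<theta>_def abs_le_iff)
  qed
  have lim: "(\<lambda>n. \<integral>y. \<Delta> y * \<theta> n y \<partial>lborel) \<longlonglongrightarrow> (\<integral>y. \<Delta> y * (indicator U y - indicator V y) \<partial>lborel)"
  proof (rule integral_dominated_convergence[where w="\<lambda>y. \<bar>\<Delta> y\<bar>"])
    show "(\<lambda>y. \<Delta> y * (indicator U y - indicator V y)) \<in> borel_measurable lborel" by measurable
    show "(\<lambda>y. \<Delta> y * \<theta> n y) \<in> borel_measurable lborel" for n
    proof -
      have "\<theta> n \<in> borel_measurable borel"
        by (intro borel_measurable_continuous_onI elementary_smooth_continuous_on \<theta>(1))
      then show ?thesis by measurable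
    qed
    show "integrable lborel (\<lambda>y. \<bar>\<Delta> y\<bar>)" using \<Delta> by simp
    show "AE y in lborel. (\<lambda>n. \<Delta> y * \<theta> n y) \<longlonglongrightarrow> \<Delta> y * (indicator U y - indicator V y)"
      unfolding \<theta>_def by (intro AE_I2 tendsto_mult tendsto_const tendsto_diff \<theta>U(4) \<theta>V(4))
    show "AE y in lborel. norm (\<Delta> y * \<theta> n y) \<le> \<bar>\<Delta> y\<bar>" for n
      using \<theta>(3) by (intro AE_I2) (simp add: abs_mult mult_left_le)
  qed
  have "(\<integral>y. \<Delta> y * \<theta> n y \<partial>lborel) \<le> ?K" for n
    using weak_gradient_translation_test[OF wg \<theta>(1)[of n] \<theta>(2)[of n] \<theta>(3)[of n], of h] unfolding \<Delta>_def by linarith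
  then have K: "(\<integral>y. \<Delta> y * (indicator U y - indicator V y) \<partial>lborel) \<le> ?K"
    by (intro LIMSEQ_le_const2[OF lim]) auto
  have iUV: "integrable lborel (\<lambda>y. \<Delta> y * (indicator U y - indicator V y))"
  proof (rule Bochner_Integration.integrable_bound[OF \<Delta>])
    show "AE y in lborel. norm (\<Delta> y * (indicator U y - indicator V y)) \<le> norm (\<Delta> y)"
      by (intro AE_I2) (auto simp: indicator_def abs_mult)
  qed measurable
  have mU: "U - P \<in> sets borel" and mV: "V - Q \<in> sets borel" by measurable
  note sU = small[OF mU U(3)] and sV = small[OF mV V(3)]
  have "(\<integral>y. \<bar>\<Delta> y\<bar> \<partial>lborel) \<le> (\<integral>y. \<Delta> y * (indicator U y - indicator V y) + \<bar>\<Delta> y\<bar> * indicator (U - P) y + \<bar>\<Delta> y\<bar> * indicator (V - Q) y \<partial>lborel)"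
  proof (rule integral_mono)
    fix y
    have "y \<in> P \<Longrightarrow> y \<in> U" "y \<in> Q \<Longrightarrow> y \<in> V" using U V by auto
    then show "\<bar>\<Delta> y\<bar> \<le> \<Delta> y * (indicator U y - indicator V y) + \<bar>\<Delta> y\<bar> * indicator (U - P) y + \<bar>\<Delta> y\<bar> * indicator (V - Q) y"
      by (cases "\<Delta> y" "0::real" rule: linorder_cases) (auto simp: P_def Q_def indicator_def)
  qed (use \<Delta> iUV sU sV in auto)
  also have "\<dots> = (\<integral>y. \<Delta> y * (indicator U y - indicator V y) \<partial>lborel) + (\<integral>y. \<bar>\<Delta> y\<bar> * indicator (U - P) y \<partial>lborel) + (\<integral>y. \<bar>\<Delta> y\<bar> * indicator (V - Q) y \<partial>lborel)"
    using iUV sU sV by simp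
  also have "\<dots> \<le> ?K + e + e" using K sU(1) sV(1) by linarith
  finally show "(\<integral>y. \<bar>f (y + h) - f y\<bar> \<partial>lborel) \<le> ?K + e0" by (simp add: \<Delta>_def e_def)
qed

lemma sobolev_W11_borel:
  fixes f :: "'a::euclidean_space \<Rightarrow> real"
  assumes "f \<in> sobolev_W11"
  obtains f' g' where "AE x in lborel. f x = f' x" "borel_weak_gradient f' g'"
proof -
  obtain g where f: "integrable lebesgue f" and g: "integrable lebesgue g" and wg: "has_weak_gradient f g"
    using assms by (auto simp: sobolev_W11_def)
  obtain f' where f': "f' \<in> borel_measurable borel" "AE x in lborel. f x = f' x"
    using borel_version[OF borel_measurable_integrable[OF f]] by metis
  obtain g' where g': "g' \<in> borel_measurable borel" "AE x in lborel. g x = g' x"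
    using borel_version[OF borel_measurable_integrable[OF g]] by metis
  have lm: "k \<in> borel_measurable lebesgue" if "k \<in> borel_measurable borel" for k :: "'a \<Rightarrow> 'c::euclidean_space"
    using that by (simp add: measurable_completion)
  have AEf: "AE x in lebesgue. f x = f' x" and AEg: "AE x in lebesgue. g x = g' x"
    using f'(2) g'(2) by (auto intro: AE_completion)
  have "integrable lebesgue f'"
    using f AEf lm[OF f'(1)] by (subst integrable_cong_AE[symmetric, OF borel_measurable_integrable[OF f]]) auto
  then have if': "integrable lborel f'" using f'(1) by (simp add: integrable_completion)
  have "integrable lebesgue g'"
    using g AEg lm[OF g'(1)] by (subst integrable_cong_AE[symmetric, OF borel_measurable_integrable[OF g]]) auto
  then have ig': "integrable lborel g'" using g'(1) by (simp add: integrable_completion)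
  have "(\<integral>x. f' x * frechet_derivative \<phi> (at x) i \<partial>lborel) = - (\<integral>x. (g' x \<bullet> i) * \<phi> x \<partial>lborel)"
    if \<phi>: "\<phi> \<in> test_functions" and i: "i \<in> Basis" for \<phi> i
  proof -
    have cd: "cont_diff 0 \<phi>" "cont_diff (Suc 0) \<phi>" using \<phi> unfolding test_functions_def by blast+
    have [measurable]: "\<phi> \<in> borel_measurable borel"
      using cd(1) by (intro borel_measurable_continuous_onI) simp
    have [measurable]: "(\<lambda>x. frechet_derivative \<phi> (at x) i) \<in> borel_measurable borel"
      using cd(2) i by (intro borel_measurable_continuous_onI) simp
    note [measurable] = f'(1) g'(1)
    have m1: "(\<lambda>x. f' x * frechet_derivative \<phi> (at x) i) \<in> borel_measurable borel"
      and m2: "(\<lambda>x. (g' x \<bullet> i) * \<phi> x) \<in> borel_measurable borel" by measurable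
    have n1: "(\<lambda>x. f x * frechet_derivative \<phi> (at x) i) \<in> borel_measurable lebesgue"
      by (intro borel_measurable_times borel_measurable_integrable[OF f] lm) measurable
    have n2: "(\<lambda>x. (g x \<bullet> i) * \<phi> x) \<in> borel_measurable lebesgue"
      by (intro borel_measurable_times borel_measurable_inner borel_measurable_integrable[OF g] lm) measurable
    have "(\<integral>x. f' x * frechet_derivative \<phi> (at x) i \<partial>lborel) = (\<integral>x. f' x * frechet_derivative \<phi> (at x) i \<partial>lebesgue)"
      using m1 by (simp add: integral_completion)
    also have "\<dots> = (\<integral>x. f x * frechet_derivative \<phi> (at x) i \<partial>lebesgue)"
      by (rule integral_cong_AE[OF lm[OF m1] n1]) (use AEf in eventually_elim, simp)
    also have "\<dots> = - (\<integral>x. (g x \<bullet> i) * \<phi> x \<partial>lebesgue)"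
      using wg \<phi> i by (auto simp: has_weak_gradient_def)
    also have "(\<integral>x. (g x \<bullet> i) * \<phi> x \<partial>lebesgue) = (\<integral>x. (g' x \<bullet> i) * \<phi> x \<partial>lebesgue)"
      by (rule integral_cong_AE[OF n2 lm[OF m2]]) (use AEg in eventually_elim, simp)
    also have "\<dots> = (\<integral>x. (g' x \<bullet> i) * \<phi> x \<partial>lborel)"
      using m2 by (simp add: integral_completion)
    finally show ?thesis .
  qed
  then have "borel_weak_gradient f' g'" using if' ig' by (auto simp: borel_weak_gradient_def)
  then show ?thesis using that f'(2) by blast
qed

section \<open>Convolution of Besov functions\<close>

text \<open>Convexity of the power at the points \<open>a / (1 - l)\<close> and \<open>b / l\<close>
  with weights \<open>1 - l\<close> and \<open>l\<close>. As \<open>l\<close> tends to 0 the factor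
  of \<open>a powr q\<close> tends to 1, so small perturbations \<open>b\<close> do not change
  limits of q-th powers.\<close>

lemma powr_add_le_weighted:
  fixes a b q l :: real
  assumes q: "1 \<le> q" and ab: "0 \<le> a" "0 \<le> b" and l: "0 < l" "l < 1"
  shows "(a + b) powr q \<le> (1 - l) powr (1 - q) * a powr q + l powr (1 - q) * b powr q"
proof -
  have ge1: "1 \<le> t powr (1 - q)" if "0 < t" "t < 1" for t :: real
  proof -
    have "t powr 0 \<le> t powr (1 - q)" using that q by (intro powr_mono') auto
    then show ?thesis using that by simp
  qed
  consider "a = 0" | "b = 0" | "0 < a" "0 < b" using ab by linarith
  then show ?thesis
  proof cases
    case 1
    then show ?thesis using mult_right_mono[OF ge1[OF l], of "b powr q"] by simp
  next
    case 2
    then show ?thesis using mult_right_mono[OF ge1[of "1 - l"], of "a powr q"] l by simp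
  next
    case 3
    have "((1 - l) *\<^sub>R (a / (1 - l)) + l *\<^sub>R (b / l)) powr q \<le> (1 - l) * (a / (1 - l)) powr q + l * (b / l) powr q"
      using l 3 by (intro convex_onD[OF powr_convex[OF q]]) auto
    moreover have "(1 - l) * (a / (1 - l)) powr q = (1 - l) powr (1 - q) * a powr q"
      using l 3 by (simp add: powr_divide powr_diff)
    moreover have "l * (b / l) powr q = l powr (1 - q) * b powr q"
      using l 3 by (simp add: powr_divide powr_diff)
    ultimately show ?thesis using l by simp
  qed
qed

lemma norm_diff_powr_le:
  fixes a b :: "'b::real_normed_vector"
  assumes q: "1 \<le> q"
  shows "norm (a - b) powr q \<le> 2 powr (q - 1) * (norm a powr q + norm b powr q)"
proof -
  have "norm (a - b) powr q \<le> (norm a + norm b) powr q"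
    using q by (intro powr_mono2 norm_triangle_ineq4) auto
  also have "\<dots> \<le> (1 - 1/2) powr (1 - q) * norm a powr q + (1/2) powr (1 - q) * norm b powr q"
    using q by (intro powr_add_le_weighted) auto
  also have "(1/2::real) powr (1 - q) = 2 powr (q - 1)"
    by (simp add: powr_divide powr_minus_divide[symmetric])
  finally show ?thesis by (simp add: algebra_simps \<open>(1/2::real) powr (1 - q) = 2 powr (q - 1)\<close>)
qed

text \<open>The power \<open>w powr q\<close> lies above its tangent at \<open>s\<close>, and this
  is solved for \<open>w\<close>; for \<open>1 < q\<close> it is Young's inequality for the factors
  \<open>a\<close> and \<open>b\<close>.\<close>

lemma tangent_powr_le:
  fixes w s q :: real
  assumes q: "1 \<le> q" and w: "0 \<le> w" and s: "0 < s"
  shows "w \<le> w powr q * (s powr (1 - q) / q) + (1 - 1 / q) * s"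
proof (cases "q = 1")
  case True
  then show ?thesis using s w by simp
next
  case False
  define p where "p = q / (q - 1)"
  define a where "a = w * s powr ((1 - q) / q)"
  define b where "b = s powr ((q - 1) / q)"
  have q1: "1 < q" using q False by simp
  have "a * b \<le> a powr q / q + b powr p / p"
    using q1 w by (intro Youngs_inequality) (auto simp: p_def a_def b_def field_simps)
  moreover have "a * b = w"
    using s q1 by (simp add: a_def b_def mult.assoc powr_add[symmetric] diff_divide_distrib)
  moreover have "a powr q = w powr q * s powr (1 - q)"
    using q1 w s by (simp add: a_def powr_mult powr_powr)
  moreover have "b powr p / p = (1 - 1 / q) * s"
    using q1 s by (simp add: b_def p_def powr_powr field_simps)
  ultimately show ?thesis by simp
qed

text \<open>Integrating the tangent inequality at a common point \<open>s\<close> and optimising in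
  \<open>s\<close> gives Jensen for the finite measure with density \<open>\<bar>k\<bar>\<close>;
  its total mass enters with the power \<open>q - 1\<close>.\<close>

lemma jensen_real:
  fixes k w :: "'a \<Rightarrow> real"
  assumes q: "1 \<le> q" and k: "integrable M k" and w[measurable]: "w \<in> borel_measurable M" and w0: "\<And>y. 0 \<le> w y"
    and I: "integrable M (\<lambda>y. \<bar>k y\<bar> * w y powr q)"
  shows "integrable M (\<lambda>y. \<bar>k y\<bar> * w y)"
    and "(\<integral>y. \<bar>k y\<bar> * w y \<partial>M) powr q \<le> (\<integral>y. \<bar>k y\<bar> \<partial>M) powr (q - 1) * (\<integral>y. \<bar>k y\<bar> * w y powr q \<partial>M)"
proof -
  have [measurable]: "k \<in> borel_measurable M" using k by auto
  have ka: "integrable M (\<lambda>y. \<bar>k y\<bar>)" using k by simp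
  show int: "integrable M (\<lambda>y. \<bar>k y\<bar> * w y)"
  proof (rule Bochner_Integration.integrable_bound[where f="\<lambda>y. \<bar>k y\<bar> * w y powr q + \<bar>k y\<bar>"])
    show "AE y in M. norm (\<bar>k y\<bar> * w y) \<le> norm (\<bar>k y\<bar> * w y powr q + \<bar>k y\<bar>)"
    proof (rule AE_I2)
      fix y
      have "w y \<le> w y powr q + 1"
      proof (cases "w y \<le> 1")
        case False
        then have "w y powr 1 \<le> w y powr q" using q by (intro powr_mono) auto
        then show ?thesis using False by simp
      qed (simp add: add_increasing)
      then have "\<bar>k y\<bar> * w y \<le> \<bar>k y\<bar> * (w y powr q + 1)" by (rule mult_left_mono) simp
      then show "norm (\<bar>k y\<bar> * w y) \<le> norm (\<bar>k y\<bar> * w y powr q + \<bar>k y\<bar>)"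
        using w0[of y] by (simp add: algebra_simps abs_mult)
    qed
  qed (use I ka in auto)
  define S where "S = (\<integral>y. \<bar>k y\<bar> \<partial>M)"
  define i where "i = (\<integral>y. \<bar>k y\<bar> * w y powr q \<partial>M)"
  define A where "A = (\<integral>y. \<bar>k y\<bar> * w y \<partial>M)"
  have nn: "0 \<le> S" "0 \<le> i" "0 \<le> A" using w0 by (auto simp: S_def i_def A_def intro!: integral_nonneg_AE)
  show "A powr q \<le> S powr (q - 1) * i"
  proof (cases "S = 0 \<or> i = 0")
    case True
    have "AE y in M. \<bar>k y\<bar> * w y = 0"
    proof (cases "S = 0")
      case True
      then have "AE y in M. \<bar>k y\<bar> = 0"
        unfolding S_def using ka by (subst (asm) integral_nonneg_eq_0_iff_AE) auto
      then show ?thesis by eventually_elim simp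
    next
      case False
      then have "i = 0" using True by simp
      then have "AE y in M. \<bar>k y\<bar> * w y powr q = 0"
        unfolding i_def using I by (subst (asm) integral_nonneg_eq_0_iff_AE) auto
      then show ?thesis by eventually_elim auto
    qed
    then have "A = 0" unfolding A_def by (simp add: integral_eq_zero_AE)
    then show ?thesis using nn by simp
  next
    case False
    then have pos: "0 < S" "0 < i" using nn by auto
    \<comment> \<open>The optimal tangent point is the q-mean of \<open>w\<close> with respect to
      the normalised weight \<open>\<bar>k\<bar> / S\<close>.\<close>
    define s where "s = (i / S) powr (1 / q)"
    have s: "0 < s" using pos by (simp add: s_def)
    have sq: "s powr q = i / S" using pos q by (simp add: s_def powr_powr)
    have "A \<le> (\<integral>y. (\<bar>k y\<bar> * w y powr q) * (s powr (1 - q) / q) + \<bar>k y\<bar> * ((1 - 1 / q) * s) \<partial>M)"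
      unfolding A_def
    proof (rule integral_mono)
      fix y
      have "\<bar>k y\<bar> * w y \<le> \<bar>k y\<bar> * (w y powr q * (s powr (1 - q) / q) + (1 - 1 / q) * s)"
        by (intro mult_left_mono tangent_powr_le q w0 s) simp
      then show "\<bar>k y\<bar> * w y \<le> (\<bar>k y\<bar> * w y powr q) * (s powr (1 - q) / q) + \<bar>k y\<bar> * ((1 - 1 / q) * s)"
        by (simp add: distrib_left mult.assoc)
    qed (use int I ka in auto)
    also have "\<dots> = i * (s powr (1 - q) / q) + S * ((1 - 1 / q) * s)"
      unfolding i_def S_def using I ka
      by (subst Bochner_Integration.integral_add) (auto simp del: integral_mult_left_zero intro!: arg_cong2[where f="(+)"] integral_mult_left)
    also have "i = s powr q * S" using sq pos by simp
    also have "s powr q * S * (s powr (1 - q) / q) = S * s / q"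
    proof -
      have "s powr q * s powr (1 - q) = s" using s by (simp add: powr_add[symmetric])
      then show ?thesis by (simp add: field_simps)
    qed
    finally have "A \<le> S * s" using q by (simp add: field_simps)
    then have "A powr q \<le> (S * s) powr q" using nn q by (intro powr_mono2) auto
    also have "\<dots> = S powr q * (i / S)" using pos s sq by (simp add: powr_mult)
    also have "\<dots> = S powr (q - 1) * i" using pos by (simp add: powr_diff)
    finally show ?thesis .
  qed
qed

lemma jensen_vector:
  fixes k :: "'a \<Rightarrow> real" and W :: "'a \<Rightarrow> 'b::{banach, second_countable_topology}"
  assumes q: "1 \<le> q" and k: "integrable M k" and W[measurable]: "W \<in> borel_measurable M"
  shows "ennreal (norm (\<integral>y. k y *\<^sub>R W y \<partial>M) powr q)
    \<le> ennreal ((\<integral>y. \<bar>k y\<bar> \<partial>M) powr (q - 1)) * (\<integral>\<^sup>+y. ennreal \<bar>k y\<bar> * ennreal (norm (W y) powr q) \<partial>M)"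
proof -
  have [measurable]: "k \<in> borel_measurable M" using k by auto
  define S where "S = (\<integral>y. \<bar>k y\<bar> \<partial>M)"
  have S: "0 \<le> S" by (auto simp: S_def intro!: integral_nonneg_AE)
  let ?I = "\<integral>\<^sup>+y. ennreal \<bar>k y\<bar> * ennreal (norm (W y) powr q) \<partial>M"
  have Ieq: "?I = (\<integral>\<^sup>+y. ennreal (\<bar>k y\<bar> * norm (W y) powr q) \<partial>M)" by (simp add: ennreal_mult)
  show ?thesis
  proof (cases "?I < \<infinity>")
    case True
    have I: "integrable M (\<lambda>y. \<bar>k y\<bar> * norm (W y) powr q)"
      using True unfolding Ieq by (intro integrableI_nonneg) auto
    note J = jensen_real[OF q k _ _ I]
    have int: "integrable M (\<lambda>y. \<bar>k y\<bar> * norm (W y))" by (rule J(1)) auto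
    have "norm (\<integral>y. k y *\<^sub>R W y \<partial>M) \<le> (\<integral>y. norm (k y *\<^sub>R W y) \<partial>M)" by (rule integral_norm_bound)
    also have "\<dots> = (\<integral>y. \<bar>k y\<bar> * norm (W y) \<partial>M)" by simp
    finally have "norm (\<integral>y. k y *\<^sub>R W y \<partial>M) powr q \<le> (\<integral>y. \<bar>k y\<bar> * norm (W y) \<partial>M) powr q"
      using q by (intro powr_mono2) auto
    also have "\<dots> \<le> S powr (q - 1) * (\<integral>y. \<bar>k y\<bar> * norm (W y) powr q \<partial>M)"
      unfolding S_def by (rule J(2)) auto
    finally have "ennreal (norm (\<integral>y. k y *\<^sub>R W y \<partial>M) powr q) \<le> ennreal (S powr (q - 1) * (\<integral>y. \<bar>k y\<bar> * norm (W y) powr q \<partial>M))"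
      by (rule ennreal_leI)
    also have "\<dots> = ennreal (S powr (q - 1)) * ?I"
      unfolding Ieq using I by (subst nn_integral_eq_integral) (auto simp: ennreal_mult intro!: ennreal_mult integral_nonneg_AE)
    finally show ?thesis by (simp add: S_def)
  next
    \<comment> \<open>With an infinite integral on the right only the factor
      \<open>S powr (q - 1)\<close> could spoil the claim, and for \<open>S = 0\<close> the kernel
      is zero almost everywhere.\<close>
    case False
    show ?thesis
    proof (cases "S = 0")
      case True
      then have "AE y in M. \<bar>k y\<bar> = 0"
        unfolding S_def using k by (subst (asm) integral_nonneg_eq_0_iff_AE) auto
      then have "AE y in M. k y *\<^sub>R W y = 0" by eventually_elim simp
      then have "(\<integral>y. k y *\<^sub>R W y \<partial>M) = 0" by (rule integral_eq_zero_AE)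
      then show ?thesis by simp
    next
      case S0: False
      then have "0 < S powr (q - 1)" using S by simp
      moreover have "?I = top" using False by (metis infinity_ennreal_def less_top)
      ultimately show ?thesis by (simp add: S_def[symmetric] ennreal_mult_top)
    qed
  qed
qed

text \<open>A form of Minkowski's integral inequality for q-th powers: Jensen for each
  \<open>x\<close>, then Tonelli.\<close>

lemma Lq_integral_operator:
  fixes k :: "'a::euclidean_space \<Rightarrow> real" and W :: "'c::euclidean_space \<Rightarrow> 'a \<Rightarrow> 'b::euclidean_space"
  assumes q: "1 \<le> q" and k: "integrable lborel k"
    and W[measurable]: "case_prod W \<in> borel_measurable (borel \<Otimes>\<^sub>M borel)"
  shows "(\<integral>\<^sup>+x. ennreal (norm (\<integral>y. k y *\<^sub>R W x y \<partial>lborel) powr q) \<partial>lborel)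
    \<le> ennreal ((\<integral>y. \<bar>k y\<bar> \<partial>lborel) powr (q - 1)) *
       (\<integral>\<^sup>+y. ennreal \<bar>k y\<bar> * (\<integral>\<^sup>+x. ennreal (norm (W x y) powr q) \<partial>lborel) \<partial>lborel)"
proof -
  have [measurable]: "k \<in> borel_measurable borel" using borel_measurable_integrable[OF k] by simp
  let ?c = "ennreal ((\<integral>y. \<bar>k y\<bar> \<partial>lborel) powr (q - 1))"
  have "(\<integral>\<^sup>+x. ennreal (norm (\<integral>y. k y *\<^sub>R W x y \<partial>lborel) powr q) \<partial>lborel)
     \<le> (\<integral>\<^sup>+x. ?c * (\<integral>\<^sup>+y. ennreal \<bar>k y\<bar> * ennreal (norm (W x y) powr q) \<partial>lborel) \<partial>lborel)"
    by (intro nn_integral_mono jensen_vector q k) measurable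
  also have "\<dots> = ?c * (\<integral>\<^sup>+x. (\<integral>\<^sup>+y. ennreal \<bar>k y\<bar> * ennreal (norm (W x y) powr q) \<partial>lborel) \<partial>lborel)"
    by (rule nn_integral_cmult) measurable
  also have "(\<integral>\<^sup>+x. (\<integral>\<^sup>+y. ennreal \<bar>k y\<bar> * ennreal (norm (W x y) powr q) \<partial>lborel) \<partial>lborel)
      = (\<integral>\<^sup>+y. (\<integral>\<^sup>+x. ennreal \<bar>k y\<bar> * ennreal (norm (W x y) powr q) \<partial>lborel) \<partial>lborel)"
    by (rule lborel_pair.Fubini'[symmetric]) measurable
  also have "\<dots> = (\<integral>\<^sup>+y. ennreal \<bar>k y\<bar> * (\<integral>\<^sup>+x. ennreal (norm (W x y) powr q) \<partial>lborel) \<partial>lborel)"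
    by (intro nn_integral_cong nn_integral_cmult) measurable
  finally show ?thesis .
qed

text \<open>The bound on \<open>W\<close> is asked for only where \<open>k\<close> is nonzero, so
  that kernels with bounded support can use it on their support.\<close>

lemma Lq_integral_operator_bound:
  fixes k :: "'a::euclidean_space \<Rightarrow> real" and W :: "'c::euclidean_space \<Rightarrow> 'a \<Rightarrow> 'b::euclidean_space"
  assumes q: "1 \<le> q" and k: "integrable lborel k"
    and W[measurable]: "case_prod W \<in> borel_measurable (borel \<Otimes>\<^sub>M borel)"
    and c: "0 \<le> c" "\<And>y. k y \<noteq> 0 \<Longrightarrow> (\<integral>\<^sup>+x. ennreal (norm (W x y) powr q) \<partial>lborel) \<le> ennreal c"
  shows "(\<integral>\<^sup>+x. ennreal (norm (\<integral>y. k y *\<^sub>R W x y \<partial>lborel) powr q) \<partial>lborel)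
    \<le> ennreal ((\<integral>y. \<bar>k y\<bar> \<partial>lborel) powr q * c)"
proof -
  have [measurable]: "k \<in> borel_measurable borel" using borel_measurable_integrable[OF k] by simp
  define S where "S = (\<integral>y. \<bar>k y\<bar> \<partial>lborel)"
  have S: "0 \<le> S" by (auto simp: S_def intro!: integral_nonneg_AE)
  have "(\<integral>\<^sup>+x. ennreal (norm (\<integral>y. k y *\<^sub>R W x y \<partial>lborel) powr q) \<partial>lborel)
    \<le> ennreal (S powr (q - 1)) * (\<integral>\<^sup>+y. ennreal \<bar>k y\<bar> * (\<integral>\<^sup>+x. ennreal (norm (W x y) powr q) \<partial>lborel) \<partial>lborel)"
    unfolding S_def by (rule Lq_integral_operator[OF q k W])
  also have "\<dots> \<le> ennreal (S powr (q - 1)) * (\<integral>\<^sup>+y. ennreal \<bar>k y\<bar> * ennreal c \<partial>lborel)"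
  proof (rule mult_left_mono, rule nn_integral_mono)
    fix y
    show "ennreal \<bar>k y\<bar> * (\<integral>\<^sup>+x. ennreal (norm (W x y) powr q) \<partial>lborel) \<le> ennreal \<bar>k y\<bar> * ennreal c"
      using c(2)[of y] by (cases "k y = 0") (auto intro: mult_left_mono)
  qed simp
  also have "(\<integral>\<^sup>+y. ennreal \<bar>k y\<bar> * ennreal c \<partial>lborel) = ennreal S * ennreal c"
    unfolding S_def using k by (subst nn_integral_multc) (auto simp: nn_integral_eq_integral)
  also have "ennreal (S powr (q - 1)) * (ennreal S * ennreal c) = ennreal (S powr (q - 1) * S * c)"
    using S c by (simp add: ennreal_mult mult.assoc)
  also have "S powr (q - 1) * S = S powr q"
    using S q by (cases "S = 0") (auto simp: powr_diff)
  finally show ?thesis by (simp add: S_def)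
qed

text \<open>A non-integrable integrand has integral 0 by convention, so splitting these integrals
  into sums requires integrability for almost every \<open>x\<close>; it follows from Tonelli and
  the first claim of \<open>jensen_real\<close>.\<close>

lemma AE_integrable_integral_operator:
  fixes k :: "'a::euclidean_space \<Rightarrow> real" and W :: "'c::euclidean_space \<Rightarrow> 'a \<Rightarrow> 'b::euclidean_space"
  assumes q: "1 \<le> q" and k: "integrable lborel k"
    and W[measurable]: "case_prod W \<in> borel_measurable (borel \<Otimes>\<^sub>M borel)"
    and c: "\<And>y. (\<integral>\<^sup>+x. ennreal (norm (W x y) powr q) \<partial>lborel) \<le> ennreal c"
  shows "AE x in lborel. integrable lborel (\<lambda>y. k y *\<^sub>R W x y)"
proof -
  have [measurable]: "k \<in> borel_measurable borel" using borel_measurable_integrable[OF k] by simp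
  have "(\<integral>\<^sup>+x. (\<integral>\<^sup>+y. ennreal \<bar>k y\<bar> * ennreal (norm (W x y) powr q) \<partial>lborel) \<partial>lborel)
      = (\<integral>\<^sup>+y. (\<integral>\<^sup>+x. ennreal \<bar>k y\<bar> * ennreal (norm (W x y) powr q) \<partial>lborel) \<partial>lborel)"
    by (rule lborel_pair.Fubini'[symmetric]) measurable
  also have "\<dots> = (\<integral>\<^sup>+y. ennreal \<bar>k y\<bar> * (\<integral>\<^sup>+x. ennreal (norm (W x y) powr q) \<partial>lborel) \<partial>lborel)"
    by (intro nn_integral_cong nn_integral_cmult) measurable
  also have "\<dots> \<le> (\<integral>\<^sup>+y. ennreal \<bar>k y\<bar> * ennreal c \<partial>lborel)"
    by (intro nn_integral_mono mult_left_mono c) simp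
  also have "\<dots> = ennreal (\<integral>y. \<bar>k y\<bar> \<partial>lborel) * ennreal c"
    using k by (subst nn_integral_multc) (auto simp: nn_integral_eq_integral)
  also have "\<dots> < \<infinity>" by (simp add: ennreal_mult_less_top)
  finally have fin: "(\<integral>\<^sup>+x. (\<integral>\<^sup>+y. ennreal \<bar>k y\<bar> * ennreal (norm (W x y) powr q) \<partial>lborel) \<partial>lborel) \<noteq> \<infinity>"
    by simp
  have "AE x in lborel. (\<integral>\<^sup>+y. ennreal \<bar>k y\<bar> * ennreal (norm (W x y) powr q) \<partial>lborel) \<noteq> \<infinity>"
    by (rule nn_integral_PInf_AE[OF _ fin]) measurable
  then show ?thesis
  proof eventually_elim
    case (elim x)
    have I: "integrable lborel (\<lambda>y. \<bar>k y\<bar> * norm (W x y) powr q)"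
      using elim by (intro integrableI_nonneg) (auto simp: ennreal_mult less_top)
    have "integrable lborel (\<lambda>y. \<bar>k y\<bar> * norm (W x y))"
      by (rule jensen_real(1)[OF q k _ _ I]) auto
    then show ?case
      by (rule Bochner_Integration.integrable_bound) auto
  qed
qed

lemma nn_integral_norm_diff_powr:
  fixes f g :: "'a \<Rightarrow> 'b::{real_normed_vector, second_countable_topology}"
  assumes q: "1 \<le> q" and [measurable]: "f \<in> borel_measurable M" "g \<in> borel_measurable M"
    and f: "(\<integral>\<^sup>+x. ennreal (norm (f x) powr q) \<partial>M) \<le> ennreal c"
    and g: "(\<integral>\<^sup>+x. ennreal (norm (g x) powr q) \<partial>M) \<le> ennreal c" and c: "0 \<le> c"
  shows "(\<integral>\<^sup>+x. ennreal (norm (f x - g x) powr q) \<partial>M) \<le> ennreal (2 powr q * c)"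
proof -
  have "(\<integral>\<^sup>+x. ennreal (norm (f x - g x) powr q) \<partial>M)
    \<le> (\<integral>\<^sup>+x. ennreal (2 powr (q - 1)) * (ennreal (norm (f x) powr q) + ennreal (norm (g x) powr q)) \<partial>M)"
    using norm_diff_powr_le[OF q]
    by (intro nn_integral_mono) (simp add: ennreal_plus[symmetric] ennreal_mult[symmetric] ennreal_leI del: ennreal_plus)
  also have "\<dots> = ennreal (2 powr (q - 1)) * ((\<integral>\<^sup>+x. ennreal (norm (f x) powr q) \<partial>M) + (\<integral>\<^sup>+x. ennreal (norm (g x) powr q) \<partial>M))"
    by (simp add: nn_integral_cmult nn_integral_add)
  also have "\<dots> \<le> ennreal (2 powr (q - 1)) * (ennreal c + ennreal c)"
    by (intro mult_left_mono add_mono f g) simp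
  also have "\<dots> = ennreal (2 powr (q - 1) * (2 * c))"
    using c by (simp add: ennreal_plus[symmetric] ennreal_mult[symmetric] del: ennreal_plus)
  also have "2 powr (q - 1) * (2 * c) = 2 powr q * c" by (simp add: powr_diff)
  finally show ?thesis .
qed

section \<open>Besov functions and their mollifications\<close>

text \<open>A Borel representative with explicit constants in place of the suprema in
  \<open>besov_space\<close>. At \<open>h = 0\<close> both sides of the bound with \<open>M\<close>
  are 0, so it can be stated for every \<open>h\<close>.\<close>

locale besov_function =
  fixes u :: "'a::euclidean_space \<Rightarrow> 'b::euclidean_space" and q r M N0 :: real
  assumes q: "1 \<le> q" and r: "0 < r" "r < 1"
    and u_borel[measurable]: "u \<in> borel_measurable borel"
    and N0: "0 \<le> N0" "(\<integral>\<^sup>+x. ennreal (norm (u x) powr q) \<partial>lborel) \<le> ennreal N0"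
    and M: "0 \<le> M" "\<And>h. (\<integral>\<^sup>+x. ennreal (norm (u (x + h) - u x) powr q) \<partial>lborel) \<le> ennreal (M * norm h powr (r * q))"
begin

definition conv :: "('a \<Rightarrow> real) \<Rightarrow> real \<Rightarrow> 'a \<Rightarrow> 'b" where
  "conv k e x = (\<integral>y. k y *\<^sub>R u (x - e *\<^sub>R y) \<partial>lborel)"

lemma conv_measurable [measurable]:
  assumes [measurable]: "k \<in> borel_measurable borel"
  shows "conv k e \<in> borel_measurable borel"
proof -
  have "(\<lambda>x. \<integral>y. k y *\<^sub>R u (x - e *\<^sub>R y) \<partial>lborel) \<in> borel_measurable borel"
    by measurable
  then show ?thesis by (simp add: conv_def[abs_def])
qed

lemma translate_Lq:
  "(\<integral>\<^sup>+x. ennreal (norm (u (x + a)) powr q) \<partial>lborel) \<le> ennreal N0"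
  "(\<integral>\<^sup>+x. ennreal (norm (u (x - a)) powr q) \<partial>lborel) \<le> ennreal N0"
proof -
  have *: "(\<integral>\<^sup>+x. ennreal (norm (u (a + x)) powr q) \<partial>lborel) \<le> ennreal N0" for a
    using N0(2) nn_integral_lborel_translate[of "\<lambda>x. ennreal (norm (u x) powr q)" a] by simp
  show "(\<integral>\<^sup>+x. ennreal (norm (u (x + a)) powr q) \<partial>lborel) \<le> ennreal N0"
    using *[of a] by (simp add: add.commute)
  show "(\<integral>\<^sup>+x. ennreal (norm (u (x - a)) powr q) \<partial>lborel) \<le> ennreal N0"
    using *[of "- a"] by simp
qed

lemma translate_diff:
  "(\<integral>\<^sup>+x. ennreal (norm (u (x + a) - u (x + b)) powr q) \<partial>lborel) \<le> ennreal (M * norm (a - b) powr (r * q))"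
proof -
  have "(\<integral>\<^sup>+x. ennreal (norm (u (x + a) - u (x + b)) powr q) \<partial>lborel)
      = (\<integral>\<^sup>+x. ennreal (norm (u (- b + x + a) - u (- b + x + b)) powr q) \<partial>lborel)"
    using nn_integral_lborel_translate[of "\<lambda>x. ennreal (norm (u (x + a) - u (x + b)) powr q)" "- b"] by simp
  also have "\<dots> = (\<integral>\<^sup>+x. ennreal (norm (u (x + (a - b)) - u x) powr q) \<partial>lborel)"
    by (simp add: algebra_simps)
  finally show ?thesis using M(2)[of "a - b"] by simp
qed

lemma conv_integrable:
  assumes k: "integrable lborel k"
  shows "AE x in lborel. integrable lborel (\<lambda>y. k y *\<^sub>R u (x - e *\<^sub>R y))"
  by (rule AE_integrable_integral_operator[OF q k _ translate_Lq(2)]) measurable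

lemma conv_integrable_shift:
  assumes k: "integrable lborel k"
  shows "AE x in lborel. integrable lborel (\<lambda>y. k y *\<^sub>R u (x + z - e *\<^sub>R y))"
proof (rule AE_integrable_integral_operator[OF q k])
  show "(\<integral>\<^sup>+x. ennreal (norm (u (x + z - e *\<^sub>R y)) powr q) \<partial>lborel) \<le> ennreal N0" for y
    using translate_Lq(1)[of "z - e *\<^sub>R y"] by (simp add: algebra_simps)
qed measurable

lemma conv_Lq:
  assumes k: "integrable lborel k"
  shows "(\<integral>\<^sup>+x. ennreal (norm (conv k e x) powr q) \<partial>lborel) \<le> ennreal ((\<integral>y. \<bar>k y\<bar> \<partial>lborel) powr q * N0)"
  unfolding conv_def by (rule Lq_integral_operator_bound[OF q k _ N0(1) translate_Lq(2)]) measurable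

lemma conv_diff_large:
  assumes k: "integrable lborel k"
  shows "(\<integral>\<^sup>+x. ennreal (norm (conv k e (x + z) - conv k e x) powr q) \<partial>lborel)
    \<le> ennreal (2 powr q * ((\<integral>y. \<bar>k y\<bar> \<partial>lborel) powr q * N0))"
proof -
  have [measurable]: "k \<in> borel_measurable borel" using borel_measurable_integrable[OF k] by simp
  have "(\<integral>\<^sup>+x. ennreal (norm (conv k e (x + z)) powr q) \<partial>lborel) = (\<integral>\<^sup>+x. ennreal (norm (conv k e x) powr q) \<partial>lborel)"
    using nn_integral_lborel_translate[of "\<lambda>x. ennreal (norm (conv k e x) powr q)" z] by (simp add: add.commute)
  then show ?thesis
    using N0(1) conv_Lq[OF k, of e] by (intro nn_integral_norm_diff_powr q) (auto, measurable)
qed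

text \<open>The integrand \<open>W\<close> is a mixed second difference of four values of
  \<open>u\<close>. Pairing them along \<open>z\<close> or along \<open>e *\<^sub>R y\<close> bounds
  it by either displacement, whence the minimum.\<close>

lemma conv_remainder_diff:
  assumes k: "integrable lborel k" and e: "0 \<le> e"
  defines "w \<equiv> \<lambda>x. conv k e x - (\<integral>y. k y \<partial>lborel) *\<^sub>R u x"
  shows "(\<integral>\<^sup>+x. ennreal (norm (w (x + z) - w x) powr q) \<partial>lborel)
    \<le> ennreal ((\<integral>y. \<bar>k y\<bar> \<partial>lborel) powr (q - 1)) *
       (\<integral>\<^sup>+y. ennreal \<bar>k y\<bar> * ennreal (2 powr q * M * min (norm z) (e * norm y) powr (r * q)) \<partial>lborel)"
proof -
  have [measurable]: "k \<in> borel_measurable borel" using borel_measurable_integrable[OF k] by simp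
  define W where "W x y = (u (x + z - e *\<^sub>R y) - u (x + z)) - (u (x - e *\<^sub>R y) - u x)" for x y
  have Wm[measurable]: "case_prod W \<in> borel_measurable (borel \<Otimes>\<^sub>M borel)"
    unfolding W_def case_prod_beta' by measurable
  have shift_m: "(\<lambda>x. u (x + a)) \<in> borel_measurable lborel" for a by measurable
  have eq: "AE x in lborel. w (x + z) - w x = (\<integral>y. k y *\<^sub>R W x y \<partial>lborel)"
    using conv_integrable[OF k, of e] conv_integrable_shift[OF k, of z e]
  proof eventually_elim
    case (elim x)
    have ku: "integrable lborel (\<lambda>y. k y *\<^sub>R u x)" for x using k by simp
    have "(\<integral>y. k y *\<^sub>R W x y \<partial>lborel)
      = (\<integral>y. (k y *\<^sub>R u (x + z - e *\<^sub>R y) - k y *\<^sub>R u (x + z)) - (k y *\<^sub>R u (x - e *\<^sub>R y) - k y *\<^sub>R u x) \<partial>lborel)"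
      by (simp add: W_def scaleR_diff_right)
    also have "\<dots> = (conv k e (x + z) - (\<integral>y. k y \<partial>lborel) *\<^sub>R u (x + z)) - (conv k e x - (\<integral>y. k y \<partial>lborel) *\<^sub>R u x)"
      using elim ku k by (simp add: conv_def)
    finally show ?case by (simp add: w_def)
  qed
  have "(\<integral>\<^sup>+x. ennreal (norm (w (x + z) - w x) powr q) \<partial>lborel)
      = (\<integral>\<^sup>+x. ennreal (norm (\<integral>y. k y *\<^sub>R W x y \<partial>lborel) powr q) \<partial>lborel)"
    by (rule nn_integral_cong_AE) (use eq in \<open>eventually_elim, simp\<close>)
  also have "\<dots> \<le> ennreal ((\<integral>y. \<bar>k y\<bar> \<partial>lborel) powr (q - 1)) *
       (\<integral>\<^sup>+y. ennreal \<bar>k y\<bar> * (\<integral>\<^sup>+x. ennreal (norm (W x y) powr q) \<partial>lborel) \<partial>lborel)"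
    by (rule Lq_integral_operator[OF q k Wm])
  also have "\<dots> \<le> ennreal ((\<integral>y. \<bar>k y\<bar> \<partial>lborel) powr (q - 1)) *
       (\<integral>\<^sup>+y. ennreal \<bar>k y\<bar> * ennreal (2 powr q * M * min (norm z) (e * norm y) powr (r * q)) \<partial>lborel)"
  proof (rule mult_left_mono, rule nn_integral_mono, rule mult_left_mono)
    fix y
    show "(\<integral>\<^sup>+x. ennreal (norm (W x y) powr q) \<partial>lborel) \<le> ennreal (2 powr q * M * min (norm z) (e * norm y) powr (r * q))"
    proof (cases "norm z \<le> e * norm y")
      case True
      have "(\<integral>\<^sup>+x. ennreal (norm ((u (x + (z - e *\<^sub>R y)) - u (x + (- e *\<^sub>R y))) - (u (x + z) - u (x + 0))) powr q) \<partial>lborel)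
          \<le> ennreal (2 powr q * (M * norm z powr (r * q)))"
        using translate_diff[of "z - e *\<^sub>R y" "- e *\<^sub>R y"] translate_diff[of z 0] M(1)
        by (intro nn_integral_norm_diff_powr q borel_measurable_diff shift_m) simp_all
      then show ?thesis using True by (simp add: W_def algebra_simps)
    next
      case False
      have "(\<integral>\<^sup>+x. ennreal (norm ((u (x + (z - e *\<^sub>R y)) - u (x + z)) - (u (x + (- e *\<^sub>R y)) - u (x + 0))) powr q) \<partial>lborel)
          \<le> ennreal (2 powr q * (M * (e * norm y) powr (r * q)))"
        using translate_diff[of "z - e *\<^sub>R y" z] translate_diff[of "- e *\<^sub>R y" 0] M(1) e
        by (intro nn_integral_norm_diff_powr q borel_measurable_diff shift_m) simp_all
      then show ?thesis using False by (simp add: W_def algebra_simps)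
    qed
  qed auto
  finally show ?thesis .
qed

text \<open>A kernel of mass one lets \<open>u x\<close> be moved under the integral; support in the
  unit ball keeps all displacements at most \<open>e\<close>.\<close>

lemma conv_remainder_Lq:
  assumes k: "integrable lborel k" and k1: "(\<integral>y. k y \<partial>lborel) = 1" and supp: "\<And>y. k y \<noteq> 0 \<Longrightarrow> norm y \<le> 1" and e: "0 \<le> e"
  shows "(\<integral>\<^sup>+x. ennreal (norm (u x - conv k e x) powr q) \<partial>lborel)
    \<le> ennreal ((\<integral>y. \<bar>k y\<bar> \<partial>lborel) powr q * (M * e powr (r * q)))"
proof -
  have [measurable]: "k \<in> borel_measurable borel" using borel_measurable_integrable[OF k] by simp
  define W where "W x y = u (x + 0) - u (x + (- e *\<^sub>R y))" for x y
  have Wm[measurable]: "case_prod W \<in> borel_measurable (borel \<Otimes>\<^sub>M borel)"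
    unfolding W_def case_prod_beta' by measurable
  have eq: "AE x in lborel. u x - conv k e x = (\<integral>y. k y *\<^sub>R W x y \<partial>lborel)"
    using conv_integrable[OF k, of e]
  proof eventually_elim
    case (elim x)
    have ku: "integrable lborel (\<lambda>y. k y *\<^sub>R u x)" for x using k by simp
    have "(\<integral>y. k y *\<^sub>R W x y \<partial>lborel) = (\<integral>y. k y *\<^sub>R u x - k y *\<^sub>R u (x - e *\<^sub>R y) \<partial>lborel)"
      by (simp add: W_def scaleR_diff_right)
    also have "\<dots> = (\<integral>y. k y \<partial>lborel) *\<^sub>R u x - conv k e x"
      using elim ku k by (simp add: conv_def)
    finally show ?case using k1 by simp
  qed
  have "(\<integral>\<^sup>+x. ennreal (norm (u x - conv k e x) powr q) \<partial>lborel)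
      = (\<integral>\<^sup>+x. ennreal (norm (\<integral>y. k y *\<^sub>R W x y \<partial>lborel) powr q) \<partial>lborel)"
    by (rule nn_integral_cong_AE) (use eq in \<open>eventually_elim, simp\<close>)
  also have "\<dots> \<le> ennreal ((\<integral>y. \<bar>k y\<bar> \<partial>lborel) powr q * (M * e powr (r * q)))"
  proof (rule Lq_integral_operator_bound[OF q k Wm])
    fix y assume "k y \<noteq> 0"
    then have "norm y \<le> 1" by (rule supp)
    then have "(e * norm y) powr (r * q) \<le> e powr (r * q)"
      using e r q by (intro powr_mono2) (auto simp: mult_left_le)
    then have "ennreal (M * (e * norm y) powr (r * q)) \<le> ennreal (M * e powr (r * q))"
      using M(1) by (intro ennreal_leI mult_left_mono)
    moreover have "(\<integral>\<^sup>+x. ennreal (norm (W x y) powr q) \<partial>lborel) \<le> ennreal (M * (e * norm y) powr (r * q))"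
      using translate_diff[of 0 "- e *\<^sub>R y"] e by (simp add: W_def)
    ultimately show "(\<integral>\<^sup>+x. ennreal (norm (W x y) powr q) \<partial>lborel) \<le> ennreal (M * e powr (r * q))" by simp
  qed (use M in auto)
  finally show ?thesis .
qed

text \<open>The increments gain a factor \<open>e powr r\<close> because \<open>\<integral>k (y + h) - k y\<close> vanishes.\<close>

lemma conv_diff_smooth:
  assumes k: "integrable lborel k" and supp: "\<And>y. k y \<noteq> 0 \<Longrightarrow> norm y \<le> 1" and e: "0 < e" and z: "norm z \<le> e"
    and K: "(\<integral>y. \<bar>k (y + z /\<^sub>R e) - k y\<bar> \<partial>lborel) \<le> K"
  shows "(\<integral>\<^sup>+x. ennreal (norm (conv k e (x + z) - conv k e x) powr q) \<partial>lborel)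
    \<le> ennreal (K powr q * (M * (2 * e) powr (r * q)))"
proof -
  have [measurable]: "k \<in> borel_measurable borel" using borel_measurable_integrable[OF k] by simp
  define h where "h = z /\<^sub>R e"
  have h: "norm h \<le> 1" "z = e *\<^sub>R h" using e z by (auto simp: h_def field_simps)
  define \<psi> where "\<psi> y = k (y + h) - k y" for y
  have kh: "integrable lborel (\<lambda>y. k (y + h))" using integrable_lborel_translate[OF k, of h] by (simp add: add.commute)
  have \<psi>: "integrable lborel \<psi>" unfolding \<psi>_def using kh k by simp
  have \<psi>0: "(\<integral>y. \<psi> y \<partial>lborel) = 0"
    unfolding \<psi>_def using kh k integral_lborel_translate[of k h] by (simp add: add.commute)
  define W where "W x y = u (x + (- e *\<^sub>R y)) - u (x + 0)" for x y
  have Wm[measurable]: "case_prod W \<in> borel_measurable (borel \<Otimes>\<^sub>M borel)"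
    unfolding W_def case_prod_beta' by measurable
  have eq: "AE x in lborel. conv k e (x + z) - conv k e x = (\<integral>y. \<psi> y *\<^sub>R W x y \<partial>lborel)"
    using conv_integrable[OF k, of e] conv_integrable_shift[OF k, of z e]
  proof eventually_elim
    case (elim x)
    have sub: "k (h + y) *\<^sub>R u (x + z - e *\<^sub>R (h + y)) = k (y + h) *\<^sub>R u (x - e *\<^sub>R y)" for y
      by (simp add: h(2) algebra_simps)
    have i1: "integrable lborel (\<lambda>y. k (y + h) *\<^sub>R u (x - e *\<^sub>R y))"
      using integrable_lborel_translate[OF elim(2), of h] by (simp only: sub)
    have "conv k e (x + z) = (\<integral>y. k (y + h) *\<^sub>R u (x - e *\<^sub>R y) \<partial>lborel)"
      using integral_lborel_translate[of "\<lambda>y. k y *\<^sub>R u (x + z - e *\<^sub>R y)" h] by (simp only: sub conv_def) simp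
    then have "conv k e (x + z) - conv k e x = (\<integral>y. k (y + h) *\<^sub>R u (x - e *\<^sub>R y) - k y *\<^sub>R u (x - e *\<^sub>R y) \<partial>lborel)"
      using i1 elim(1) by (simp add: conv_def)
    also have "\<dots> = (\<integral>y. \<psi> y *\<^sub>R W x y + \<psi> y *\<^sub>R u x \<partial>lborel)"
      by (simp add: \<psi>_def W_def algebra_simps)
    also have "\<dots> = (\<integral>y. \<psi> y *\<^sub>R W x y \<partial>lborel) + (\<integral>y. \<psi> y *\<^sub>R u x \<partial>lborel)"
    proof (rule Bochner_Integration.integral_add)
      have "(\<lambda>y. \<psi> y *\<^sub>R W x y) = (\<lambda>y. (k (y + h) *\<^sub>R u (x - e *\<^sub>R y) - k y *\<^sub>R u (x - e *\<^sub>R y)) - \<psi> y *\<^sub>R u x)"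
        by (simp add: fun_eq_iff \<psi>_def W_def algebra_simps)
      then show "integrable lborel (\<lambda>y. \<psi> y *\<^sub>R W x y)" using i1 elim(1) \<psi> by simp
    qed (use \<psi> in simp)
    also have "(\<integral>y. \<psi> y *\<^sub>R u x \<partial>lborel) = 0" using \<psi> \<psi>0 by simp
    finally show ?case by simp
  qed
  have "(\<integral>\<^sup>+x. ennreal (norm (conv k e (x + z) - conv k e x) powr q) \<partial>lborel)
      = (\<integral>\<^sup>+x. ennreal (norm (\<integral>y. \<psi> y *\<^sub>R W x y \<partial>lborel) powr q) \<partial>lborel)"
    by (rule nn_integral_cong_AE) (use eq in \<open>eventually_elim, simp\<close>)
  also have "\<dots> \<le> ennreal ((\<integral>y. \<bar>\<psi> y\<bar> \<partial>lborel) powr q * (M * (2 * e) powr (r * q)))"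
  proof (rule Lq_integral_operator_bound[OF q \<psi> Wm])
    fix y assume "\<psi> y \<noteq> 0"
    then have "k (y + h) \<noteq> 0 \<or> k y \<noteq> 0" by (auto simp: \<psi>_def)
    \<comment> \<open>Both terms of \<psi> live within distance 2 of the origin because
      \<open>norm h \<le> 1\<close>; hence the \<open>2 * e\<close> in the bound.\<close>
    then have "norm y \<le> 2"
    proof
      assume "k (y + h) \<noteq> 0"
      then have "norm (y + h) \<le> 1" by (rule supp)
      then show ?thesis using h(1) norm_triangle_ineq4[of "y + h" h] by simp
    next
      assume "k y \<noteq> 0"
      then show ?thesis using supp[of y] by simp
    qed
    then have "(e * norm y) powr (r * q) \<le> (2 * e) powr (r * q)"
      using e r q by (intro powr_mono2) auto
    then have "ennreal (M * (e * norm y) powr (r * q)) \<le> ennreal (M * (2 * e) powr (r * q))"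
      using M(1) by (intro ennreal_leI mult_left_mono)
    moreover have "(\<integral>\<^sup>+x. ennreal (norm (W x y) powr q) \<partial>lborel) \<le> ennreal (M * (e * norm y) powr (r * q))"
      using translate_diff[of "- e *\<^sub>R y" 0] e by (simp add: W_def)
    ultimately show "(\<integral>\<^sup>+x. ennreal (norm (W x y) powr q) \<partial>lborel) \<le> ennreal (M * (2 * e) powr (r * q))" by simp
  qed (use M in auto)
  also have "\<dots> \<le> ennreal (K powr q * (M * (2 * e) powr (r * q)))"
    using K M(1) q unfolding \<psi>_def h_def[symmetric]
    by (intro ennreal_leI mult_right_mono powr_mono2) (auto intro!: integral_nonneg_AE)
  finally show ?thesis .
qed

end

section \<open>Increments at scales below the mollification parameter\<close>

text \<open>A normalised tent: being Lipschitz with bounded support, it has an elementary L1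
  translation bound. The ball of radius 3 leaves room for both supports when
  \<open>norm h \<le> 1\<close>.\<close>

lemma tent_kernel_exists:
  obtains \<phi> :: "'a::euclidean_space \<Rightarrow> real" and c :: real where
    "integrable lborel \<phi>" "(\<integral>y. \<phi> y \<partial>lborel) = 1" "(\<integral>y. \<bar>\<phi> y\<bar> \<partial>lborel) = 1"
    "\<And>y. \<phi> y \<noteq> 0 \<Longrightarrow> norm y \<le> 1" "0 \<le> c"
    "\<And>h. norm h \<le> 1 \<Longrightarrow> (\<integral>y. \<bar>\<phi> (y + h) - \<phi> y\<bar> \<partial>lborel) \<le> c * norm h"
proof -
  define t where "t y = max 0 (1 - norm y)" for y :: 'a
  have tm[measurable]: "t \<in> borel_measurable borel" unfolding t_def by measurable
  have ind: "integrable lborel (indicator (ball (0::'a) R) :: 'a \<Rightarrow> real)" for R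
    using emeasure_bounded_finite[of "ball (0::'a) R"] by (intro integrable_real_indicator) auto
  have t_int: "integrable lborel t"
    by (rule Bochner_Integration.integrable_bound[OF ind[of 1]]) (auto simp: t_def indicator_def)
  define s where "s = (\<integral>y. t y \<partial>lborel)"
  have "0 < s"
  proof -
    have "s \<noteq> 0"
    proof
      assume "s = 0"
      then have "AE y in lborel. t y = 0"
        unfolding s_def using t_int by (subst (asm) integral_nonneg_eq_0_iff_AE) (auto simp: t_def)
      then have "AE y in lborel. y \<notin> ball (0::'a) 1"
        by eventually_elim (auto simp: t_def)
      then have "emeasure lborel (ball (0::'a) 1) = emeasure lborel ({} :: 'a set)"
        by (intro emeasure_eq_AE) auto
      then show False using less_imp_neq[OF unit_ball_vol_pos[of "real DIM('a)"]] by (auto simp: emeasure_ball)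
    qed
    moreover have "0 \<le> s" unfolding s_def by (auto simp: t_def intro!: integral_nonneg_AE)
    ultimately show ?thesis by simp
  qed
  have lip: "\<bar>t (y + h) - t y\<bar> \<le> norm h * indicator (ball 0 3) y" if h: "norm h \<le> 1" for y h
  proof (cases "norm y < 3")
    case True
    have "\<bar>norm (y + h) - norm y\<bar> \<le> norm h" using norm_triangle_ineq3[of "y + h" y] by simp
    then show ?thesis using True by (auto simp: t_def)
  next
    case False
    have "norm (y + h) \<ge> norm y - norm h" using norm_triangle_ineq4[of "y + h" h] by simp
    then show ?thesis using False h by (simp add: t_def)
  qed
  define b where "b = (\<integral>y. indicator (ball (0::'a) 3) y \<partial>lborel :: real)"
  show ?thesis
  proof
    show "integrable lborel (\<lambda>y. t y / s)" using t_int by simp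
    show "(\<integral>y. t y / s \<partial>lborel) = 1" using \<open>0 < s\<close> by (simp add: s_def)
    have "\<bar>t y / s\<bar> = t y / s" for y using \<open>0 < s\<close> by (simp add: t_def)
    then show "(\<integral>y. \<bar>t y / s\<bar> \<partial>lborel) = 1" using \<open>0 < s\<close> by (simp add: s_def)
    show "norm y \<le> 1" if "t y / s \<noteq> 0" for y using that by (auto simp: t_def max_def split: if_splits)
    show "0 \<le> b / s" using \<open>0 < s\<close> by (simp add: b_def)
    fix h :: 'a assume h: "norm h \<le> 1"
    have th: "integrable lborel (\<lambda>y. t (y + h))" using integrable_lborel_translate[OF t_int, of h] by (simp add: add.commute)
    have "(\<integral>y. \<bar>t (y + h) - t y\<bar> \<partial>lborel) \<le> (\<integral>y. norm h * indicator (ball (0::'a) 3) y \<partial>lborel)"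
      using th t_int ind[of 3] lip[OF h] by (intro integral_mono) auto
    then have "(\<integral>y. \<bar>t (y + h) - t y\<bar> \<partial>lborel) / s \<le> norm h * b / s"
      using \<open>0 < s\<close> by (intro divide_right_mono) (auto simp: b_def)
    moreover have "\<bar>t (y + h) / s - t y / s\<bar> = \<bar>t (y + h) - t y\<bar> / s" for y
      using \<open>0 < s\<close> by (simp add: diff_divide_distrib[symmetric] abs_divide)
    ultimately show "(\<integral>y. \<bar>t (y + h) / s - t y / s\<bar> \<partial>lborel) \<le> b / s * norm h"
      by (simp add: mult.commute)
  qed
qed

text \<open>A shift by \<open>e *\<^sub>R h\<close> in space becomes a shift by \<open>h\<close> of
  the kernel, where Sobolev regularity applies. The function \<open>v\<close> is arbitrary because
  both \<open>u\<close> and its average are needed.\<close>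

lemma conv_shift_identity:
  fixes v :: "'a::euclidean_space \<Rightarrow> 'b::euclidean_space" and k :: "'a \<Rightarrow> real" and h :: 'a
  assumes q: "1 \<le> q" and k: "integrable lborel k" and [measurable]: "v \<in> borel_measurable borel"
    and c: "(\<integral>\<^sup>+x. ennreal (norm (v x) powr q) \<partial>lborel) \<le> ennreal c"
  shows "AE x in lborel. integrable lborel (\<lambda>y. k y *\<^sub>R v (x - e *\<^sub>R y)) \<and>
    integrable lborel (\<lambda>y. k y *\<^sub>R v (x + e *\<^sub>R h - e *\<^sub>R y)) \<and>
    integrable lborel (\<lambda>y. k (y + h) *\<^sub>R v (x - e *\<^sub>R y)) \<and>
    (\<integral>y. k y *\<^sub>R v (x + e *\<^sub>R h - e *\<^sub>R y) \<partial>lborel) = (\<integral>y. k (y + h) *\<^sub>R v (x - e *\<^sub>R y) \<partial>lborel)"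
proof -
  have [measurable]: "k \<in> borel_measurable borel" using borel_measurable_integrable[OF k] by simp
  have tr: "(\<integral>\<^sup>+x. ennreal (norm (v (x + a)) powr q) \<partial>lborel) \<le> ennreal c" for a
    using c nn_integral_lborel_translate[of "\<lambda>x. ennreal (norm (v x) powr q)" a] by (simp add: add.commute)
  have 1: "AE x in lborel. integrable lborel (\<lambda>y. k y *\<^sub>R v (x - e *\<^sub>R y))"
  proof (rule AE_integrable_integral_operator[OF q k])
    show "(\<integral>\<^sup>+x. ennreal (norm (v (x - e *\<^sub>R y)) powr q) \<partial>lborel) \<le> ennreal c" for y
      using tr[of "- e *\<^sub>R y"] by simp
  qed measurable
  have 2: "AE x in lborel. integrable lborel (\<lambda>y. k y *\<^sub>R v (x + e *\<^sub>R h - e *\<^sub>R y))"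
  proof (rule AE_integrable_integral_operator[OF q k])
    show "(\<integral>\<^sup>+x. ennreal (norm (v (x + e *\<^sub>R h - e *\<^sub>R y)) powr q) \<partial>lborel) \<le> ennreal c" for y
      using tr[of "e *\<^sub>R h - e *\<^sub>R y"] by (simp add: algebra_simps)
  qed measurable
  from 1 2 show ?thesis
  proof eventually_elim
    case (elim x)
    have sub: "k (h + y) *\<^sub>R v (x + e *\<^sub>R h - e *\<^sub>R (h + y)) = k (y + h) *\<^sub>R v (x - e *\<^sub>R y)" for y
      by (simp add: algebra_simps)
    have "integrable lborel (\<lambda>y. k (y + h) *\<^sub>R v (x - e *\<^sub>R y))"
      using integrable_lborel_translate[OF elim(2), of h] by (simp only: sub)
    moreover have "(\<integral>y. k y *\<^sub>R v (x + e *\<^sub>R h - e *\<^sub>R y) \<partial>lborel) = (\<integral>y. k (y + h) *\<^sub>R v (x - e *\<^sub>R y) \<partial>lborel)"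
      using integral_lborel_translate[of "\<lambda>y. k y *\<^sub>R v (x + e *\<^sub>R h - e *\<^sub>R y)" h] by (simp only: sub) simp
    ultimately show ?case using elim by blast
  qed
qed

text \<open>Comparing \<open>u\<close> with its average \<open>b\<close> over a ball of radius \<open>e\<close>: the increments of \<open>b\<close> are small because
  the averaging kernel is Lipschitz, and those of the convolution of \<open>u - b\<close> because \<open>k\<close> is a Sobolev function
  and \<open>u - b\<close> has norm \<open>O(e powr r)\<close>.\<close>

lemma (in besov_function) conv_diff_sobolev:
  assumes wg: "borel_weak_gradient k g"
  obtains C where "0 \<le> C"
    "\<And>e z. 0 < e \<Longrightarrow> norm z \<le> e \<Longrightarrow>
      (\<integral>\<^sup>+x. ennreal (norm (conv k e (x + z) - conv k e x) powr q) \<partial>lborel)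
        \<le> ennreal (C * (norm z powr q * e powr ((r - 1) * q)))"
proof -
  have k: "integrable lborel k" using wg by (auto simp: borel_weak_gradient_def)
  have km[measurable]: "k \<in> borel_measurable borel" using borel_measurable_integrable[OF k] by simp
  obtain \<phi> :: "'a \<Rightarrow> real" and c where \<phi>: "integrable lborel \<phi>" "(\<integral>y. \<phi> y \<partial>lborel) = 1" "(\<integral>y. \<bar>\<phi> y\<bar> \<partial>lborel) = 1"
    "\<And>y. \<phi> y \<noteq> 0 \<Longrightarrow> norm y \<le> 1" "0 \<le> c"
    "\<And>h. norm h \<le> 1 \<Longrightarrow> (\<integral>y. \<bar>\<phi> (y + h) - \<phi> y\<bar> \<partial>lborel) \<le> c * norm h"
    using tent_kernel_exists by blast
  have [measurable]: "\<phi> \<in> borel_measurable borel" using borel_measurable_integrable[OF \<phi>(1)] by simp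
  define G where "G = (\<integral>y. norm (g y) \<partial>lborel)"
  define S where "S = (\<integral>y. \<bar>k y\<bar> \<partial>lborel)"
  have GS: "0 \<le> G" "0 \<le> S" by (auto simp: G_def S_def intro!: integral_nonneg_AE)
  define C1 where "C1 = G powr q * M"
  define C2 where "C2 = S powr q * (c powr q * (M * 2 powr (r * q)))"
  have C12: "0 \<le> C1" "0 \<le> C2" using M(1) by (auto simp: C1_def C2_def)
  show ?thesis
  proof
    show "0 \<le> 2 powr q * (C1 + C2)" using C12 by simp
    fix e :: real and z :: 'a assume e: "0 < e" and z: "norm z \<le> e"
    define h where "h = z /\<^sub>R e"
    have h: "norm h \<le> 1" "z = e *\<^sub>R h" "norm h = norm z / e" using e z by (auto simp: h_def field_simps)
    define b where "b = conv \<phi> e"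
    have bm[measurable]: "b \<in> borel_measurable borel" unfolding b_def by measurable
    define \<psi> where "\<psi> y = k (y + h) - k y" for y
    have kh: "integrable lborel (\<lambda>y. k (y + h))" using integrable_lborel_translate[OF k, of h] by (simp add: add.commute)
    have \<psi>: "integrable lborel \<psi>" unfolding \<psi>_def using kh k by simp
    have \<psi>S: "(\<integral>y. \<bar>\<psi> y\<bar> \<partial>lborel) \<le> norm h * G"
      unfolding \<psi>_def G_def by (rule weak_gradient_translation[OF wg])
    have bN: "(\<integral>\<^sup>+x. ennreal (norm (b x) powr q) \<partial>lborel) \<le> ennreal N0"
      using conv_Lq[OF \<phi>(1), of e] \<phi>(3) by (simp add: b_def)
    have ub: "(\<integral>\<^sup>+x. ennreal (norm (u x - b x) powr q) \<partial>lborel) \<le> ennreal (M * e powr (r * q))"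
      using conv_remainder_Lq[OF \<phi>(1,2,4), of e] \<phi>(3) e by (simp add: b_def)
    have bd: "(\<integral>\<^sup>+x. ennreal (norm (b (x + z) - b x) powr q) \<partial>lborel) \<le> ennreal ((c * norm h) powr q * (M * (2 * e) powr (r * q)))"
      unfolding b_def
      by (rule conv_diff_smooth[OF \<phi>(1,4) e z]) (use \<phi>(6)[OF h(1)] in \<open>simp_all add: h_def\<close>)
    define W1 where "W1 x y = u (x - e *\<^sub>R y) - b (x - e *\<^sub>R y)" for x y
    define W2 where "W2 x y = b (x + z - e *\<^sub>R y) - b (x - e *\<^sub>R y)" for x y
    have W1m[measurable]: "case_prod W1 \<in> borel_measurable (borel \<Otimes>\<^sub>M borel)"
      unfolding W1_def case_prod_beta' by measurable
    have W2m[measurable]: "case_prod W2 \<in> borel_measurable (borel \<Otimes>\<^sub>M borel)"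
      unfolding W2_def case_prod_beta' by measurable
    \<comment> \<open>\<open>P\<close> puts the increment on the kernel and integrates it against
      \<open>u - b\<close>; \<open>Q\<close> leaves the kernel alone and uses the increments of
      \<open>b\<close>.\<close>
    define P where "P x = (\<integral>y. \<psi> y *\<^sub>R W1 x y \<partial>lborel)" for x
    define Q where "Q x = (\<integral>y. k y *\<^sub>R W2 x y \<partial>lborel)" for x
    have [measurable]: "\<psi> \<in> borel_measurable borel" unfolding \<psi>_def by measurable
    have Pm[measurable]: "P \<in> borel_measurable borel" and Qm[measurable]: "Q \<in> borel_measurable borel"
      unfolding P_def[abs_def] Q_def[abs_def] by measurable
    have eq: "AE x in lborel. conv k e (x + z) - conv k e x = P x - (- Q x)"
      using conv_shift_identity[OF q k u_borel N0(2), of e h] conv_shift_identity[OF q k bm bN, of e h]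
    proof eventually_elim
      case (elim x)
      have iu: "integrable lborel (\<lambda>y. \<psi> y *\<^sub>R u (x - e *\<^sub>R y))" and ib: "integrable lborel (\<lambda>y. \<psi> y *\<^sub>R b (x - e *\<^sub>R y))"
        unfolding \<psi>_def scaleR_diff_left using elim by auto
      have "conv k e (x + z) - conv k e x = (\<integral>y. \<psi> y *\<^sub>R u (x - e *\<^sub>R y) \<partial>lborel)"
        unfolding \<psi>_def scaleR_diff_left conv_def h(2) using elim by simp
      also have "\<dots> = P x + (\<integral>y. \<psi> y *\<^sub>R b (x - e *\<^sub>R y) \<partial>lborel)"
        unfolding P_def W1_def scaleR_diff_right using iu ib by simp
      also have "(\<integral>y. \<psi> y *\<^sub>R b (x - e *\<^sub>R y) \<partial>lborel) = Q x"
        unfolding Q_def W2_def scaleR_diff_right \<psi>_def scaleR_diff_left h(2) using elim by simp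
      finally show ?case by simp
    qed
    have Pb: "(\<integral>\<^sup>+x. ennreal (norm (P x) powr q) \<partial>lborel) \<le> ennreal (C1 * (norm z powr q * e powr ((r - 1) * q)))"
    proof -
      have "(\<integral>\<^sup>+x. ennreal (norm (P x) powr q) \<partial>lborel) \<le> ennreal ((\<integral>y. \<bar>\<psi> y\<bar> \<partial>lborel) powr q * (M * e powr (r * q)))"
        unfolding P_def
      proof (rule Lq_integral_operator_bound[OF q \<psi> W1m])
        show "(\<integral>\<^sup>+x. ennreal (norm (W1 x y) powr q) \<partial>lborel) \<le> ennreal (M * e powr (r * q))" for y
          using ub nn_integral_lborel_translate[of "\<lambda>x. ennreal (norm (u x - b x) powr q)" "- e *\<^sub>R y"]
          by (simp add: W1_def)
      qed (use M in auto)
      also have "\<dots> \<le> ennreal ((norm h * G) powr q * (M * e powr (r * q)))"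
        using M(1) q \<psi>S by (intro ennreal_leI mult_right_mono powr_mono2) (auto intro!: integral_nonneg_AE)
      \<comment> \<open>The identity \<open>norm h = norm z / e\<close> trades
        \<open>e powr (r * q)\<close> for
        \<open>norm z powr q * e powr ((r - 1) * q)\<close>.\<close>
      also have "(norm h * G) powr q * (M * e powr (r * q)) = C1 * (norm z powr q * e powr ((r - 1) * q))"
        using e GS by (simp add: C1_def h(3) powr_mult powr_divide left_diff_distrib powr_diff field_simps)
      finally show ?thesis .
    qed
    have Qb: "(\<integral>\<^sup>+x. ennreal (norm (Q x) powr q) \<partial>lborel) \<le> ennreal (C2 * (norm z powr q * e powr ((r - 1) * q)))"
    proof -
      have "(\<integral>\<^sup>+x. ennreal (norm (Q x) powr q) \<partial>lborel) \<le> ennreal (S powr q * ((c * norm h) powr q * (M * (2 * e) powr (r * q))))"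
        unfolding Q_def S_def
      proof (rule Lq_integral_operator_bound[OF q k W2m])
        show "(\<integral>\<^sup>+x. ennreal (norm (W2 x y) powr q) \<partial>lborel) \<le> ennreal ((c * norm h) powr q * (M * (2 * e) powr (r * q)))" for y
          using bd nn_integral_lborel_translate[of "\<lambda>x. ennreal (norm (b (x + z) - b x) powr q)" "- e *\<^sub>R y"]
          by (simp add: W2_def algebra_simps)
      qed (use M in auto)
      also have "S powr q * ((c * norm h) powr q * (M * (2 * e) powr (r * q))) = C2 * (norm z powr q * e powr ((r - 1) * q))"
        using e \<phi>(5) by (simp add: C2_def h(3) powr_mult powr_divide left_diff_distrib powr_diff field_simps)
      finally show ?thesis .
    qed
    have "(\<integral>\<^sup>+x. ennreal (norm (conv k e (x + z) - conv k e x) powr q) \<partial>lborel)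
        = (\<integral>\<^sup>+x. ennreal (norm (P x - (- Q x)) powr q) \<partial>lborel)"
      by (rule nn_integral_cong_AE) (use eq in \<open>eventually_elim, simp\<close>)
    also have "\<dots> \<le> ennreal (2 powr q * ((C1 + C2) * (norm z powr q * e powr ((r - 1) * q))))"
    proof (rule nn_integral_norm_diff_powr[OF q])
      have "C1 * (norm z powr q * e powr ((r - 1) * q)) \<le> (C1 + C2) * (norm z powr q * e powr ((r - 1) * q))"
        "C2 * (norm z powr q * e powr ((r - 1) * q)) \<le> (C1 + C2) * (norm z powr q * e powr ((r - 1) * q))"
        using C12 by (intro mult_right_mono; simp)+
      then show "(\<integral>\<^sup>+x. ennreal (norm (P x) powr q) \<partial>lborel) \<le> ennreal ((C1 + C2) * (norm z powr q * e powr ((r - 1) * q)))"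
        "(\<integral>\<^sup>+x. ennreal (norm (- Q x) powr q) \<partial>lborel) \<le> ennreal ((C1 + C2) * (norm z powr q * e powr ((r - 1) * q)))"
        using Pb Qb by (auto intro: order_trans ennreal_leI)
    qed (use C12 in auto)
    finally show "(\<integral>\<^sup>+x. ennreal (norm (conv k e (x + z) - conv k e x) powr q) \<partial>lborel)
        \<le> ennreal (2 powr q * (C1 + C2) * (norm z powr q * e powr ((r - 1) * q)))" by (simp add: mult.assoc)
  qed
qed

section \<open>Radial integrals and averages\<close>

lemma nn_integral_radial:
  fixes f :: "real \<Rightarrow> ennreal"
  assumes [measurable]: "f \<in> borel_measurable borel"
  shows "(\<integral>\<^sup>+z. f (norm (z::'a::euclidean_space)) \<partial>lborel)
    = emeasure (sphere_measure :: 'a measure) UNIV * (\<integral>\<^sup>+t. indicator {0<..} t * ennreal (t ^ (DIM('a) - 1)) * f t \<partial>lborel)"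
proof -
  have "(\<integral>\<^sup>+z. f (norm (z::'a)) \<partial>lborel)
    = (\<integral>\<^sup>+t. indicator {0<..} t * ennreal (t ^ (DIM('a) - 1)) * (\<integral>\<^sup>+n. f (norm (t *\<^sub>R (n::'a))) \<partial>sphere_measure) \<partial>lborel)"
    by (rule polar_coordinates) measurable
  also have "\<dots> = (\<integral>\<^sup>+t. emeasure (sphere_measure :: 'a measure) UNIV * (indicator {0<..} t * ennreal (t ^ (DIM('a) - 1)) * f t) \<partial>lborel)"
  proof (rule nn_integral_cong)
    fix t :: real
    show "indicator {0<..} t * ennreal (t ^ (DIM('a) - 1)) * (\<integral>\<^sup>+n. f (norm (t *\<^sub>R (n::'a))) \<partial>sphere_measure)
      = emeasure (sphere_measure :: 'a measure) UNIV * (indicator {0<..} t * ennreal (t ^ (DIM('a) - 1)) * f t)"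
    proof (cases "0 < t")
      case True
      have "(\<integral>\<^sup>+n. f (norm (t *\<^sub>R (n::'a))) \<partial>sphere_measure) = (\<integral>\<^sup>+n. f t \<partial>(sphere_measure :: 'a measure))"
        using AE_sphere_measure[where 'a='a] True by (intro nn_integral_cong_AE) (auto elim!: eventually_mono)
      then show ?thesis using True by (simp add: mult_ac)
    qed simp
  qed
  also have "\<dots> = emeasure (sphere_measure :: 'a measure) UNIV * (\<integral>\<^sup>+t. indicator {0<..} t * ennreal (t ^ (DIM('a) - 1)) * f t \<partial>lborel)"
    by (rule nn_integral_cmult) measurable
  finally show ?thesis .
qed

lemma power_mult_powr_DIM:
  assumes "0 < t"
  shows "t ^ (DIM('a::euclidean_space) - 1) * t powr (s - real DIM('a)) = t powr (s - 1)"
proof -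
  have "t ^ (DIM('a) - 1) = t powr (real DIM('a) - 1)"
    using assms by (simp add: powr_realpow[symmetric] of_nat_diff)
  then show ?thesis using assms by (simp add: powr_add[symmetric])
qed

text \<open>The exponent is written \<open>s - DIM('a)\<close> so that the radial density turns it
  into \<open>s - 1\<close>. The case \<open>s = 0\<close> is the logarithmic one, and
  \<open>t powr (0 - 1)\<close> is left in this form below to match.\<close>

lemma nn_integral_radial_powr:
  assumes A[measurable]: "A \<in> sets borel"
  shows "(\<integral>\<^sup>+z. indicator A (norm (z::'a::euclidean_space)) * ennreal (norm z powr (s - real DIM('a))) \<partial>lborel)
    = emeasure (sphere_measure :: 'a measure) UNIV * (\<integral>\<^sup>+t. indicator {0<..} t * (indicator A t * ennreal (t powr (s - 1))) \<partial>lborel)"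
proof -
  have "(\<integral>\<^sup>+z. indicator A (norm (z::'a)) * ennreal (norm z powr (s - real DIM('a))) \<partial>lborel)
    = emeasure (sphere_measure :: 'a measure) UNIV * (\<integral>\<^sup>+t. indicator {0<..} t * ennreal (t ^ (DIM('a) - 1)) * (indicator A t * ennreal (t powr (s - real DIM('a)))) \<partial>lborel)"
    by (rule nn_integral_radial) measurable
  also have "(\<integral>\<^sup>+t. indicator {0<..} t * ennreal (t ^ (DIM('a) - 1)) * (indicator A t * ennreal (t powr (s - real DIM('a)))) \<partial>lborel)
    = (\<integral>\<^sup>+t. indicator {0<..} t * (indicator A t * ennreal (t powr (s - 1))) \<partial>lborel)"
  proof (rule nn_integral_cong)
    fix t :: real
    show "indicator {0<..} t * ennreal (t ^ (DIM('a) - 1)) * (indicator A t * ennreal (t powr (s - real DIM('a))))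
      = indicator {0<..} t * (indicator A t * ennreal (t powr (s - 1)))"
    proof (cases "0 < t")
      case True
      then show ?thesis
        using power_mult_powr_DIM[OF True, of s, where 'a='a]
        by (simp add: ennreal_mult[symmetric] indicator_def del: ennreal_power)
    qed simp
  qed
  finally show ?thesis .
qed

lemma nn_integral_powr_Icc_0:
  assumes "0 < s" "0 < e"
  shows "(\<integral>\<^sup>+t. indicator {0<..} t * (indicator {..e} t * ennreal (t powr (s - 1))) \<partial>lborel) = ennreal (e powr s / s)"
proof -
  have "((\<lambda>t. t powr (s - 1)) has_integral (e powr (s - 1 + 1) / (s - 1 + 1))) {0..e}"
    using assms by (intro has_integral_powr_from_0) auto
  from nn_integral_has_integral_lebesgue[OF _ this]
  have "(\<integral>\<^sup>+t. ennreal (indicator {0..e} t * t powr (s - 1)) \<partial>lborel) = ennreal (e powr s / s)"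
    by (simp add: mult.commute)
  moreover have "indicator {0<..} t * (indicator {..e} t * ennreal (t powr (s - 1))) = ennreal (indicator {0..e} t * t powr (s - 1))" for t
    by (cases "t = 0") (auto simp: indicator_def)
  ultimately show ?thesis by simp
qed

lemma nn_integral_powr_atLeast:
  assumes "0 < s" "0 < e"
  shows "(\<integral>\<^sup>+t. indicator {0<..} t * (indicator {e..} t * ennreal (t powr (- s - 1))) \<partial>lborel) = ennreal (e powr (- s) / s)"
proof -
  have "((\<lambda>t. t powr (- s - 1)) has_integral -(e powr (- s - 1 + 1) / (- s - 1 + 1))) {e..}"
    using has_integral_powr_to_inf[of "- s - 1" e] assms by simp
  from nn_integral_has_integral_lebesgue[OF _ this]
  have "(\<integral>\<^sup>+t. ennreal (indicator {e..} t * t powr (- s - 1)) \<partial>lborel) = ennreal (e powr (- s) / s)"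
    by (simp add: mult.commute)
  moreover have "indicator {0<..} t * (indicator {e..} t * ennreal (t powr (- s - 1))) = ennreal (indicator {e..} t * t powr (- s - 1))" for t
    using assms by (auto simp: indicator_def)
  ultimately show ?thesis by simp
qed

lemma nn_integral_inverse_Icc:
  assumes "0 < e" "e \<le> d"
  shows "(\<integral>\<^sup>+t. indicator {0<..} t * (indicator {e..d} t * ennreal (t powr (0 - 1))) \<partial>lborel) = ennreal (ln d - ln e)"
proof -
  have "(\<integral>\<^sup>+t. ennreal (t powr (0 - 1)) * indicator {e..d} t \<partial>lborel) = ennreal (ln d - ln e)"
    using assms by (intro nn_integral_FTC_Icc) (auto intro!: derivative_eq_intros simp: powr_minus_divide)
  moreover have "indicator {0<..} t * (indicator {e..d} t * ennreal (t powr (0 - 1))) = ennreal (t powr (0 - 1)) * indicator {e..d} t" for t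
    using assms by (auto simp: indicator_def)
  ultimately show ?thesis by simp
qed

section \<open>Logarithmic rates and limits of averages\<close>

lemma filterlim_abs_ln_at_right_0: "filterlim (\<lambda>e::real. \<bar>ln e\<bar>) at_top (at_right 0)"
proof -
  have "filterlim (ln :: real \<Rightarrow> real) at_infinity (at_right 0)"
    by (rule filterlim_mono[OF ln_at_0 at_bot_le_at_infinity order_refl])
  from filterlim_at_infinity_imp_norm_at_top[OF this] show ?thesis by simp
qed

lemma tendsto_divide_abs_ln: "((\<lambda>e::real. c / \<bar>ln e\<bar>) \<longlongrightarrow> 0) (at_right 0)"
  by (rule tendsto_divide_0[OF tendsto_const filterlim_at_top_imp_at_infinity[OF filterlim_abs_ln_at_right_0]])

text \<open>Approximate identities of mass \<open>m\<close> on the half-line: near 0 the function is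
  close to \<open>l\<close>, and away from 0 it is at most \<open>B\<close> against a vanishing
  tail. A single lemma serves the kernels and the logarithmic weights of the shell.\<close>

lemma average_tendsto:
  fixes P :: "'e \<Rightarrow> real \<Rightarrow> ennreal" and \<Phi> :: "real \<Rightarrow> ennreal"
  assumes \<Phi>m[measurable]: "\<Phi> \<in> borel_measurable borel" and B: "0 \<le> B" "\<And>t. 0 < t \<Longrightarrow> \<Phi> t \<le> ennreal B"
    and lim: "(\<Phi> \<longlongrightarrow> ennreal l) (at_right 0)" and l: "0 \<le> l" and m: "0 \<le> m"
    and P: "\<forall>\<^sub>F e in F. P e \<in> borel_measurable borel \<and> (\<forall>t\<le>0. P e t = 0) \<and> (\<integral>\<^sup>+t. P e t \<partial>lborel) = ennreal m"
    and tail: "\<And>d. 0 < d \<Longrightarrow> ((\<lambda>e. \<integral>\<^sup>+t. indicator {d<..} t * P e t \<partial>lborel) \<longlongrightarrow> 0) F"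
  shows "((\<lambda>e. \<integral>\<^sup>+t. P e t * \<Phi> t \<partial>lborel) \<longlongrightarrow> ennreal (m * l)) F"
proof -
  define X where "X e = (\<integral>\<^sup>+t. P e t * \<Phi> t \<partial>lborel)" for e
  define \<tau> where "\<tau> d e = enn2real (\<integral>\<^sup>+t. indicator {d<..} t * P e t \<partial>lborel)" for d e
  have \<tau>0: "(\<tau> d \<longlongrightarrow> 0) F" if "0 < d" for d
    using tendsto_enn2real[of _ 0, OF _ order_refl] tail[OF that] by (simp add: \<tau>_def[abs_def])
  have \<tau>eq: "(\<integral>\<^sup>+t. indicator {d<..} t * P e t \<partial>lborel) = ennreal (\<tau> d e)"
    if "(\<integral>\<^sup>+t. P e t \<partial>lborel) = ennreal m" for d e
  proof -
    have "(\<integral>\<^sup>+t. indicator {d<..} t * P e t \<partial>lborel) \<le> (\<integral>\<^sup>+t. P e t \<partial>lborel)"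
      by (intro nn_integral_mono) (auto simp: indicator_def)
    also have "\<dots> < top" using that by simp
    finally show ?thesis by (simp add: \<tau>_def)
  qed
  have Xfin: "X e \<le> ennreal (m * B)"
    if "P e \<in> borel_measurable borel \<and> (\<forall>t\<le>0. P e t = 0) \<and> (\<integral>\<^sup>+t. P e t \<partial>lborel) = ennreal m" for e
  proof -
    have "X e \<le> (\<integral>\<^sup>+t. P e t * ennreal B \<partial>lborel)"
      unfolding X_def
    proof (rule nn_integral_mono)
      fix t
      show "P e t * \<Phi> t \<le> P e t * ennreal B"
        using that B(2)[of t] by (cases "0 < t") (auto intro: mult_left_mono)
    qed
    also have "\<dots> = ennreal m * ennreal B" using that by (subst nn_integral_multc) auto
    finally show ?thesis using m B by (simp add: ennreal_mult)
  qed
  define x where "x e = enn2real (X e)" for e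
  have Xx: "X e = ennreal (x e)"
    if "P e \<in> borel_measurable borel \<and> (\<forall>t\<le>0. P e t = 0) \<and> (\<integral>\<^sup>+t. P e t \<partial>lborel) = ennreal m" for e
    using order.strict_trans1[OF Xfin[OF that], of top] by (simp add: x_def)
  \<comment> \<open>For \<open>l = 0\<close> the lower bound is trivial, since
    \<open>ennreal\<close> sends negative numbers to 0.\<close>
  have near: "\<exists>d>0. \<forall>t. 0 < t \<and> t \<le> d \<longrightarrow> ennreal (l - \<kappa>) \<le> \<Phi> t \<and> \<Phi> t \<le> ennreal (l + \<kappa>)" if \<kappa>: "0 < \<kappa>" for \<kappa>
  proof -
    have "\<forall>\<^sub>F t in at_right 0. \<Phi> t < ennreal (l + \<kappa>)"
      using \<kappa> l by (intro order_tendstoD(2)[OF lim]) (simp add: ennreal_less_iff)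
    moreover have "\<forall>\<^sub>F t in at_right 0. ennreal (l - \<kappa>) \<le> \<Phi> t"
    proof (cases "0 < l")
      case True
      then have "\<forall>\<^sub>F t in at_right 0. ennreal (l - \<kappa>) < \<Phi> t"
        using \<kappa> l by (intro order_tendstoD(1)[OF lim]) (simp add: ennreal_lessI)
      then show ?thesis by eventually_elim simp
    next
      case False
      then have "ennreal (l - \<kappa>) = 0" using \<kappa> by (simp add: ennreal_neg)
      then show ?thesis by simp
    qed
    ultimately have "\<forall>\<^sub>F t in at_right 0. ennreal (l - \<kappa>) \<le> \<Phi> t \<and> \<Phi> t \<le> ennreal (l + \<kappa>)"
      by eventually_elim auto
    then obtain d where d: "0 < d" "\<And>t. 0 < t \<Longrightarrow> t < d \<Longrightarrow> ennreal (l - \<kappa>) \<le> \<Phi> t \<and> \<Phi> t \<le> ennreal (l + \<kappa>)"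
      unfolding eventually_at_right_field by auto
    show ?thesis by (rule exI[of _ "d / 2"]) (use d in auto)
  qed
  \<comment> \<open>In the lower bound the tail is added on the right instead of being subtracted on
    the left, since subtraction in \<open>ennreal\<close> truncates.\<close>
  have bounds: "\<exists>d>0. \<forall>\<^sub>F e in F. x e \<le> m * (l + \<kappa>) + B * \<tau> d e \<and> m * (l - \<kappa>) \<le> x e + l * \<tau> d e" if \<kappa>: "0 < \<kappa>" for \<kappa>
  proof -
    obtain d where d: "0 < d" "\<And>t. 0 < t \<Longrightarrow> t \<le> d \<Longrightarrow> ennreal (l - \<kappa>) \<le> \<Phi> t \<and> \<Phi> t \<le> ennreal (l + \<kappa>)"
      using near[OF \<kappa>] by blast
    have "\<forall>\<^sub>F e in F. x e \<le> m * (l + \<kappa>) + B * \<tau> d e \<and> m * (l - \<kappa>) \<le> x e + l * \<tau> d e"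
      using P
    proof eventually_elim
      case (elim e)
      then have [measurable]: "P e \<in> borel_measurable borel" and P0: "\<And>t. t \<le> 0 \<Longrightarrow> P e t = 0"
        and Pm: "(\<integral>\<^sup>+t. P e t \<partial>lborel) = ennreal m" by auto
      have \<tau>n: "0 \<le> \<tau> d e" "0 \<le> x e" by (simp_all add: \<tau>_def x_def)
      have "X e \<le> (\<integral>\<^sup>+t. P e t * ennreal (l + \<kappa>) + indicator {d<..} t * P e t * ennreal B \<partial>lborel)"
        unfolding X_def
      proof (rule nn_integral_mono)
        fix t
        consider "t \<le> 0" | "0 < t" "t \<le> d" | "0 < t" "d < t" by linarith
        then show "P e t * \<Phi> t \<le> P e t * ennreal (l + \<kappa>) + indicator {d<..} t * P e t * ennreal B"
        proof cases
          case 2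
          then have "P e t * \<Phi> t \<le> P e t * ennreal (l + \<kappa>)" using d by (intro mult_left_mono) auto
          then show ?thesis by (simp add: add_increasing2)
        next
          case 3
          then have "P e t * \<Phi> t \<le> P e t * ennreal B" using B by (intro mult_left_mono) auto
          then show ?thesis using 3 by (simp add: add_increasing)
        qed (simp add: P0)
      qed
      also have "\<dots> = ennreal m * ennreal (l + \<kappa>) + ennreal (\<tau> d e) * ennreal B"
        by (simp add: nn_integral_add nn_integral_multc Pm \<tau>eq[OF Pm])
      also have "\<dots> = ennreal (m * (l + \<kappa>) + B * \<tau> d e)"
        using m l \<kappa> B \<tau>n by (simp add: ennreal_mult ennreal_plus mult.commute)
      finally have up: "x e \<le> m * (l + \<kappa>) + B * \<tau> d e"
        unfolding Xx[OF elim] using m l \<kappa> B \<tau>n by (subst (asm) ennreal_le_iff) auto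
      have "ennreal m * ennreal (l - \<kappa>) = (\<integral>\<^sup>+t. P e t * ennreal (l - \<kappa>) \<partial>lborel)"
        by (simp add: nn_integral_multc Pm)
      also have "\<dots> \<le> (\<integral>\<^sup>+t. P e t * \<Phi> t + indicator {d<..} t * P e t * ennreal l \<partial>lborel)"
      proof (rule nn_integral_mono)
        fix t
        consider "t \<le> 0" | "0 < t" "t \<le> d" | "0 < t" "d < t" by linarith
        then show "P e t * ennreal (l - \<kappa>) \<le> P e t * \<Phi> t + indicator {d<..} t * P e t * ennreal l"
        proof cases
          case 2
          then have "P e t * ennreal (l - \<kappa>) \<le> P e t * \<Phi> t" using d by (intro mult_left_mono) auto
          then show ?thesis by (simp add: add_increasing2)
        next
          case 3
          have "P e t * ennreal (l - \<kappa>) \<le> P e t * ennreal l" using \<kappa> by (intro mult_left_mono ennreal_leI) auto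
          then show ?thesis using 3 by (simp add: add_increasing)
        qed (simp add: P0)
      qed
      also have "\<dots> = X e + ennreal (\<tau> d e) * ennreal l"
        by (simp add: nn_integral_add nn_integral_multc \<tau>eq[OF Pm] X_def)
      also have "\<dots> = ennreal (x e + l * \<tau> d e)"
        unfolding Xx[OF elim] using l \<tau>n by (simp add: ennreal_mult ennreal_plus mult.commute)
      finally have "ennreal (m * (l - \<kappa>)) \<le> ennreal (x e + l * \<tau> d e)"
        using m by (simp add: ennreal_mult')
      then have "m * (l - \<kappa>) \<le> x e + l * \<tau> d e"
        using l \<tau>n by (subst (asm) ennreal_le_iff) auto
      then show ?case using up by simp
    qed
    then show ?thesis using d(1) by blast
  qed
  have "(x \<longlongrightarrow> m * l) F"
  proof (rule order_tendstoI)
    fix a assume a: "m * l < a"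
    \<comment> \<open>Half of the available room divided by \<open>m + 1\<close>, which unlike
      \<open>m\<close> is never 0.\<close>
    define \<kappa> where "\<kappa> = (a - m * l) / (2 * (m + 1))"
    have \<kappa>: "0 < \<kappa>" "m * \<kappa> < a - m * l" 
    proof -
      show "0 < \<kappa>" using a m by (simp add: \<kappa>_def)
      have "m / (2 * (m + 1)) < 1" using m by (simp add: divide_less_eq)
      then have "(a - m * l) * (m / (2 * (m + 1))) < (a - m * l) * 1" using a by (intro mult_strict_left_mono) auto
      then show "m * \<kappa> < a - m * l" by (simp add: \<kappa>_def mult.commute)
    qed
    obtain d where d: "0 < d" "\<forall>\<^sub>F e in F. x e \<le> m * (l + \<kappa>) + B * \<tau> d e \<and> m * (l - \<kappa>) \<le> x e + l * \<tau> d e"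
      using bounds[OF \<kappa>(1)] by blast
    have "((\<lambda>e. m * (l + \<kappa>) + B * \<tau> d e) \<longlongrightarrow> m * (l + \<kappa>) + B * 0) F"
      by (intro tendsto_intros \<tau>0 d)
    then have "\<forall>\<^sub>F e in F. m * (l + \<kappa>) + B * \<tau> d e < a"
      by (rule order_tendstoD) (use \<kappa> in \<open>simp add: algebra_simps\<close>)
    with d(2) show "\<forall>\<^sub>F e in F. x e < a" by eventually_elim auto
  next
    fix a assume a: "a < m * l"
    define \<kappa> where "\<kappa> = (m * l - a) / (2 * (m + 1))"
    have \<kappa>: "0 < \<kappa>" "m * \<kappa> < m * l - a" 
    proof -
      show "0 < \<kappa>" using a m by (simp add: \<kappa>_def)
      have "m / (2 * (m + 1)) < 1" using m by (simp add: divide_less_eq)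
      then have "(m * l - a) * (m / (2 * (m + 1))) < (m * l - a) * 1" using a by (intro mult_strict_left_mono) auto
      then show "m * \<kappa> < m * l - a" by (simp add: \<kappa>_def mult.commute)
    qed
    obtain d where d: "0 < d" "\<forall>\<^sub>F e in F. x e \<le> m * (l + \<kappa>) + B * \<tau> d e \<and> m * (l - \<kappa>) \<le> x e + l * \<tau> d e"
      using bounds[OF \<kappa>(1)] by blast
    have "((\<lambda>e. m * (l - \<kappa>) - l * \<tau> d e) \<longlongrightarrow> m * (l - \<kappa>) - l * 0) F"
      by (intro tendsto_intros \<tau>0 d)
    then have "\<forall>\<^sub>F e in F. a < m * (l - \<kappa>) - l * \<tau> d e"
      by (rule order_tendstoD) (use \<kappa> in \<open>simp add: algebra_simps\<close>)
    with d(2) show "\<forall>\<^sub>F e in F. a < x e" by eventually_elim auto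
  qed
  then have "((\<lambda>e. ennreal (x e)) \<longlongrightarrow> ennreal (m * l)) F" by (rule tendsto_ennrealI)
  moreover have "\<forall>\<^sub>F e in F. ennreal (x e) = X e" using P by eventually_elim (simp add: Xx)
  ultimately have "(X \<longlongrightarrow> ennreal (m * l)) F" by (rule Lim_transform_eventually)
  then show ?thesis by (simp add: X_def[abs_def])
qed

text \<open>For fixed \<open>t\<close> the limit along \<open>F\<close> removes \<open>b\<close>;
  only then \<open>t\<close> tends to 0, and the factor of \<open>a\<close> tends to 1. The two
  inequalities are those that \<open>powr_add_le_weighted\<close> yields in both directions.\<close>

lemma weighted_sandwich_tendsto:
  fixes a b g :: "'e \<Rightarrow> real"
  assumes a: "(a \<longlongrightarrow> l) F" and b: "(b \<longlongrightarrow> 0) F"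
    and up: "\<And>t. 0 < t \<Longrightarrow> t < 1 \<Longrightarrow> \<forall>\<^sub>F e in F. g e \<le> (1 - t) powr (1 - q) * a e + t powr (1 - q) * b e"
    and lo: "\<And>t. 0 < t \<Longrightarrow> t < 1 \<Longrightarrow> \<forall>\<^sub>F e in F. a e \<le> (1 - t) powr (1 - q) * g e + t powr (1 - q) * b e"
  shows "(g \<longlongrightarrow> l) F"
proof (rule order_tendstoI)
  fix c assume c: "l < c"
  have "((\<lambda>t. (1 - t) powr (1 - q) * l) \<longlongrightarrow> (1 - 0) powr (1 - q) * l) (at_right 0)"
    by (intro tendsto_intros) auto
  then have "\<forall>\<^sub>F t in at_right 0. (1 - t) powr (1 - q) * l < c"
    by (rule order_tendstoD) (use c in simp)
  moreover have "\<forall>\<^sub>F t in at_right (0::real). t \<in> {0<..<1}" by (rule eventually_at_right_real) simp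
  ultimately have "\<forall>\<^sub>F t in at_right 0. t \<in> {0<..<1} \<and> (1 - t) powr (1 - q) * l < c" by eventually_elim auto
  then have "\<exists>t. t \<in> {0<..<1} \<and> (1 - t) powr (1 - q) * l < c"
    by (rule eventually_happens'[OF trivial_limit_at_right_real])
  then obtain t where "t \<in> {0<..<1} \<and> (1 - t) powr (1 - q) * l < c" ..
  then have t: "0 < t" "t < 1" "(1 - t) powr (1 - q) * l < c" by auto
  have "((\<lambda>e. (1 - t) powr (1 - q) * a e + t powr (1 - q) * b e) \<longlongrightarrow> (1 - t) powr (1 - q) * l + t powr (1 - q) * 0) F"
    by (intro tendsto_intros a b)
  then have "\<forall>\<^sub>F e in F. (1 - t) powr (1 - q) * a e + t powr (1 - q) * b e < c"
    by (rule order_tendstoD) (use t in simp)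
  with up[OF t(1,2)] show "\<forall>\<^sub>F e in F. g e < c" by eventually_elim simp
next
  fix c assume c: "c < l"
  \<comment> \<open>The factor \<open>(1 - t) powr (q - 1)\<close> comes from solving the second
    inequality for \<open>g e\<close>.\<close>
  have "((\<lambda>t. (1 - t) powr (q - 1) * l) \<longlongrightarrow> (1 - 0) powr (q - 1) * l) (at_right 0)"
    by (intro tendsto_intros) auto
  then have "\<forall>\<^sub>F t in at_right 0. c < (1 - t) powr (q - 1) * l"
    by (rule order_tendstoD) (use c in simp)
  moreover have "\<forall>\<^sub>F t in at_right (0::real). t \<in> {0<..<1}" by (rule eventually_at_right_real) simp
  ultimately have "\<forall>\<^sub>F t in at_right 0. t \<in> {0<..<1} \<and> c < (1 - t) powr (q - 1) * l" by eventually_elim auto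
  then have "\<exists>t. t \<in> {0<..<1} \<and> c < (1 - t) powr (q - 1) * l"
    by (rule eventually_happens'[OF trivial_limit_at_right_real])
  then obtain t where "t \<in> {0<..<1} \<and> c < (1 - t) powr (q - 1) * l" ..
  then have t: "0 < t" "t < 1" "c < (1 - t) powr (q - 1) * l" by auto
  have "((\<lambda>e. (1 - t) powr (q - 1) * (a e - t powr (1 - q) * b e)) \<longlongrightarrow> (1 - t) powr (q - 1) * (l - t powr (1 - q) * 0)) F"
    by (intro tendsto_intros a b)
  then have "\<forall>\<^sub>F e in F. c < (1 - t) powr (q - 1) * (a e - t powr (1 - q) * b e)"
    by (rule order_tendstoD) (use t in simp)
  with lo[OF t(1,2)] show "\<forall>\<^sub>F e in F. c < g e"
  proof eventually_elim
    case (elim e)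
    have "(1 - t) powr (q - 1) * (a e - t powr (1 - q) * b e) \<le> (1 - t) powr (q - 1) * ((1 - t) powr (1 - q) * g e)"
      using elim(1) by (intro mult_left_mono) auto
    also have "\<dots> = g e" using t by (simp add: mult.assoc[symmetric] powr_add[symmetric])
    finally show ?case using elim(2) by simp
  qed
qed

section \<open>The energy of a mollified function\<close>

definition increment :: "real \<Rightarrow> 'a set \<Rightarrow> ('a::euclidean_space \<Rightarrow> 'b::euclidean_space) \<Rightarrow> 'a \<Rightarrow> ennreal" where
  "increment q E v z = (\<integral>\<^sup>+x. indicator E x * (indicator E (x + z) * ennreal (norm (v (x + z) - v x) powr q)) \<partial>lborel)"

text \<open>The q-th power of the Gagliardo seminorm, restricted to pairs whose distance lies in
  \<open>R\<close> and written in terms of the displacement \<open>z\<close>; the choice of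
  \<open>R\<close> isolates a range of scales.\<close>

definition energy :: "real \<Rightarrow> real \<Rightarrow> 'a set \<Rightarrow> ('a::euclidean_space \<Rightarrow> 'b::euclidean_space) \<Rightarrow> real set \<Rightarrow> ennreal" where
  "energy q r E v R = (\<integral>\<^sup>+z. indicator R (norm z) * ennreal (norm z powr (- (r * q) - real DIM('a))) * increment q E v z \<partial>lborel)"

lemma increment_measurable [measurable]:
  assumes [measurable]: "E \<in> sets borel" "v \<in> borel_measurable borel"
  shows "increment q E v \<in> borel_measurable borel"
  unfolding increment_def[abs_def] by measurable

lemma increment_le:
  "increment q E v z \<le> (\<integral>\<^sup>+x. ennreal (norm (v (x + z) - v x) powr q) \<partial>lborel)"
  unfolding increment_def by (intro nn_integral_mono) (auto simp: indicator_def)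

lemma increment_scale:
  fixes u :: "'a::euclidean_space \<Rightarrow> 'b::euclidean_space"
  assumes [measurable]: "E \<in> sets borel" "u \<in> borel_measurable borel"
  shows "increment q E (\<lambda>x. m *\<^sub>R u x) z = ennreal (\<bar>m\<bar> powr q) * increment q E u z"
proof -
  have "norm (m *\<^sub>R u (x + z) - m *\<^sub>R u x) powr q = \<bar>m\<bar> powr q * norm (u (x + z) - u x) powr q" for x
    by (simp add: scaleR_diff_right[symmetric] powr_mult)
  then have "increment q E (\<lambda>x. m *\<^sub>R u x) z
    = (\<integral>\<^sup>+x. ennreal (\<bar>m\<bar> powr q) * (indicator E x * (indicator E (x + z) * ennreal (norm (u (x + z) - u x) powr q))) \<partial>lborel)"
    unfolding increment_def by (intro nn_integral_cong) (simp add: ennreal_mult mult_ac)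
  also have "\<dots> = ennreal (\<bar>m\<bar> powr q) * increment q E u z"
    unfolding increment_def by (rule nn_integral_cmult) measurable
  finally show ?thesis .
qed

text \<open>The triangle inequality enters as a hypothesis, so that the roles of the mollified
  function and of the multiple of \<open>u\<close> can be exchanged.\<close>

lemma increment_triangle:
  fixes v1 v2 v3 :: "'a::euclidean_space \<Rightarrow> 'b::euclidean_space"
  assumes q: "1 \<le> q" and t: "0 < t" "t < 1"
    and [measurable]: "E \<in> sets borel" "v1 \<in> borel_measurable borel" "v2 \<in> borel_measurable borel" "v3 \<in> borel_measurable borel"
    and tri: "\<And>x. norm (v1 (x + z) - v1 x) \<le> norm (v2 (x + z) - v2 x) + norm (v3 (x + z) - v3 x)"
  shows "increment q E v1 z \<le> ennreal ((1 - t) powr (1 - q)) * increment q E v2 z + ennreal (t powr (1 - q)) * increment q E v3 z"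
proof -
  have "increment q E v1 z \<le> (\<integral>\<^sup>+x. ennreal ((1 - t) powr (1 - q)) * (indicator E x * (indicator E (x + z) * ennreal (norm (v2 (x + z) - v2 x) powr q)))
      + ennreal (t powr (1 - q)) * (indicator E x * (indicator E (x + z) * ennreal (norm (v3 (x + z) - v3 x) powr q))) \<partial>lborel)"
    unfolding increment_def
  proof (rule nn_integral_mono)
    fix x
    have "norm (v1 (x + z) - v1 x) powr q \<le> (norm (v2 (x + z) - v2 x) + norm (v3 (x + z) - v3 x)) powr q"
      using q tri by (intro powr_mono2) auto
    also have "\<dots> \<le> (1 - t) powr (1 - q) * norm (v2 (x + z) - v2 x) powr q + t powr (1 - q) * norm (v3 (x + z) - v3 x) powr q"
      by (intro powr_add_le_weighted q t) auto
    finally have "ennreal (norm (v1 (x + z) - v1 x) powr q)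
      \<le> ennreal ((1 - t) powr (1 - q)) * ennreal (norm (v2 (x + z) - v2 x) powr q) + ennreal (t powr (1 - q)) * ennreal (norm (v3 (x + z) - v3 x) powr q)"
      by (simp add: ennreal_mult[symmetric] ennreal_plus[symmetric] ennreal_leI del: ennreal_plus)
    then show "indicator E x * (indicator E (x + z) * ennreal (norm (v1 (x + z) - v1 x) powr q))
      \<le> ennreal ((1 - t) powr (1 - q)) * (indicator E x * (indicator E (x + z) * ennreal (norm (v2 (x + z) - v2 x) powr q)))
      + ennreal (t powr (1 - q)) * (indicator E x * (indicator E (x + z) * ennreal (norm (v3 (x + z) - v3 x) powr q)))"
      by (simp add: indicator_def)
  qed
  also have "\<dots> = ennreal ((1 - t) powr (1 - q)) * increment q E v2 z + ennreal (t powr (1 - q)) * increment q E v3 z"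
    unfolding increment_def by (simp add: nn_integral_add nn_integral_cmult)
  finally show ?thesis .
qed

lemma energy_linear_le:
  fixes v1 v2 v3 :: "'a::euclidean_space \<Rightarrow> 'b::euclidean_space"
  assumes [measurable]: "E \<in> sets borel" "R \<in> sets borel" "v2 \<in> borel_measurable borel" "v3 \<in> borel_measurable borel"
    and le: "\<And>z. increment q E v1 z \<le> a * increment q E v2 z + b * increment q E v3 z"
  shows "energy q r E v1 R \<le> a * energy q r E v2 R + b * energy q r E v3 R"
proof -
  let ?w = "\<lambda>z::'a. indicator R (norm z) * ennreal (norm z powr (- (r * q) - real DIM('a)))"
  have "energy q r E v1 R \<le> (\<integral>\<^sup>+z. a * (?w z * increment q E v2 z) + b * (?w z * increment q E v3 z) \<partial>lborel)"
    unfolding energy_def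
  proof (rule nn_integral_mono)
    fix z :: 'a
    have "?w z * increment q E v1 z \<le> ?w z * (a * increment q E v2 z + b * increment q E v3 z)"
      by (intro mult_left_mono le) simp
    then show "?w z * increment q E v1 z \<le> a * (?w z * increment q E v2 z) + b * (?w z * increment q E v3 z)"
      by (simp add: distrib_left mult_ac)
  qed
  also have "\<dots> = a * energy q r E v2 R + b * energy q r E v3 R"
    unfolding energy_def by (simp add: nn_integral_add nn_integral_cmult)
  finally show ?thesis .
qed

lemma energy_scale:
  fixes u :: "'a::euclidean_space \<Rightarrow> 'b::euclidean_space"
  assumes [measurable]: "E \<in> sets borel" "R \<in> sets borel" "u \<in> borel_measurable borel"
  shows "energy q r E (\<lambda>x. m *\<^sub>R u x) R = ennreal (\<bar>m\<bar> powr q) * energy q r E u R"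
proof -
  let ?w = "\<lambda>z::'a. indicator R (norm z) * ennreal (norm z powr (- (r * q) - real DIM('a)))"
  have "energy q r E (\<lambda>x. m *\<^sub>R u x) R = (\<integral>\<^sup>+z. ennreal (\<bar>m\<bar> powr q) * (?w z * increment q E u z) \<partial>lborel)"
    unfolding energy_def by (simp add: increment_scale mult_ac)
  also have "\<dots> = ennreal (\<bar>m\<bar> powr q) * energy q r E u R"
    unfolding energy_def by (rule nn_integral_cmult) measurable
  finally show ?thesis .
qed

lemma energy_split:
  fixes v :: "'a::euclidean_space \<Rightarrow> 'b::euclidean_space"
  assumes [measurable]: "E \<in> sets borel" "v \<in> borel_measurable borel" and e: "0 < e" "e < 1"
  shows "energy q r E v UNIV = energy q r E v {e<..<1} + (energy q r E v {..e} + energy q r E v {1..})"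
proof -
  let ?g = "\<lambda>z::'a. ennreal (norm z powr (- (r * q) - real DIM('a))) * increment q E v z"
  have "energy q r E v UNIV = (\<integral>\<^sup>+z. indicator {e<..<1} (norm z) * ?g z
      + (indicator {..e} (norm z) * ?g z + indicator {1..} (norm z) * ?g z) \<partial>lborel)"
    unfolding energy_def by (rule nn_integral_cong) (use e in \<open>auto simp: indicator_def\<close>)
  also have "\<dots> = energy q r E v {e<..<1} + (energy q r E v {..e} + energy q r E v {1..})"
    by (simp add: nn_integral_add energy_def mult.assoc)
  finally show ?thesis .
qed

text \<open>A power bound on the increments reduces the energy to a one-dimensional integral; it is
  used with \<open>p = 0\<close> far from the diagonal and with \<open>p = q\<close> near
  it.\<close>

lemma energy_le_radial:
  fixes v :: "'a::euclidean_space \<Rightarrow> 'b::euclidean_space"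
  assumes [measurable]: "R \<in> sets borel"
    and le: "\<And>z. norm z \<in> R \<Longrightarrow> increment q E v z \<le> c * ennreal (norm z powr p)"
  shows "energy q r E v R \<le> c * (emeasure (sphere_measure :: 'a measure) UNIV *
    (\<integral>\<^sup>+t. indicator {0<..} t * (indicator R t * ennreal (t powr (p - r * q - 1))) \<partial>lborel))"
proof -
  have "energy q r E v R \<le> (\<integral>\<^sup>+z. c * (indicator R (norm (z::'a)) * ennreal (norm z powr ((p - r * q) - real DIM('a)))) \<partial>lborel)"
    unfolding energy_def
  proof (rule nn_integral_mono)
    fix z :: 'a
    show "indicator R (norm z) * ennreal (norm z powr (- (r * q) - real DIM('a))) * increment q E v z
      \<le> c * (indicator R (norm z) * ennreal (norm z powr ((p - r * q) - real DIM('a))))"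
    proof (cases "norm z \<in> R")
      case True
      have "ennreal (norm z powr (- (r * q) - real DIM('a))) * increment q E v z
        \<le> ennreal (norm z powr (- (r * q) - real DIM('a))) * (c * ennreal (norm z powr p))"
        by (intro mult_left_mono le True) simp
      also have "\<dots> = c * (ennreal (norm z powr (- (r * q) - real DIM('a))) * ennreal (norm z powr p))"
        by (simp add: mult_ac)
      also have "\<dots> = c * ennreal (norm z powr ((p - r * q) - real DIM('a)))"
        by (simp add: ennreal_mult[symmetric] powr_add[symmetric] algebra_simps)
      finally show ?thesis using True by simp
    qed simp
  qed
  also have "\<dots> = c * (\<integral>\<^sup>+z. indicator R (norm (z::'a)) * ennreal (norm z powr ((p - r * q) - real DIM('a))) \<partial>lborel)"
    by (rule nn_integral_cmult) measurable
  also have "(\<integral>\<^sup>+z. indicator R (norm (z::'a)) * ennreal (norm z powr ((p - r * q) - real DIM('a))) \<partial>lborel)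
    = emeasure (sphere_measure :: 'a measure) UNIV * (\<integral>\<^sup>+t. indicator {0<..} t * (indicator R t * ennreal (t powr ((p - r * q) - 1))) \<partial>lborel)"
    by (rule nn_integral_radial_powr) measurable
  finally show ?thesis by simp
qed

text \<open>The density \<open>t ^ (DIM('a) - 1)\<close> and the weight combine to
  \<open>1 / t\<close> times \<open>t powr (- (r * q))\<close>; the latter stays inside the
  spherical integral, where it normalises the increments.\<close>

lemma energy_polar:
  fixes v :: "'a::euclidean_space \<Rightarrow> 'b::euclidean_space"
  assumes [measurable]: "E \<in> sets borel" "R \<in> sets borel" "v \<in> borel_measurable borel"
  shows "energy q r E v R = (\<integral>\<^sup>+t. indicator {0<..} t * (indicator R t * ennreal (t powr (0 - 1))) *
     (\<integral>\<^sup>+n. ennreal (t powr (- (r * q))) * increment q E v (t *\<^sub>R n) \<partial>sphere_measure) \<partial>lborel)"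
proof -
  have "energy q r E v R = (\<integral>\<^sup>+t. indicator {0<..} t * ennreal (t ^ (DIM('a) - 1)) *
     (\<integral>\<^sup>+n. indicator R (norm (t *\<^sub>R n)) * ennreal (norm (t *\<^sub>R n) powr (- (r * q) - real DIM('a))) * increment q E v (t *\<^sub>R n) \<partial>sphere_measure) \<partial>lborel)"
    unfolding energy_def by (rule polar_coordinates) measurable
  also have "\<dots> = (\<integral>\<^sup>+t. indicator {0<..} t * (indicator R t * ennreal (t powr (0 - 1))) *
     (\<integral>\<^sup>+n. ennreal (t powr (- (r * q))) * increment q E v (t *\<^sub>R n) \<partial>sphere_measure) \<partial>lborel)"
  proof (rule nn_integral_cong)
    fix t :: real
    let ?I = "\<integral>\<^sup>+n. increment q E v (t *\<^sub>R n) \<partial>sphere_measure"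
    show "indicator {0<..} t * ennreal (t ^ (DIM('a) - 1)) *
     (\<integral>\<^sup>+n. indicator R (norm (t *\<^sub>R n)) * ennreal (norm (t *\<^sub>R n) powr (- (r * q) - real DIM('a))) * increment q E v (t *\<^sub>R n) \<partial>sphere_measure)
     = indicator {0<..} t * (indicator R t * ennreal (t powr (0 - 1))) *
     (\<integral>\<^sup>+n. ennreal (t powr (- (r * q))) * increment q E v (t *\<^sub>R n) \<partial>sphere_measure)"
    proof (cases "0 < t")
      case True
      have "(\<integral>\<^sup>+n. indicator R (norm (t *\<^sub>R n)) * ennreal (norm (t *\<^sub>R n) powr (- (r * q) - real DIM('a))) * increment q E v (t *\<^sub>R n) \<partial>sphere_measure)
        = (\<integral>\<^sup>+n. (indicator R t * ennreal (t powr (- (r * q) - real DIM('a)))) * increment q E v (t *\<^sub>R n) \<partial>sphere_measure)"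
        using AE_sphere_measure[where 'a='a] True
        by (intro nn_integral_cong_AE) (auto elim!: eventually_mono)
      also have "\<dots> = indicator R t * ennreal (t powr (- (r * q) - real DIM('a))) * ?I"
        by (rule nn_integral_cmult) measurable
      finally have 1: "(\<integral>\<^sup>+n. indicator R (norm (t *\<^sub>R n)) * ennreal (norm (t *\<^sub>R n) powr (- (r * q) - real DIM('a))) * increment q E v (t *\<^sub>R n) \<partial>sphere_measure)
        = indicator R t * ennreal (t powr (- (r * q) - real DIM('a))) * ?I" .
      have 2: "(\<integral>\<^sup>+n. ennreal (t powr (- (r * q))) * increment q E v (t *\<^sub>R n) \<partial>sphere_measure) = ennreal (t powr (- (r * q))) * ?I"
        by (rule nn_integral_cmult) measurable
      have 3: "ennreal (t ^ (DIM('a) - 1)) * ennreal (t powr (- (r * q) - real DIM('a))) = ennreal (t powr (0 - 1)) * ennreal (t powr (- (r * q)))"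
      proof -
        have "t powr (0 - 1) * t powr (- (r * q)) = t powr (- (r * q) - 1)"
          by (subst powr_add[symmetric], rule arg_cong[where f="\<lambda>s. t powr s"]) simp
        then have "t ^ (DIM('a) - 1) * t powr (- (r * q) - real DIM('a)) = t powr (0 - 1) * t powr (- (r * q))"
          using power_mult_powr_DIM[OF True, of "- (r * q)", where 'a='a] by (simp only:)
        then show ?thesis using True by (simp only: ennreal_mult[symmetric] zero_le_power less_imp_le powr_ge_zero)
      qed
      have 4: "a * (i * b * x) = (i * c) * (d * x)" if "a * b = c * d" for a b c d i x :: ennreal
      proof -
        have "a * (i * b * x) = (a * b) * (i * x)" by (simp only: mult_ac)
        also have "\<dots> = (i * c) * (d * x)" unfolding that by (simp only: mult_ac)
        finally show ?thesis .
      qed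
      have 5: "indicator {0<..} t = (1::ennreal)" using True by simp
      show ?thesis unfolding 1 2 5 mult_1_left by (rule 4[OF 3])
    qed simp
  qed
  finally show ?thesis .
qed

section \<open>Splitting the energy by scales\<close>

context besov_function
begin

text \<open>The function \<Phi> of the overview, with cone measure as surface measure.\<close>

definition sphere_increment :: "'a set \<Rightarrow> real \<Rightarrow> ennreal" where
  "sphere_increment E t = (\<integral>\<^sup>+n. ennreal (t powr (- (r * q))) * increment q E u (t *\<^sub>R n) \<partial>sphere_measure)"

lemma sphere_increment_measurable [measurable]:
  assumes [measurable]: "E \<in> sets borel"
  shows "sphere_increment E \<in> borel_measurable borel"
  unfolding sphere_increment_def[abs_def]
  by (rule sphere_measure.borel_measurable_nn_integral) measurable

lemma sphere_increment_le:
  assumes t: "0 < t"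
  shows "sphere_increment E t \<le> ennreal (M * measure (sphere_measure :: 'a measure) UNIV)"
proof -
  have "sphere_increment E t \<le> (\<integral>\<^sup>+n. ennreal M \<partial>(sphere_measure :: 'a measure))"
    unfolding sphere_increment_def
  proof (rule nn_integral_mono_AE)
    show "AE n in sphere_measure. ennreal (t powr (- (r * q))) * increment q E u (t *\<^sub>R n) \<le> ennreal M"
      using AE_sphere_measure
    proof eventually_elim
      case (elim n)
      have "increment q E u (t *\<^sub>R n) \<le> ennreal (M * t powr (r * q))"
        using order_trans[OF increment_le M(2)[of "t *\<^sub>R n"]] elim t by simp
      then have "ennreal (t powr (- (r * q))) * increment q E u (t *\<^sub>R n) \<le> ennreal (t powr (- (r * q))) * ennreal (M * t powr (r * q))"
        by (intro mult_left_mono) auto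
      also have "\<dots> = ennreal M"
      proof -
        have "t powr (- (r * q)) * (M * t powr (r * q)) = M" using t by (simp add: powr_minus field_simps)
        then show ?thesis using M(1) by (simp add: ennreal_mult[symmetric])
      qed
      finally show ?case .
    qed
  qed
  also have "\<dots> = ennreal (M * measure (sphere_measure :: 'a measure) UNIV)"
    using M(1) by (simp add: sphere_measure.emeasure_eq_measure ennreal_mult)
  finally show ?thesis .
qed

lemma energy_mid_eq:
  assumes [measurable]: "E \<in> sets borel"
  shows "energy q r E u {e<..<1}
    = (\<integral>\<^sup>+t. indicator {0<..} t * (indicator {e<..<1} t * ennreal (t powr (0 - 1))) * sphere_increment E t \<partial>lborel)"
  unfolding sphere_increment_def by (rule energy_polar) measurable

text \<open>The weights \<open>1 / (t * \<bar>ln e\<bar>)\<close> on \<open>(e, 1)\<close> have mass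
  1, and their part beyond a fixed \<open>d\<close> has mass at most a constant over
  \<open>\<bar>ln e\<bar>\<close>.\<close>

lemma energy_mid_tendsto:
  assumes [measurable]: "E \<in> sets borel" and l: "0 \<le> l" and lim: "(sphere_increment E \<longlongrightarrow> ennreal l) (at_right 0)"
  shows "((\<lambda>e. ennreal (1 / \<bar>ln e\<bar>) * energy q r E u {e<..<1}) \<longlongrightarrow> ennreal l) (at_right 0)"
proof -
  define P :: "real \<Rightarrow> real \<Rightarrow> ennreal" where "P = (\<lambda>e t. ennreal (1 / \<bar>ln e\<bar>) * (indicator {0<..} t * (indicator {e<..<1} t * ennreal (t powr (0 - 1)))))"
  have [measurable]: "P e \<in> borel_measurable borel" for e unfolding P_def by measurable
  have log: "(\<integral>\<^sup>+t. indicator {0<..} t * (indicator {a<..<b} t * ennreal (t powr (0 - 1))) \<partial>lborel) = ennreal (ln b - ln a)"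
    if "0 < a" "a \<le> b" for a b :: real
  proof -
    have "AE t in lborel. t \<notin> {a, b}" by (intro AE_not_in countable_imp_null_set_lborel) auto
    then have "(\<integral>\<^sup>+t. indicator {0<..} t * (indicator {a<..<b} t * ennreal (t powr (0 - 1))) \<partial>lborel)
      = (\<integral>\<^sup>+t. indicator {0<..} t * (indicator {a..b} t * ennreal (t powr (0 - 1))) \<partial>lborel)"
      by (intro nn_integral_cong_AE, eventually_elim) (auto simp: indicator_def)
    then show ?thesis using nn_integral_inverse_Icc[OF that] by simp
  qed
  have ev: "\<forall>\<^sub>F e in at_right (0::real). e \<in> {0<..<1}" by (rule eventually_at_right_real) simp
  have "((\<lambda>e. \<integral>\<^sup>+t. P e t * sphere_increment E t \<partial>lborel) \<longlongrightarrow> ennreal (1 * l)) (at_right 0)"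
  proof (rule average_tendsto[where P=P and \<Phi>="sphere_increment E" and m=1, OF _ _ sphere_increment_le lim l])
    show "\<forall>\<^sub>F e in at_right 0. P e \<in> borel_measurable borel \<and> (\<forall>t\<le>0. P e t = 0) \<and> (\<integral>\<^sup>+t. P e t \<partial>lborel) = ennreal 1"
      using ev
    proof eventually_elim
      case (elim e)
      have "(\<integral>\<^sup>+t. P e t \<partial>lborel) = ennreal (1 / \<bar>ln e\<bar>) * ennreal (ln 1 - ln e)"
        using log[of e 1] elim unfolding P_def by (subst nn_integral_cmult) auto
      also have "\<dots> = ennreal 1" using elim by (simp add: ennreal_mult'[symmetric])
      finally show ?case using elim by (auto simp: P_def)
    qed
    fix d :: real assume d: "0 < d"
    \<comment> \<open>\<open>- ln d\<close> is the logarithmic length of \<open>(d, 1)\<close>; the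
      maximum covers \<open>d \<ge> 1\<close>, where nothing remains.\<close>
    define c where "c = max 0 (- ln d)"
    have lim0: "((\<lambda>e. ennreal (c / \<bar>ln e\<bar>)) \<longlongrightarrow> 0) (at_right 0)"
      using tendsto_ennrealI[OF tendsto_divide_abs_ln[of c]] by simp
    have "\<forall>\<^sub>F e in at_right (0::real). e \<in> {0<..<min d 1}"
      by (rule eventually_at_right_real) (use d in simp)
    then have bd: "\<forall>\<^sub>F e in at_right 0. (\<integral>\<^sup>+t. indicator {d<..} t * P e t \<partial>lborel) \<le> ennreal (c / \<bar>ln e\<bar>)"
    proof eventually_elim
      case (elim e)
      have "(\<integral>\<^sup>+t. indicator {d<..} t * P e t \<partial>lborel)
        \<le> (\<integral>\<^sup>+t. ennreal (1 / \<bar>ln e\<bar>) * (indicator {0<..} t * (indicator {min d 1<..<1} t * ennreal (t powr (0 - 1)))) \<partial>lborel)"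
        unfolding P_def by (intro nn_integral_mono) (auto simp: indicator_def)
      also have "\<dots> = ennreal (1 / \<bar>ln e\<bar>) * ennreal (ln 1 - ln (min d 1))"
        using log[of "min d 1" 1] d by (subst nn_integral_cmult) auto
      also have "\<dots> = ennreal (c / \<bar>ln e\<bar>)"
        using d by (simp add: ennreal_mult'[symmetric] c_def min_def max_def)
      finally show ?case by simp
    qed
    show "((\<lambda>e. \<integral>\<^sup>+t. indicator {d<..} t * P e t \<partial>lborel) \<longlongrightarrow> 0) (at_right 0)"
      by (rule tendsto_sandwich[OF _ bd tendsto_const lim0]) simp
  qed (use M(1) in auto)
  then show ?thesis
    unfolding mult_1_left
  proof (rule Lim_transform_eventually)
    have "(\<integral>\<^sup>+t. P e t * sphere_increment E t \<partial>lborel) = ennreal (1 / \<bar>ln e\<bar>) * energy q r E u {e<..<1}" for e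
    unfolding energy_mid_eq[OF assms(1)] P_def
    by (subst nn_integral_cmult[symmetric]) (auto simp: mult.assoc)
    then show "\<forall>\<^sub>F e in at_right 0. (\<integral>\<^sup>+t. P e t * sphere_increment E t \<partial>lborel) = ennreal (1 / \<bar>ln e\<bar>) * energy q r E u {e<..<1}" by simp
  qed
qed

text \<open>Far from the diagonal only \<open>u \<in> L\<^sup>q\<close> is used, near it the regularity of the kernel; both
  contributions stay bounded as the scale tends to zero.\<close>

lemma energy_far_bound:
  assumes k: "integrable lborel k"
  obtains C where "0 \<le> C" "\<And>e E. energy q r E (conv k e) {1..} \<le> ennreal C"
proof -
  define c where "c = 2 powr q * ((\<integral>y. \<bar>k y\<bar> \<partial>lborel) powr q * N0)"
  define s where "s = measure (sphere_measure :: 'a measure) UNIV"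
  have c: "0 \<le> c" using N0 by (simp add: c_def)
  have rq: "0 < r * q" using r q by simp
  have "energy q r E (conv k e) {1..} \<le> ennreal (c * (s * (1 / (r * q))))" for e E
  proof -
    have "energy q r E (conv k e) {1..} \<le> ennreal c * (emeasure (sphere_measure :: 'a measure) UNIV *
      (\<integral>\<^sup>+t. indicator {0<..} t * (indicator {1..} t * ennreal (t powr (0 - r * q - 1))) \<partial>lborel))"
    proof (rule energy_le_radial)
      fix z :: 'a assume "norm z \<in> {1..}"
      then have "ennreal (norm z powr 0) = 1" by (auto simp: powr_def)
      then show "increment q E (conv k e) z \<le> ennreal c * ennreal (norm z powr 0)"
        using order_trans[OF increment_le conv_diff_large[OF k, of e z]] by (simp add: c_def)
    qed simp
    also have "(\<integral>\<^sup>+t. indicator {0<..} t * (indicator {1..} t * ennreal (t powr (0 - r * q - 1))) \<partial>lborel) = ennreal (1 / (r * q))"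
      using nn_integral_powr_atLeast[OF rq, of 1] by simp
    finally show ?thesis
      using c rq by (simp add: sphere_measure.emeasure_eq_measure s_def ennreal_mult[symmetric])
  qed
  moreover have "0 \<le> c * (s * (1 / (r * q)))" using c rq by (simp add: s_def)
  ultimately show ?thesis using that by blast
qed

lemma energy_near_bound:
  assumes wg: "borel_weak_gradient k g"
  obtains C where "0 \<le> C" "\<And>e E. 0 < e \<Longrightarrow> energy q r E (conv k e) {..e} \<le> ennreal C"
proof -
  obtain c where c: "0 \<le> c"
    "\<And>e z. 0 < e \<Longrightarrow> norm z \<le> e \<Longrightarrow>
      (\<integral>\<^sup>+x. ennreal (norm (conv k e (x + z) - conv k e x) powr q) \<partial>lborel)
        \<le> ennreal (c * (norm z powr q * e powr ((r - 1) * q)))"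
    by (rule conv_diff_sobolev[OF wg]) (rule that)
  define s where "s = measure (sphere_measure :: 'a measure) UNIV"
  \<comment> \<open>Positive because \<open>r < 1\<close>: the radial integral converges at 0, and
    its factor \<open>e powr a\<close> cancels \<open>e powr ((r - 1) * q)\<close>.\<close>
  define a where "a = q - r * q"
  have a: "0 < a" using r q by (simp add: a_def)
  have "energy q r E (conv k e) {..e} \<le> ennreal (c * (s * (1 / a)))" if e: "0 < e" for e E
  proof -
    have "energy q r E (conv k e) {..e} \<le> ennreal (c * e powr ((r - 1) * q)) * (emeasure (sphere_measure :: 'a measure) UNIV *
      (\<integral>\<^sup>+t. indicator {0<..} t * (indicator {..e} t * ennreal (t powr (q - r * q - 1))) \<partial>lborel))"
    proof (rule energy_le_radial)
      fix z :: 'a assume "norm z \<in> {..e}"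
      then have "increment q E (conv k e) z \<le> ennreal (c * (norm z powr q * e powr ((r - 1) * q)))"
        using order_trans[OF increment_le c(2)[OF e, of z]] by simp
      then show "increment q E (conv k e) z \<le> ennreal (c * e powr ((r - 1) * q)) * ennreal (norm z powr q)"
        using c(1) by (simp add: ennreal_mult[symmetric] mult_ac)
    qed simp
    also have "(\<integral>\<^sup>+t. indicator {0<..} t * (indicator {..e} t * ennreal (t powr (q - r * q - 1))) \<partial>lborel) = ennreal (e powr a / a)"
      using nn_integral_powr_Icc_0[OF a e] by (simp add: a_def)
    also have "ennreal (c * e powr ((r - 1) * q)) * (emeasure (sphere_measure :: 'a measure) UNIV * ennreal (e powr a / a))
      = ennreal ((c * e powr ((r - 1) * q)) * (s * (e powr a / a)))"
      using c(1) a by (simp add: sphere_measure.emeasure_eq_measure s_def ennreal_mult[symmetric])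
    also have "(c * e powr ((r - 1) * q)) * (s * (e powr a / a)) = c * (s * (1 / a)) * (e powr ((r - 1) * q) * e powr a)"
      by simp
    also have "e powr ((r - 1) * q) * e powr a = 1"
    proof -
      have "(r - 1) * q + a = 0" by (simp add: a_def algebra_simps)
      then show ?thesis using e by (simp add: powr_add[symmetric])
    qed
    finally show ?thesis by simp
  qed
  moreover have "0 \<le> c * (s * (1 / a))" using c(1) a by (simp add: s_def)
  ultimately show ?thesis using that by blast
qed

text \<open>Bounding the minimum by \<open>norm z\<close> leaves \<open>dt / t\<close> and hence the
  logarithm, uniformly in \<open>b\<close>. Bounding it by \<open>e * b\<close> leaves an integral
  that converges at infinity and whose power of \<open>e\<close> cancels.\<close>

lemma radial_min_bound:
  assumes e: "0 < e" "e < 1" and b: "0 \<le> b"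
  shows "(\<integral>\<^sup>+z. indicator {e<..<1} (norm (z::'a)) * ennreal (norm z powr (- (r * q) - real DIM('a))) *
      ennreal (min (norm z) (e * b) powr (r * q)) \<partial>lborel)
    \<le> ennreal (measure (sphere_measure :: 'a measure) UNIV * min \<bar>ln e\<bar> (b powr (r * q) / (r * q)))"
proof -
  have rq: "0 < r * q" using r q by simp
  let ?s = "measure (sphere_measure :: 'a measure) UNIV"
  let ?L = "\<integral>\<^sup>+z. indicator {e<..<1} (norm (z::'a)) * ennreal (norm z powr (- (r * q) - real DIM('a))) *
      ennreal (min (norm z) (e * b) powr (r * q)) \<partial>lborel"
  have 1: "?L \<le> ennreal (?s * \<bar>ln e\<bar>)"
  proof -
    have "?L \<le> (\<integral>\<^sup>+z. indicator {e..1} (norm (z::'a)) * ennreal (norm z powr (0 - real DIM('a))) \<partial>lborel)"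
    proof (rule nn_integral_mono)
      fix z :: 'a
      have "norm z powr (- (r * q) - real DIM('a)) * min (norm z) (e * b) powr (r * q) \<le> norm z powr (- (r * q) - real DIM('a)) * norm z powr (r * q)"
        using rq e b by (intro mult_left_mono powr_mono2) auto
      also have "\<dots> = norm z powr (0 - real DIM('a))" by (simp add: powr_add[symmetric])
      finally have "ennreal (norm z powr (- (r * q) - real DIM('a))) * ennreal (min (norm z) (e * b) powr (r * q)) \<le> ennreal (norm z powr (0 - real DIM('a)))"
        by (simp add: ennreal_mult[symmetric] ennreal_leI)
      then show "indicator {e<..<1} (norm z) * ennreal (norm z powr (- (r * q) - real DIM('a))) *
          ennreal (min (norm z) (e * b) powr (r * q)) \<le> indicator {e..1} (norm z) * ennreal (norm z powr (0 - real DIM('a)))"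
        by (auto simp: indicator_def)
    qed
    also have "\<dots> = emeasure (sphere_measure :: 'a measure) UNIV * (\<integral>\<^sup>+t. indicator {0<..} t * (indicator {e..1} t * ennreal (t powr (0 - 1))) \<partial>lborel)"
      by (rule nn_integral_radial_powr) simp
    also have "\<dots> = ennreal (?s * \<bar>ln e\<bar>)"
      unfolding nn_integral_inverse_Icc[OF e(1) less_imp_le[OF e(2)]]
      using e by (simp add: sphere_measure.emeasure_eq_measure ennreal_mult[symmetric])
    finally show ?thesis .
  qed
  have 2: "?L \<le> ennreal (?s * (b powr (r * q) / (r * q)))"
  proof -
    have "?L \<le> (\<integral>\<^sup>+z. ennreal ((e * b) powr (r * q)) * (indicator {e..} (norm (z::'a)) * ennreal (norm z powr (- (r * q) - real DIM('a)))) \<partial>lborel)"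
    proof (rule nn_integral_mono)
      fix z :: 'a
      have "min (norm z) (e * b) powr (r * q) \<le> (e * b) powr (r * q)"
        using rq e b by (intro powr_mono2) auto
      then have "ennreal (min (norm z) (e * b) powr (r * q)) \<le> ennreal ((e * b) powr (r * q))" by (rule ennreal_leI)
      then have "ennreal (norm z powr (- (r * q) - real DIM('a))) * ennreal (min (norm z) (e * b) powr (r * q))
         \<le> ennreal ((e * b) powr (r * q)) * ennreal (norm z powr (- (r * q) - real DIM('a)))"
        by (subst mult.commute) (rule mult_right_mono, auto)
      then show "indicator {e<..<1} (norm z) * ennreal (norm z powr (- (r * q) - real DIM('a))) *
          ennreal (min (norm z) (e * b) powr (r * q)) \<le> ennreal ((e * b) powr (r * q)) * (indicator {e..} (norm z) * ennreal (norm z powr (- (r * q) - real DIM('a))))"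
        by (auto simp: indicator_def)
    qed
    also have "\<dots> = ennreal ((e * b) powr (r * q)) * (\<integral>\<^sup>+z. indicator {e..} (norm (z::'a)) * ennreal (norm z powr (- (r * q) - real DIM('a))) \<partial>lborel)"
      by (rule nn_integral_cmult) measurable
    also have "(\<integral>\<^sup>+z. indicator {e..} (norm (z::'a)) * ennreal (norm z powr (- (r * q) - real DIM('a))) \<partial>lborel)
      = emeasure (sphere_measure :: 'a measure) UNIV * (\<integral>\<^sup>+t. indicator {0<..} t * (indicator {e..} t * ennreal (t powr (- (r * q) - 1))) \<partial>lborel)"
      by (rule nn_integral_radial_powr) simp
    also have "\<dots> = ennreal (?s * (e powr (- (r * q)) / (r * q)))"
      unfolding nn_integral_powr_atLeast[OF rq e(1)]
      using rq by (simp add: sphere_measure.emeasure_eq_measure ennreal_mult[symmetric])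
    also have "ennreal ((e * b) powr (r * q)) * ennreal (?s * (e powr (- (r * q)) / (r * q)))
      = ennreal ((e * b) powr (r * q) * (?s * (e powr (- (r * q)) / (r * q))))"
      using rq by (simp add: ennreal_mult[symmetric])
    also have "(e * b) powr (r * q) * (?s * (e powr (- (r * q)) / (r * q))) = ?s * (b powr (r * q) / (r * q))"
      using e b by (simp add: powr_mult powr_minus field_simps)
    finally show ?thesis .
  qed
  show ?thesis using 1 2 by (auto simp: min_def)
qed

text \<open>Tonelli brings the shell integral inside the integral over \<open>y\<close>, where
  \<open>radial_min_bound\<close> applies; the part of that bound uniform in \<open>y\<close> makes
  \<open>\<bar>k\<bar>\<close> a dominating function.\<close>

lemma remainder_energy_tendsto:
  assumes k: "integrable lborel k" and [measurable]: "E \<in> sets borel"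
  shows "((\<lambda>e. ennreal (1 / \<bar>ln e\<bar>) * energy q r E (\<lambda>x. conv k e x - (\<integral>y. k y \<partial>lborel) *\<^sub>R u x) {e<..<1}) \<longlongrightarrow> 0) (at_right 0)"
proof -
  have [measurable]: "k \<in> borel_measurable borel" using borel_measurable_integrable[OF k] by simp
  have rq: "0 < r * q" using r q by simp
  define S where "S = (\<integral>y. \<bar>k y\<bar> \<partial>lborel)"
  define s where "s = measure (sphere_measure :: 'a measure) UNIV"
  have S: "0 \<le> S" "0 \<le> s" by (auto simp: S_def s_def intro!: integral_nonneg_AE)
  define c where "c = S powr (q - 1) * (2 powr q * M) * s"
  have c: "0 \<le> c" using M(1) S by (simp add: c_def)
  \<comment> \<open>The bound normalised by the logarithm, with \<open>t\<close> in place of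
    \<open>\<bar>ln e\<bar>\<close>, so that the limit becomes dominated convergence at
    infinity.\<close>
  define H where "H t = (\<integral>y. \<bar>k y\<bar> * min 1 (norm y powr (r * q) / (r * q) / t) \<partial>lborel)" for t
  have Hint: "integrable lborel (\<lambda>y. \<bar>k y\<bar> * min 1 (norm y powr (r * q) / (r * q) / t))" if "0 < t" for t
  proof (rule Bochner_Integration.integrable_bound[OF k])
    show "AE y in lborel. norm (\<bar>k y\<bar> * min 1 (norm y powr (r * q) / (r * q) / t)) \<le> norm (k y)"
      using that rq by (intro AE_I2) (auto simp: abs_mult intro!: mult_left_le)
  qed measurable
  have "(H \<longlongrightarrow> (\<integral>y. 0 \<partial>(lborel :: 'a measure))) at_top"
    unfolding H_def
  proof (rule integral_dominated_convergence_at_top)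
    show "integrable lborel (\<lambda>y. \<bar>k y\<bar>)" using k by simp
    show "\<forall>\<^sub>F t in at_top. AE y in lborel. norm (\<bar>k y\<bar> * min 1 (norm y powr (r * q) / (r * q) / t)) \<le> \<bar>k y\<bar>"
      using eventually_gt_at_top[of 0]
      by eventually_elim (use rq in \<open>auto simp: abs_mult intro!: mult_left_le\<close>)
    show "AE y in lborel. ((\<lambda>t. \<bar>k y\<bar> * min 1 (norm y powr (r * q) / (r * q) / t)) \<longlongrightarrow> 0) at_top"
    proof (rule AE_I2)
      fix y :: 'a
      have "((\<lambda>t. norm y powr (r * q) / (r * q) / t) \<longlongrightarrow> 0) at_top"
        by (rule tendsto_divide_0[OF tendsto_const filterlim_at_top_imp_at_infinity[OF filterlim_ident]])
      then have "((\<lambda>t. \<bar>k y\<bar> * min 1 (norm y powr (r * q) / (r * q) / t)) \<longlongrightarrow> \<bar>k y\<bar> * min 1 0) at_top"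
        by (intro tendsto_intros)
      then show "((\<lambda>t. \<bar>k y\<bar> * min 1 (norm y powr (r * q) / (r * q) / t)) \<longlongrightarrow> 0) at_top" by simp
    qed
  qed (use k in auto)
  then have "((\<lambda>e. c * H \<bar>ln e\<bar>) \<longlongrightarrow> c * 0) (at_right 0)"
    by (intro tendsto_mult tendsto_const filterlim_compose[OF _ filterlim_abs_ln_at_right_0]) simp
  then have lim: "((\<lambda>e. ennreal (c * H \<bar>ln e\<bar>)) \<longlongrightarrow> 0) (at_right 0)"
    using tendsto_ennrealI by fastforce
  have "\<forall>\<^sub>F e in at_right (0::real). e \<in> {0<..<1}" by (rule eventually_at_right_real) simp
  then have "\<forall>\<^sub>F e in at_right 0. ennreal (1 / \<bar>ln e\<bar>) * energy q r E (\<lambda>x. conv k e x - (\<integral>y. k y \<partial>lborel) *\<^sub>R u x) {e<..<1} \<le> ennreal (c * H \<bar>ln e\<bar>)"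
  proof eventually_elim
    case (elim e)
    then have e: "0 < e" "e < 1" by auto
    have le: "0 < \<bar>ln e\<bar>" using e by simp
    let ?w = "\<lambda>x. conv k e x - (\<integral>y. k y \<partial>lborel) *\<^sub>R u x"
    let ?g = "\<lambda>z::'a. indicator {e<..<1} (norm z) * ennreal (norm z powr (- (r * q) - real DIM('a)))"
    let ?a = "ennreal (S powr (q - 1)) * ennreal (2 powr q * M)"
    have "energy q r E ?w {e<..<1} \<le> (\<integral>\<^sup>+z. ?a * (\<integral>\<^sup>+y. ennreal \<bar>k y\<bar> * (?g z * ennreal (min (norm z) (e * norm y) powr (r * q))) \<partial>lborel) \<partial>lborel)"
      unfolding energy_def
    proof (rule nn_integral_mono)
      fix z :: 'a
      have "increment q E ?w z \<le> ennreal (S powr (q - 1)) *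
       (\<integral>\<^sup>+y. ennreal \<bar>k y\<bar> * ennreal (2 powr q * M * min (norm z) (e * norm y) powr (r * q)) \<partial>lborel)"
        unfolding S_def using order_trans[OF increment_le conv_remainder_diff[OF k less_imp_le[OF e(1)], of z]] .
      also have "(\<integral>\<^sup>+y. ennreal \<bar>k y\<bar> * ennreal (2 powr q * M * min (norm z) (e * norm y) powr (r * q)) \<partial>lborel)
        = (\<integral>\<^sup>+y. ennreal (2 powr q * M) * (ennreal \<bar>k y\<bar> * ennreal (min (norm z) (e * norm y) powr (r * q))) \<partial>lborel)"
        using M(1) by (intro nn_integral_cong) (simp add: ennreal_mult mult_ac)
      also have "\<dots> = ennreal (2 powr q * M) * (\<integral>\<^sup>+y. ennreal \<bar>k y\<bar> * ennreal (min (norm z) (e * norm y) powr (r * q)) \<partial>lborel)"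
        by (rule nn_integral_cmult) measurable
      finally have "?g z * increment q E ?w z \<le> ?g z * (ennreal (S powr (q - 1)) * (ennreal (2 powr q * M) * (\<integral>\<^sup>+y. ennreal \<bar>k y\<bar> * ennreal (min (norm z) (e * norm y) powr (r * q)) \<partial>lborel)))"
        by (rule mult_left_mono) simp
      also have "\<dots> = ?a * (?g z * (\<integral>\<^sup>+y. ennreal \<bar>k y\<bar> * ennreal (min (norm z) (e * norm y) powr (r * q)) \<partial>lborel))"
        by (simp only: mult_ac)
      also have "?g z * (\<integral>\<^sup>+y. ennreal \<bar>k y\<bar> * ennreal (min (norm z) (e * norm y) powr (r * q)) \<partial>lborel)
        = (\<integral>\<^sup>+y. ?g z * (ennreal \<bar>k y\<bar> * ennreal (min (norm z) (e * norm y) powr (r * q))) \<partial>lborel)"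
        by (rule nn_integral_cmult[symmetric]) measurable
      finally show "?g z * increment q E ?w z \<le> ?a * (\<integral>\<^sup>+y. ennreal \<bar>k y\<bar> * (?g z * ennreal (min (norm z) (e * norm y) powr (r * q))) \<partial>lborel)"
        by (simp only: mult.left_commute)
    qed
    also have "\<dots> = ?a * (\<integral>\<^sup>+z. (\<integral>\<^sup>+y. ennreal \<bar>k y\<bar> * (?g z * ennreal (min (norm z) (e * norm y) powr (r * q))) \<partial>lborel) \<partial>lborel)"
      by (rule nn_integral_cmult) measurable
    also have "(\<integral>\<^sup>+z. (\<integral>\<^sup>+y. ennreal \<bar>k y\<bar> * (?g z * ennreal (min (norm z) (e * norm y) powr (r * q))) \<partial>lborel) \<partial>lborel)
      = (\<integral>\<^sup>+y. (\<integral>\<^sup>+z. ennreal \<bar>k y\<bar> * (?g z * ennreal (min (norm z) (e * norm y) powr (r * q))) \<partial>lborel) \<partial>lborel)"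
      by (rule lborel_pair.Fubini'[symmetric]) measurable
    also have "\<dots> \<le> (\<integral>\<^sup>+y. ennreal (\<bar>k y\<bar> * min 1 (norm y powr (r * q) / (r * q) / \<bar>ln e\<bar>)) * ennreal (s * \<bar>ln e\<bar>) \<partial>lborel)"
    proof (rule nn_integral_mono)
      fix y :: 'a
      have "(\<integral>\<^sup>+z. ennreal \<bar>k y\<bar> * (?g z * ennreal (min (norm z) (e * norm y) powr (r * q))) \<partial>lborel)
        = ennreal \<bar>k y\<bar> * (\<integral>\<^sup>+z. ?g z * ennreal (min (norm z) (e * norm y) powr (r * q)) \<partial>lborel)"
        by (rule nn_integral_cmult) measurable
      also have "\<dots> \<le> ennreal \<bar>k y\<bar> * ennreal (s * min \<bar>ln e\<bar> (norm y powr (r * q) / (r * q)))"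
        unfolding s_def by (intro mult_left_mono radial_min_bound e) auto
      also have "s * min \<bar>ln e\<bar> (norm y powr (r * q) / (r * q)) = min 1 (norm y powr (r * q) / (r * q) / \<bar>ln e\<bar>) * (s * \<bar>ln e\<bar>)"
      proof -
        have "min 1 (norm y powr (r * q) / (r * q) / \<bar>ln e\<bar>) * \<bar>ln e\<bar> = min \<bar>ln e\<bar> (norm y powr (r * q) / (r * q))"
          using le by (simp add: min_mult_distrib_right)
        then show ?thesis by (simp only: mult_ac)
      qed
      also have "ennreal \<bar>k y\<bar> * ennreal (min 1 (norm y powr (r * q) / (r * q) / \<bar>ln e\<bar>) * (s * \<bar>ln e\<bar>))
        = ennreal (\<bar>k y\<bar> * min 1 (norm y powr (r * q) / (r * q) / \<bar>ln e\<bar>)) * ennreal (s * \<bar>ln e\<bar>)"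
      proof -
        have 1: "0 \<le> min 1 (norm y powr (r * q) / (r * q) / \<bar>ln e\<bar>)" using rq le by (auto simp: min_def)
        have 2: "0 \<le> s * \<bar>ln e\<bar>" using S by simp
        show ?thesis unfolding ennreal_mult[OF 1 2] ennreal_mult[OF abs_ge_zero 1] by (simp only: mult.assoc)
      qed
      finally show "(\<integral>\<^sup>+z. ennreal \<bar>k y\<bar> * (?g z * ennreal (min (norm z) (e * norm y) powr (r * q))) \<partial>lborel)
        \<le> ennreal (\<bar>k y\<bar> * min 1 (norm y powr (r * q) / (r * q) / \<bar>ln e\<bar>)) * ennreal (s * \<bar>ln e\<bar>)" .
    qed
    also have "\<dots> = ennreal (H \<bar>ln e\<bar>) * ennreal (s * \<bar>ln e\<bar>)"
      unfolding H_def using Hint[OF le] rq le by (subst nn_integral_multc) (auto simp: nn_integral_eq_integral)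
    finally have "energy q r E ?w {e<..<1} \<le> ?a * (ennreal (H \<bar>ln e\<bar>) * ennreal (s * \<bar>ln e\<bar>))"
      by (simp add: mult_left_mono)
    then have "ennreal (1 / \<bar>ln e\<bar>) * energy q r E ?w {e<..<1} \<le> ennreal (1 / \<bar>ln e\<bar>) * (?a * (ennreal (H \<bar>ln e\<bar>) * ennreal (s * \<bar>ln e\<bar>)))"
      by (rule mult_left_mono) simp
    also have "\<dots> = ennreal (1 / \<bar>ln e\<bar> * (S powr (q - 1) * (2 powr q * M) * (H \<bar>ln e\<bar> * (s * \<bar>ln e\<bar>))))"
    proof -
      have "0 \<le> H \<bar>ln e\<bar>" unfolding H_def using rq le by (auto intro!: integral_nonneg_AE)
      have 1: "0 \<le> H \<bar>ln e\<bar> * (s * \<bar>ln e\<bar>)" "0 \<le> s * \<bar>ln e\<bar>" "0 \<le> 2 powr q * M" "0 \<le> S powr (q - 1)"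
          using \<open>0 \<le> H \<bar>ln e\<bar>\<close> S M(1) by auto
        show ?thesis
          using 1 \<open>0 \<le> H \<bar>ln e\<bar>\<close> by (simp only: ennreal_mult[symmetric] mult_nonneg_nonneg zero_le_divide_1_iff abs_ge_zero)
    qed
    also have "1 / \<bar>ln e\<bar> * (S powr (q - 1) * (2 powr q * M) * (H \<bar>ln e\<bar> * (s * \<bar>ln e\<bar>))) = c * H \<bar>ln e\<bar>"
      using le by (simp add: c_def)
    finally show ?case .
  qed
  then show ?thesis by (intro tendsto_sandwich[OF _ _ tendsto_const lim]) auto
qed

theorem energy_limit:
  assumes wg: "borel_weak_gradient k g" and E[measurable]: "E \<in> sets borel"
    and l: "0 \<le> l" and lim: "(sphere_increment E \<longlongrightarrow> ennreal l) (at_right 0)"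
  shows "((\<lambda>e. ennreal (1 / \<bar>ln e\<bar>) * energy q r E (conv k e) UNIV) \<longlongrightarrow> ennreal (\<bar>\<integral>y. k y \<partial>lborel\<bar> powr q * l)) (at_right 0)"
proof -
  have k: "integrable lborel k" using wg by (auto simp: borel_weak_gradient_def)
  have [measurable]: "k \<in> borel_measurable borel" using borel_measurable_integrable[OF k] by simp
  define m where "m = (\<integral>y. k y \<partial>lborel)"
  define c where "c e = ennreal (1 / \<bar>ln e\<bar>)" for e :: real
  define w where "w e x = conv k e x - m *\<^sub>R u x" for e x
  define v where "v x = m *\<^sub>R u x" for x
  have [measurable]: "w e \<in> borel_measurable borel" "v \<in> borel_measurable borel" for e
    unfolding w_def[abs_def] v_def[abs_def] by measurable
  define A where "A e = c e * energy q r E v {e<..<1}" for e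
  define B where "B e = c e * energy q r E (w e) {e<..<1}" for e
  define G where "G e = c e * energy q r E (conv k e) {e<..<1}" for e
  have A: "(A \<longlongrightarrow> ennreal (\<bar>m\<bar> powr q * l)) (at_right 0)"
  proof -
    have "((\<lambda>e. ennreal (\<bar>m\<bar> powr q) * (c e * energy q r E u {e<..<1})) \<longlongrightarrow> ennreal (\<bar>m\<bar> powr q) * ennreal l) (at_right 0)"
      unfolding c_def by (intro ennreal_tendsto_cmult energy_mid_tendsto E l lim) simp
    moreover have "ennreal (\<bar>m\<bar> powr q) * (c e * energy q r E u {e<..<1}) = A e" for e
      unfolding A_def v_def by (subst energy_scale) (auto simp: mult_ac)
    ultimately show ?thesis using l by (simp add: ennreal_mult)
  qed
  have B: "(B \<longlongrightarrow> 0) (at_right 0)"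
    unfolding B_def c_def w_def m_def by (rule remainder_energy_tendsto[OF k E])
  have up: "G e \<le> ennreal ((1 - t) powr (1 - q)) * A e + ennreal (t powr (1 - q)) * B e" if t: "0 < t" "t < 1" for e t
  proof -
    have "energy q r E (conv k e) {e<..<1} \<le> ennreal ((1 - t) powr (1 - q)) * energy q r E v {e<..<1} + ennreal (t powr (1 - q)) * energy q r E (w e) {e<..<1}"
    proof (rule energy_linear_le)
      fix z
      show "increment q E (conv k e) z \<le> ennreal ((1 - t) powr (1 - q)) * increment q E v z + ennreal (t powr (1 - q)) * increment q E (w e) z"
      proof (rule increment_triangle[OF q t])
        fix x
        have "conv k e (x + z) - conv k e x = (v (x + z) - v x) + (w e (x + z) - w e x)" by (simp add: w_def v_def)
        then show "norm (conv k e (x + z) - conv k e x) \<le> norm (v (x + z) - v x) + norm (w e (x + z) - w e x)"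
          by (metis norm_triangle_ineq)
      qed measurable
    qed measurable
    then have "c e * energy q r E (conv k e) {e<..<1} \<le> c e * (ennreal ((1 - t) powr (1 - q)) * energy q r E v {e<..<1} + ennreal (t powr (1 - q)) * energy q r E (w e) {e<..<1})"
      by (rule mult_left_mono) simp
    then show ?thesis by (simp add: G_def A_def B_def distrib_left mult_ac)
  qed
  have lo: "A e \<le> ennreal ((1 - t) powr (1 - q)) * G e + ennreal (t powr (1 - q)) * B e" if t: "0 < t" "t < 1" for e t
  proof -
    have "energy q r E v {e<..<1} \<le> ennreal ((1 - t) powr (1 - q)) * energy q r E (conv k e) {e<..<1} + ennreal (t powr (1 - q)) * energy q r E (w e) {e<..<1}"
    proof (rule energy_linear_le)
      fix z
      show "increment q E v z \<le> ennreal ((1 - t) powr (1 - q)) * increment q E (conv k e) z + ennreal (t powr (1 - q)) * increment q E (w e) z"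
      proof (rule increment_triangle[OF q t])
        fix x
        have "v (x + z) - v x = (conv k e (x + z) - conv k e x) - (w e (x + z) - w e x)" by (simp add: w_def v_def)
        then show "norm (v (x + z) - v x) \<le> norm (conv k e (x + z) - conv k e x) + norm (w e (x + z) - w e x)"
          by (metis norm_triangle_ineq4)
      qed measurable
    qed measurable
    then have "c e * energy q r E v {e<..<1} \<le> c e * (ennreal ((1 - t) powr (1 - q)) * energy q r E (conv k e) {e<..<1} + ennreal (t powr (1 - q)) * energy q r E (w e) {e<..<1})"
      by (rule mult_left_mono) simp
    then show ?thesis by (simp add: G_def A_def B_def distrib_left mult_ac)
  qed
  have finA: "\<forall>\<^sub>F e in at_right 0. A e < top" by (rule order_tendstoD(2)[OF A]) simp
  have finB: "\<forall>\<^sub>F e in at_right 0. B e < top" by (rule order_tendstoD(2)[OF B]) simp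
  \<comment> \<open>Finiteness of \<open>G e\<close> is read off from the upper inequality; the
    comparison can then be made in the reals.\<close>
  have fin: "\<forall>\<^sub>F e in at_right 0. A e < top \<and> B e < top \<and> G e < top"
    using finA finB
  proof eventually_elim
    case (elim e)
    have "G e < top"
      using order.strict_trans1[OF up[of "1/2" e], of top] elim by (simp add: ennreal_mult_less_top)
    then show ?case using elim by simp
  qed
  have "((\<lambda>e. enn2real (G e)) \<longlongrightarrow> \<bar>m\<bar> powr q * l) (at_right 0)"
  proof (rule weighted_sandwich_tendsto[where q=q])
    show "((\<lambda>e. enn2real (A e)) \<longlongrightarrow> \<bar>m\<bar> powr q * l) (at_right 0)"
      by (rule tendsto_enn2real[OF A]) (use l in simp)
    show "((\<lambda>e. enn2real (B e)) \<longlongrightarrow> 0) (at_right 0)"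
      by (rule tendsto_enn2real) (use B in auto)
    have real: "enn2real x \<le> a * enn2real y + b * enn2real z"
      if "x \<le> ennreal a * y + ennreal b * z" "y < top" "z < top" "0 \<le> a" "0 \<le> b" for x y z :: ennreal and a b
    proof -
      have "enn2real x \<le> enn2real (ennreal a * y + ennreal b * z)"
        using that by (intro enn2real_mono) (auto simp: ennreal_mult_less_top)
      also have "\<dots> = a * enn2real y + b * enn2real z"
        using that by (simp add: enn2real_plus ennreal_mult_less_top enn2real_mult)
      finally show ?thesis .
    qed
    fix t :: real assume t: "0 < t" "t < 1"
    show "\<forall>\<^sub>F e in at_right 0. enn2real (G e) \<le> (1 - t) powr (1 - q) * enn2real (A e) + t powr (1 - q) * enn2real (B e)"
      using fin by eventually_elim (rule real[OF up[OF t]], auto)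
    show "\<forall>\<^sub>F e in at_right 0. enn2real (A e) \<le> (1 - t) powr (1 - q) * enn2real (G e) + t powr (1 - q) * enn2real (B e)"
      using fin by eventually_elim (rule real[OF lo[OF t]], auto)
  qed
  then have "((\<lambda>e. ennreal (enn2real (G e))) \<longlongrightarrow> ennreal (\<bar>m\<bar> powr q * l)) (at_right 0)" by (rule tendsto_ennrealI)
  moreover have "\<forall>\<^sub>F e in at_right 0. ennreal (enn2real (G e)) = G e" using fin by eventually_elim simp
  ultimately have G: "(G \<longlongrightarrow> ennreal (\<bar>m\<bar> powr q * l)) (at_right 0)" by (rule Lim_transform_eventually)
  obtain C1 where C1: "0 \<le> C1" "\<And>e E. energy q r E (conv k e) {1..} \<le> ennreal C1"
    by (rule energy_far_bound[OF k]) (rule that)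
  obtain C2 where C2: "0 \<le> C2" "\<And>e E. 0 < e \<Longrightarrow> energy q r E (conv k e) {..e} \<le> ennreal C2"
    by (rule energy_near_bound[OF wg]) (rule that)
  define T where "T e = c e * (energy q r E (conv k e) {..e} + energy q r E (conv k e) {1..})" for e
  have ev: "\<forall>\<^sub>F e in at_right (0::real). e \<in> {0<..<1}" by (rule eventually_at_right_real) simp
  have "(T \<longlongrightarrow> 0) (at_right 0)"
  proof (rule tendsto_sandwich[OF _ _ tendsto_const])
    show "((\<lambda>e. ennreal ((C2 + C1) / \<bar>ln e\<bar>)) \<longlongrightarrow> 0) (at_right 0)"
      using tendsto_ennrealI[OF tendsto_divide_abs_ln[of "C2 + C1"]] by simp
    show "\<forall>\<^sub>F e in at_right 0. T e \<le> ennreal ((C2 + C1) / \<bar>ln e\<bar>)"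
      using ev
    proof eventually_elim
      case (elim e)
      have "T e \<le> c e * (ennreal C2 + ennreal C1)"
        unfolding T_def using elim by (intro mult_left_mono add_mono C1(2) C2(2)) auto
      also have "\<dots> = ennreal ((C2 + C1) / \<bar>ln e\<bar>)"
        using C1(1) C2(1) by (simp add: c_def ennreal_plus[symmetric] ennreal_mult[symmetric] del: ennreal_plus)
      finally show ?case .
    qed
  qed simp
  from tendsto_add[OF G this]
  have "((\<lambda>e. G e + T e) \<longlongrightarrow> ennreal (\<bar>m\<bar> powr q * l)) (at_right 0)" by simp
  moreover have "\<forall>\<^sub>F e in at_right 0. G e + T e = c e * energy q r E (conv k e) UNIV"
    using ev
  proof eventually_elim
    case (elim e)
    have "energy q r E (conv k e) UNIV = energy q r E (conv k e) {e<..<1} + (energy q r E (conv k e) {..e} + energy q r E (conv k e) {1..})"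
      by (rule energy_split[OF E]) (measurable, use elim in auto)
    then show ?case by (simp add: G_def T_def distrib_left)
  qed
  ultimately have "((\<lambda>e. c e * energy q r E (conv k e) UNIV) \<longlongrightarrow> ennreal (\<bar>m\<bar> powr q * l)) (at_right 0)"
    by (rule Lim_transform_eventually)
  then show ?thesis by (simp add: c_def m_def)
qed

end

section \<open>Passing to Borel representatives\<close>

lemma nn_integral_lebesgue_AE_eq:
  fixes f :: "'a::euclidean_space \<Rightarrow> ennreal"
  assumes "AE x in lborel. f x = g x"
  shows "(\<integral>\<^sup>+x. f x \<partial>lebesgue) = (\<integral>\<^sup>+x. g x \<partial>lborel)"
  unfolding nn_integral_completion by (rule nn_integral_cong_AE[OF assms])

lemma measurable_lebesgue_AE:
  fixes f :: "'a::euclidean_space \<Rightarrow> 'b::euclidean_space"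
  assumes g: "g \<in> borel_measurable borel" and ae: "AE x in lborel. f x = g x"
  shows "f \<in> borel_measurable lebesgue"
proof (rule measurableI)
  fix A :: "'b set" assume A: "A \<in> sets borel"
  have 1: "AE x in lebesgue. x \<in> g -` A \<longleftrightarrow> x \<in> f -` A"
    by (rule AE_completion, use ae in eventually_elim) auto
  have "g -` A \<inter> space borel \<in> sets borel" by (rule measurable_sets[OF g A])
  then have 2: "g -` A \<in> sets lebesgue" by simp
  show "f -` A \<inter> space lebesgue \<in> sets lebesgue"
    using completion.in_sets_AE[OF 1 2] by simp
qed simp

lemma integral_lebesgue_AE_eq:
  fixes f :: "'a::euclidean_space \<Rightarrow> 'b::euclidean_space"
  assumes g: "g \<in> borel_measurable borel" and ae: "AE x in lborel. f x = g x"
  shows "(\<integral>x. f x \<partial>lebesgue) = (\<integral>x. g x \<partial>lborel)"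
proof -
  have "(\<integral>x. f x \<partial>lebesgue) = (\<integral>x. g x \<partial>lebesgue)"
    by (rule integral_cong_AE[OF measurable_lebesgue_AE[OF g ae] _ AE_completion[OF ae]])
      (use g in \<open>simp add: measurable_completion\<close>)
  also have "\<dots> = (\<integral>x. g x \<partial>lborel)" using g by (intro integral_completion) simp
  finally show ?thesis .
qed

text \<open>Preimages of null sets under invertible dilations and translations are null; this
  carries almost-everywhere identities over to shifted and scaled arguments.\<close>

lemma AE_lborel_affine:
  fixes a :: "'a::euclidean_space"
  assumes ae: "AE x in lborel. P x" and c: "c \<noteq> 0"
  shows "AE x in lborel. P (a + c *\<^sub>R x)"
proof -
  obtain N where N: "{x. \<not> P x} \<subseteq> N" "N \<in> null_sets lborel"
    using ae by (auto elim!: AE_E simp: null_sets_def)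
  have [measurable]: "N \<in> sets borel" using N by auto
  have "0 = (\<integral>\<^sup>+x. indicator N x \<partial>lborel)" using null_setsD1[OF N(2)] by simp
  also have "\<dots> = (\<integral>\<^sup>+x. indicator N (a + x) \<partial>lborel)"
    by (rule nn_integral_lborel_translate[symmetric]) simp
  also have "\<dots> = ennreal (\<bar>c\<bar> ^ DIM('a)) * (\<integral>\<^sup>+x. indicator N (a + c *\<^sub>R x) \<partial>lborel)"
    by (rule nn_integral_lborel_scale[OF _ c]) simp
  finally have "ennreal (\<bar>c\<bar> ^ DIM('a)) = 0 \<or> (\<integral>\<^sup>+x. indicator N (a + c *\<^sub>R x) \<partial>lborel) = (0::ennreal)"
    by (metis mult_eq_0_iff)
  moreover have "ennreal (\<bar>c\<bar> ^ DIM('a)) \<noteq> 0"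
    unfolding ennreal_eq_0_iff not_le using c by simp
  ultimately have "(\<integral>\<^sup>+x. indicator N (a + c *\<^sub>R x) \<partial>lborel) = (0::ennreal)" by blast
  then have "AE x in lborel. indicator N (a + c *\<^sub>R x) = (0::ennreal)"
    by (subst (asm) nn_integral_0_iff_AE) auto
  then show ?thesis
    by eventually_elim (use N in \<open>auto simp: indicator_def split: if_splits\<close>)
qed

text \<open>By polar coordinates the vectors above a null set of radii form a null set; a kernel and
  its Borel version agree only for almost every radius.\<close>

lemma AE_lborel_norm:
  assumes ae: "AE t in lborel. P (t::real)"
  shows "AE z in (lborel :: 'a::euclidean_space measure). P (norm z)"
proof -
  obtain N where N: "{x. \<not> P x} \<subseteq> N" "N \<in> null_sets lborel"
    using ae by (auto elim!: AE_E simp: null_sets_def)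
  have [measurable]: "N \<in> sets borel" using N by auto
  have "(\<integral>\<^sup>+t. indicator {0<..} t * ennreal (t ^ (DIM('a) - 1)) * indicator N t \<partial>lborel) = (\<integral>\<^sup>+t. 0 \<partial>(lborel::real measure))"
    by (rule nn_integral_cong_AE) (use AE_not_in[OF N(2)] in eventually_elim, auto)
  then have "(\<integral>\<^sup>+z. indicator N (norm (z::'a)) \<partial>lborel) = (0::ennreal)"
    by (subst nn_integral_radial) auto
  then have "AE z in lborel. indicator N (norm (z::'a)) = (0::ennreal)"
    by (subst (asm) nn_integral_0_iff_AE) auto
  then show ?thesis
    by eventually_elim (use N in \<open>auto simp: indicator_def split: if_splits\<close>)
qed

text \<open>Substitution of \<open>y + z\<close> for \<open>x\<close> in the inner integral; the
  general weight \<open>w\<close> covers both the Gagliardo weight and the kernels.\<close>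

lemma double_integral_increment:
  fixes v :: "'a::euclidean_space \<Rightarrow> 'b::euclidean_space"
  assumes [measurable]: "E \<in> sets borel" "v \<in> borel_measurable borel" "w \<in> borel_measurable borel"
  shows "(\<integral>\<^sup>+y. (\<integral>\<^sup>+x. w (x - y) * (indicator E y * (indicator E x * ennreal (norm (v x - v y) powr q))) \<partial>lborel) \<partial>lborel)
    = (\<integral>\<^sup>+z. w z * increment q E v z \<partial>lborel)"
proof -
  have "(\<integral>\<^sup>+x. w (x - y) * (indicator E y * (indicator E x * ennreal (norm (v x - v y) powr q))) \<partial>lborel)
    = (\<integral>\<^sup>+z. w z * (indicator E y * (indicator E (y + z) * ennreal (norm (v (y + z) - v y) powr q))) \<partial>lborel)" for y
    by (subst nn_integral_lborel_translate[symmetric, where c=y]) auto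
  then have "(\<integral>\<^sup>+y. (\<integral>\<^sup>+x. w (x - y) * (indicator E y * (indicator E x * ennreal (norm (v x - v y) powr q))) \<partial>lborel) \<partial>lborel)
    = (\<integral>\<^sup>+y. (\<integral>\<^sup>+z. w z * (indicator E y * (indicator E (y + z) * ennreal (norm (v (y + z) - v y) powr q))) \<partial>lborel) \<partial>lborel)"
    by simp
  also have "\<dots> = (\<integral>\<^sup>+z. (\<integral>\<^sup>+y. w z * (indicator E y * (indicator E (y + z) * ennreal (norm (v (y + z) - v y) powr q))) \<partial>lborel) \<partial>lborel)"
    by (rule lborel_pair.Fubini') measurable
  also have "\<dots> = (\<integral>\<^sup>+z. w z * increment q E v z \<partial>lborel)"
    unfolding increment_def by (intro nn_integral_cong nn_integral_cmult) measurable
  finally show ?thesis .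
qed

lemma ennreal_powr_powr_inverse:
  assumes "0 < q"
  shows "ennreal_powr (ennreal_powr x (1 / q)) q = x"
  using assms by (cases x) (auto simp: ennreal_powr_def powr_powr)

lemma gagliardo_seminorm_powr:
  fixes v :: "'a::euclidean_space \<Rightarrow> 'b::euclidean_space"
  assumes q: "0 < q" and [measurable]: "E' \<in> sets borel" "v \<in> borel_measurable borel"
    and E: "AE x in lborel. x \<in> E \<longleftrightarrow> x \<in> E'"
  shows "ennreal_powr (gagliardo_seminorm r q E v) q = energy q r E' v UNIV"
proof -
  let ?w = "\<lambda>z::'a. ennreal (norm z powr (- (r * q) - real DIM('a)))"
  \<comment> \<open>Valid on the diagonal too, where both sides are 0 because
    \<open>0 powr a = 0\<close>.\<close>
  have w: "ennreal (norm (v x - v y) powr q / norm (x - y) powr (real DIM('a) + r * q)) = ?w (x - y) * ennreal (norm (v x - v y) powr q)" for x y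
  proof -
    have "- (r * q) - real DIM('a) = - (real DIM('a) + r * q)" by simp
    then have "norm (x - y) powr (- (r * q) - real DIM('a)) = inverse (norm (x - y) powr (real DIM('a) + r * q))"
      by (simp only: powr_minus)
    then show ?thesis by (simp add: ennreal_mult[symmetric] divide_inverse mult.commute)
  qed
  have "(\<integral>\<^sup>+ y\<in>E. (\<integral>\<^sup>+ x\<in>E. ennreal (norm (v x - v y) powr q / norm (x - y) powr (real DIM('a) + r * q)) \<partial>lebesgue) \<partial>lebesgue)
    = (\<integral>\<^sup>+y. (\<integral>\<^sup>+x. ?w (x - y) * (indicator E' y * (indicator E' x * ennreal (norm (v x - v y) powr q))) \<partial>lborel) \<partial>lborel)"
  proof (rule nn_integral_lebesgue_AE_eq)
    show "AE y in lborel. (\<integral>\<^sup>+ x\<in>E. ennreal (norm (v x - v y) powr q / norm (x - y) powr (real DIM('a) + r * q)) \<partial>lebesgue) * indicator E y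
      = (\<integral>\<^sup>+x. ?w (x - y) * (indicator E' y * (indicator E' x * ennreal (norm (v x - v y) powr q))) \<partial>lborel)"
      using E
    proof eventually_elim
      case (elim y)
      have "(\<integral>\<^sup>+ x\<in>E. ennreal (norm (v x - v y) powr q / norm (x - y) powr (real DIM('a) + r * q)) \<partial>lebesgue)
        = (\<integral>\<^sup>+x. ?w (x - y) * (indicator E' x * ennreal (norm (v x - v y) powr q)) \<partial>lborel)"
        by (rule nn_integral_lebesgue_AE_eq, use E in eventually_elim) (auto simp: w indicator_def)
      then show ?case using elim by (auto simp: indicator_def)
    qed
  qed
  also have "\<dots> = (\<integral>\<^sup>+z. ?w z * increment q E' v z \<partial>lborel)"
    by (rule double_integral_increment) measurable
  also have "\<dots> = energy q r E' v UNIV" by (simp add: energy_def)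
  finally show ?thesis using q by (simp add: gagliardo_seminorm_def ennreal_powr_powr_inverse)
qed

lemma sets_lebesgue_borel_version:
  fixes E :: "'a::euclidean_space set"
  assumes "E \<in> sets lebesgue"
  obtains E' where "E' \<in> sets borel" "AE x in lborel. x \<in> E \<longleftrightarrow> x \<in> E'"
proof -
  have "main_part lborel E \<in> sets borel" "E = main_part lborel E \<union> null_part lborel E"
    using main_part_sets[OF assms] main_part_null_part_Un[OF assms] by auto
  moreover obtain N where "N \<in> null_sets lborel" "null_part lborel E \<subseteq> N"
    using null_part[OF assms] by auto
  ultimately show ?thesis
    using AE_not_in[of N lborel] by (intro that[of "main_part lborel E"]) (auto elim!: eventually_mono)
qed

lemma besov_space_borel_version:
  fixes u :: "'a::euclidean_space \<Rightarrow> 'b::euclidean_space"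
  assumes q: "1 \<le> q" and r: "0 < r" "r < 1" and u: "u \<in> besov_space r q"
  obtains u' M N0 where "AE x in lborel. u x = u' x" "besov_function u' q r M N0"
proof -
  have "u \<in> borel_measurable lebesgue" using u by (simp add: besov_space_def)
  then obtain u' where [measurable]: "u' \<in> borel_measurable borel" and ae: "AE x in lborel. u x = u' x"
    by (rule borel_version)
  let ?N = "\<integral>\<^sup>+ x. ennreal (norm (u x) powr q) \<partial>lebesgue"
  let ?D = "\<lambda>h. \<integral>\<^sup>+ x. ennreal (norm (u (x + h) - u x) powr q / norm h powr (r * q)) \<partial>lebesgue"
  let ?S = "SUP h\<in>UNIV - {0}. ?D h"
  have N: "?N < top" and S: "?S < top" using u by (auto simp: besov_space_def)
  have "besov_function u' q r (enn2real ?S) (enn2real ?N)"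
  proof
    have "(\<integral>\<^sup>+x. ennreal (norm (u' x) powr q) \<partial>lborel) = ?N"
      by (rule nn_integral_lebesgue_AE_eq[symmetric], use ae in eventually_elim) simp
    then show "(\<integral>\<^sup>+x. ennreal (norm (u' x) powr q) \<partial>lborel) \<le> ennreal (enn2real ?N)" using N by simp
    fix h :: 'a
    show "(\<integral>\<^sup>+x. ennreal (norm (u' (x + h) - u' x) powr q) \<partial>lborel) \<le> ennreal (enn2real ?S * norm h powr (r * q))"
    proof (cases "h = 0")
      case False
      have aeh: "AE x in lborel. u (x + h) = u' (x + h)"
        using AE_lborel_affine[OF ae, of 1 h] by (simp add: add.commute)
      have "?D h = (\<integral>\<^sup>+x. ennreal (norm (u' (x + h) - u' x) powr q) / ennreal (norm h powr (r * q)) \<partial>lborel)"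
        by (rule nn_integral_lebesgue_AE_eq, use ae aeh in eventually_elim) (use False in \<open>simp add: divide_ennreal\<close>)
      also have "\<dots> = (\<integral>\<^sup>+x. ennreal (norm (u' (x + h) - u' x) powr q) \<partial>lborel) / ennreal (norm h powr (r * q))"
        by (rule nn_integral_divide) measurable
      finally have D: "?D h = (\<integral>\<^sup>+x. ennreal (norm (u' (x + h) - u' x) powr q) \<partial>lborel) / ennreal (norm h powr (r * q))" .
      have "?D h \<le> ?S" by (rule SUP_upper) (use False in simp)
      also have "\<dots> = ennreal (enn2real ?S)" using S by simp
      finally have "?D h * ennreal (norm h powr (r * q)) \<le> ennreal (enn2real ?S) * ennreal (norm h powr (r * q))"
        by (rule mult_right_mono) simp
      moreover have "?D h * ennreal (norm h powr (r * q)) = (\<integral>\<^sup>+x. ennreal (norm (u' (x + h) - u' x) powr q) \<partial>lborel)"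
        unfolding D ennreal_divide_times using False by (subst ennreal_divide_self) auto
      ultimately show ?thesis by (simp add: ennreal_mult)
    qed simp
  qed (use q r in auto)
  with ae show ?thesis by (rule that)
qed

text \<open>For each fixed \<open>x\<close> the two integrands agree almost everywhere in the
  integration variable, so equality holds at every point and the mollified function does not depend
  on the representatives.\<close>

lemma (in besov_function) mollify_eq_conv:
  assumes k[measurable]: "k \<in> borel_measurable borel" and \<eta>: "AE x in lborel. \<eta> x = k x"
    and v: "AE x in lborel. v x = u x" and e: "0 < e"
  shows "mollify \<eta> v e x = conv k e x"
proof -
  have "AE y in lborel. v (x + (- e) *\<^sub>R y) = u (x + (- e) *\<^sub>R y)"
    by (rule AE_lborel_affine[OF v]) (use e in simp)
  then have "AE y in lborel. \<eta> y *\<^sub>R v (x - e *\<^sub>R y) = k y *\<^sub>R u (x - e *\<^sub>R y)"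
    using \<eta> by eventually_elim simp
  then show ?thesis
    unfolding mollify_def conv_def by (intro integral_lebesgue_AE_eq) measurable
qed

text \<open>Null sets do not affect the inner integral for any single direction \<open>n\<close>, so
  no exceptional set of directions arises and the Hausdorff integral is that of a Borel
  function.\<close>

lemma (in besov_function) sphere_increment_eq:
  assumes E'[measurable]: "E' \<in> sets borel" and E: "AE x in lborel. x \<in> E \<longleftrightarrow> x \<in> E'"
    and v: "AE x in lborel. v x = u x" and t: "0 < t"
  shows "(\<integral>\<^sup>+ n\<in>sphere 0 1. (\<integral>\<^sup>+ x\<in>E. ennreal (indicat_real E (x + t *\<^sub>R n) *
                (norm (v (x + t *\<^sub>R n) - v x) powr q / t powr (r * q))) \<partial>lebesgue)
             \<partial>hausdorff_measure (DIM('a) - 1)) = sphere_increment E' t"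
proof -
  have "(\<integral>\<^sup>+ x\<in>E. ennreal (indicat_real E (x + t *\<^sub>R n) * (norm (v (x + t *\<^sub>R n) - v x) powr q / t powr (r * q))) \<partial>lebesgue)
    = ennreal (t powr (- (r * q))) * increment q E' u (t *\<^sub>R n)" for n
  proof -
    have sh: "AE x in lborel. P (x + t *\<^sub>R n)" if "AE x in lborel. P x" for P
      using AE_lborel_affine[OF that, of 1 "t *\<^sub>R n"] by (simp add: add.commute)
    have "(\<integral>\<^sup>+ x\<in>E. ennreal (indicat_real E (x + t *\<^sub>R n) * (norm (v (x + t *\<^sub>R n) - v x) powr q / t powr (r * q))) \<partial>lebesgue)
      = (\<integral>\<^sup>+x. ennreal (t powr (- (r * q))) * (indicator E' x * (indicator E' (x + t *\<^sub>R n) * ennreal (norm (u (x + t *\<^sub>R n) - u x) powr q))) \<partial>lborel)"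
      by (rule nn_integral_lebesgue_AE_eq, use E sh[OF E] v sh[OF v] in eventually_elim)
        (auto simp: indicator_def ennreal_mult[symmetric] powr_minus divide_inverse mult.commute)
    also have "\<dots> = ennreal (t powr (- (r * q))) * increment q E' u (t *\<^sub>R n)"
      unfolding increment_def by (rule nn_integral_cmult) measurable
    finally show ?thesis .
  qed
  then show ?thesis
    unfolding sphere_increment_def by (simp only:) (rule nn_integral_hausdorff_sphere, measurable)
qed

section \<open>Kernels\<close>

text \<open>Measurability is given on the half-line only, so extension by 0 precedes the choice of a
  representative.\<close>

lemma kernel_borel_version:
  fixes \<rho> :: "real \<Rightarrow> real"
  assumes "\<rho> \<in> borel_measurable (lebesgue_on {0<..})"
  obtains \<rho>' where "\<rho>' \<in> borel_measurable borel" "AE t in lborel. 0 < t \<longrightarrow> \<rho> t = \<rho>' t"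
proof -
  have "(\<lambda>t. indicator {0<..} t *\<^sub>R \<rho> t) \<in> borel_measurable lebesgue"
    using assms by (subst (asm) borel_measurable_restrict_space_iff) auto
  then obtain \<rho>' where "\<rho>' \<in> borel_measurable borel" and ae: "AE t in lborel. indicator {0<..} t *\<^sub>R \<rho> t = \<rho>' t"
    by (rule borel_version)
  moreover from ae have "AE t in lborel. 0 < t \<longrightarrow> \<rho> t = \<rho>' t"
    by eventually_elim auto
  ultimately show ?thesis using that by blast
qed

context besov_function
begin

text \<open>Polar coordinates turn the kernel functional into a radial average of
  \<open>sphere_increment\<close>, the form treated by \<open>average_tendsto\<close>.\<close>

lemma kernel_double_integral:
  assumes E'[measurable]: "E' \<in> sets borel" and E: "AE x in lborel. x \<in> E \<longleftrightarrow> x \<in> E'"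
    and v: "AE x in lborel. v x = u x"
    and \<rho>'[measurable]: "\<rho>' \<in> borel_measurable borel" and \<rho>: "AE t in lborel. 0 < t \<longrightarrow> \<rho> t = \<rho>' t"
    and nn: "\<And>t. 0 < t \<Longrightarrow> 0 \<le> \<rho> t"
  shows "(\<integral>\<^sup>+ x\<in>E. (\<integral>\<^sup>+ y\<in>E. ennreal (\<rho> (norm (x - y)) * (norm (v x - v y) powr q / norm (x - y) powr (r * q))) \<partial>lebesgue) \<partial>lebesgue)
    = (\<integral>\<^sup>+t. indicator {0<..} t * ennreal (t ^ (DIM('a) - 1)) * ennreal (\<rho>' t) * sphere_increment E' t \<partial>lborel)"
proof -
  define w where "w z = ennreal (\<rho>' (norm z)) * ennreal (norm z powr (- (r * q)))" for z :: 'a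
  have [measurable]: "w \<in> borel_measurable borel" unfolding w_def[abs_def] by measurable
  have ae: "AE z in (lborel :: 'a measure). 0 < norm z \<longrightarrow> \<rho> (norm z) = \<rho>' (norm z)"
    by (rule AE_lborel_norm[OF \<rho>])
  have "(\<integral>\<^sup>+ x\<in>E. (\<integral>\<^sup>+ y\<in>E. ennreal (\<rho> (norm (x - y)) * (norm (v x - v y) powr q / norm (x - y) powr (r * q))) \<partial>lebesgue) \<partial>lebesgue)
    = (\<integral>\<^sup>+x. (\<integral>\<^sup>+y. w (y - x) * (indicator E' x * (indicator E' y * ennreal (norm (u y - u x) powr q))) \<partial>lborel) \<partial>lborel)"
  proof (rule nn_integral_lebesgue_AE_eq)
    show "AE x in lborel. (\<integral>\<^sup>+ y\<in>E. ennreal (\<rho> (norm (x - y)) * (norm (v x - v y) powr q / norm (x - y) powr (r * q))) \<partial>lebesgue) * indicator E x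
      = (\<integral>\<^sup>+y. w (y - x) * (indicator E' x * (indicator E' y * ennreal (norm (u y - u x) powr q))) \<partial>lborel)"
      using E v
    proof eventually_elim
      case (elim x)
      have "AE y in lborel. 0 < norm (- x + y) \<longrightarrow> \<rho> (norm (- x + y)) = \<rho>' (norm (- x + y))"
        using AE_lborel_affine[OF ae, of 1 "- x"] by simp
      then have aex: "AE y in lborel. 0 < norm (x - y) \<longrightarrow> \<rho> (norm (x - y)) = \<rho>' (norm (x - y))"
        by (simp add: norm_minus_commute)
      have "(\<integral>\<^sup>+ y\<in>E. ennreal (\<rho> (norm (x - y)) * (norm (v x - v y) powr q / norm (x - y) powr (r * q))) \<partial>lebesgue)
        = (\<integral>\<^sup>+y. w (y - x) * (indicator E' y * ennreal (norm (u y - u x) powr q)) \<partial>lborel)"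
      proof (rule nn_integral_lebesgue_AE_eq, use E v aex in eventually_elim)
        case (elim y)
        have "ennreal (\<rho> (norm (x - y)) * (norm (v x - v y) powr q / norm (x - y) powr (r * q)))
          = w (y - x) * ennreal (norm (u y - u x) powr q)"
        proof (cases "x = y")
          case False
          then have "\<rho> (norm (x - y)) = \<rho>' (norm (x - y))" "0 \<le> \<rho>' (norm (x - y))"
            using elim nn[of "norm (x - y)"] by auto
          then show ?thesis
            using elim \<open>v x = u x\<close> unfolding w_def norm_minus_commute[of y x] norm_minus_commute[of "u y" "u x"]
            by (simp add: ennreal_mult[symmetric] powr_minus divide_inverse mult_ac)
        qed (use q in simp)
        then show ?case using elim by (auto simp: indicator_def)
      qed
      then show ?case using elim by (auto simp: indicator_def)
    qed
  qed
  also have "\<dots> = (\<integral>\<^sup>+z. w z * increment q E' u z \<partial>lborel)"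
    by (rule double_integral_increment) measurable
  also have "\<dots> = (\<integral>\<^sup>+t. indicator {0<..} t * ennreal (t ^ (DIM('a) - 1)) * (\<integral>\<^sup>+n. w (t *\<^sub>R n) * increment q E' u (t *\<^sub>R n) \<partial>sphere_measure) \<partial>lborel)"
    by (rule polar_coordinates) measurable
  also have "\<dots> = (\<integral>\<^sup>+t. indicator {0<..} t * ennreal (t ^ (DIM('a) - 1)) * ennreal (\<rho>' t) * sphere_increment E' t \<partial>lborel)"
  proof (rule nn_integral_cong)
    fix t :: real
    show "indicator {0<..} t * ennreal (t ^ (DIM('a) - 1)) * (\<integral>\<^sup>+n. w (t *\<^sub>R n) * increment q E' u (t *\<^sub>R n) \<partial>sphere_measure)
      = indicator {0<..} t * ennreal (t ^ (DIM('a) - 1)) * ennreal (\<rho>' t) * sphere_increment E' t"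
    proof (cases "0 < t")
      case True
      have "(\<integral>\<^sup>+n. w (t *\<^sub>R n) * increment q E' u (t *\<^sub>R n) \<partial>sphere_measure)
        = (\<integral>\<^sup>+n. ennreal (\<rho>' t) * (ennreal (t powr (- (r * q))) * increment q E' u (t *\<^sub>R n)) \<partial>sphere_measure)"
        using AE_sphere_measure[where 'a='a] True
        by (intro nn_integral_cong_AE) (auto elim!: eventually_mono simp: w_def mult.assoc)
      also have "\<dots> = ennreal (\<rho>' t) * sphere_increment E' t"
        unfolding sphere_increment_def by (rule nn_integral_cmult) measurable
      finally show ?thesis by (simp only: mult.assoc)
    qed simp
  qed
  finally show ?thesis .
qed

lemma kernel_double_integral_tendsto:
  assumes E'[measurable]: "E' \<in> sets borel" and E: "AE x in lborel. x \<in> E \<longleftrightarrow> x \<in> E'"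
    and v: "AE x in lborel. v x = u x" and ker: "is_kernel TYPE('a) a \<rho>"
    and l: "0 \<le> l" and lim: "(sphere_increment E' \<longlongrightarrow> ennreal l) (at_right 0)"
  shows "((\<lambda>e. \<integral>\<^sup>+ x\<in>E. (\<integral>\<^sup>+ y\<in>E. ennreal (\<rho> e (norm (x - y)) * (norm (v x - v y) powr q / norm (x - y) powr (r * q)))
            \<partial>lebesgue) \<partial>lebesgue) \<longlongrightarrow> ennreal (1 / measure (sphere_measure :: 'a measure) UNIV * l)) (at_right 0)"
proof -
  define s where "s = measure (sphere_measure :: 'a measure) UNIV"
  have s: "0 < s" using sphere_measure_UNIV_pos[where 'a='a] by (simp add: s_def sphere_measure.emeasure_eq_measure)
  have a: "0 < a" and ker1: "\<And>e. 0 < e \<Longrightarrow> ereal e < a \<Longrightarrow> \<rho> e \<in> borel_measurable (lebesgue_on {0<..})"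
    "\<And>e t. 0 < e \<Longrightarrow> ereal e < a \<Longrightarrow> 0 < t \<Longrightarrow> 0 \<le> \<rho> e t"
    "\<And>e. 0 < e \<Longrightarrow> ereal e < a \<Longrightarrow> (\<integral>\<^sup>+ z. ennreal (\<rho> e (norm (z :: 'a))) \<partial>lebesgue) = 1"
    and tail: "\<And>d. 0 < d \<Longrightarrow> ((\<lambda>e. \<integral>\<^sup>+ t\<in>{d<..}. ennreal (\<rho> e t * t ^ (DIM('a) - 1)) \<partial>lebesgue) \<longlongrightarrow> 0) (at_right 0)"
    using ker unfolding is_kernel_def by auto
  \<comment> \<open>The implications make the claim hold for every \<open>e\<close>, so that a whole
    family \<open>R\<close> can be chosen at once.\<close>
  have "\<exists>g. 0 < e \<longrightarrow> ereal e < a \<longrightarrow> g \<in> borel_measurable borel \<and> (AE t in lborel. 0 < t \<longrightarrow> \<rho> e t = g t)" for e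
    using kernel_borel_version[OF ker1(1)[of e]] by metis
  then obtain R where R: "\<And>e. 0 < e \<Longrightarrow> ereal e < a \<Longrightarrow> R e \<in> borel_measurable borel"
    "\<And>e. 0 < e \<Longrightarrow> ereal e < a \<Longrightarrow> AE t in lborel. 0 < t \<longrightarrow> \<rho> e t = R e t"
    by metis
  define P where "P e t = indicator {0<..} t * ennreal (t ^ (DIM('a) - 1)) * ennreal (R e t)" for e t :: real
  \<comment> \<open>A real bound is interposed because \<open>a\<close> may be infinite.\<close>
  obtain b where b: "0 < b" "ereal b < a" using ereal_dense2[OF a] by (auto simp: zero_ereal_def)
  have ev: "\<forall>\<^sub>F e in at_right (0::real). 0 < e \<and> ereal e < a"
    using eventually_at_right_real[OF b(1)]
    by eventually_elim (use b(2) in \<open>auto intro: less_trans[of _ "ereal b"]\<close>)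
  have "((\<lambda>e. \<integral>\<^sup>+t. P e t * sphere_increment E' t \<partial>lborel) \<longlongrightarrow> ennreal (1 / s * l)) (at_right 0)"
  proof (rule average_tendsto[where P=P and \<Phi>="sphere_increment E'" and m="1 / s", OF _ _ sphere_increment_le lim l])
    show "\<forall>\<^sub>F e in at_right 0. P e \<in> borel_measurable borel \<and> (\<forall>t\<le>0. P e t = 0) \<and> (\<integral>\<^sup>+t. P e t \<partial>lborel) = ennreal (1 / s)"
      using ev
    proof eventually_elim
      case (elim e)
      then have [measurable]: "R e \<in> borel_measurable borel" and aeR: "AE t in lborel. 0 < t \<longrightarrow> \<rho> e t = R e t"
        using R by auto
      have "1 = (\<integral>\<^sup>+ z. ennreal (\<rho> e (norm (z :: 'a))) \<partial>lebesgue)" using ker1(3) elim by simp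
      also have "\<dots> = (\<integral>\<^sup>+ z. ennreal (R e (norm (z :: 'a))) \<partial>lborel)"
        by (rule nn_integral_lebesgue_AE_eq,
            use AE_lborel_norm[OF aeR, where 'a='a] AE_lborel_singleton[of "0::'a"] in eventually_elim) auto
      also have "\<dots> = ennreal s * (\<integral>\<^sup>+t. P e t \<partial>lborel)"
        unfolding P_def s_def sphere_measure.emeasure_eq_measure[symmetric] by (rule nn_integral_radial) measurable
      \<comment> \<open>Unit mass over the whole space becomes mass \<open>1 / s\<close> of the
        radial weight, as the spherical part contributes the factor \<open>s\<close>.\<close>
      finally have 1: "ennreal s * (\<integral>\<^sup>+t. P e t \<partial>lborel) = 1" ..
      have "(\<integral>\<^sup>+t. P e t \<partial>lborel) = ennreal (1 / s)"
      proof (cases "\<integral>\<^sup>+t. P e t \<partial>lborel")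
        case (real x)
        then have "ennreal (s * x) = ennreal 1" using 1 s by (simp add: ennreal_mult)
        then have "s * x = 1" using real s by (subst (asm) ennreal_inj) auto
        then have "x = 1 / s" using s by (simp add: field_simps)
        then show ?thesis using real by simp
      next
        case top
        then show ?thesis using 1 s by (simp add: ennreal_mult_top)
      qed
      moreover have "P e \<in> borel_measurable borel" unfolding P_def[abs_def] by measurable
      ultimately show ?case by (simp add: P_def)
    qed
    fix d :: real assume d: "0 < d"
    show "((\<lambda>e. \<integral>\<^sup>+t. indicator {d<..} t * P e t \<partial>lborel) \<longlongrightarrow> 0) (at_right 0)"
    proof (rule Lim_transform_eventually[OF tail[OF d]])
      show "\<forall>\<^sub>F e in at_right 0. (\<integral>\<^sup>+ t\<in>{d<..}. ennreal (\<rho> e t * t ^ (DIM('a) - 1)) \<partial>lebesgue) = (\<integral>\<^sup>+t. indicator {d<..} t * P e t \<partial>lborel)"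
        using ev
      proof eventually_elim
        case (elim e)
        note e = elim
        have aeR: "AE t in lborel. 0 < t \<longrightarrow> \<rho> e t = R e t" using R(2) e by simp
        show ?case
        proof (rule nn_integral_lebesgue_AE_eq, use aeR in eventually_elim)
          case (elim t)
          show ?case
          proof (cases "d < t")
            case True
            then have "ennreal (\<rho> e t * t ^ (DIM('a) - 1)) = ennreal (t ^ (DIM('a) - 1)) * ennreal (R e t)"
              using elim e d ker1(2)[of e t] by (simp add: ennreal_mult mult.commute)
            then show ?thesis using True d by (simp add: P_def del: ennreal_power)
          qed simp
        qed
      qed
    qed
  qed (use M(1) s in auto)
  then show ?thesis
    unfolding s_def
  proof (rule Lim_transform_eventually)
    show "\<forall>\<^sub>F e in at_right 0. (\<integral>\<^sup>+t. P e t * sphere_increment E' t \<partial>lborel)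
      = (\<integral>\<^sup>+ x\<in>E. (\<integral>\<^sup>+ y\<in>E. ennreal (\<rho> e (norm (x - y)) * (norm (v x - v y) powr q / norm (x - y) powr (r * q))) \<partial>lebesgue) \<partial>lebesgue)"
      using ev
      by eventually_elim (unfold P_def, rule kernel_double_integral[symmetric, OF E' E v R ker1(2)], auto)
  qed
qed

end

section \<open>Identification of the three limits\<close>

theorem theorem1p2:
  fixes u :: "real ^ 'n \<Rightarrow> real ^ 'd"
    and E :: "(real ^ 'n) set"
    and \<eta> :: "real ^ 'n \<Rightarrow> real"
    and q r :: real
    and L :: ennreal
  assumes "1 \<le> q" and "0 < r" and "r < 1"
    and "u \<in> besov_space r q"
    and "E \<in> sets lebesgue"
    and "\<eta> \<in> sobolev_W11"
    and "L < \<infinity>"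
    and "((\<lambda>\<epsilon>. \<integral>\<^sup>+ n\<in>sphere 0 1.
             (\<integral>\<^sup>+ x\<in>E. ennreal (indicat_real E (x + \<epsilon> *\<^sub>R n) *
                (norm (u (x + \<epsilon> *\<^sub>R n) - u x) powr q / \<epsilon> powr (r * q))) \<partial>lebesgue)
             \<partial>hausdorff_measure (CARD('n) - 1)) \<longlongrightarrow> L) (at_right 0)"
  shows "\<forall>a \<rho>. is_kernel TYPE(real ^ 'n) a \<rho> \<longrightarrow>
     (\<exists>G K. G < \<infinity> \<and> K < \<infinity> \<and>
        ((\<lambda>\<epsilon>. ennreal (1 / \<bar>ln \<epsilon>\<bar>) *
            ennreal_powr (gagliardo_seminorm r q E (mollify \<eta> u \<epsilon>)) q) \<longlongrightarrow> G) (at_right 0) \<and>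
        ((\<lambda>\<epsilon>. \<integral>\<^sup>+ x\<in>E. (\<integral>\<^sup>+ y\<in>E.
            ennreal (\<rho> \<epsilon> (norm (x - y)) * (norm (u x - u y) powr q / norm (x - y) powr (r * q)))
            \<partial>lebesgue) \<partial>lebesgue) \<longlongrightarrow> K) (at_right 0) \<and>
        G = ennreal (\<bar>\<integral>z. \<eta> z \<partial>lebesgue\<bar> powr q) *
              emeasure (hausdorff_measure (CARD('n) - 1)) (sphere (0 :: real ^ 'n) 1) * K \<and>
        G = ennreal (\<bar>\<integral>z. \<eta> z \<partial>lebesgue\<bar> powr q) * L)"
proof (intro allI impI)
  fix a \<rho> assume ker: "is_kernel TYPE(real ^ 'n) a \<rho>"
  have dim: "DIM(real ^ 'n) = CARD('n)" by simp
  obtain u' M N0 where u': "AE x in lborel. u x = u' x" and besov: "besov_function u' q r M N0"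
    using besov_space_borel_version[OF assms(1-4)] .
  interpret besov_function u' q r M N0 by (rule besov)
  obtain E' where E'[measurable]: "E' \<in> sets borel" and E: "AE x in lborel. x \<in> E \<longleftrightarrow> x \<in> E'"
    using sets_lebesgue_borel_version[OF assms(5)] .
  obtain k g where k: "AE x in lborel. \<eta> x = k x" and wg: "borel_weak_gradient k g"
    using sobolev_W11_borel[OF assms(6)] .
  have [measurable]: "k \<in> borel_measurable borel"
    using wg borel_measurable_integrable[of lborel k] by (simp add: borel_weak_gradient_def)
  define l where "l = enn2real L"
  have l: "0 \<le> l" "L = ennreal l" using assms(7) by (auto simp: l_def)
  define s where "s = measure (sphere_measure :: (real ^ 'n) measure) UNIV"
  have s: "0 < s" using sphere_measure_UNIV_pos[where 'a="real ^ 'n"] by (simp add: s_def sphere_measure.emeasure_eq_measure)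
  define m where "m = \<bar>\<integral>z. \<eta> z \<partial>lebesgue\<bar> powr q"
  have m: "m = \<bar>\<integral>z. k z \<partial>lborel\<bar> powr q"
    unfolding m_def by (subst integral_lebesgue_AE_eq[OF _ k]) auto
  have pos: "\<forall>\<^sub>F e in at_right (0::real). 0 < e" by (rule eventually_at_right_less)
  have lim: "(sphere_increment E' \<longlongrightarrow> ennreal l) (at_right 0)"
    unfolding l(2)[symmetric]
    by (rule Lim_transform_eventually[OF assms(8)], use pos in eventually_elim)
      (rule sphere_increment_eq[OF E' E u', unfolded dim])
  have G: "((\<lambda>e. ennreal (1 / \<bar>ln e\<bar>) * ennreal_powr (gagliardo_seminorm r q E (mollify \<eta> u e)) q) \<longlongrightarrow> ennreal (m * l)) (at_right 0)"
    unfolding m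
  proof (rule Lim_transform_eventually[OF energy_limit[OF wg E' l(1) lim]], use pos in eventually_elim)
    case (elim e)
    then have "mollify \<eta> u e = conv k e" using mollify_eq_conv[OF _ k u'] by auto
    then show ?case using q gagliardo_seminorm_powr[OF _ E' conv_measurable E, of q k r e] by simp
  qed
  have H: "emeasure (hausdorff_measure (CARD('n) - 1)) (sphere (0 :: real ^ 'n) 1) = ennreal s"
    using emeasure_hausdorff_sphere[of "UNIV :: (real ^ 'n) set", unfolded dim]
    by (simp add: s_def sphere_measure.emeasure_eq_measure)
  show "\<exists>G K. G < \<infinity> \<and> K < \<infinity> \<and>
        ((\<lambda>\<epsilon>. ennreal (1 / \<bar>ln \<epsilon>\<bar>) *
            ennreal_powr (gagliardo_seminorm r q E (mollify \<eta> u \<epsilon>)) q) \<longlongrightarrow> G) (at_right 0) \<and>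
        ((\<lambda>\<epsilon>. \<integral>\<^sup>+ x\<in>E. (\<integral>\<^sup>+ y\<in>E.
            ennreal (\<rho> \<epsilon> (norm (x - y)) * (norm (u x - u y) powr q / norm (x - y) powr (r * q)))
            \<partial>lebesgue) \<partial>lebesgue) \<longlongrightarrow> K) (at_right 0) \<and>
        G = ennreal (\<bar>\<integral>z. \<eta> z \<partial>lebesgue\<bar> powr q) *
              emeasure (hausdorff_measure (CARD('n) - 1)) (sphere (0 :: real ^ 'n) 1) * K \<and>
        G = ennreal (\<bar>\<integral>z. \<eta> z \<partial>lebesgue\<bar> powr q) * L"
    unfolding H m_def[symmetric]
  proof (intro exI conjI)
    \<comment> \<open>The mass \<open>1 / s\<close> of the radial kernel weights cancels the measure
      \<open>s\<close> of the sphere.\<close>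
    show "ennreal (m * l) = ennreal m * ennreal s * ennreal (1 / s * l)"
      using s l(1) by (simp add: ennreal_mult[symmetric] m_def)
    show "ennreal (m * l) = ennreal m * L"
      using l by (simp add: ennreal_mult m_def)
  qed (use G kernel_double_integral_tendsto[OF E' E u' ker l(1) lim] in \<open>simp_all add: s_def\<close>)
qed

end
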